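(* Let $r_1,r_2$ be positive integers with $r_2\mid r_1$, let $A(t)\in\mathrm{GL}(4,\mathbb{R})$ be given by $A(t)e_\nu=e_\nu$, $A(t)e_{2+\nu}=e_{2+\nu}+r_\nu t\,e_\nu$ for $\nu=1,2$, and let $G=\mathbb{R}^4\rtimes_A\mathbb{R}$, $\Gamma=\mathbb{Z}^4\rtimes_A\mathbb{Z}$. Let $\mathcal{H}$ be the left-invariant distribution spanned by $s_1=e_3$, $s_2=e_4$, $s_3=b$, with the orientation and Riemannian metric $g$ making $s_1,s_2,s_3$ a positively oriented orthonormal frame. Let $\nabla$ be a left-invariant metric connection in $\mathcal{H}$ with $\sum_{i=1}^3g(\nabla_{s_i}s_j,s_i)=0$ for $j=1,2,3$, and $\varepsilon:\Gamma\to\mathbb{Z}_2$ a homomorphism. Let $D$ be the associated sub-Dirac operator on $\Gamma\setminus G$ and $\alpha=-\frac12(\Gamma_{12}^3+\Gamma_{23}^1+\Gamma_{31}^2)$. Then the spectral multiplicity function of $D$ is $m(D)=m_1+m_2+m_3+m_4$, where $m_1=0$ if $\varepsilon_1=1$ or $\varepsilon_2=1$, $m_2=0$ if $\varepsilon_2=1$, $m_3=0$ if $\varepsilon_1=1$, and otherwise, with sums taken over $\xi_\nu\in2\mathbb{Z}+\varepsilon_\nu$ ($\nu=1,\dots,4$) and $\xi_5\in2\mathbb{Z}+\dot\varepsilon(1)$ subject to the indicated restrictions, $$m_1=\sum_{\xi_3,\xi_4,\xi_5}\Big(\delta\big(\alpha+\pi(\xi_3^2+\xi_4^2+\xi_5^2)^{1/2}\big)+\delta\big(\alpha-\pi(\xi_3^2+\xi_4^2+\xi_5^2)^{1/2}\big)\Big),$$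 $$m_2=\sum_{\xi_1\ne0}\frac{|r_1\xi_1|}{2}\sum_{\xi_4}\Big(\delta\big(\alpha-\pi\,\mathrm{sgn}(r_1\xi_1)\xi_4\big)+\sum_{k=1}^\infty\sum_{\pm}\delta\big(\alpha\pm(2\pi k|r_1\xi_1|+\pi^2\xi_4^2)^{1/2}\big)\Big),$$ $$m_3=\sum_{\xi_2\ne0}\frac{|r_2\xi_2|}{2}\sum_{\xi_3}\Big(\delta\big(\alpha+\pi\,\mathrm{sgn}(r_2\xi_2)\xi_3\big)+\sum_{k=1}^\infty\sum_{\pm}\delta\big(\alpha\pm(2\pi k|r_2\xi_2|+\pi^2\xi_3^2)^{1/2}\big)\Big),$$ $$m_4=\sum_{\xi_1\ne0}\sum_{\xi_2\ne0}\frac{\gcd(|r_1\xi_1|,|r_2\xi_2|)}{2}\sum_{0\le\xi_3\le2q_{(\xi_1,\xi_2)}-1}\;\sum_{\xi_4}\Big(\delta(\lambda_0(\xi))+\sum_{k=1}^\infty\big(\delta(\lambda_k^+(\xi))+\delta(\lambda_k^-(\xi))\big)\Big),$$ with $q_{(\xi_1,\xi_2)}=|r_1\xi_1|/\gcd(|r_1\xi_1|,|r_2\xi_2|)$, $$\lambda_0(\xi)=\alpha-\pi\frac{r_1\xi_1\xi_4-r_2\xi_2\xi_3}{(r_1^2\xi_1^2+r_2^2\xi_2^2)^{1/2}},\qquad \lambda_k^\pm(\xi)=\alpha\pm\Big(2\pi k(r_1^2\xi_1^2+r_2^2\xi_2^2)^{1/2}+\pi^2\frac{(r_1\xi_1\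xi_4-r_2\xi_2\xi_3)^2}{r_1^2\xi_1^2+r_2^2\xi_2^2}\Big)^{1/2}.$$
   Context: The group law of $G$ is $(x,s)(y,t)=(x+A(s)y,s+t)$. The Lie algebra of $G$ has basis $e_1,\dots,e_4,b$ with the only nontrivial brackets $[b,e_3]=r_1e_1$, $[b,e_4]=r_2e_2$; elements of the Lie algebra are identified with left-invariant vector fields. $\mathbb{Z}_2=\{0,1\}$; $\varepsilon_\nu:=\varepsilon(e_\nu,0)\in\{0,1\}$ for $\nu=1,\dots,4$ and $\dot\varepsilon(l)=\varepsilon(0,l)$, values viewed as integers. A metric connection in $\mathcal{H}$ differentiates sections of $\mathcal{H}$ along $\mathcal{H}$ and is compatible with $g$; $\Gamma_{ij}^k=g(\nabla_{s_i}s_j,s_k)$. $L^2(G,\varepsilon)$ is the completion of the space of continuous $\varphi:G\to\mathbb{C}$ with $\varphi(\gamma y)=e^{i\pi\varepsilon(\gamma)}\varphi(y)$ ($\gamma\in\Gamma$, $y\in G$) with respect to the $L^2$-norm over $\Gamma\setminus G$ for the normalised invariant measure. With $\Delta=\mathbb{C}^2$ and Clifford action $$s_1=\begin{pmatrix}0&i\\ i&0\end{pmatrix},\quad s_2=\begin{pmatrix}0&-1\\1&0\end{pmatrix},\quad s_3=\begin{pmatrix}i&0\\0&-i\end{pmatrix},$$ the sub-Dirac operator acts on smooth $\varepsilon$-equivariant functions $G\to\Delta$ by $$D=\sum_i d\rho(s_i)\otimes s_i+\frac14\sum_{i,j,k}\Gamma_{ij}^k\,I\otimes s_is_js_k,$$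 where $d\rho(s_i)$ is differentiation along the left-invariant vector field $s_i$. The spectral multiplicity function is $m(D):\mathbb{R}\to\mathbb{N}\cup\{|\mathbb{N}|\}$, $m(D)(\lambda)=\dim\ker(D-\lambda I)$ (Hilbert space dimension, for the closure of $D$ in $L^2(G,\varepsilon)\otimes\mathbb{C}^2$). $\delta(\lambda)$ denotes the function on $\mathbb{R}$ with value $1$ at $\lambda$ and $0$ elsewhere; infinite sums of such functions with values in $\mathbb{N}\cup\{|\mathbb{N}|\}$ are pointwise. *)

theory Defs
  imports "HOL-Analysis.Analysis" "HOL-Algebra.Elementary_Groups"
begin

section \<open>The group and its lattice\<close>

type_synonym pt = "(real ^ 4) \<times> real"

definition matA :: "int \<Rightarrow> int \<Rightarrow> real \<Rightarrow> real ^ 4 ^ 4" where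
  "matA r1 r2 t = (\<chi> i j.
     if i = j then 1
     else if i = 1 \<and> j = 3 then of_int r1 * t
     else if i = 2 \<and> j = 4 then of_int r2 * t
     else 0)"

definition grpG :: "int \<Rightarrow> int \<Rightarrow> pt monoid" where
  "grpG r1 r2 = \<lparr>carrier = UNIV,
     monoid.mult = (\<lambda>(x, s) (y, t). (x + matA r1 r2 s *v y, s + t)),
     one = (0, 0)\<rparr>"

definition grpGamma :: "int \<Rightarrow> int \<Rightarrow> pt monoid" where
  "grpGamma r1 r2 = (grpG r1 r2)\<lparr>carrier := {(x, s). (\<forall>i. x $ i \<in> \<int>) \<and> s \<in> \<int>}\<rparr>"

section \<open>Smooth maps and left-invariant vector fields\<close>

primrec Ck :: "nat \<Rightarrow> ('a::real_normed_vector \<Rightarrow> 'b::real_normed_vector) \<Rightarrow> bool" where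
  "Ck 0 f \<longleftrightarrow> continuous_on UNIV f"
| "Ck (Suc k) f \<longleftrightarrow> (\<forall>x. f differentiable (at x)) \<and>
     (\<forall>v. Ck k (\<lambda>x. frechet_derivative f (at x) v))"

definition smooth :: "('a::real_normed_vector \<Rightarrow> 'b::real_normed_vector) \<Rightarrow> bool" where
  "smooth f \<longleftrightarrow> (\<forall>k. Ck k f)"

text \<open>All tangent spaces of the group are identified with the ambient vector space.\<close>

definition dL :: "int \<Rightarrow> int \<Rightarrow> pt \<Rightarrow> pt \<Rightarrow> pt \<Rightarrow> pt" where
  "dL r1 r2 a y = frechet_derivative (\<lambda>z. a \<otimes>\<^bsub>grpG r1 r2\<^esub> z) (at y)"

definition left_field :: "int \<Rightarrow> int \<Rightarrow> pt \<Rightarrow> (pt \<Rightarrow> pt)" where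
  "left_field r1 r2 v = (\<lambda>y. dL r1 r2 y \<one>\<^bsub>grpG r1 r2\<^esub> v)"

definition along :: "(pt \<Rightarrow> pt) \<Rightarrow> (pt \<Rightarrow> 'b::real_normed_vector) \<Rightarrow> (pt \<Rightarrow> 'b)" where
  "along X f = (\<lambda>y. frechet_derivative f (at y) (X y))"

definition push :: "int \<Rightarrow> int \<Rightarrow> pt \<Rightarrow> (pt \<Rightarrow> pt) \<Rightarrow> (pt \<Rightarrow> pt)" where
  "push r1 r2 a X = (\<lambda>y. let z = inv\<^bsub>grpG r1 r2\<^esub> a \<otimes>\<^bsub>grpG r1 r2\<^esub> y in dL r1 r2 a z (X z))"

section \<open>The distribution, its metric, and left-invariant metric connections\<close>

definition frame :: "int \<Rightarrow> int \<Rightarrow> 3 \<Rightarrow> (pt \<Rightarrow> pt)" where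
  "frame r1 r2 i = left_field r1 r2
     (if i = 1 then (axis 3 1, 0) else if i = 2 then (axis 4 1, 0) else (0, 1))"

definition distH :: "int \<Rightarrow> int \<Rightarrow> pt \<Rightarrow> pt set" where
  "distH r1 r2 y = span (range (\<lambda>i. frame r1 r2 i y))"

definition sections :: "int \<Rightarrow> int \<Rightarrow> (pt \<Rightarrow> pt) set" where
  "sections r1 r2 = {X. smooth X \<and> (\<forall>y. X y \<in> distH r1 r2 y)}"

text \<open>The metric on the distribution for which the frame is orthonormal; it is only meaningful
  for vectors of the distribution.\<close>

definition metricH :: "int \<Rightarrow> int \<Rightarrow> pt \<Rightarrow> pt \<Rightarrow> pt \<Rightarrow> real" where
  "metricH r1 r2 y u v =
     (let B = range (\<lambda>i. frame r1 r2 i y)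
      in \<Sum>b\<in>B. representation B u b * representation B v b)"

definition connection :: "int \<Rightarrow> int \<Rightarrow> ((pt \<Rightarrow> pt) \<Rightarrow> (pt \<Rightarrow> pt) \<Rightarrow> (pt \<Rightarrow> pt)) \<Rightarrow> bool" where
  "connection r1 r2 nabla \<longleftrightarrow>
     (\<forall>X\<in>sections r1 r2. \<forall>Y\<in>sections r1 r2. nabla X Y \<in> sections r1 r2) \<and>
     (\<forall>X\<in>sections r1 r2. \<forall>X'\<in>sections r1 r2. \<forall>Y\<in>sections r1 r2.
        nabla (\<lambda>y. X y + X' y) Y = (\<lambda>y. nabla X Y y + nabla X' Y y)) \<and>
     (\<forall>X\<in>sections r1 r2. \<forall>Y\<in>sections r1 r2. \<forall>Y'\<in>sections r1 r2.
        nabla X (\<lambda>y. Y y + Y' y) = (\<lambda>y. nabla X Y y + nabla X Y' y)) \<and>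
     (\<forall>f :: pt \<Rightarrow> real. smooth f \<longrightarrow> (\<forall>X\<in>sections r1 r2. \<forall>Y\<in>sections r1 r2.
        nabla (\<lambda>y. f y *\<^sub>R X y) Y = (\<lambda>y. f y *\<^sub>R nabla X Y y) \<and>
        nabla X (\<lambda>y. f y *\<^sub>R Y y) = (\<lambda>y. along X f y *\<^sub>R Y y + f y *\<^sub>R nabla X Y y)))"

definition metric_connection :: "int \<Rightarrow> int \<Rightarrow> ((pt \<Rightarrow> pt) \<Rightarrow> (pt \<Rightarrow> pt) \<Rightarrow> (pt \<Rightarrow> pt)) \<Rightarrow> bool" where
  "metric_connection r1 r2 nabla \<longleftrightarrow> connection r1 r2 nabla \<and>
     (\<forall>X\<in>sections r1 r2. \<forall>Y\<in>sections r1 r2. \<forall>Z\<in>sections r1 r2. \<forall>y.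
        along X (\<lambda>z. metricH r1 r2 z (Y z) (Z z)) y =
          metricH r1 r2 y (nabla X Y y) (Z y) + metricH r1 r2 y (Y y) (nabla X Z y))"

definition left_invariant_connection ::
    "int \<Rightarrow> int \<Rightarrow> ((pt \<Rightarrow> pt) \<Rightarrow> (pt \<Rightarrow> pt) \<Rightarrow> (pt \<Rightarrow> pt)) \<Rightarrow> bool" where
  "left_invariant_connection r1 r2 nabla \<longleftrightarrow>
     (\<forall>a. \<forall>X\<in>sections r1 r2. \<forall>Y\<in>sections r1 r2.
        nabla (push r1 r2 a X) (push r1 r2 a Y) = push r1 r2 a (nabla X Y))"

definition christoffel ::
    "int \<Rightarrow> int \<Rightarrow> ((pt \<Rightarrow> pt) \<Rightarrow> (pt \<Rightarrow> pt) \<Rightarrow> (pt \<Rightarrow> pt)) \<Rightarrow> 3 \<Rightarrow> 3 \<Rightarrow> 3 \<Rightarrow> pt \<Rightarrow> real" where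
  "christoffel r1 r2 nabla i j k y =
     metricH r1 r2 y (nabla (frame r1 r2 i) (frame r1 r2 j) y) (frame r1 r2 k y)"

text \<open>For a left-invariant connection the coefficients are constant functions on the group,
  so their value at the identity is used here.\<close>

definition alpha_const :: "int \<Rightarrow> int \<Rightarrow> ((pt \<Rightarrow> pt) \<Rightarrow> (pt \<Rightarrow> pt) \<Rightarrow> (pt \<Rightarrow> pt)) \<Rightarrow> real" where
  "alpha_const r1 r2 nabla = - (1 / 2) *
     (christoffel r1 r2 nabla 1 2 3 \<one>\<^bsub>grpG r1 r2\<^esub> +
      christoffel r1 r2 nabla 2 3 1 \<one>\<^bsub>grpG r1 r2\<^esub> +
      christoffel r1 r2 nabla 3 1 2 \<one>\<^bsub>grpG r1 r2\<^esub>)"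

section \<open>The sub-Dirac operator\<close>

type_synonym spinor = "complex ^ 2"

definition clifford :: "3 \<Rightarrow> complex ^ 2 ^ 2" where
  "clifford i =
     (if i = 1 then vector [vector [0, \<i>], vector [\<i>, 0]]
      else if i = 2 then vector [vector [0, -1], vector [1, 0]]
      else vector [vector [\<i>, 0], vector [0, -\<i>]])"

definition equivariant :: "int \<Rightarrow> int \<Rightarrow> (pt \<Rightarrow> int) \<Rightarrow> (pt \<Rightarrow> spinor) \<Rightarrow> bool" where
  "equivariant r1 r2 eps \<phi> \<longleftrightarrow>
     (\<forall>\<gamma>\<in>carrier (grpGamma r1 r2). \<forall>y.
        \<phi> (\<gamma> \<otimes>\<^bsub>grpG r1 r2\<^esub> y) = exp (\<i> * of_real pi * of_int (eps \<gamma>)) *s \<phi> y)"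

definition Dirac_domain :: "int \<Rightarrow> int \<Rightarrow> (pt \<Rightarrow> int) \<Rightarrow> (pt \<Rightarrow> spinor) set" where
  "Dirac_domain r1 r2 eps = {\<phi>. smooth \<phi> \<and> equivariant r1 r2 eps \<phi>}"

definition Dirac :: "int \<Rightarrow> int \<Rightarrow> ((pt \<Rightarrow> pt) \<Rightarrow> (pt \<Rightarrow> pt) \<Rightarrow> (pt \<Rightarrow> pt)) \<Rightarrow>
    (pt \<Rightarrow> spinor) \<Rightarrow> (pt \<Rightarrow> spinor)" where
  "Dirac r1 r2 nabla \<phi> = (\<lambda>y.
     (\<Sum>i\<in>UNIV. clifford i *v along (frame r1 r2 i) \<phi> y) +
     (1 / 4) *\<^sub>R (\<Sum>i\<in>UNIV. \<Sum>j\<in>UNIV. \<Sum>k\<in>UNIV.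
        christoffel r1 r2 nabla i j k y *\<^sub>R ((clifford i ** clifford j ** clifford k) *v \<phi> y)))"

section \<open>The Hilbert space\<close>

text \<open>Every left translation of the group is an affine map of determinant one, so Lebesgue
  measure is a Haar measure.  The half-open unit cube below meets every \<open>\<Gamma>\<close>-orbit exactly once
  (see \<open>fundamental_domain\<close>) and has measure one.  Hence integration over it realises integration of
  \<open>\<Gamma>\<close>-invariant functions over the quotient against the normalised invariant measure.\<close>

definition fund :: "pt set" where
  "fund = {(x, s). (\<forall>i. 0 \<le> x $ i \<and> x $ i < 1) \<and> 0 \<le> s \<and> s < 1}"

definition L2ip :: "(pt \<Rightarrow> spinor) \<Rightarrow> (pt \<Rightarrow> spinor) \<Rightarrow> complex" where
  "L2ip \<phi> \<psi> = (LINT y:fund|lborel. (\<Sum>j\<in>UNIV. \<phi> y $ j * cnj (\<psi> y $ j)))"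

definition L2norm :: "(pt \<Rightarrow> spinor) \<Rightarrow> real" where
  "L2norm \<phi> = sqrt (LINT y:fund|lborel. (norm (\<phi> y))\<^sup>2)"

text \<open>The completion of the continuous equivariant functions is realised as their closure among
  the square-integrable measurable equivariant functions.  Functions are not identified modulo null
  sets, so \<open>L2norm\<close> is only a seminorm here.  Values in \<open>\<complex>\<^sup>2\<close> account for
  the tensor factor.\<close>

definition L2 :: "int \<Rightarrow> int \<Rightarrow> (pt \<Rightarrow> int) \<Rightarrow> (pt \<Rightarrow> spinor) set" where
  "L2 r1 r2 eps = {\<psi>. \<psi> \<in> borel_measurable borel \<and> equivariant r1 r2 eps \<psi> \<and>
     set_integrable lborel fund (\<lambda>y. (norm (\<psi> y))\<^sup>2) \<and>
     (\<exists>u. (\<forall>n. continuous_on UNIV (u n) \<and> equivariant r1 r2 eps (u n)) \<and>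
          (\<lambda>n::nat. L2norm (\<lambda>y. u n y - \<psi> y)) \<longlonglongrightarrow> 0)}"

definition closure_graph :: "int \<Rightarrow> int \<Rightarrow> (pt \<Rightarrow> int) \<Rightarrow>
    ((pt \<Rightarrow> pt) \<Rightarrow> (pt \<Rightarrow> pt) \<Rightarrow> (pt \<Rightarrow> pt)) \<Rightarrow> ((pt \<Rightarrow> spinor) \<times> (pt \<Rightarrow> spinor)) set" where
  "closure_graph r1 r2 eps nabla = {(\<psi>, \<eta>). \<psi> \<in> L2 r1 r2 eps \<and> \<eta> \<in> L2 r1 r2 eps \<and>
     (\<exists>u. (\<forall>n::nat. u n \<in> Dirac_domain r1 r2 eps) \<and>
          (\<lambda>n. L2norm (\<lambda>y. u n y - \<psi> y)) \<longlonglongrightarrow> 0 \<and>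
          (\<lambda>n. L2norm (\<lambda>y. Dirac r1 r2 nabla (u n) y - \<eta> y)) \<longlonglongrightarrow> 0)}"

definition Dirac_eigenspace :: "int \<Rightarrow> int \<Rightarrow> (pt \<Rightarrow> int) \<Rightarrow>
    ((pt \<Rightarrow> pt) \<Rightarrow> (pt \<Rightarrow> pt) \<Rightarrow> (pt \<Rightarrow> pt)) \<Rightarrow> real \<Rightarrow> (pt \<Rightarrow> spinor) set" where
  "Dirac_eigenspace r1 r2 eps nabla l =
     {\<psi>. (\<psi>, \<lambda>y. l *\<^sub>R \<psi> y) \<in> closure_graph r1 r2 eps nabla}"

text \<open>Orthonormal bases are maximal orthonormal systems.  Since \<open>L2ip\<close> is only
  semidefinite, maximality says that vectors orthogonal to the system are null.\<close>

definition orthonormal_basis :: "(pt \<Rightarrow> spinor) set \<Rightarrow> (pt \<Rightarrow> spinor) set \<Rightarrow> bool" where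
  "orthonormal_basis V B \<longleftrightarrow> B \<subseteq> V \<and>
     (\<forall>f\<in>B. \<forall>g\<in>B. L2ip f g = (if f = g then 1 else 0)) \<and>
     (\<forall>f\<in>V. (\<forall>g\<in>B. L2ip f g = 0) \<longrightarrow> L2norm f = 0)"

text \<open>In \<open>enat\<close>, the element \<open>\<infinity>\<close> stands for the cardinal of the natural numbers, which is why
  the basis is required to be countable.\<close>

definition hilbert_dim :: "(pt \<Rightarrow> spinor) set \<Rightarrow> enat" where
  "hilbert_dim V = (THE n. \<exists>B. orthonormal_basis V B \<and> countable B \<and>
     n = (if finite B then enat (card B) else \<infinity>))"

definition spectral_mult :: "int \<Rightarrow> int \<Rightarrow> (pt \<Rightarrow> int) \<Rightarrow>
    ((pt \<Rightarrow> pt) \<Rightarrow> (pt \<Rightarrow> pt) \<Rightarrow> (pt \<Rightarrow> pt)) \<Rightarrow> real \<Rightarrow> enat" where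
  "spectral_mult r1 r2 eps nabla l = hilbert_dim (Dirac_eigenspace r1 r2 eps nabla l)"

section \<open>The multiplicity formulas\<close>

definition delta :: "real \<Rightarrow> real \<Rightarrow> enat" where
  "delta a l = (if l = a then 1 else 0)"

definition coset2 :: "int \<Rightarrow> int set" where
  "coset2 e = {2 * z + e | z. True}"

text \<open>The weights \<open>\<bar>r\<^sub>1\<xi>\<^sub>1\<bar> / 2\<close>, \<open>\<bar>r\<^sub>2\<xi>\<^sub>2\<bar> / 2\<close> and \<open>gcd \<bar>r\<^sub>1\<xi>\<^sub>1\<bar> \<bar>r\<^sub>2\<xi>\<^sub>2\<bar> / 2\<close> are integers, because
  \<open>r\<^sub>\<nu>\<xi>\<^sub>\<nu>\<close> is even for \<open>\<xi>\<^sub>\<nu> \<in> 2\<int> + \<epsilon>\<^sub>\<nu>\<close> (see \<open>weights_even\<close>); \<open>div\<close> is therefore exact.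
  Every family in \<open>enat\<close> is summable, its sum being the supremum of the finite partial sums.\<close>

definition mpart1 :: "int \<Rightarrow> int \<Rightarrow> int \<Rightarrow> int \<Rightarrow> int \<Rightarrow> real \<Rightarrow> real \<Rightarrow> enat" where
  "mpart1 e1 e2 e3 e4 e5 \<alpha> l = (if e1 = 1 \<or> e2 = 1 then 0 else
     (\<Sum>\<^sub>\<infinity>(x3, x4, x5)\<in>coset2 e3 \<times> coset2 e4 \<times> coset2 e5.
        delta (\<alpha> + pi * sqrt (of_int (x3\<^sup>2 + x4\<^sup>2 + x5\<^sup>2))) l +
        delta (\<alpha> - pi * sqrt (of_int (x3\<^sup>2 + x4\<^sup>2 + x5\<^sup>2))) l))"

definition mpart2 :: "int \<Rightarrow> int \<Rightarrow> int \<Rightarrow> int \<Rightarrow> real \<Rightarrow> real \<Rightarrow> enat" where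
  "mpart2 r1 e1 e2 e4 \<alpha> l = (if e2 = 1 then 0 else
     (\<Sum>\<^sub>\<infinity>x1\<in>coset2 e1 - {0}. of_nat (nat (\<bar>r1 * x1\<bar> div 2)) *
       (\<Sum>\<^sub>\<infinity>x4\<in>coset2 e4.
          delta (\<alpha> - pi * sgn (of_int (r1 * x1)) * of_int x4) l +
          (\<Sum>\<^sub>\<infinity>k\<in>{1::nat..}.
             delta (\<alpha> + sqrt (2 * pi * of_nat k * of_int \<bar>r1 * x1\<bar> + pi\<^sup>2 * (of_int x4)\<^sup>2)) l +
             delta (\<alpha> - sqrt (2 * pi * of_nat k * of_int \<bar>r1 * x1\<bar> + pi\<^sup>2 * (of_int x4)\<^sup>2)) l))))"

definition mpart3 :: "int \<Rightarrow> int \<Rightarrow> int \<Rightarrow> int \<Rightarrow> real \<Rightarrow> real \<Rightarrow> enat" where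
  "mpart3 r2 e1 e2 e3 \<alpha> l = (if e1 = 1 then 0 else
     (\<Sum>\<^sub>\<infinity>x2\<in>coset2 e2 - {0}. of_nat (nat (\<bar>r2 * x2\<bar> div 2)) *
       (\<Sum>\<^sub>\<infinity>x3\<in>coset2 e3.
          delta (\<alpha> + pi * sgn (of_int (r2 * x2)) * of_int x3) l +
          (\<Sum>\<^sub>\<infinity>k\<in>{1::nat..}.
             delta (\<alpha> + sqrt (2 * pi * of_nat k * of_int \<bar>r2 * x2\<bar> + pi\<^sup>2 * (of_int x3)\<^sup>2)) l +
             delta (\<alpha> - sqrt (2 * pi * of_nat k * of_int \<bar>r2 * x2\<bar> + pi\<^sup>2 * (of_int x3)\<^sup>2)) l))))"

definition rho :: "int \<Rightarrow> int \<Rightarrow> int \<Rightarrow> int \<Rightarrow> real" where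
  "rho r1 r2 x1 x2 = sqrt (of_int (r1\<^sup>2 * x1\<^sup>2 + r2\<^sup>2 * x2\<^sup>2))"

definition lambda0 :: "int \<Rightarrow> int \<Rightarrow> real \<Rightarrow> int \<Rightarrow> int \<Rightarrow> int \<Rightarrow> int \<Rightarrow> real" where
  "lambda0 r1 r2 \<alpha> x1 x2 x3 x4 =
     \<alpha> - pi * (of_int (r1 * x1 * x4 - r2 * x2 * x3) / rho r1 r2 x1 x2)"

text \<open>The parameter \<open>s\<close> is the sign \<open>\<plusminus>1\<close>.\<close>

definition lambda_k :: "int \<Rightarrow> int \<Rightarrow> real \<Rightarrow> real \<Rightarrow> nat \<Rightarrow> int \<Rightarrow> int \<Rightarrow> int \<Rightarrow> int \<Rightarrow> real" where
  "lambda_k r1 r2 \<alpha> s k x1 x2 x3 x4 =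
     \<alpha> + s * sqrt (2 * pi * of_nat k * rho r1 r2 x1 x2 +
       pi\<^sup>2 * ((of_int (r1 * x1 * x4 - r2 * x2 * x3))\<^sup>2 / of_int (r1\<^sup>2 * x1\<^sup>2 + r2\<^sup>2 * x2\<^sup>2)))"

definition mpart4 :: "int \<Rightarrow> int \<Rightarrow> int \<Rightarrow> int \<Rightarrow> int \<Rightarrow> int \<Rightarrow> real \<Rightarrow> real \<Rightarrow> enat" where
  "mpart4 r1 r2 e1 e2 e3 e4 \<alpha> l =
     (\<Sum>\<^sub>\<infinity>x1\<in>coset2 e1 - {0}. \<Sum>\<^sub>\<infinity>x2\<in>coset2 e2 - {0}.
       (let d = gcd \<bar>r1 * x1\<bar> \<bar>r2 * x2\<bar>; q = \<bar>r1 * x1\<bar> div d in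
         of_nat (nat (d div 2)) *
         (\<Sum>x3\<in>coset2 e3 \<inter> {0..2 * q - 1}. \<Sum>\<^sub>\<infinity>x4\<in>coset2 e4.
            delta (lambda0 r1 r2 \<alpha> x1 x2 x3 x4) l +
            (\<Sum>\<^sub>\<infinity>k\<in>{1::nat..}.
               delta (lambda_k r1 r2 \<alpha> 1 k x1 x2 x3 x4) l +
               delta (lambda_k r1 r2 \<alpha> (-1) k x1 x2 x3 x4) l))))"

section \<open>Consistency checks\<close>

lemma matA_mult_vec:
  "matA r1 r2 t *v x =
     x + (of_int r1 * t * x $ 3) *\<^sub>R axis 1 1 + (of_int r2 * t * x $ 4) *\<^sub>R axis 2 1"
  by (simp add: vec_eq_iff matA_def matrix_vector_mult_def sum_4 forall_4 axis_def)

lemma matA_axis: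
  "matA r1 r2 t *v axis 1 1 = axis 1 1"
  "matA r1 r2 t *v axis 2 1 = axis 2 1"
  "matA r1 r2 t *v axis 3 1 = axis 3 1 + (of_int r1 * t) *\<^sub>R axis 1 1"
  "matA r1 r2 t *v axis 4 1 = axis 4 1 + (of_int r2 * t) *\<^sub>R axis 2 1"
  by (simp_all add: matA_mult_vec vec_eq_iff forall_4 axis_def)

lemma carrier_grpG [simp]: "carrier (grpG r1 r2) = UNIV"
  and one_grpG [simp]: "\<one>\<^bsub>grpG r1 r2\<^esub> = (0, 0)"
  and mult_grpG: "(x, s) \<otimes>\<^bsub>grpG r1 r2\<^esub> (y, t) = (x + matA r1 r2 s *v y, s + t)"
  by (simp_all add: grpG_def)

lemma carrier_grpGamma: "carrier (grpGamma r1 r2) = {(x, s). (\<forall>i. x $ i \<in> \<int>) \<and> s \<in> \<int>}"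
  and one_grpGamma [simp]: "\<one>\<^bsub>grpGamma r1 r2\<^esub> = (0, 0)"
  and mult_grpGamma: "(x, s) \<otimes>\<^bsub>grpGamma r1 r2\<^esub> (y, t) = (x + matA r1 r2 s *v y, s + t)"
  by (simp_all add: grpGamma_def grpG_def)

lemma group_grpG: "group (grpG r1 r2)"
proof (rule groupI)
  fix a assume "a \<in> carrier (grpG r1 r2)"
  obtain x s where a: "a = (x, s)" by force
  have "(- (matA r1 r2 (-s) *v x), -s) \<otimes>\<^bsub>grpG r1 r2\<^esub> a = \<one>\<^bsub>grpG r1 r2\<^esub>"
    by (simp add: a mult_grpG)
  then show "\<exists>b\<in>carrier (grpG r1 r2). b \<otimes>\<^bsub>grpG r1 r2\<^esub> a = \<one>\<^bsub>grpG r1 r2\<^esub>"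
    by (metis UNIV_I carrier_grpG)
qed (auto simp: mult_grpG matA_mult_vec vec_eq_iff forall_4 axis_def algebra_simps)

lemma subgroup_grpGamma: "subgroup (carrier (grpGamma r1 r2)) (grpG r1 r2)"
proof (rule group.subgroupI[OF group_grpG])
  fix a assume a: "a \<in> carrier (grpGamma r1 r2)"
  obtain x s where xs: "a = (x, s)" by force
  have "(- (matA r1 r2 (-s) *v x), -s) \<otimes>\<^bsub>grpG r1 r2\<^esub> a = \<one>\<^bsub>grpG r1 r2\<^esub>"
    by (simp add: xs mult_grpG)
  then have "inv\<^bsub>grpG r1 r2\<^esub> a = (- (matA r1 r2 (-s) *v x), -s)"
    by (intro group.inv_equality[OF group_grpG]) auto
  then show "inv\<^bsub>grpG r1 r2\<^esub> a \<in> carrier (grpGamma r1 r2)"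
    using a by (auto simp: xs carrier_grpGamma matA_mult_vec forall_4 axis_def)
next
  fix a b assume "a \<in> carrier (grpGamma r1 r2)" "b \<in> carrier (grpGamma r1 r2)"
  then show "a \<otimes>\<^bsub>grpG r1 r2\<^esub> b \<in> carrier (grpGamma r1 r2)"
    by (auto simp: carrier_grpGamma mult_grpG matA_mult_vec forall_4 axis_def)
next
  have "(0, 0) \<in> carrier (grpGamma r1 r2)" by (simp add: carrier_grpGamma)
  then show "carrier (grpGamma r1 r2) \<noteq> {}" by blast
qed auto

lemma fundamental_domain: "\<exists>!\<gamma>. \<gamma> \<in> carrier (grpGamma r1 r2) \<and> \<gamma> \<otimes>\<^bsub>grpG r1 r2\<^esub> y \<in> fund"
proof -
  obtain x s where y: "y = (x, s)" by force
  have unit: "z + w \<in> {0..<1} \<and> z \<in> \<int> \<longleftrightarrow> z = - of_int \<lfloor>w\<rfloor>" for z w :: real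
  proof
    assume h: "z + w \<in> {0..<1} \<and> z \<in> \<int>"
    then obtain m where m: "z = of_int m" by (auto elim: Ints_cases)
    have "\<lfloor>w\<rfloor> = - m" using h m by (intro floor_unique) auto
    then show "z = - of_int \<lfloor>w\<rfloor>" by (simp add: m)
  next
    assume "z = - of_int \<lfloor>w\<rfloor>"
    then show "z + w \<in> {0..<1} \<and> z \<in> \<int>"
      using floor_correct[of w] by (auto simp: algebra_simps)
  qed
  define t :: real where "t = - of_int \<lfloor>s\<rfloor>"
  define n :: "real ^ 4" where "n = (\<chi> i. - of_int \<lfloor>(matA r1 r2 t *v x) $ i\<rfloor>)"
  have key: "(m, l) \<in> carrier (grpGamma r1 r2) \<and> (m, l) \<otimes>\<^bsub>grpG r1 r2\<^esub> y \<in> fund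
      \<longleftrightarrow> (m, l) = (n, t)" for m l
  proof -
    have "(m, l) \<in> carrier (grpGamma r1 r2) \<and> (m, l) \<otimes>\<^bsub>grpG r1 r2\<^esub> y \<in> fund \<longleftrightarrow>
      (l + s \<in> {0..<1} \<and> l \<in> \<int>) \<and>
      (\<forall>i. m $ i + (matA r1 r2 l *v x) $ i \<in> {0..<1} \<and> m $ i \<in> \<int>)"
      by (auto simp: y carrier_grpGamma mult_grpG fund_def)
    also have "\<dots> \<longleftrightarrow> (m, l) = (n, t)"
      unfolding unit by (auto simp: t_def n_def vec_eq_iff)
    finally show ?thesis .
  qed
  show ?thesis
    by (rule ex1I[of _ "(n, t)"]) (use key in \<open>auto simp del: mult_grpG\<close>)
qed

lemma left_field_eq:
  "left_field r1 r2 (v, c) (x, s) = (matA r1 r2 s *v v, c)"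
proof -
  have "((\<lambda>z. (x + matA r1 r2 s *v fst z, s + snd z)) has_derivative
      (\<lambda>z. (matA r1 r2 s *v fst z, snd z))) (at (0, 0))"
    by (auto intro!: derivative_eq_intros
        bounded_linear.has_derivative[OF matrix_vector_mul_bounded_linear])
  then have "frechet_derivative (\<lambda>z. (x, s) \<otimes>\<^bsub>grpG r1 r2\<^esub> z) (at (0, 0)) =
      (\<lambda>z. (matA r1 r2 s *v fst z, snd z))"
    by (intro frechet_derivative_at[symmetric]) (simp add: grpG_def case_prod_unfold)
  then show ?thesis by (simp add: left_field_def dL_def)
qed

lemma frame_eq:
  "frame r1 r2 1 (x, s) = (axis 3 1 + (of_int r1 * s) *\<^sub>R axis 1 1, 0)"
  "frame r1 r2 2 (x, s) = (axis 4 1 + (of_int r2 * s) *\<^sub>R axis 2 1, 0)"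
  "frame r1 r2 3 (x, s) = (0, 1)"
  by (simp_all add: frame_def left_field_eq matA_axis)

lemma weights_even:
  assumes hom: "eps \<in> hom (grpGamma r1 r2) (integer_mod_group 2)"
  shows "x \<in> coset2 (eps (axis 1 1, 0)) \<Longrightarrow> even (r1 * x)"
    and "x \<in> coset2 (eps (axis 2 1, 0)) \<Longrightarrow> even (r2 * x)"
proof -
  let ?M = "grpGamma r1 r2"
  have add: "even (eps ((x, s) \<otimes>\<^bsub>?M\<^esub> (y, t)) - (eps (x, s) + eps (y, t)))"
    if "(x, s) \<in> carrier ?M" "(y, t) \<in> carrier ?M" for x s y t
  proof -
    have "eps ((x, s) \<otimes>\<^bsub>?M\<^esub> (y, t)) = (eps (x, s) + eps (y, t)) mod 2"
      using hom_mult[OF hom that] by (simp add: integer_mod_group_def)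
    then show ?thesis by presburger
  qed
  have zero: "even (eps (0, 0))"
    using add[of 0 0 0 0] by (simp add: carrier_grpGamma mult_grpGamma)
  have mulp: "even (eps (real n *\<^sub>R axis i 1, 0) - int n * eps (axis i 1, 0))" for n and i :: 4
  proof (induction n)
    case 0 then show ?case by (simp add: zero)
  next
    case (Suc n)
    have "even (eps ((real n *\<^sub>R axis i 1, 0) \<otimes>\<^bsub>?M\<^esub> (axis i 1, 0)) -
        (eps (real n *\<^sub>R axis i 1, 0) + eps (axis i 1, 0)))"
      by (rule add) (auto simp: carrier_grpGamma axis_def)
    moreover have "(real n *\<^sub>R axis i 1, 0) \<otimes>\<^bsub>?M\<^esub> (axis i 1, 0) = (real (Suc n) *\<^sub>R axis i 1, 0)"
      by (simp add: mult_grpGamma matA_mult_vec algebra_simps)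
    ultimately show ?case using Suc.IH by (simp add: algebra_simps)
  qed
  have mulm: "even (eps (- (real n *\<^sub>R axis i 1), 0) + int n * eps (axis i 1, 0))" for n and i :: 4
  proof -
    have "even (eps ((- (real n *\<^sub>R axis i 1), 0) \<otimes>\<^bsub>?M\<^esub> (real n *\<^sub>R axis i 1, 0)) -
        (eps (- (real n *\<^sub>R axis i 1), 0) + eps (real n *\<^sub>R axis i 1, 0)))"
      by (rule add) (auto simp: carrier_grpGamma axis_def)
    moreover have "(- (real n *\<^sub>R axis i 1), 0) \<otimes>\<^bsub>?M\<^esub> (real n *\<^sub>R axis i 1, 0) = (0, 0)"
      by (simp add: mult_grpGamma matA_mult_vec algebra_simps)
    ultimately have "even (eps (0, 0) -
        (eps (- (real n *\<^sub>R axis i 1), 0) + eps (real n *\<^sub>R axis i 1, 0)))"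
      by simp
    then show ?thesis
      using mulp[of n i] zero unfolding even_diff even_add by blast
  qed
  have muli: "even (eps (of_int r *\<^sub>R axis i 1, 0) - r * eps (axis i 1, 0))" for r and i :: 4
  proof (cases "r \<ge> 0")
    case True then show ?thesis using mulp[of "nat r" i] by simp
  next
    case False then show ?thesis using mulm[of "nat (- r)" i] by simp
  qed
  have main: "even (r * eps (axis i 1, 0))"
    if A: "matA r1 r2 1 *v axis j 1 = axis j 1 + of_int r *\<^sub>R axis i 1"
      and i: "i = 1 \<or> i = 2" for r and i j :: 4
  proof -
    have c: "(axis j 1, 0) \<in> carrier ?M" "(axis i 1, 0) \<in> carrier ?M"
      "(of_int r *\<^sub>R axis i 1, 0) \<in> carrier ?M" "(0, 1) \<in> carrier ?M"
      "(axis j 1 + of_int r *\<^sub>R axis i 1, 0) \<in> carrier ?M"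
      by (auto simp: carrier_grpGamma axis_def)
    have 1: "(0, 1) \<otimes>\<^bsub>?M\<^esub> (axis j 1, 0) = (axis j 1 + of_int r *\<^sub>R axis i 1, 1)"
      "(axis j 1 + of_int r *\<^sub>R axis i 1, 0) \<otimes>\<^bsub>?M\<^esub> (0, 1) = (axis j 1 + of_int r *\<^sub>R axis i 1, 1)"
      "(axis j 1, 0) \<otimes>\<^bsub>?M\<^esub> (of_int r *\<^sub>R axis i 1, 0) = (axis j 1 + of_int r *\<^sub>R axis i 1, 0)"
      by (simp_all add: mult_grpGamma A) (simp_all add: matA_mult_vec)
    show ?thesis
      using add[OF c(4) c(1)] add[OF c(5) c(4)] add[OF c(1) c(3)] muli[of r i]
      unfolding 1 even_diff even_add by blast
  qed
  have "even (r1 * eps (axis 1 1, 0))" "even (r2 * eps (axis 2 1, 0))"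
    using main[of 3 r1 1] main[of 4 r2 2] by (simp_all add: matA_axis)
  then show "x \<in> coset2 (eps (axis 1 1, 0)) \<Longrightarrow> even (r1 * x)"
    and "x \<in> coset2 (eps (axis 2 1, 0)) \<Longrightarrow> even (r2 * x)"
    by (auto simp: coset2_def)
qed

lemma enat_summable: "(f :: 'a \<Rightarrow> enat) summable_on A"
  by (rule nonneg_summable_on_complete) simp

end

theory Submission
  imports Defs "HOL-Real_Asymp.Real_Asymp"
begin

text \<open>Vanishing of the traces \<open>\<Sum>\<^sub>i g(\<nabla>\<^bsub>s\<^sub>i\<^esub>s\<^sub>j, s\<^sub>i)\<close> leaves in the zero-order term of \<open>D\<close> only the
  cyclic products \<open>s\<^sub>1s\<^sub>2s\<^sub>3\<close>, which act as a scalar; hence \<open>D = \<Sum>\<^sub>i s\<^sub>i d\<rho>(s\<^sub>i) + \<alpha>\<close>.  This operator is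
  symmetric, so each of its multiplicities is the number of members with that eigenvalue in any
  complete orthonormal system of eigenfunctions.

  Where \<open>\<xi>\<^sub>1 = \<xi>\<^sub>2 = 0\<close>, characters provide eigenfunctions with the eigenvalues of a Hermitian
  \<open>2 \<times> 2\<close> matrix.  The other characters of \<open>\<real>\<^sup>4\<close> are averaged over the lattice against a function
  \<open>w\<close> of the last coordinate.  On such a theta series \<open>D\<close> acts as a Dirac operator in one variable
  on \<open>w\<close>, which Gaussians times Hermite polynomials diagonalise.  Completeness holds because these
  functions are dense in a weighted uniform norm, and because theta series and characters span a
  uniformly dense set of equivariant functions.  The integer translation acts on \<open>(\<xi>\<^sub>3, \<xi>\<^sub>4)\<close> by adding
  \<open>(r\<^sub>1\<xi>\<^sub>1, r\<^sub>2\<xi>\<^sub>2)\<close>; its orbits index the series, and counting them produces the weights.\<close>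

section \<open>Square-integrable spinors\<close>

text \<open>Put a = \<open>r1 * x1\<close>, b = \<open>r2 * x2\<close>. On a theta series the first
  two frame fields multiply the weight by i pi (x3 + a t) and i pi (x4 + b t), and the third
  differentiates it. Writing (x3 + a t) + i (x4 + b t) = omega (rho (t + sigma) + i d), with omega
  of modulus one and rho the length of (a, b), merges the two moving forms into one harmonic
  oscillator and a constant d, the component of (x3, x4) normal to (a, b). Level k then gives a 2 by
  2 block with eigenvalues plus and minus the root of 2 pi k rho + (pi d)^2; at k = 0 only one
  vector survives, whence the unpaired delta in the formulas. Orbits move (x3, x4) parallel to (a,
  b), so d is an orbit invariant. The obstacle is completeness. The functions orthogonal to a fixed
  f form a family closed under uniform limits, and this family is enlarged until it contains every
  continuous equivariant function. Summation over the integers costs a factor 1 + t^2, so the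
  Hermite functions must be dense in a sup norm with that weight. Since spinors are not identified
  modulo null sets, the inner product is only semidefinite, and vanishing always means vanishing
  norm.\<close>

definition sqi :: "(pt \<Rightarrow> spinor) \<Rightarrow> bool" where
  "sqi f \<longleftrightarrow> f \<in> borel_measurable borel \<and> set_integrable lborel fund (\<lambda>y. (norm (f y))\<^sup>2)"

definition spip :: "spinor \<Rightarrow> spinor \<Rightarrow> complex" where
  "spip v w = (\<Sum>j\<in>UNIV. v $ j * cnj (w $ j))"

lemma spip_add_left: "spip (u + v) w = spip u w + spip v w"
  and spip_scale_left: "spip (c *s v) w = c * spip v w"
  and spip_add_right: "spip w (u + v) = spip w u + spip w v"
  and spip_scale_right: "spip w (c *s v) = cnj c * spip w v"
  by (simp_all add: spip_def sum.distrib sum_distrib_left algebra_simps)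

lemma spip_commute: "spip w v = cnj (spip v w)"
  by (simp add: spip_def mult.commute)

lemma spip_self: "spip v v = of_real ((norm v)\<^sup>2)"
  by (simp add: spip_def norm_vec_def L2_set_def complex_norm_square[symmetric] sum_nonneg)

lemma norm_spip_le: "norm (spip v w) \<le> norm v * norm w"
proof -
  have "norm (spip v w) \<le> (\<Sum>j\<in>UNIV. norm (v $ j) * norm (w $ j))"
    unfolding spip_def by (rule order_trans[OF norm_sum]) (simp add: norm_mult)
  also have "\<dots> = (\<Sum>j\<in>UNIV. \<bar>norm (v $ j)\<bar> * \<bar>norm (w $ j)\<bar>)" by simp
  also have "\<dots> \<le> L2_set (\<lambda>j. norm (v $ j)) UNIV * L2_set (\<lambda>j. norm (w $ j)) UNIV"
    by (rule L2_set_mult_ineq)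
  finally show ?thesis by (simp add: norm_vec_def)
qed

lemma measurable_spip [measurable (raw)]:
  assumes "f \<in> borel_measurable M" "g \<in> borel_measurable M"
  shows "(\<lambda>y. spip (f y) (g y)) \<in> borel_measurable M"
proof -
  have "continuous_on UNIV (\<lambda>p. spip (fst p) (snd p))"
    unfolding spip_def by (intro continuous_intros)
  from borel_measurable_continuous_on[OF this borel_measurable_Pair[OF assms]]
  show ?thesis by simp
qed

lemma fund_sets [measurable]: "fund \<in> sets borel"
proof -
  have "fund = (\<Inter>i. {p :: pt. 0 \<le> fst p $ i} \<inter> {p. fst p $ i < 1}) \<inter>
    ({p. 0 \<le> snd p} \<inter> {p. snd p < 1})"
    by (auto simp: fund_def)
  also have "\<dots> \<in> sets borel"
    by (intro sets.Int sets.finite_INT borel_closed borel_open closed_Collect_le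
        open_Collect_less continuous_intros) auto
  finally show ?thesis .
qed

lemma bounded_fund: "bounded fund"
proof (rule boundedI)
  fix y assume "y \<in> fund"
  then have *: "\<bar>fst y $ i\<bar> \<le> 1" "\<bar>snd y\<bar> \<le> 1" for i
    by (auto simp: fund_def abs_le_iff order.strict_implies_order) (smt (verit))+
  have "norm (fst y) \<le> (\<Sum>i\<in>UNIV. \<bar>fst y $ i\<bar>)" by (rule norm_le_l1_cart)
  also have "\<dots> \<le> (\<Sum>i\<in>(UNIV :: 4 set). 1)" by (rule sum_mono) (rule *)
  finally have "norm (fst y) \<le> 4" by simp
  then show "norm y \<le> 5"
    using norm_Pair_le[of "fst y" "snd y"] *(2) by simp
qed

lemma emeasure_fund_finite: "emeasure lborel fund < \<infinity>"
  by (rule emeasure_bounded_finite) (rule bounded_fund)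

lemma set_integrable_fund_bounded:
  fixes f :: "pt \<Rightarrow> 'b::{banach, second_countable_topology}"
  assumes [measurable]: "f \<in> borel_measurable borel" and b: "\<And>y. y \<in> fund \<Longrightarrow> norm (f y) \<le> C"
  shows "set_integrable lborel fund f"
proof -
  have "set_integrable lborel fund (\<lambda>y. C)"
    using emeasure_fund_finite by (simp add: set_integrable_def)
  then show ?thesis
    by (rule set_integrable_bound)
      (auto simp: set_borel_measurable_def intro!: AE_I2 order_trans[OF b])
qed

lemma spip_bound: "norm (spip v w) \<le> ((norm v)\<^sup>2 + (norm w)\<^sup>2) / 2"
  using norm_spip_le[of v w] sum_squares_bound[of "norm v" "norm w"] by simp

lemma sqi_spip:
  assumes "sqi f" "sqi g"
  shows "set_integrable lborel fund (\<lambda>y. spip (f y) (g y))"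
proof -
  have [measurable]: "f \<in> borel_measurable borel" "g \<in> borel_measurable borel"
    using assms by (auto simp: sqi_def)
  have "set_integrable lborel fund (\<lambda>y. ((norm (f y))\<^sup>2 + (norm (g y))\<^sup>2) / 2)"
    using assms by (intro set_integral_add set_integrable_divide) (auto simp: sqi_def)
  then show ?thesis
    by (rule set_integrable_bound)
      (use spip_bound in \<open>auto simp: set_borel_measurable_def intro!: AE_I2\<close>)
qed

lemma L2ip_eq: "L2ip f g = (LINT y:fund|lborel. spip (f y) (g y))"
  by (simp add: L2ip_def spip_def)

lemma sqi_scale: "sqi f \<Longrightarrow> sqi (\<lambda>y. c *s f y)"
proof -
  assume f: "sqi f"
  then have [measurable]: "f \<in> borel_measurable borel" by (simp add: sqi_def)
  have "continuous_on UNIV (\<lambda>v :: spinor. c *s v)"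
    unfolding vector_scalar_mult_def by (intro continuous_intros)
  from borel_measurable_continuous_on[OF this, of f borel] have
    "(\<lambda>y. c *s f y) \<in> borel_measurable borel" by simp
  moreover have "norm (c *s v) = norm c * norm v" for v :: spinor
    by (simp add: norm_vec_def norm_mult L2_set_right_distrib)
  ultimately show ?thesis using f by (simp add: sqi_def power_mult_distrib)
qed

lemma sqi_add: "sqi f \<Longrightarrow> sqi g \<Longrightarrow> sqi (\<lambda>y. f y + g y)"
proof -
  assume fg: "sqi f" "sqi g"
  then have [measurable]: "f \<in> borel_measurable borel" "g \<in> borel_measurable borel"
    by (auto simp: sqi_def)
  have "set_integrable lborel fund (\<lambda>y. 2 * ((norm (f y))\<^sup>2 + (norm (g y))\<^sup>2))"
    using fg by (intro set_integrable_mult_right set_integral_add) (auto simp: sqi_def)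
  then have "set_integrable lborel fund (\<lambda>y. (norm (f y + g y))\<^sup>2)"
  proof (rule set_integrable_bound)
    have "(norm (f y + g y))\<^sup>2 \<le> 2 * ((norm (f y))\<^sup>2 + (norm (g y))\<^sup>2)" for y
    proof -
      have "(norm (f y + g y))\<^sup>2 \<le> (norm (f y) + norm (g y))\<^sup>2"
        by (intro power_mono norm_triangle_ineq) auto
      then show ?thesis using sum_squares_bound[of "norm (f y)" "norm (g y)"]
        by (simp add: power2_sum)
    qed
    then show "AE x in lborel. x \<in> fund \<longrightarrow>
        norm ((norm (f x + g x))\<^sup>2) \<le> norm (2 * ((norm (f x))\<^sup>2 + (norm (g x))\<^sup>2))"
      by (intro AE_I2) simp
  qed (auto simp: set_borel_measurable_def)
  then show ?thesis by (simp add: sqi_def)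
qed

lemma sqi_zero: "sqi (\<lambda>y. 0)" by (simp add: sqi_def set_integrable_def)

lemma sqi_sum: "finite F \<Longrightarrow> (\<And>b. b \<in> F \<Longrightarrow> sqi (f b)) \<Longrightarrow> sqi (\<lambda>y. \<Sum>b\<in>F. f b y)"
  by (induction F rule: finite_induct) (auto simp: sqi_zero sqi_add)

lemma sqi_diff: "sqi f \<Longrightarrow> sqi g \<Longrightarrow> sqi (\<lambda>y. f y - g y)"
  using sqi_add[of f "\<lambda>y. (-1) *s g y"] sqi_scale[of g "-1"]
  by (simp add: vector_scalar_mult_def vec_eq_iff minus_vec_def plus_vec_def)

lemma sqi_bounded:
  assumes [measurable]: "f \<in> borel_measurable borel" and b: "\<And>y. y \<in> fund \<Longrightarrow> norm (f y) \<le> C"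
  shows "sqi f"
  unfolding sqi_def
proof
  show "set_integrable lborel fund (\<lambda>y. (norm (f y))\<^sup>2)"
    using b by (intro set_integrable_fund_bounded[where C = "C\<^sup>2"]) (auto intro!: power_mono)
qed simp

lemma sqi_continuous:
  assumes "continuous_on UNIV f"
  shows "sqi f"
proof -
  have "compact (closure fund)" using bounded_fund by (simp add: compact_closure)
  then have "compact (f ` closure fund)"
    by (intro compact_continuous_image continuous_on_subset[OF assms]) auto
  then obtain C where "\<And>y. y \<in> closure fund \<Longrightarrow> norm (f y) \<le> C"
    by (meson compact_imp_bounded bounded_iff imageI)
  then show ?thesis
    using closure_subset by (intro sqi_bounded borel_measurable_continuous_onI assms) blast
qed

lemma L2ip_add_left: "sqi f \<Longrightarrow> sqi g \<Longrightarrow> sqi h \<Longrightarrow> L2ip (\<lambda>y. f y + g y) h = L2ip f h + L2ip g h"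
  by (simp add: L2ip_eq spip_add_left set_integral_add sqi_spip)

lemma L2ip_scale_left: "L2ip (\<lambda>y. c *s f y) h = c * L2ip f h"
  by (simp add: L2ip_eq spip_scale_left)

lemma L2ip_commute: "L2ip g f = cnj (L2ip f g)"
proof -
  have "(LINT y:fund|lborel. spip (g y) (f y)) = (LINT y:fund|lborel. cnj (spip (f y) (g y)))"
    by (simp only: flip: spip_commute)
  also have "\<dots> = cnj (LINT y:fund|lborel. spip (f y) (g y))"
    unfolding set_lebesgue_integral_def
    by (simp only: Bochner_Integration.integral_cnj flip: complex_cnj_scaleR)
  finally show ?thesis by (simp add: L2ip_eq)
qed

lemma norm_L2ip_commute: "norm (L2ip f g) = norm (L2ip g f)"
  by (subst L2ip_commute) simp

lemma L2ip_zero_left [simp]: "L2ip (\<lambda>y. 0) h = 0"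
  by (simp add: L2ip_eq spip_def)

lemma L2ip_sum_left:
  "finite F \<Longrightarrow> (\<And>b. b \<in> F \<Longrightarrow> sqi (f b)) \<Longrightarrow> sqi h \<Longrightarrow>
    L2ip (\<lambda>y. \<Sum>b\<in>F. f b y) h = (\<Sum>b\<in>F. L2ip (f b) h)"
  by (induction F rule: finite_induct) (auto simp: L2ip_add_left sqi_sum)

lemma L2ip_diff_left:
  assumes "sqi f" "sqi g" "sqi h"
  shows "L2ip (\<lambda>y. f y - g y) h = L2ip f h - L2ip g h"
proof -
  have [simp]: "spip (u - v) w = spip u w - spip v w" for u v w
    by (simp add: spip_def sum_subtractf algebra_simps)
  show ?thesis using assms by (simp add: L2ip_eq set_integral_diff sqi_spip)
qed

lemma L2ip_add_right: "sqi f \<Longrightarrow> sqi g \<Longrightarrow> sqi h \<Longrightarrow> L2ip h (\<lambda>y. f y + g y) = L2ip h f + L2ip h g"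
  using L2ip_add_left[of f g h] by (metis L2ip_commute complex_cnj_add)

lemma L2ip_scale_right: "L2ip h (\<lambda>y. c *s f y) = cnj c * L2ip h f"
  by (metis L2ip_commute L2ip_scale_left complex_cnj_mult)

lemma L2ip_diff_right: "sqi f \<Longrightarrow> sqi g \<Longrightarrow> sqi h \<Longrightarrow> L2ip h (\<lambda>y. f y - g y) = L2ip h f - L2ip h g"
  using L2ip_diff_left[of f g h] by (metis L2ip_commute complex_cnj_diff)

lemma L2norm_nonneg [simp]: "0 \<le> L2norm f"
  by (simp add: L2norm_def set_lebesgue_integral_def integral_nonneg_AE)

lemma L2norm_sq: "(L2norm f)\<^sup>2 = (LINT y:fund|lborel. (norm (f y))\<^sup>2)"
  unfolding L2norm_def
  by (rule real_sqrt_pow2) (simp add: set_lebesgue_integral_def integral_nonneg_AE)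

lemma L2ip_self: "L2ip f f = of_real ((L2norm f)\<^sup>2)"
  unfolding L2norm_sq L2ip_eq spip_self
  by (simp add: set_lebesgue_integral_def scaleR_conv_of_real flip: of_real_mult of_real_power)

text \<open>For positive a and b the bound is smallest at t = b / a, where it equals a b. This form
  of the arithmetic-geometric inequality gives Cauchy-Schwarz for a semidefinite form, where a norm
  may be zero.\<close>

lemma le_mult_of_scaled:
  fixes x a b :: real
  assumes "a \<ge> 0" "b \<ge> 0" "\<And>t. t > 0 \<Longrightarrow> x \<le> (t * a\<^sup>2 + b\<^sup>2 / t) / 2"
  shows "x \<le> a * b"
proof -
  \<comment> \<open>Raising both numbers by e keeps the optimal t = (b + e) / (a + e) meaningful
    when a or b is zero; afterwards e tends to 0.\<close>
  have le: "x \<le> (a + e) * (b + e)" if "e > 0" for e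
  proof -
    have pos: "a + e > 0" "b + e > 0" using assms that by auto
    define t where "t = (b + e) / (a + e)"
    have t: "t > 0" using pos by (simp add: t_def)
    have "x \<le> (t * a\<^sup>2 + b\<^sup>2 / t) / 2" by (rule assms(3)[OF t])
    also have "\<dots> \<le> (t * (a + e)\<^sup>2 + (b + e)\<^sup>2 / t) / 2"
      using t assms that by (intro divide_right_mono add_mono mult_left_mono power_mono) auto
    also have "\<dots> = (a + e) * (b + e)"
    proof -
      have "t * (a + e)\<^sup>2 = (b + e) * (a + e)" "(b + e)\<^sup>2 / t = (b + e) * (a + e)"
        using pos by (simp_all add: t_def power2_eq_square)
      then show ?thesis by simp
    qed
    finally show ?thesis .
  qed
  have "((\<lambda>e. (a + e) * (b + e)) \<longlongrightarrow> (a + 0) * (b + 0)) (at_right 0)"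
    by (intro tendsto_intros)
  then have "((\<lambda>e. (a + e) * (b + e)) \<longlongrightarrow> a * b) (at_right 0)" by simp
  moreover have "eventually (\<lambda>e. x \<le> (a + e) * (b + e)) (at_right 0)"
    using eventually_at_right_less[of 0] by eventually_elim (rule le)
  ultimately show ?thesis by (rule tendsto_lowerbound) simp
qed

lemma L2_Cauchy_Schwarz:
  assumes "sqi f" "sqi g"
  shows "norm (L2ip f g) \<le> L2norm f * L2norm g"
proof (rule le_mult_of_scaled)
  fix t :: real assume t: "t > 0"
  have [measurable]: "f \<in> borel_measurable borel" "g \<in> borel_measurable borel"
    using assms by (auto simp: sqi_def)
  have i: "set_integrable lborel fund (\<lambda>y. (norm (f y))\<^sup>2)"
    "set_integrable lborel fund (\<lambda>y. (norm (g y))\<^sup>2)"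
    using assms by (auto simp: sqi_def)
  have le: "norm (spip v w) \<le> (t * (norm v)\<^sup>2 + (norm w)\<^sup>2 / t) / 2" for v w
  proof -
    have "2 * (sqrt t * norm v) * (norm w / sqrt t) \<le> (sqrt t * norm v)\<^sup>2 + (norm w / sqrt t)\<^sup>2"
      by (rule sum_squares_bound)
    then have "2 * (norm v * norm w) \<le> t * (norm v)\<^sup>2 + (norm w)\<^sup>2 / t"
      using t by (simp add: power_mult_distrib power_divide)
    then show ?thesis using norm_spip_le[of v w] by simp
  qed
  have "norm (L2ip f g) \<le> (LINT y:fund|lborel. norm (spip (f y) (g y)))"
    unfolding L2ip_eq by (rule set_integral_norm_bound) (rule sqi_spip[OF assms])
  also have "\<dots> \<le> (LINT y:fund|lborel. (t * (norm (f y))\<^sup>2 + (norm (g y))\<^sup>2 / t) / 2)"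
    using i le by (intro set_integral_mono set_integrable_norm sqi_spip assms
        set_integrable_divide set_integral_add set_integrable_mult_right) auto
  also have "\<dots> = (t * (L2norm f)\<^sup>2 + (L2norm g)\<^sup>2 / t) / 2"
    unfolding L2norm_sq using i by (simp add: set_integral_add set_integrable_divide)
  finally show "norm (L2ip f g) \<le> (t * (L2norm f)\<^sup>2 + (L2norm g)\<^sup>2 / t) / 2" .
qed auto

lemma L2norm_triangle:
  assumes "sqi f" "sqi g"
  shows "L2norm (\<lambda>y. f y + g y) \<le> L2norm f + L2norm g"
proof (rule power2_le_imp_le)
  have "of_real ((L2norm (\<lambda>y. f y + g y))\<^sup>2) = L2ip (\<lambda>y. f y + g y) (\<lambda>y. f y + g y)"
    by (simp add: L2ip_self)
  also have "\<dots> = L2ip f f + L2ip g g + (L2ip f g + cnj (L2ip f g))"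
    using assms by (simp add: L2ip_add_left L2ip_add_right sqi_add L2ip_commute[of g f])
  also have "\<dots> = of_real ((L2norm f)\<^sup>2 + (L2norm g)\<^sup>2 + 2 * Re (L2ip f g))"
    by (simp add: L2ip_self complex_add_cnj)
  finally have "(L2norm (\<lambda>y. f y + g y))\<^sup>2 = (L2norm f)\<^sup>2 + (L2norm g)\<^sup>2 + 2 * Re (L2ip f g)"
    by (simp only: of_real_eq_iff)
  moreover have "Re (L2ip f g) \<le> L2norm f * L2norm g"
    using complex_Re_le_cmod[of "L2ip f g"] L2_Cauchy_Schwarz[OF assms] by linarith
  ultimately show "(L2norm (\<lambda>y. f y + g y))\<^sup>2 \<le> (L2norm f + L2norm g)\<^sup>2"
    by (simp add: power2_sum)
qed simp

lemma L2norm_scale: "L2norm (\<lambda>y. c *s f y) = norm c * L2norm f"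
proof -
  have "norm (c *s v) = norm c * norm v" for v :: spinor
    by (simp add: norm_vec_def norm_mult L2_set_right_distrib)
  then show ?thesis
    by (simp add: L2norm_def power_mult_distrib real_sqrt_mult)
qed

section \<open>Orthonormal systems\<close>

definition orthonormal :: "(pt \<Rightarrow> spinor) set \<Rightarrow> bool" where
  "orthonormal B \<longleftrightarrow> (\<forall>f\<in>B. \<forall>g\<in>B. L2ip f g = (if f = g then 1 else 0))"

definition proj_off :: "(pt \<Rightarrow> spinor) set \<Rightarrow> (pt \<Rightarrow> spinor) \<Rightarrow> (pt \<Rightarrow> spinor)" where
  "proj_off F f = (\<lambda>y. f y - (\<Sum>b\<in>F. L2ip f b *s b y))"

text \<open>The third equation is Pythagoras: it gives Bessel's inequality in general and Parseval's
  identity once the residual has norm zero.\<close>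

lemma proj_off:
  assumes F: "finite F" "\<And>b. b \<in> F \<Longrightarrow> sqi b" "orthonormal F" and f: "sqi f"
  shows "sqi (proj_off F f)"
    and "b \<in> F \<Longrightarrow> L2ip (proj_off F f) b = 0"
    and "(L2norm (proj_off F f))\<^sup>2 = (L2norm f)\<^sup>2 - (\<Sum>b\<in>F. (norm (L2ip f b))\<^sup>2)"
proof -
  have s: "sqi (\<lambda>y. \<Sum>b\<in>F. L2ip f b *s b y)" using F by (intro sqi_sum sqi_scale) auto
  show p: "sqi (proj_off F f)" unfolding proj_off_def by (intro sqi_diff f s)
  have zero: "L2ip (proj_off F f) b = 0" if b: "b \<in> F" for b
  proof -
    have "L2ip (proj_off F f) b = L2ip f b - (\<Sum>c\<in>F. L2ip f c * L2ip c b)"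
      using F f s b
      by (simp add: proj_off_def L2ip_diff_left L2ip_sum_left sqi_scale L2ip_scale_left)
    also have "(\<Sum>c\<in>F. L2ip f c * L2ip c b) = (\<Sum>c\<in>F. if c = b then L2ip f c else 0)"
      using F b by (intro sum.cong) (auto simp: orthonormal_def)
    finally show ?thesis using F b by simp
  qed
  then show "b \<in> F \<Longrightarrow> L2ip (proj_off F f) b = 0" .
  have z2: "L2ip (\<lambda>y. \<Sum>b\<in>F. L2ip f b *s b y) (proj_off F f) = 0"
  proof -
    have "L2ip b (proj_off F f) = 0" if "b \<in> F" for b
      using zero[OF that] by (subst L2ip_commute) simp
    then show ?thesis using F p by (simp add: L2ip_sum_left sqi_scale L2ip_scale_left)
  qed
  have "L2ip (proj_off F f) (proj_off F f) = L2ip f (proj_off F f)"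
    using L2ip_diff_left[OF f s p] z2 by (simp add: proj_off_def)
  also have "\<dots> = L2ip f f - cnj (L2ip (\<lambda>y. \<Sum>b\<in>F. L2ip f b *s b y) f)"
    using L2ip_diff_right[OF f s f] unfolding proj_off_def by (simp only: flip: L2ip_commute)
  also have "L2ip (\<lambda>y. \<Sum>b\<in>F. L2ip f b *s b y) f = (\<Sum>b\<in>F. of_real ((norm (L2ip f b))\<^sup>2))"
  proof -
    have "L2ip f b * L2ip b f = of_real ((norm (L2ip f b))\<^sup>2)" for b
      by (subst L2ip_commute[of b f]) (simp only: complex_norm_square)
    then show ?thesis using F f by (simp add: L2ip_sum_left sqi_scale L2ip_scale_left)
  qed
  finally have "of_real ((L2norm (proj_off F f))\<^sup>2) =
      (of_real ((L2norm f)\<^sup>2 - (\<Sum>b\<in>F. (norm (L2ip f b))\<^sup>2)) :: complex)"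
    by (simp add: L2ip_self)
  then show "(L2norm (proj_off F f))\<^sup>2 = (L2norm f)\<^sup>2 - (\<Sum>b\<in>F. (norm (L2ip f b))\<^sup>2)"
    by (simp only: of_real_eq_iff)
qed

lemma L2norm_of_orthonormal: "orthonormal B \<Longrightarrow> b \<in> B \<Longrightarrow> (L2norm b)\<^sup>2 = 1"
  using L2ip_self[of b] by (auto simp: orthonormal_def simp flip: of_real_power)

text \<open>Double counting of the squared coefficients between \<open>F\<close> and
  \<open>B\<close>: by Parseval for \<open>B\<close> each element of \<open>F\<close> contributes
  exactly 1, by Bessel for \<open>F\<close> each element of \<open>B\<close> receives at most
  1.\<close>

lemma card_orthonormal_le:
  assumes V: "\<And>f. f \<in> V \<Longrightarrow> sqi f"
    and lin: "\<And>f g c. f \<in> V \<Longrightarrow> g \<in> V \<Longrightarrow> (\<lambda>y. f y + c *s g y) \<in> V"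
    and B: "orthonormal_basis V B" "finite B"
    and F: "orthonormal F" "F \<subseteq> V" "finite F"
  shows "card F \<le> card B"
proof -
  have Bo: "orthonormal B" "B \<subseteq> V" using B by (auto simp: orthonormal_basis_def orthonormal_def)
  have lins: "(\<lambda>y. f y + (\<Sum>b\<in>G. c b *s b y)) \<in> V" if "finite G" "f \<in> V" "G \<subseteq> V" for G f c
    using that
  proof (induction G rule: finite_induct)
    case (insert b G)
    then have "(\<lambda>y. (f y + (\<Sum>b\<in>G. c b *s b y)) + c b *s b y) \<in> V" by (intro lin) auto
    moreover have "(\<lambda>y. (f y + (\<Sum>b\<in>G. c b *s b y)) + c b *s b y) =
        (\<lambda>y. f y + (\<Sum>b\<in>insert b G. c b *s b y))"
      using insert by (auto simp: fun_eq_iff)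
    ultimately show ?case by simp
  qed simp
  have parseval: "(L2norm f)\<^sup>2 = (\<Sum>b\<in>B. (norm (L2ip f b))\<^sup>2)" if f: "f \<in> V" for f
  proof -
    \<comment> \<open>The residual is a finite linear combination, so it stays in \<open>V\<close>,
      where maximality of \<open>B\<close> forces its norm to vanish.\<close>
    have "proj_off B f = (\<lambda>y. f y + (\<Sum>b\<in>B. (- L2ip f b) *s b y))"
      by (simp add: proj_off_def fun_eq_iff sum_negf vec_eq_iff)
    then have "proj_off B f \<in> V" using lins[OF B(2) f Bo(2), of "\<lambda>b. - L2ip f b"] by simp
    moreover have "\<forall>b\<in>B. L2ip (proj_off B f) b = 0"
      using Bo B V f by (intro ballI proj_off(2)) auto
    ultimately have "L2norm (proj_off B f) = 0" using B by (auto simp: orthonormal_basis_def)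
    then show ?thesis using proj_off(3)[OF B(2) _ Bo(1) V[OF f]] Bo V by auto
  qed
  have bessel: "(\<Sum>g\<in>F. (norm (L2ip b g))\<^sup>2) \<le> 1" if b: "b \<in> B" for b
  proof -
    have "(L2norm (proj_off F b))\<^sup>2 = (L2norm b)\<^sup>2 - (\<Sum>g\<in>F. (norm (L2ip b g))\<^sup>2)"
      using F V Bo b by (intro proj_off(3)) auto
    then show ?thesis using L2norm_of_orthonormal[OF Bo(1) b] by (smt (verit) zero_le_power2)
  qed
  have "real (card F) = (\<Sum>g\<in>F. (L2norm g)\<^sup>2)"
    using L2norm_of_orthonormal[OF F(1)] by simp
  also have "\<dots> = (\<Sum>g\<in>F. \<Sum>b\<in>B. (norm (L2ip g b))\<^sup>2)"
    using F parseval by (intro sum.cong) auto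
  also have "\<dots> = (\<Sum>b\<in>B. \<Sum>g\<in>F. (norm (L2ip b g))\<^sup>2)"
    by (subst sum.swap) (simp add: norm_L2ip_commute)
  also have "\<dots> \<le> (\<Sum>b\<in>B. 1)" by (intro sum_mono bessel)
  finally show ?thesis by simp
qed

text \<open>The definite description needs all countable bases to give one value. If some basis is
  finite, the preceding bound makes every other one finite and gives both inequalities between the
  cardinalities; otherwise all bases are infinite.\<close>

lemma hilbert_dim_eq:
  assumes V: "\<And>f. f \<in> V \<Longrightarrow> sqi f"
    and lin: "\<And>f g c. f \<in> V \<Longrightarrow> g \<in> V \<Longrightarrow> (\<lambda>y. f y + c *s g y) \<in> V"
    and B: "orthonormal_basis V B" "countable B"
  shows "hilbert_dim V = (if finite B then enat (card B) else \<infinity>)"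
  unfolding hilbert_dim_def
proof (rule the_equality)
  have sub: "orthonormal C \<and> C \<subseteq> V" if "orthonormal_basis V C" for C
    using that by (auto simp: orthonormal_basis_def orthonormal_def)
  have mono: "orthonormal G" if "orthonormal C" "G \<subseteq> C" for C G
    using that unfolding orthonormal_def by (meson subsetD)
  have fin: "finite C \<and> card C \<le> card D"
    if C: "orthonormal_basis V C" and D: "orthonormal_basis V D" "finite D" for C D
  proof -
    have le: "card G \<le> card D" if "finite G" "G \<subseteq> C" for G
      using card_orthonormal_le[OF V lin D, of G] sub[OF C] mono that by blast
    have "finite C"
    proof (rule ccontr)
      assume "infinite C"
      then obtain G where "finite G" "card G = Suc (card D)" "G \<subseteq> C"
        by (meson infinite_arbitrarily_large)
      then show False using le[of G] by simp
    qed
    then show ?thesis using le[of C] by simp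
  qed
  fix n assume "\<exists>C. orthonormal_basis V C \<and> countable C \<and> n =
    (if finite C then enat (card C) else \<infinity>)"
  then obtain C where C: "orthonormal_basis V C" "n = (if finite C then enat (card C) else \<infinity>)"
    by blast
  show "n = (if finite B then enat (card B) else \<infinity>)"
    using fin[OF C(1) B(1)] fin[OF B(1) C(1)] C(2) by (auto intro: antisym)
qed (use B in blast)

section \<open>Invariance of the integral over the fundamental domain\<close>

text \<open>Conjugation with diag(1, 1, -1, -1) turns A(t) into A(-t), the inverse of A(t). A
  determinant equal to its own inverse has square 1, which avoids expanding a 4 by 4
  determinant.\<close>

lemma abs_det_matA: "\<bar>det (matA r1 r2 t)\<bar> = 1"
proof -
  have inv: "matA r1 r2 t ** matA r1 r2 (- t) = mat 1" for t
    unfolding matrix_eq by (simp flip: matrix_vector_mul_assoc)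
      (simp add: matA_mult_vec vec_eq_iff forall_4 axis_def)
  define S :: "real ^ 4 ^ 4"
    where "S = (\<chi> i j. if i = j then (if i = 1 \<or> i = 2 then 1 else -1) else 0)"
  have Sx: "S *v x = (\<chi> i. if i = 1 \<or> i = 2 then x $ i else - x $ i)" for x
    by (simp add: S_def matrix_vector_mult_def vec_eq_iff forall_4 sum_4)
  have "S ** (matA r1 r2 t ** S) = matA r1 r2 (- t)"
    unfolding matrix_eq by (simp flip: matrix_vector_mul_assoc)
      (simp add: matA_mult_vec Sx vec_eq_iff forall_4 axis_def)
  then have "det S * (det (matA r1 r2 t) * det S) = det (matA r1 r2 (- t))"
    by (metis det_mul)
  moreover have "S ** S = mat 1"
    unfolding matrix_eq by (simp flip: matrix_vector_mul_assoc) (simp add: Sx vec_eq_iff)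
  then have "det S * det S = 1" by (metis det_mul det_I)
  moreover have "det (matA r1 r2 t) * det (matA r1 r2 (- t)) = 1"
    using inv by (metis det_mul det_I)
  ultimately have "(det (matA r1 r2 t))\<^sup>2 = 1"
    by (metis (no_types, lifting) mult.assoc mult.commute mult_1 power2_eq_square)
  then show ?thesis by (auto simp: power2_eq_1_iff)
qed

lemma distr_matA: "distr lborel lborel (\<lambda>x. matA r1 r2 t *v x) = lborel"
proof -
  have lin: "linear (\<lambda>x. matA r1 r2 u *v x)" for u by (rule matrix_vector_mul_linear)
  have cont: "continuous_on UNIV (\<lambda>x. matA r1 r2 u *v x)" for u
    by (rule linear_continuous_on[OF matrix_vector_mul_bounded_linear])
  have meas [measurable]: "(\<lambda>x. matA r1 r2 u *v x) \<in> borel_measurable borel" for u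
    by (rule borel_measurable_continuous_onI[OF cont])
  have inv: "matA r1 r2 u *v (matA r1 r2 (- u) *v x) = x" for u x
    by (simp add: matA_mult_vec vec_eq_iff forall_4 axis_def)
  have "lborel = distr lborel borel (\<lambda>x. matA r1 r2 t *v x)"
  proof (rule lborel_eqI)
    fix l u :: "real ^ 4" assume lu: "\<And>b. b \<in> Basis \<Longrightarrow> l \<bullet> b \<le> u \<bullet> b"
    have im: "(\<lambda>x. matA r1 r2 t *v x) -` box l u = (\<lambda>x. matA r1 r2 (- t) *v x) ` box l u"
      using inv[of t] inv[of "- t"] by (auto simp: image_iff) (metis add.inverse_inverse)
    have lm: "box l u \<in> lmeasurable" by simp
    have lm2: "(\<lambda>x. matA r1 r2 (- t) *v x) ` box l u \<in> lmeasurable"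
      by (rule measurable_linear_image[OF lin lm])
    have ms: "(\<lambda>x. matA r1 r2 t *v x) -` box l u \<in> sets borel"
      by (rule borel_open) (rule open_vimage[OF open_box cont])
    have "emeasure (distr lborel borel (\<lambda>x. matA r1 r2 t *v x)) (box l u) =
        emeasure lborel ((\<lambda>x. matA r1 r2 t *v x) -` box l u)"
      by (subst emeasure_distr) auto
    also have "\<dots> = emeasure lebesgue ((\<lambda>x. matA r1 r2 (- t) *v x) ` box l u)"
      using ms by (simp add: im)
    also have "\<dots> = ennreal (measure lebesgue ((\<lambda>x. matA r1 r2 (- t) *v x) ` box l u))"
      by (rule emeasure_eq_measure2[OF lm2])
    also have "measure lebesgue ((\<lambda>x. matA r1 r2 (- t) *v x) ` box l u) =
      measure lebesgue (box l u)"
      using measure_linear_image[OF lin lm] by (simp add: abs_det_matA)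
    also have "ennreal (measure lebesgue (box l u)) = (\<Prod>b\<in>Basis. (u - l) \<bullet> b)"
      using lu by (simp add: measure_lborel_box_eq)
    finally show "emeasure (distr lborel borel (\<lambda>x. matA r1 r2 t *v x)) (box l u) =
      (\<Prod>b\<in>Basis. (u - l) \<bullet> b)" .
  qed simp
  moreover have "distr lborel lborel (\<lambda>x. matA r1 r2 t *v x) =
    distr lborel borel (\<lambda>x. matA r1 r2 t *v x)"
    by (rule distr_cong) auto
  ultimately show ?thesis by simp
qed

section \<open>Invariance of Lebesgue measure under left and right translations of the group\<close>

lemma nn_integral_translate:
  fixes f :: "'a::euclidean_space \<Rightarrow> ennreal"
  assumes [measurable]: "f \<in> borel_measurable borel"
  shows "(\<integral>\<^sup>+x. f (c + x) \<partial>lborel) = (\<integral>\<^sup>+x. f x \<partial>lborel)"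
proof -
  have "(\<integral>\<^sup>+x. f x \<partial>lborel) = (\<integral>\<^sup>+x. f x \<partial>distr lborel borel ((+) c))"
    by (simp add: lborel_distr_plus)
  also have "\<dots> = (\<integral>\<^sup>+x. f (c + x) \<partial>lborel)" by (rule nn_integral_distr) auto
  finally show ?thesis by simp
qed

lemma nn_integral_pt:
  fixes f :: "pt \<Rightarrow> ennreal"
  assumes [measurable]: "f \<in> borel_measurable borel"
  shows "(\<integral>\<^sup>+y. f y \<partial>lborel) = (\<integral>\<^sup>+s. \<integral>\<^sup>+x. f (x, s) \<partial>lborel \<partial>lborel)"
proof -
  have "f \<in> borel_measurable (lborel \<Otimes>\<^sub>M lborel)"
    unfolding lborel_prod using assms by simp
  from lborel_pair.nn_integral_snd[OF this] show ?thesis by (simp add: lborel_prod)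
qed

lemma continuous_matA [continuous_intros]:
  assumes "continuous_on S f" "continuous_on S g"
  shows "continuous_on S (\<lambda>y. matA r1 r2 (f y) *v g y)"
  unfolding matA_mult_vec by (intro continuous_intros assms)

lemma continuous_mult_left [continuous_intros]:
  "continuous_on UNIV (\<lambda>y. a \<otimes>\<^bsub>grpG r1 r2\<^esub> y)"
  by (cases a) (auto simp: grpG_def case_prod_unfold intro!: continuous_intros)

lemma continuous_mult_right [continuous_intros]:
  "continuous_on UNIV (\<lambda>y. y \<otimes>\<^bsub>grpG r1 r2\<^esub> a)"
  by (cases a) (auto simp: grpG_def case_prod_unfold intro!: continuous_intros)

lemma measurable_mult_left [measurable]: "(\<lambda>y. a \<otimes>\<^bsub>grpG r1 r2\<^esub> y) \<in> borel_measurable borel"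
  by (rule borel_measurable_continuous_onI[OF continuous_mult_left])

lemma measurable_mult_right [measurable]: "(\<lambda>y. y \<otimes>\<^bsub>grpG r1 r2\<^esub> a) \<in> borel_measurable borel"
  by (rule borel_measurable_continuous_onI[OF continuous_mult_right])

lemma nn_integral_mult_left:
  assumes [measurable]: "f \<in> borel_measurable borel"
  shows "(\<integral>\<^sup>+y. f (a \<otimes>\<^bsub>grpG r1 r2\<^esub> y) \<partial>lborel) = (\<integral>\<^sup>+y. f y \<partial>lborel)"
proof -
  obtain n k where a: "a = (n, k)" by force
  have slice [measurable]: "(\<lambda>x. f (x, s)) \<in> borel_measurable borel" for s
    by measurable
  have "(\<integral>\<^sup>+y. f (a \<otimes>\<^bsub>grpG r1 r2\<^esub> y) \<partial>lborel) =
      (\<integral>\<^sup>+s. \<integral>\<^sup>+x. f (n + matA r1 r2 k *v x, k + s) \<partial>lborel \<partial>lborel)"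
    by (subst nn_integral_pt) (auto simp: a mult_grpG)
  also have "\<dots> = (\<integral>\<^sup>+s. \<integral>\<^sup>+x. f (n + x, k + s) \<partial>lborel \<partial>lborel)"
  proof (rule nn_integral_cong)
    fix s
    have [measurable]: "(\<lambda>x. matA r1 r2 k *v x) \<in> borel_measurable borel"
      by (rule borel_measurable_continuous_onI) (intro continuous_intros)
    have "(\<integral>\<^sup>+x. f (n + x, k + s) \<partial>lborel) =
        (\<integral>\<^sup>+x. f (n + x, k + s) \<partial>distr lborel lborel (\<lambda>x. matA r1 r2 k *v x))"
      by (simp only: distr_matA)
    also have "\<dots> = (\<integral>\<^sup>+x. f (n + matA r1 r2 k *v x, k + s) \<partial>lborel)"
      by (rule nn_integral_distr) auto
    finally show "(\<integral>\<^sup>+x. f (n + matA r1 r2 k *v x, k + s) \<partial>lborel) =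
      (\<integral>\<^sup>+x. f (n + x, k + s) \<partial>lborel)" ..
  qed
  also have "\<dots> = (\<integral>\<^sup>+y. f ((n, k) + y) \<partial>lborel)"
    by (subst nn_integral_pt) auto
  also have "\<dots> = (\<integral>\<^sup>+y. f y \<partial>lborel)" by (rule nn_integral_translate) simp
  finally show ?thesis .
qed

text \<open>On the slice with last coordinate s, right multiplication by (v, t) merely translates by
  A(s) v, so translation invariance of the slices suffices.\<close>

lemma nn_integral_mult_right:
  assumes [measurable]: "f \<in> borel_measurable borel"
  shows "(\<integral>\<^sup>+y. f (y \<otimes>\<^bsub>grpG r1 r2\<^esub> a) \<partial>lborel) = (\<integral>\<^sup>+y. f y \<partial>lborel)"
proof -
  obtain v t where a: "a = (v, t)" by force
  have "(\<integral>\<^sup>+y. f (y \<otimes>\<^bsub>grpG r1 r2\<^esub> a) \<partial>lborel) =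
      (\<integral>\<^sup>+s. \<integral>\<^sup>+x. f (matA r1 r2 s *v v + x, s + t) \<partial>lborel \<partial>lborel)"
    by (subst nn_integral_pt) (auto simp: a mult_grpG add.commute)
  also have "\<dots> = (\<integral>\<^sup>+s. \<integral>\<^sup>+x. f (x, s + t) \<partial>lborel \<partial>lborel)"
  proof (rule nn_integral_cong)
    fix s
    have "(\<lambda>x. f (x, s + t)) \<in> borel_measurable borel" by measurable
    from nn_integral_translate[OF this]
    show "(\<integral>\<^sup>+x. f (matA r1 r2 s *v v + x, s + t) \<partial>lborel) = (\<integral>\<^sup>+x. f (x, s + t) \<partial>lborel)" .
  qed
  also have "\<dots> = (\<integral>\<^sup>+y. f ((0, t) + y) \<partial>lborel)"
    by (subst nn_integral_pt) (auto simp: add.commute)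
  also have "\<dots> = (\<integral>\<^sup>+y. f y \<partial>lborel)" by (rule nn_integral_translate) simp
  finally show ?thesis .
qed

section \<open>The lattice and the choice of the fundamental domain\<close>

lemma countable_Gamma: "countable (carrier (grpGamma r1 r2))"
proof -
  let ?h = "\<lambda>(m :: int, n :: int, p :: int, q :: int, k :: int).
      ((\<chi> i. of_int (if i = 1 then m else if i = 2 then n else if i = 3 then p else q))
        :: real ^ 4, of_int k :: real)"
  have "carrier (grpGamma r1 r2) \<subseteq> range ?h"
  proof
    fix g assume "g \<in> carrier (grpGamma r1 r2)"
    then obtain x s where g: "g = (x, s)" "\<And>i. x $ i \<in> \<int>" "s \<in> \<int>" by (auto simp: carrier_grpGamma)
    have "g = ?h (\<lfloor>x $ 1\<rfloor>, \<lfloor>x $ 2\<rfloor>, \<lfloor>x $ 3\<rfloor>, \<lfloor>x $ 4\<rfloor>, \<lfloor>s\<rfloor>)"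
      using g by (simp add: vec_eq_iff forall_4)
    then show "g \<in> range ?h" by blast
  qed
  then show ?thesis by (rule countable_subset) simp
qed

lemma mult_assoc_G: "(x \<otimes>\<^bsub>grpG r1 r2\<^esub> y) \<otimes>\<^bsub>grpG r1 r2\<^esub> z = x \<otimes>\<^bsub>grpG r1 r2\<^esub> (y \<otimes>\<^bsub>grpG r1 r2\<^esub> z)"
  by (rule monoid.m_assoc[OF group.is_monoid[OF group_grpG]]) auto

lemma inv_G [simp]:
  "inv\<^bsub>grpG r1 r2\<^esub> a \<otimes>\<^bsub>grpG r1 r2\<^esub> (a \<otimes>\<^bsub>grpG r1 r2\<^esub> y) = y"
  "a \<otimes>\<^bsub>grpG r1 r2\<^esub> (inv\<^bsub>grpG r1 r2\<^esub> a \<otimes>\<^bsub>grpG r1 r2\<^esub> y) = y"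
  "(y \<otimes>\<^bsub>grpG r1 r2\<^esub> a) \<otimes>\<^bsub>grpG r1 r2\<^esub> inv\<^bsub>grpG r1 r2\<^esub> a = y"
  "(y \<otimes>\<^bsub>grpG r1 r2\<^esub> inv\<^bsub>grpG r1 r2\<^esub> a) \<otimes>\<^bsub>grpG r1 r2\<^esub> a = y"
proof -
  interpret group "grpG r1 r2" by (rule group_grpG)
  show "inv\<^bsub>grpG r1 r2\<^esub> a \<otimes>\<^bsub>grpG r1 r2\<^esub> (a \<otimes>\<^bsub>grpG r1 r2\<^esub> y) = y"
    "a \<otimes>\<^bsub>grpG r1 r2\<^esub> (inv\<^bsub>grpG r1 r2\<^esub> a \<otimes>\<^bsub>grpG r1 r2\<^esub> y) = y"
    by (simp_all add: m_assoc[symmetric] del: one_grpG)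
  show "(y \<otimes>\<^bsub>grpG r1 r2\<^esub> a) \<otimes>\<^bsub>grpG r1 r2\<^esub> inv\<^bsub>grpG r1 r2\<^esub> a = y"
    "(y \<otimes>\<^bsub>grpG r1 r2\<^esub> inv\<^bsub>grpG r1 r2\<^esub> a) \<otimes>\<^bsub>grpG r1 r2\<^esub> a = y"
    by (simp_all add: m_assoc del: one_grpG)
qed

text \<open>Right translation commutes with the left action of the lattice, so it carries one fundamental
  domain to another, and the integral of an invariant function does not depend on the domain.\<close>

lemma nn_integral_fund_right:
  fixes F :: "pt \<Rightarrow> ennreal"
  assumes F [measurable]: "F \<in> borel_measurable borel"
    and inv: "\<And>\<gamma> y. \<gamma> \<in> carrier (grpGamma r1 r2) \<Longrightarrow> F (\<gamma> \<otimes>\<^bsub>grpG r1 r2\<^esub> y) = F y"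
  shows "(\<integral>\<^sup>+y\<in>fund. F (y \<otimes>\<^bsub>grpG r1 r2\<^esub> a) \<partial>lborel) = (\<integral>\<^sup>+y\<in>fund. F y \<partial>lborel)"
proof -
  let ?m = "mult (grpG r1 r2)" and ?C = "carrier (grpGamma r1 r2)"
  let ?i = "\<lambda>g. inv\<^bsub>grpG r1 r2\<^esub> g"
  note fund_sets [measurable]
  have cnt: "countable ?C" by (rule countable_Gamma)
  have invC: "?i g \<in> ?C" if "g \<in> ?C" for g
    by (rule subgroup.m_inv_closed[OF subgroup_grpGamma that])
  have ii: "?i (?i g) = g" for g by (simp add: group.inv_inv[OF group_grpG])
  have bij: "bij_betw ?i ?C ?C"
    by (rule bij_betw_byWitness[where f' = ?i]) (auto simp: ii invC)
  \<comment> \<open>Since \<open>fund\<close> meets every orbit exactly once, this sum over the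
    lattice can be inserted as a factor 1. Swapping it with the integral and translating by g moves
    the sum onto the indicator of the translated domain, where it is again 1.\<close>
  have one: "(\<integral>\<^sup>+g. indicator fund (?m g y) \<partial>count_space ?C) = (1 :: ennreal)" for y
  proof -
    obtain g where g: "g \<in> ?C" "?m g y \<in> fund" "\<And>h. h \<in> ?C \<Longrightarrow> ?m h y \<in> fund \<Longrightarrow> h = g"
      using fundamental_domain[of r1 r2 y] by blast
    have "?m h y \<in> fund \<longleftrightarrow> h = g" if "h \<in> ?C" for h using g that by blast
    then have "(\<integral>\<^sup>+h. indicator fund (?m h y) \<partial>count_space ?C) =
        (\<integral>\<^sup>+h. indicator {g} h \<partial>count_space ?C)"
      by (intro nn_integral_cong) (simp add: indicator_def)
    also have "\<dots> = 1" using g(1) by (simp add: emeasure_count_space)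
    finally show ?thesis by simp
  qed
  have "(\<integral>\<^sup>+y\<in>fund. F (?m y a) \<partial>lborel) =
    (\<integral>\<^sup>+y. F (?m y a) * indicator fund (?m (?m y a) (?i a)) \<partial>lborel)"
    by simp
  also have "\<dots> = (\<integral>\<^sup>+z. F z * indicator fund (?m z (?i a)) \<partial>lborel)"
    by (rule nn_integral_mult_right[where f = "\<lambda>z. F z * indicator fund (?m z (?i a))"]) measurable
  also have "\<dots> =
    (\<integral>\<^sup>+z. \<integral>\<^sup>+g. F z * indicator fund (?m z (?i a)) * indicator fund (?m g z)
      \<partial>count_space ?C \<partial>lborel)"
    by (subst nn_integral_cmult) (auto simp: one)
  also have "\<dots> =
    (\<integral>\<^sup>+g. \<integral>\<^sup>+z. F z * indicator fund (?m z (?i a)) * indicator fund (?m g z)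
      \<partial>lborel \<partial>count_space ?C)"
    by (rule nn_integral_count_space_nn_integral[OF cnt]) measurable
  also have "\<dots> = (\<integral>\<^sup>+g. \<integral>\<^sup>+z. F z * indicator fund (?m (?i g) (?m z (?i a))) *
    indicator fund z \<partial>lborel \<partial>count_space ?C)"
  proof (rule nn_integral_cong)
    fix g assume "g \<in> space (count_space ?C)"
    then have g: "g \<in> ?C" by simp
    have "(\<integral>\<^sup>+z. F z * indicator fund (?m z (?i a)) * indicator fund (?m g z) \<partial>lborel) =
       (\<integral>\<^sup>+z. F (?m g z) * indicator fund (?m (?i g) (?m (?m g z) (?i a))) *
         indicator fund (?m g z) \<partial>lborel)"
      by (simp add: inv[OF g] mult_assoc_G)
    also have "\<dots> =
      (\<integral>\<^sup>+z. F z * indicator fund (?m (?i g) (?m z (?i a))) * indicator fund z \<partial>lborel)"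
      by (rule nn_integral_mult_left[where f = "\<lambda>z. F z * indicator fund (?m (?i g) (?m z (?i a))) *
        indicator fund z"])
        measurable
    finally show "(\<integral>\<^sup>+z. F z * indicator fund (?m z (?i a)) * indicator fund (?m g z) \<partial>lborel) =
      \<dots>" .
  qed
  also have "\<dots> = (\<integral>\<^sup>+z. \<integral>\<^sup>+g. F z * indicator fund (?m (?i g) (?m z (?i a))) *
    indicator fund z \<partial>count_space ?C \<partial>lborel)"
    by (rule nn_integral_count_space_nn_integral[OF cnt, symmetric]) measurable
  also have "\<dots> =
    (\<integral>\<^sup>+z. F z * indicator fund z * (\<integral>\<^sup>+g. indicator fund (?m (?i g) (?m z (?i a))) \<partial>count_space ?C)
      \<partial>lborel)"
    by (subst nn_integral_cmult[symmetric]) (auto simp: mult_ac)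
  also have "\<dots> = (\<integral>\<^sup>+z\<in>fund. F z \<partial>lborel)"
  proof -
    have "(\<integral>\<^sup>+g. indicator fund (?m (?i g) w) \<partial>count_space ?C) = (1 :: ennreal)" for w
      using nn_integral_bij_count_space[OF bij, of "\<lambda>g. indicator fund (?m g w)"] one[of w] by simp
    then show ?thesis by simp
  qed
  finally show ?thesis .
qed

lemma integral_fund_right_real:
  fixes F :: "pt \<Rightarrow> real"
  assumes F [measurable]: "F \<in> borel_measurable borel" and b: "\<And>y. \<bar>F y\<bar> \<le> C"
    and inv: "\<And>\<gamma> y. \<gamma> \<in> carrier (grpGamma r1 r2) \<Longrightarrow> F (\<gamma> \<otimes>\<^bsub>grpG r1 r2\<^esub> y) = F y"
  shows "(LINT y:fund|lborel. F (y \<otimes>\<^bsub>grpG r1 r2\<^esub> a)) = (LINT y:fund|lborel. F y)"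
proof -
  note fund_sets [measurable]
  \<comment> \<open>Adding the bound \<open>C\<close> makes the integrand nonnegative, so that the
    result for nonnegative integrals applies; the constant cancels at the end.\<close>
  have nn: "(LINT y:fund|lborel. G y + C) = enn2real (\<integral>\<^sup>+y\<in>fund. ennreal (G y + C) \<partial>lborel)"
    if [measurable]: "G \<in> borel_measurable borel" and "\<And>y. \<bar>G y\<bar> \<le> C" for G :: "pt \<Rightarrow> real"
  proof -
    have "0 \<le> G y + C" for y using that(2)[of y] by simp
    then have "(LINT y:fund|lborel. G y + C) =
      enn2real (\<integral>\<^sup>+y. ennreal (indicator fund y *\<^sub>R (G y + C)) \<partial>lborel)"
      unfolding set_lebesgue_integral_def by (intro integral_eq_nn_integral) auto
    also have "(\<integral>\<^sup>+y. ennreal (indicator fund y *\<^sub>R (G y + C)) \<partial>lborel) =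
      (\<integral>\<^sup>+y\<in>fund. ennreal (G y + C) \<partial>lborel)"
      by (intro nn_integral_cong) (auto simp: indicator_def)
    finally show ?thesis .
  qed
  have eq: "(LINT y:fund|lborel. F (y \<otimes>\<^bsub>grpG r1 r2\<^esub> a) + C) = (LINT y:fund|lborel. F y + C)"
    using nn_integral_fund_right[of "\<lambda>y. ennreal (F y + C)" r1 r2 a] inv b by (simp add: nn)
  have "set_integrable lborel fund (\<lambda>y. C)"
    by (rule set_integrable_fund_bounded[where C = "\<bar>C\<bar>"]) auto
  moreover have "set_integrable lborel fund (\<lambda>y. F (y \<otimes>\<^bsub>grpG r1 r2\<^esub> a))"
    "set_integrable lborel fund F"
    by (rule set_integrable_fund_bounded[where C = C]; use b in simp)+
  ultimately show ?thesis using eq by (simp add: set_integral_add)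
qed

lemma integral_fund_right:
  fixes F :: "pt \<Rightarrow> complex"
  assumes F [measurable]: "F \<in> borel_measurable borel" and b: "\<And>y. norm (F y) \<le> C"
    and inv: "\<And>\<gamma> y. \<gamma> \<in> carrier (grpGamma r1 r2) \<Longrightarrow> F (\<gamma> \<otimes>\<^bsub>grpG r1 r2\<^esub> y) = F y"
  shows "(LINT y:fund|lborel. F (y \<otimes>\<^bsub>grpG r1 r2\<^esub> a)) = (LINT y:fund|lborel. F y)"
proof -
  have "set_integrable lborel fund (\<lambda>y. F (y \<otimes>\<^bsub>grpG r1 r2\<^esub> a))" "set_integrable lborel fund F"
    by (rule set_integrable_fund_bounded[where C = C]; use b in simp)+
  note i = this[unfolded set_integrable_def]
  have "\<bar>Re (F y)\<bar> \<le> C" "\<bar>Im (F y)\<bar> \<le> C" for y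
    using abs_Re_le_cmod[of "F y"] abs_Im_le_cmod[of "F y"] b[of y] by linarith+
  then have "(LINT y:fund|lborel. Re (F (y \<otimes>\<^bsub>grpG r1 r2\<^esub> a))) = (LINT y:fund|lborel. Re (F y))"
    "(LINT y:fund|lborel. Im (F (y \<otimes>\<^bsub>grpG r1 r2\<^esub> a))) = (LINT y:fund|lborel. Im (F y))"
    using inv by (auto intro!: integral_fund_right_real)
  moreover have "Re (LINT y:fund|lborel. G y) = (LINT y:fund|lborel. Re (G y))"
    "Im (LINT y:fund|lborel. G y) = (LINT y:fund|lborel. Im (G y))"
    if "integrable lborel (\<lambda>y. indicator fund y *\<^sub>R G y)" for G :: "pt \<Rightarrow> complex"
    using integral_Re[OF that] integral_Im[OF that] by (simp_all add: set_lebesgue_integral_def)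
  ultimately show ?thesis using i by (simp add: complex_eq_iff)
qed

section \<open>Smooth maps\<close>

lemma Ck_const: "Ck k (\<lambda>x. c)"
  by (induction k arbitrary: c) auto

text \<open>The frame fields are affine functions of the point, since A(s) is affine in s; their
  smoothness is an instance.\<close>

lemma smooth_affine:
  assumes "bounded_linear f"
  shows "smooth (\<lambda>x. c + f x)"
  unfolding smooth_def
proof
  fix k
  have d: "((\<lambda>x. c + f x) has_derivative f) (at x)" for x
    using bounded_linear_imp_has_derivative[OF assms, of "at x"]
    by (auto intro!: derivative_eq_intros)
  have fd: "frechet_derivative (\<lambda>x. c + f x) (at x) = f" for x
    using frechet_derivative_at[OF d] by simp
  show "Ck k (\<lambda>x. c + f x)"
  proof (cases k)
    case 0
    then show ?thesis using continuous_on_add[OF continuous_on_const linear_continuous_on[OF assms]]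
      by simp
  next
    case (Suc j)
    have "(\<lambda>x. c + f x) differentiable (at x)" for x using d by (auto simp: differentiable_def)
    then show ?thesis by (simp add: Suc fd Ck_const)
  qed
qed

lemma smooth_has_derivative:
  "smooth f \<Longrightarrow> (f has_derivative frechet_derivative f (at x)) (at x)"
  unfolding smooth_def using frechet_derivative_works by (metis Ck.simps(2))

lemma smooth_continuous_derivative:
  "smooth f \<Longrightarrow> continuous_on UNIV (\<lambda>x. frechet_derivative f (at x) v)"
  unfolding smooth_def by (metis Ck.simps)

lemma smooth_continuous: "smooth f \<Longrightarrow> continuous_on UNIV f"
  unfolding smooth_def by (metis Ck.simps(1))

section \<open>The frame\<close>

definition fvec :: "3 \<Rightarrow> pt" where
  "fvec i = (if i = 1 then (axis 3 1, 0) else if i = 2 then (axis 4 1, 0) else (0, 1))"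

lemma frame_fvec: "frame r1 r2 i y = (matA r1 r2 (snd y) *v fst (fvec i), snd (fvec i))"
  by (cases y) (simp add: frame_def fvec_def left_field_eq)

text \<open>These functionals are dual to the frame at every point at once: A(s) alters only the
  first two coordinates, so the third, the fourth and the last one read off the frame
  coefficients.\<close>

definition hcoord :: "3 \<Rightarrow> pt \<Rightarrow> real" where
  "hcoord i v = (if i = 1 then fst v $ 3 else if i = 2 then fst v $ 4 else snd v)"

lemma exhaust_3': "i = 1 \<or> i = 2 \<or> i = (3 :: 3)" using exhaust_3 by blast

lemma hcoord_linear:
  "hcoord i (u + v) = hcoord i u + hcoord i v" "hcoord i (c *\<^sub>R u) = c * hcoord i u"
    "hcoord i 0 = 0"
  by (simp_all add: hcoord_def)

lemma hcoord_sum: "hcoord i (\<Sum>x\<in>A. f x) = (\<Sum>x\<in>A. hcoord i (f x))"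
  by (induction A rule: infinite_finite_induct) (auto simp: hcoord_linear)

lemma hcoord_frame: "hcoord k (frame r1 r2 i y) = (if i = k then 1 else 0)"
  using exhaust_3'[of k] exhaust_3'[of i]
  by (auto simp: hcoord_def frame_fvec fvec_def matA_mult_vec axis_def)

lemma inj_frame: "inj (\<lambda>i. frame r1 r2 i y)"
proof (rule injI)
  fix i j assume "frame r1 r2 i y = frame r1 r2 j y"
  then have "hcoord j (frame r1 r2 i y) = hcoord j (frame r1 r2 j y)" by simp
  then show "i = j" by (simp add: hcoord_frame split: if_splits)
qed

lemma independent_frame: "independent (range (\<lambda>i. frame r1 r2 i y))"
proof (rule independent_if_scalars_zero)
  fix f x assume z: "(\<Sum>v\<in>range (\<lambda>i. frame r1 r2 i y). f v *\<^sub>R v) = 0"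
    and "x \<in> range (\<lambda>i. frame r1 r2 i y)"
  then obtain k where x: "x = frame r1 r2 k y" by blast
  have "0 = hcoord k (\<Sum>i\<in>UNIV. f (frame r1 r2 i y) *\<^sub>R frame r1 r2 i y)"
    using z by (simp add: sum.reindex[OF inj_frame] o_def hcoord_linear)
  also have "\<dots> = f x"
    by (simp add: hcoord_sum hcoord_linear hcoord_frame x if_distrib cong: if_cong)
  finally show "f x = 0" by simp
qed simp

lemma representation_frame:
  assumes "u \<in> distH r1 r2 y"
  shows "representation (range (\<lambda>i. frame r1 r2 i y)) u (frame r1 r2 k y) = hcoord k u"
proof -
  let ?B = "range (\<lambda>i. frame r1 r2 i y)"
  have u: "(\<Sum>b\<in>?B. representation ?B u b *\<^sub>R b) = u"
    using assms independent_frame by (intro sum_representation_eq) (auto simp: distH_def)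
  have "hcoord k u = hcoord k (\<Sum>i\<in>UNIV. representation ?B u (frame r1 r2 i y) *\<^sub>R frame r1 r2 i y)"
    using u by (simp add: sum.reindex[OF inj_frame] o_def)
  also have "\<dots> = representation ?B u (frame r1 r2 k y)"
    by (simp add: hcoord_sum hcoord_linear hcoord_frame if_distrib cong: if_cong)
  finally show ?thesis by simp
qed

lemma metricH_eq:
  assumes "u \<in> distH r1 r2 y" "v \<in> distH r1 r2 y"
  shows "metricH r1 r2 y u v = (\<Sum>i\<in>UNIV. hcoord i u * hcoord i v)"
  unfolding metricH_def Let_def using assms
  by (simp add: sum.reindex[OF inj_frame] representation_frame)

lemma frame_distH: "frame r1 r2 i y \<in> distH r1 r2 y"
  unfolding distH_def by (rule span_base) simp

lemma frame_sections: "frame r1 r2 i \<in> sections r1 r2"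
proof -
  have "frame r1 r2 i = (\<lambda>y. fvec i +
      ((of_int r1 * fst (fvec i) $ 3 * snd y) *\<^sub>R axis 1 1 + (of_int r2 * fst (fvec i) $ 4 * snd y)
        *\<^sub>R axis 2 1, 0))"
    by (rule ext) (simp add: frame_fvec matA_mult_vec prod_eq_iff algebra_simps)
  moreover have "bounded_linear (\<lambda>y :: pt.
      ((of_int r1 * fst (fvec i) $ 3 * snd y) *\<^sub>R axis 1 1 + (of_int r2 * fst (fvec i) $ 4 * snd y)
        *\<^sub>R axis 2 1, 0 :: real) :: pt)"
    by (intro bounded_linear_Pair bounded_linear_add bounded_linear_scaleR_const
        bounded_linear_mult_const bounded_linear_const_mult bounded_linear_snd
          bounded_linear_ident bounded_linear_zero)
  ultimately have "smooth (frame r1 r2 i)" by (simp only: smooth_affine)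
  then show ?thesis by (simp add: sections_def frame_distH)
qed

lemma dL_eq: "dL r1 r2 (x, s) y v = (matA r1 r2 s *v fst v, snd v)"
proof -
  have "((\<lambda>z. (x + matA r1 r2 s *v fst z, s + snd z)) has_derivative
      (\<lambda>z. (matA r1 r2 s *v fst z, snd z))) (at y)"
    by (auto intro!: derivative_eq_intros
        bounded_linear.has_derivative[OF matrix_vector_mul_bounded_linear])
  then have "frechet_derivative (\<lambda>z. (x, s) \<otimes>\<^bsub>grpG r1 r2\<^esub> z) (at y) =
      (\<lambda>z. (matA r1 r2 s *v fst z, snd z))"
    by (intro frechet_derivative_at[symmetric]) (simp add: grpG_def case_prod_unfold)
  then show ?thesis by (simp add: dL_def)
qed

lemma matA_add: "matA r1 r2 (s + t) *v v = matA r1 r2 s *v (matA r1 r2 t *v v)"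
  by (simp add: matA_mult_vec vec_eq_iff axis_def algebra_simps)

lemma push_frame: "push r1 r2 a (frame r1 r2 i) = frame r1 r2 i"
proof
  fix y
  obtain x s where a: "a = (x, s)" by force
  define z where "z = inv\<^bsub>grpG r1 r2\<^esub> a \<otimes>\<^bsub>grpG r1 r2\<^esub> y"
  have "a \<otimes>\<^bsub>grpG r1 r2\<^esub> z = y" by (simp add: z_def)
  then have "snd y = s + snd z" by (cases z) (auto simp: a mult_grpG)
  then show "push r1 r2 a (frame r1 r2 i) y = frame r1 r2 i y"
    by (simp add: push_def Let_def z_def[symmetric]) (simp add: a dL_eq frame_fvec matA_add)
qed

section \<open>The sub-Dirac operator of a metric connection without torsion trace\<close>

lemma clifford_mult:
  "clifford 1 *v v = vector [\<i> * v $ 2, \<i> * v $ 1]"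
  "clifford 2 *v v = vector [- v $ 2, v $ 1]"
  "clifford 3 *v v = vector [\<i> * v $ 1, - \<i> * v $ 2]"
  by (simp_all add: clifford_def vec_eq_iff forall_2 matrix_vector_mult_def sum_2)

text \<open>By the Clifford relations the products with i = j or i = k collapse to multiples of a
  single generator, and their coefficients add up to twice a trace. For distinct indices, s_1 s_2 =
  s_3 and s_3^2 = -1, and skewness makes each cyclic coefficient occur twice; this turns 1/4 into
  -1/2.\<close>

lemma clifford_triple_sum:
  fixes G :: "3 \<Rightarrow> 3 \<Rightarrow> 3 \<Rightarrow> real"
  assumes anti: "\<And>i j k. G i j k = - G i k j" and tr: "\<And>j. (\<Sum>i\<in>UNIV. G i j i) = 0"
  shows "(1 / 4) *\<^sub>R (\<Sum>i\<in>UNIV. \<Sum>j\<in>UNIV. \<Sum>k\<in>UNIV.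
      G i j k *\<^sub>R ((clifford i ** clifford j ** clifford k) *v v)) =
    (- (1 / 2) * (G 1 2 3 + G 2 3 1 + G 3 1 2)) *\<^sub>R v"
proof -
  have d: "G i j j = 0" for i j using anti[of i j j] by simp
  have a: "G i 2 1 = - G i 1 2" "G i 3 1 = - G i 1 3" "G i 3 2 = - G i 2 3" for i
    by (rule anti)+
  have t: "G 3 1 3 = - G 2 1 2" "G 3 2 3 = G 1 1 2" "G 2 2 3 = - G 1 1 3"
    using tr[of 1] tr[of 2] tr[of 3] by (simp_all add: sum_3 d a)
  show ?thesis
    by (simp add: sum_3 d a t matrix_vector_mul_assoc[symmetric] clifford_mult vec_eq_iff forall_2)
      (simp add: scaleR_conv_of_real field_simps)
qed

lemma Dirac_eq:
  assumes mc: "metric_connection r1 r2 nabla" and li: "left_invariant_connection r1 r2 nabla"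
    and tr: "\<And>j y. (\<Sum>i\<in>UNIV. metricH r1 r2 y
           (nabla (frame r1 r2 i) (frame r1 r2 j) y) (frame r1 r2 i y)) = 0"
  shows "Dirac r1 r2 nabla \<phi> = (\<lambda>y. (\<Sum>i\<in>UNIV. clifford i *v along (frame r1 r2 i) \<phi> y) +
    alpha_const r1 r2 nabla *\<^sub>R \<phi> y)"
proof
  fix y
  let ?N = "\<lambda>i j. nabla (frame r1 r2 i) (frame r1 r2 j)"
  let ?G = "\<lambda>i j k. christoffel r1 r2 nabla i j k"
  have Ns: "?N i j \<in> sections r1 r2" for i j
    using mc frame_sections by (auto simp: metric_connection_def connection_def)
  have ND: "?N i j y \<in> distH r1 r2 y" for i j y using Ns[of i j] unfolding sections_def by blast
  have G: "?G i j k y = hcoord k (?N i j y)" for i j k y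
    by (simp add: christoffel_def metricH_eq[OF ND frame_distH] hcoord_frame
      if_distrib cong: if_cong)
  \<comment> \<open>Left translation by y carries the value at the identity to y, and
    \<open>dL\<close> does not change the coordinates that \<open>hcoord\<close> reads.\<close>
  have const: "?G i j k y = ?G i j k (0, 0)" for i j k y
  proof -
    have "?N i j = push r1 r2 y (?N i j)"
      using li frame_sections[of r1 r2 i] frame_sections[of r1 r2 j] push_frame
      unfolding left_invariant_connection_def by metis
    then have "?N i j y = push r1 r2 y (?N i j) y" by simp
    also have "\<dots> = dL r1 r2 y (0, 0) (?N i j (0, 0))"
      using group.l_inv[OF group_grpG, of y r1 r2] by (simp add: push_def Let_def)
    finally have "?N i j y = dL r1 r2 y (0, 0) (?N i j (0, 0))" .
    then show ?thesis
      by (cases y) (simp add: G dL_eq hcoord_def matA_mult_vec axis_def)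
  qed
  \<comment> \<open>The metric of two frame fields is constant, so its derivative vanishes and
    metric compatibility becomes skewness in the last two indices.\<close>
  have anti: "?G i j k y = - ?G i k j y" for i j k
  proof -
    have "along (frame r1 r2 i) (\<lambda>z. metricH r1 r2 z (frame r1 r2 j z) (frame r1 r2 k z)) y =
       metricH r1 r2 y (?N i j y) (frame r1 r2 k y) + metricH r1 r2 y (frame r1 r2 j y) (?N i k y)"
      using mc frame_sections unfolding metric_connection_def by blast
    moreover have
      "along (frame r1 r2 i) (\<lambda>z. metricH r1 r2 z (frame r1 r2 j z) (frame r1 r2 k z)) y = 0"
      by (simp add: metricH_eq[OF frame_distH frame_distH] hcoord_frame along_def
        frechet_derivative_const)
    moreover have "metricH r1 r2 y (frame r1 r2 j y) (?N i k y) = ?G i k j y"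
      by (simp add: christoffel_def metricH_eq[OF ND frame_distH] metricH_eq[OF frame_distH ND]
        mult.commute)
    ultimately show ?thesis by (simp add: christoffel_def)
  qed
  have t: "(\<Sum>i\<in>UNIV. ?G i j i y) = 0" for j
    using tr[where j = j and y = y] by (simp add: christoffel_def)
  show "Dirac r1 r2 nabla \<phi> y = (\<Sum>i\<in>UNIV. clifford i *v along (frame r1 r2 i) \<phi> y) +
    alpha_const r1 r2 nabla *\<^sub>R \<phi> y"
    unfolding Dirac_def clifford_triple_sum[of "\<lambda>i j k. ?G i j k y", OF anti t]
    by (simp add: alpha_const_def const[of _ _ _ y])
qed

section \<open>Symmetry of the sub-Dirac operator\<close>

text \<open>The integral curves of the frame fields are straight lines, obtained by right
  multiplication with a one-parameter subgroup. This is how right invariance of the integral enters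
  the integration by parts. The next lemma adds that each field is constant along its own
  lines.\<close>

lemma mult_fvec: "y \<otimes>\<^bsub>grpG r1 r2\<^esub> (t *\<^sub>R fvec i) = y + t *\<^sub>R frame r1 r2 i y"
  by (cases y) (simp add: frame_fvec scaleR_prod_def mult_grpG matA_mult_vec algebra_simps)

lemma frame_flow: "frame r1 r2 i (y + t *\<^sub>R frame r1 r2 i y) = frame r1 r2 i y"
  using exhaust_3'[of i] by (auto simp: frame_fvec fvec_def)

lemma continuous_frame: "continuous_on S (frame r1 r2 i)"
  using smooth_continuous[of "frame r1 r2 i"] frame_sections[of r1 r2 i]
  by (auto simp: sections_def intro: continuous_on_subset)

lemma invariant_bounded:
  assumes c: "continuous_on UNIV F"
    and inv: "\<And>\<gamma> y. \<gamma> \<in> carrier (grpGamma r1 r2) \<Longrightarrow> F (\<gamma> \<otimes>\<^bsub>grpG r1 r2\<^esub> y) = F y"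
  obtains C where "\<And>y. norm (F y :: 'b::real_normed_vector) \<le> C"
proof -
  have "compact (F ` closure fund)"
    using bounded_fund
    by (intro compact_continuous_image continuous_on_subset[OF c]) (auto simp: compact_closure)
  then obtain C where C: "\<And>y. y \<in> closure fund \<Longrightarrow> norm (F y) \<le> C"
    by (meson compact_imp_bounded bounded_iff imageI)
  have "norm (F y) \<le> C" for y
    using fundamental_domain[of r1 r2 y] inv C closure_subset[of fund] by (metis subsetD)
  then show ?thesis by (rule that)
qed

text \<open>The derivative is the limit of difference quotients between \<open>F\<close> and its
  right translates. Each of these has integral zero, and dominated convergence passes to the
  limit.\<close>

lemma integral_fund_along:
  fixes F :: "pt \<Rightarrow> complex"
  assumes F: "\<And>y. (F has_derivative F' y) (at y)"
    and c: "continuous_on UNIV (\<lambda>y. F' y (frame r1 r2 i y))"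
    and inv: "\<And>\<gamma> y. \<gamma> \<in> carrier (grpGamma r1 r2) \<Longrightarrow> F (\<gamma> \<otimes>\<^bsub>grpG r1 r2\<^esub> y) = F y"
  shows "(LINT y:fund|lborel. F' y (frame r1 r2 i y)) = 0"
proof -
  let ?X = "\<lambda>y. F' y (frame r1 r2 i y)"
  note fund_sets [measurable]
  have cF: "continuous_on UNIV F"
    using F by (intro continuous_at_imp_continuous_on ballI has_derivative_continuous) blast
  note [measurable] = borel_measurable_continuous_onI[OF cF] borel_measurable_continuous_onI[OF c]
  obtain C where C: "\<And>y. norm (F y) \<le> C" using invariant_bounded[OF cF inv] by metis
  \<comment> \<open>The integral lines issuing from the closed domain during times in [0, 1] sweep
    out a compact set, on which the derivative has a bound \<open>M\<close>; this bound dominates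
    all difference quotients.\<close>
  define \<Phi> where "\<Phi> = (\<lambda>(y, t). y + t *\<^sub>R frame r1 r2 i y)"
  have "compact (\<Phi> ` (closure fund \<times> {0..1}))"
    unfolding \<Phi>_def using bounded_fund
    by (intro compact_continuous_image compact_Times)
      (auto simp: compact_closure case_prod_unfold intro!: continuous_intros
        continuous_on_compose2[OF continuous_frame])
  then have "compact (?X ` \<Phi> ` (closure fund \<times> {0..1}))"
    using compact_continuous_image[OF continuous_on_subset[OF c]] by blast
  then obtain M where M: "\<And>z. z \<in> \<Phi> ` (closure fund \<times> {0..1}) \<Longrightarrow> norm (?X z) \<le> M"
    by (meson compact_imp_bounded bounded_iff imageI)
  have deriv: "((\<lambda>t. F (y + t *\<^sub>R frame r1 r2 i y)) has_vector_derivative ?X (y +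
    t *\<^sub>R frame r1 r2 i y)) (at t within S)"
    for y t S
  proof -
    have "((\<lambda>t. y +
      t *\<^sub>R frame r1 r2 i y) has_derivative (\<lambda>h. h *\<^sub>R frame r1 r2 i y)) (at t within S)"
      by (auto intro!: derivative_eq_intros)
    from has_derivative_compose[OF this F]
    have "((\<lambda>t. F (y + t *\<^sub>R frame r1 r2 i y)) has_derivative
        (\<lambda>h. F' (y + t *\<^sub>R frame r1 r2 i y) (h *\<^sub>R frame r1 r2 i y))) (at t within S)" .
    moreover have "linear (F' z)" for z using F has_derivative_linear by blast
    ultimately show ?thesis
      by (simp add: has_vector_derivative_def linear_scale frame_flow)
  qed
  \<comment> \<open>The step 1 / (n + 1) never exceeds 1, so every quotient is controlled on the
    swept compact set.\<close>
  define h where "h n =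
    (\<lambda>y. of_nat (Suc n) * (F (y \<otimes>\<^bsub>grpG r1 r2\<^esub> ((1 / real (Suc n)) *\<^sub>R fvec i)) - F y))" for n
  have h0: "(LINT y:fund|lborel. h n y) = 0" for n
  proof -
    have i: "set_integrable lborel fund (\<lambda>y. F (y \<otimes>\<^bsub>grpG r1 r2\<^esub> a))" "set_integrable lborel fund F"
      for a
      by (rule set_integrable_fund_bounded[where C = C]; use C in simp)+
    show ?thesis
      unfolding h_def using integral_fund_right[OF _ C inv] i by (simp add: set_integral_diff)
  qed
  have lim: "(\<lambda>n. h n y) \<longlonglongrightarrow> ?X y" for y
  proof -
    have "((\<lambda>t. F (y + t *\<^sub>R frame r1 r2 i y)) has_vector_derivative ?X y) (at 0)"
      using deriv[of y 0 UNIV] by simp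
    then have "((\<lambda>t. (F (y + t *\<^sub>R frame r1 r2 i y) - F y) /\<^sub>R t) \<longlongrightarrow> ?X y) (at 0)"
    proof -
      assume "((\<lambda>t. F (y + t *\<^sub>R frame r1 r2 i y)) has_vector_derivative ?X y) (at 0)"
      then have
        "((\<lambda>t. norm (F (y + t *\<^sub>R frame r1 r2 i y) - F y - t *\<^sub>R ?X y) / norm t) \<longlongrightarrow> 0) (at 0)"
        by (simp add: has_vector_derivative_def has_derivative_at)
      then have "((\<lambda>t. norm ((F (y + t *\<^sub>R frame r1 r2 i y) - F y) /\<^sub>R t - ?X y)) \<longlongrightarrow> 0) (at 0)"
      proof (rule Lim_transform_eventually)
        have "norm (v - t *\<^sub>R x) / norm t = norm (v /\<^sub>R t - x)" if "t \<noteq> 0"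
          for v x :: complex and t :: real
        proof -
          have "v /\<^sub>R t - x = (v - t *\<^sub>R x) /\<^sub>R t" using that by (simp add: scaleR_diff_right)
          then show ?thesis by (simp add: divide_inverse)
        qed
        then show "\<forall>\<^sub>F t in at 0. norm (F (y + t *\<^sub>R frame r1 r2 i y) - F y - t *\<^sub>R ?X y) / norm t =
            norm ((F (y + t *\<^sub>R frame r1 r2 i y) - F y) /\<^sub>R t - ?X y)"
          by (intro eventually_at_filter[THEN iffD2] always_eventually) blast
      qed
      then show ?thesis by (rule LIM_zero_cancel[OF tendsto_norm_zero_cancel])
    qed
    moreover have "filterlim (\<lambda>n. 1 / real (Suc n)) (at 0) sequentially"
      using LIMSEQ_inverse_real_of_nat by (auto simp: filterlim_at inverse_eq_divide)
    ultimately have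
      "(\<lambda>n. (F (y + (1 / real (Suc n)) *\<^sub>R frame r1 r2 i y) - F y) /\<^sub>R (1 / real (Suc n))) \<longlonglongrightarrow> ?X y"
      by (rule filterlim_compose)
    moreover have "h n y =
      (F (y + (1 / real (Suc n)) *\<^sub>R frame r1 r2 i y) - F y) /\<^sub>R (1 / real (Suc n))" for n
      by (simp add: h_def mult_fvec scaleR_conv_of_real del: of_nat_Suc)
    ultimately show ?thesis by simp
  qed
  have bd: "norm (h n y) \<le> M" if y: "y \<in> fund" for n y
  proof -
    have "norm (F (y + (1 / real (Suc n)) *\<^sub>R frame r1 r2 i y) - F (y + 0 *\<^sub>R frame r1 r2 i y)) \<le>
      M * norm (1 / real (Suc n) - 0)"
    proof (rule differentiable_bound)
      show "convex {0 .. 1 / real (Suc n)}" by simp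
      fix t :: real assume t: "t \<in> {0 .. 1 / real (Suc n)}"
      show "((\<lambda>t. F (y + t *\<^sub>R frame r1 r2 i y)) has_derivative (\<lambda>u. u *\<^sub>R ?X (y +
        t *\<^sub>R frame r1 r2 i y))) (at t within {0 .. 1 / real (Suc n)})"
        using deriv by (simp add: has_vector_derivative_def)
      have "1 / real (Suc n) \<le> 1" by simp
      then have "t \<in> {0..1}" using t unfolding atLeastAtMost_iff by linarith
      then have "y + t *\<^sub>R frame r1 r2 i y \<in> \<Phi> ` (closure fund \<times> {0..1})"
        using y closure_subset[of fund] by (force simp: \<Phi>_def)
      from M[OF this] show "onorm (\<lambda>u. u *\<^sub>R ?X (y + t *\<^sub>R frame r1 r2 i y)) \<le> M"
        using onorm_scaleR_left[of "\<lambda>u :: real. u" "?X (y + t *\<^sub>R frame r1 r2 i y)"]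
        by (simp add: onorm_id[unfolded id_def])
    qed auto
    then have "norm (F (y + (1 / real (Suc n)) *\<^sub>R frame r1 r2 i y) - F y) \<le> M / real (Suc n)"
      by simp
    moreover have "norm (h n y) =
      real (Suc n) * norm (F (y + (1 / real (Suc n)) *\<^sub>R frame r1 r2 i y) - F y)"
      by (simp only: h_def mult_fvec norm_mult norm_of_nat)
    ultimately show ?thesis by (simp add: field_simps del: of_nat_Suc)
  qed
  have "(\<lambda>n. LINT y:fund|lborel. h n y) \<longlonglongrightarrow> (LINT y:fund|lborel. ?X y)"
    unfolding set_lebesgue_integral_def
  proof (rule integral_dominated_convergence)
    have "set_integrable lborel fund (\<lambda>y. M)"
      by (rule set_integrable_fund_bounded[where C = "\<bar>M\<bar>"]) auto
    then show "integrable lborel (\<lambda>y. indicator fund y *\<^sub>R M)" by (simp add: set_integrable_def)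
    show "AE y in lborel. (\<lambda>n. indicator fund y *\<^sub>R h n y) \<longlonglongrightarrow> indicator fund y *\<^sub>R ?X y"
      by (intro AE_I2 tendsto_scaleR tendsto_const lim)
    show "AE y in lborel. norm (indicator fund y *\<^sub>R h n y) \<le> indicator fund y *\<^sub>R M" for n
      using bd by (intro AE_I2) (auto simp: indicator_def)
    show "(\<lambda>y. indicator fund y *\<^sub>R h n y) \<in> borel_measurable lborel" for n
      unfolding h_def by measurable
  qed measurable
  then show ?thesis using h0 by (simp add: LIMSEQ_const_iff)
qed

lemma bounded_bilinear_spip: "bounded_bilinear spip"
proof
  show "spip (a + a') b = spip a b + spip a' b" for a a' b by (rule spip_add_left)
  show "spip a (b + b') = spip a b + spip a b'" for a b b' by (rule spip_add_right)
  show "spip (r *\<^sub>R a) b = r *\<^sub>R spip a b" for r a b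
    by (simp add: spip_def scaleR_right.sum)
  show "spip a (r *\<^sub>R b) = r *\<^sub>R spip a b" for r a b
    by (simp add: spip_def scaleR_right.sum)
  show "\<exists>K. \<forall>a b. norm (spip a b) \<le> norm a * norm b * K"
    using norm_spip_le by (intro exI[of _ 1]) simp
qed

lemma continuous_spip [continuous_intros]:
  "continuous_on S f \<Longrightarrow> continuous_on S g \<Longrightarrow> continuous_on S (\<lambda>y. spip (f y) (g y))"
  by (rule bounded_bilinear.continuous_on[OF bounded_bilinear_spip])

lemma bounded_linear_mult_vec: "bounded_linear (\<lambda>v :: spinor. A *v v)"
proof -
  have "linear (\<lambda>v :: spinor. A *v v)"
    by (rule linearI)
      (simp_all add: matrix_vector_mult_def vec_eq_iff sum.distrib algebra_simps scaleR_right.sum)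
  then show ?thesis by (simp add: linear_conv_bounded_linear)
qed

lemma clifford_skew: "spip (clifford i *v v) w = - spip v (clifford i *v w)"
  using exhaust_3'[of i] by (auto simp: clifford_mult spip_def sum_2)

text \<open>\<open>Ck\<close> provides continuity of derivatives only in fixed directions. The frame
  field is therefore expanded in constant directions with continuous scalar coefficients.\<close>

lemma continuous_along:
  assumes "smooth f"
  shows "continuous_on UNIV (along (frame r1 r2 i) f)"
proof -
  let ?D = "\<lambda>y. frechet_derivative f (at y)"
  have lin: "linear (?D y)" for y
    using smooth_has_derivative[OF assms] has_derivative_linear by blast
  have fr: "frame r1 r2 i y = fvec i + (of_int r1 * fst (fvec i) $ 3 * snd y) *\<^sub>R (axis 1 1, 0)
      + (of_int r2 * fst (fvec i) $ 4 * snd y) *\<^sub>R (axis 2 1, 0)" for y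
    by (simp add: frame_fvec matA_mult_vec prod_eq_iff algebra_simps)
  have "along (frame r1 r2 i) f = (\<lambda>y. ?D y (fvec i)
      + (of_int r1 * fst (fvec i) $ 3 * snd y) *\<^sub>R ?D y (axis 1 1, 0)
      + (of_int r2 * fst (fvec i) $ 4 * snd y) *\<^sub>R ?D y (axis 2 1, 0))"
    unfolding along_def fr by (simp only: linear_add[OF lin] linear_scale[OF lin])
  then show ?thesis
    by (simp only:) (intro continuous_intros smooth_continuous_derivative[OF assms])
qed

definition DD :: "int \<Rightarrow> int \<Rightarrow> real \<Rightarrow> (pt \<Rightarrow> spinor) \<Rightarrow> (pt \<Rightarrow> spinor)" where
  "DD r1 r2 \<alpha> \<phi> = (\<lambda>y. (\<Sum>i\<in>UNIV. clifford i *v along (frame r1 r2 i) \<phi> y) + \<alpha> *\<^sub>R \<phi> y)"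

lemma continuous_DD:
  assumes "smooth f"
  shows "continuous_on UNIV (DD r1 r2 \<alpha> f)"
  unfolding DD_def
  by (intro continuous_intros continuous_along smooth_continuous assms
      continuous_on_sum bounded_linear.continuous_on[OF bounded_linear_mult_vec])

lemma equivariant_spip:
  assumes "equivariant r1 r2 eps f" "equivariant r1 r2 eps g" "\<gamma> \<in> carrier (grpGamma r1 r2)"
  shows "spip (f (\<gamma> \<otimes>\<^bsub>grpG r1 r2\<^esub> y)) (g (\<gamma> \<otimes>\<^bsub>grpG r1 r2\<^esub> y)) = spip (f y) (g y)"
proof -
  have "exp (\<i> * of_real pi * of_int k) * cnj (exp (\<i> * of_real pi * of_int k)) = 1" for k
  proof -
    have "norm (exp (\<i> * of_real pi * of_int k)) = 1" by (simp add: norm_exp_eq_Re)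
    then show ?thesis
      using complex_norm_square[of "exp (\<i> * of_real pi * of_int k)"] by simp
  qed
  moreover have "f (\<gamma> \<otimes>\<^bsub>grpG r1 r2\<^esub> y) = exp (\<i> * of_real pi * of_int (eps \<gamma>)) *s f y"
    "g (\<gamma> \<otimes>\<^bsub>grpG r1 r2\<^esub> y) = exp (\<i> * of_real pi * of_int (eps \<gamma>)) *s g y"
    using assms unfolding equivariant_def by blast+
  ultimately show ?thesis
    by (simp add: spip_scale_left spip_scale_right mult.commute[of "cnj _"] flip: mult.assoc)
qed

lemma equivariant_mult_vec:
  "equivariant r1 r2 eps f \<Longrightarrow> equivariant r1 r2 eps (\<lambda>y. A *v f y)"
  by (simp add: equivariant_def)
    (simp add: vec_eq_iff matrix_vector_mult_def sum_distrib_left algebra_simps)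

text \<open>Clifford multiplication is skew-Hermitian, and differentiation along a frame field is
  skew because derivatives of invariant functions integrate to zero; the two signs cancel.\<close>

lemma DD_symmetric:
  assumes f: "f \<in> Dirac_domain r1 r2 eps" and g: "g \<in> Dirac_domain r1 r2 eps"
  shows "L2ip (DD r1 r2 \<alpha> f) g = L2ip f (DD r1 r2 \<alpha> g)"
proof -
  have sf: "smooth f" "equivariant r1 r2 eps f" and sg: "smooth g" "equivariant r1 r2 eps g"
    using f g by (auto simp: Dirac_domain_def)
  let ?a = "\<lambda>i y. spip (clifford i *v along (frame r1 r2 i) f y) (g y)"
  let ?b = "\<lambda>i y. spip (f y) (clifford i *v along (frame r1 r2 i) g y)"
  have cm: "continuous_on UNIV (\<lambda>y. A *v h y)" if "continuous_on UNIV h"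
    for A :: "complex^2^2" and h :: "pt \<Rightarrow> spinor"
    by (rule bounded_linear.continuous_on[OF bounded_linear_mult_vec that])
  have ca: "continuous_on UNIV (?a i)" "continuous_on UNIV (?b i)" for i
    by (intro continuous_intros cm continuous_along smooth_continuous sf sg)+
  have int: "set_integrable lborel fund h" if h: "continuous_on UNIV h" for h :: "pt \<Rightarrow> complex"
  proof -
    have "compact (h ` closure fund)"
      using bounded_fund
      by (intro compact_continuous_image continuous_on_subset[OF h]) (auto simp: compact_closure)
    then obtain C where "\<And>y. y \<in> closure fund \<Longrightarrow> norm (h y) \<le> C"
      by (meson compact_imp_bounded bounded_iff imageI)
    then show ?thesis
      using closure_subset
      by (intro set_integrable_fund_bounded borel_measurable_continuous_onI h) blast
  qed
  have key: "(LINT y:fund|lborel. ?a i y) = (LINT y:fund|lborel. ?b i y)" for i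
  proof -
    have "(LINT y:fund|lborel. ?a i y - ?b i y) = 0"
    proof -
      define F where "F = (\<lambda>y. spip (clifford i *v f y) (g y))"
      define F' where "F' = (\<lambda>y h. spip (clifford i *v f y) (frechet_derivative g (at y) h) +
          spip (clifford i *v frechet_derivative f (at y) h) (g y))"
      have d: "(F has_derivative F' y) (at y)" for y
        unfolding F_def F'_def
        by (intro bounded_bilinear.FDERIV[OF bounded_bilinear_spip]
            bounded_linear.has_derivative[OF bounded_linear_mult_vec] smooth_has_derivative sf sg)
      have e: "F' y (frame r1 r2 i y) = ?a i y - ?b i y" for y
        by (simp add: F'_def along_def clifford_skew)
      have "(LINT y:fund|lborel. F' y (frame r1 r2 i y)) = 0"
      proof (rule integral_fund_along)
        show "(F has_derivative F' y) (at y)" for y by (rule d)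
        show "continuous_on UNIV (\<lambda>y. F' y (frame r1 r2 i y))"
          unfolding e by (intro continuous_intros ca)
        show "F (\<gamma> \<otimes>\<^bsub>grpG r1 r2\<^esub> y) = F y" if "\<gamma> \<in> carrier (grpGamma r1 r2)" for \<gamma> y
          unfolding F_def by (rule equivariant_spip[OF equivariant_mult_vec[OF sf(2)] sg(2) that])
      qed
      then show ?thesis by (simp add: e)
    qed
    then show ?thesis using int[OF ca(1)] int[OF ca(2)] by (simp add: set_integral_diff)
  qed
  have cfg: "continuous_on UNIV (\<lambda>y. spip (f y) (g y))"
    by (intro continuous_intros smooth_continuous sf sg)
  interpret spip: bounded_bilinear spip by (rule bounded_bilinear_spip)
  have "L2ip (DD r1 r2 \<alpha> f) g = (LINT y:fund|lborel. (\<Sum>i\<in>UNIV. ?a i y) + \<alpha> *\<^sub>R spip (f y) (g y))"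
    by (simp add: L2ip_eq DD_def spip.add_left spip.sum_left spip.scaleR_left)
  also have "\<dots> = (\<Sum>i\<in>UNIV. LINT y:fund|lborel. ?a i y) +
    \<alpha> *\<^sub>R (LINT y:fund|lborel. spip (f y) (g y))"
    using int[OF ca(1)] int[OF cfg] by (simp add: sum_3 set_integral_add)
  also have "\<dots> = (\<Sum>i\<in>UNIV. LINT y:fund|lborel. ?b i y) +
    \<alpha> *\<^sub>R (LINT y:fund|lborel. spip (f y) (g y))"
    by (simp only: key)
  also have "\<dots> = (LINT y:fund|lborel. (\<Sum>i\<in>UNIV. ?b i y) + \<alpha> *\<^sub>R spip (f y) (g y))"
    using int[OF ca(2)] int[OF cfg] by (simp add: sum_3 set_integral_add)
  also have "\<dots> = L2ip f (DD r1 r2 \<alpha> g)"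
    by (simp add: L2ip_eq DD_def spip.add_right spip.sum_right spip.scaleR_right)
  finally show ?thesis .
qed


section \<open>Multiplicities from a complete orthonormal system of eigenfunctions\<close>

lemma Ck_add: "Ck k f \<Longrightarrow> Ck k g \<Longrightarrow> Ck k (\<lambda>x. f x + g x)"
proof (induction k arbitrary: f g)
  case (Suc k)
  have "frechet_derivative (\<lambda>x. f x + g x) (at x) =
      (\<lambda>h. frechet_derivative f (at x) h + frechet_derivative g (at x) h)" for x
    using Suc.prems by (intro frechet_derivative_at[symmetric] has_derivative_add)
      (auto simp flip: frechet_derivative_works)
  then show ?case using Suc by (auto intro: differentiable_add)
qed (auto intro: continuous_on_add)

lemma Ck_bounded_linear:
  assumes L: "bounded_linear L"
  shows "Ck k f \<Longrightarrow> Ck k (\<lambda>x. L (f x))"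
proof (induction k arbitrary: f)
  case 0
  then show ?case using bounded_linear.continuous_on[OF L] by simp
next
  case (Suc k)
  have d: "((\<lambda>x. L (f x)) has_derivative (\<lambda>h. L (frechet_derivative f (at x) h))) (at x)" for x
    using Suc.prems
    by (intro bounded_linear.has_derivative[OF L]) (auto simp flip: frechet_derivative_works)
  then have "frechet_derivative (\<lambda>x. L (f x)) (at x) = (\<lambda>h. L (frechet_derivative f (at x) h))"
    for x
    by (intro frechet_derivative_at[symmetric])
  moreover have "(\<lambda>x. L (f x)) differentiable (at x)" for x using d
    by (auto simp: differentiable_def)
  ultimately show ?case using Suc by auto
qed

lemma smooth_lincomb:
  fixes f g :: "pt \<Rightarrow> spinor"
  assumes "smooth f" "smooth g"
  shows "smooth (\<lambda>y. f y + c *s g y)"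
proof -
  have "linear (\<lambda>v :: spinor. c *s v)"
    by (rule linearI) (simp_all add: vec_eq_iff algebra_simps)
  then have L: "bounded_linear (\<lambda>v :: spinor. c *s v)" by (simp add: linear_conv_bounded_linear)
  show ?thesis using assms Ck_add[OF _ Ck_bounded_linear[OF L]] unfolding smooth_def by blast
qed

lemma smooth_continuous_spinor: "f \<in> Dirac_domain r1 r2 eps \<Longrightarrow> continuous_on UNIV f"
  by (simp add: Dirac_domain_def smooth_continuous)

lemma equivariant_lincomb:
  "equivariant r1 r2 eps f \<Longrightarrow> equivariant r1 r2 eps g \<Longrightarrow> equivariant r1 r2 eps (\<lambda>y. f y + c *s g y)"
  by (simp add: equivariant_def vec_eq_iff algebra_simps)

lemma DD_lincomb:
  assumes "smooth f" "smooth g"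
  shows "DD r1 r2 \<alpha> (\<lambda>y. f y + c *s g y) = (\<lambda>y. DD r1 r2 \<alpha> f y + c *s DD r1 r2 \<alpha> g y)"
proof -
  have "linear (\<lambda>v :: spinor. c *s v)"
    by (rule linearI) (simp_all add: vec_eq_iff algebra_simps)
  then have L: "bounded_linear (\<lambda>v :: spinor. c *s v)" by (simp add: linear_conv_bounded_linear)
  have "frechet_derivative (\<lambda>y. f y + c *s g y) (at y) =
      (\<lambda>h. frechet_derivative f (at y) h + c *s frechet_derivative g (at y) h)" for y
    by (intro frechet_derivative_at[symmetric] has_derivative_add smooth_has_derivative assms
        bounded_linear.has_derivative[OF L])
  then have "along X (\<lambda>y. f y + c *s g y) y = along X f y + c *s along X g y" for X y
    by (simp add: along_def)
  then show ?thesis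
    by (simp add: DD_def fun_eq_iff vec_eq_iff sum_3 matrix_vector_mult_def sum_2 algebra_simps)
qed

lemma L2_sqi: "f \<in> L2 r1 r2 eps \<Longrightarrow> sqi f"
  by (simp add: L2_def sqi_def)

lemma L2_continuous:
  assumes "continuous_on UNIV f" "equivariant r1 r2 eps f"
  shows "f \<in> L2 r1 r2 eps"
proof -
  have "L2norm (\<lambda>y. f y - f y) = 0" by (simp add: L2norm_def)
  then have "\<exists>u. (\<forall>n. continuous_on UNIV (u n) \<and> equivariant r1 r2 eps (u n)) \<and>
          (\<lambda>n::nat. L2norm (\<lambda>y. u n y - f y)) \<longlonglongrightarrow> 0"
    using assms by (intro exI[of _ "\<lambda>n. f"]) simp
  then show ?thesis
    using assms sqi_continuous[OF assms(1)] by (simp add: L2_def sqi_def)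
qed

lemma L2norm_lincomb_limit:
  assumes s: "\<And>n :: nat. sqi (u n)" "\<And>n. sqi (v n)" "sqi f" "sqi g"
    and "(\<lambda>n. L2norm (\<lambda>y. u n y - f y)) \<longlonglongrightarrow> 0" "(\<lambda>n. L2norm (\<lambda>y. v n y - g y)) \<longlonglongrightarrow> 0"
  shows "(\<lambda>n. L2norm (\<lambda>y. (u n y + c *s v n y) - (f y + c *s g y))) \<longlonglongrightarrow> 0"
proof (rule Lim_null_comparison)
  show "(\<lambda>n. L2norm (\<lambda>y. u n y - f y) + norm c * L2norm (\<lambda>y. v n y - g y)) \<longlonglongrightarrow> 0"
    using tendsto_add[OF assms(5) tendsto_mult_left[OF assms(6), of "norm c"]] by simp
  have "L2norm (\<lambda>y. (u n y + c *s v n y) - (f y + c *s g y)) \<le>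
      L2norm (\<lambda>y. u n y - f y) + norm c * L2norm (\<lambda>y. v n y - g y)" for n
  proof -
    have "(\<lambda>y. (u n y + c *s v n y) - (f y + c *s g y)) = (\<lambda>y. (u n y - f y) + c *s (v n y - g y))"
      by (simp add: fun_eq_iff vec_eq_iff algebra_simps)
    moreover have "L2norm (\<lambda>y. (u n y - f y) + c *s (v n y - g y)) \<le>
        L2norm (\<lambda>y. u n y - f y) + L2norm (\<lambda>y. c *s (v n y - g y))"
      by (intro L2norm_triangle sqi_diff sqi_scale s)
    ultimately show ?thesis by (simp only: L2norm_scale)
  qed
  then show "\<forall>\<^sub>F n in sequentially. norm (L2norm (\<lambda>y. (u n y + c *s v n y) - (f y + c *s g y))) \<le>
      L2norm (\<lambda>y. u n y - f y) + norm c * L2norm (\<lambda>y. v n y - g y)"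
    unfolding real_norm_def abs_of_nonneg[OF L2norm_nonneg] by (intro always_eventually allI)
qed

lemma L2_lincomb:
  assumes "f \<in> L2 r1 r2 eps" "g \<in> L2 r1 r2 eps"
  shows "(\<lambda>y. f y + c *s g y) \<in> L2 r1 r2 eps"
proof -
  obtain u where u: "\<And>n :: nat. continuous_on UNIV (u n)" "\<And>n. equivariant r1 r2 eps (u n)"
    "(\<lambda>n. L2norm (\<lambda>y. u n y - f y)) \<longlonglongrightarrow> 0" using assms(1) by (auto simp: L2_def)
  obtain v where v: "\<And>n :: nat. continuous_on UNIV (v n)" "\<And>n. equivariant r1 r2 eps (v n)"
    "(\<lambda>n. L2norm (\<lambda>y. v n y - g y)) \<longlonglongrightarrow> 0" using assms(2) by (auto simp: L2_def)
  have s: "sqi (\<lambda>y. f y + c *s g y)"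
    using assms by (intro sqi_add sqi_scale L2_sqi)
  have "continuous_on UNIV (\<lambda>y. u n y + c *s v n y)" for n
    unfolding vector_scalar_mult_def using u v by (intro continuous_intros)
  moreover have "(\<lambda>n. L2norm (\<lambda>y. (u n y + c *s v n y) - (f y + c *s g y))) \<longlonglongrightarrow> 0"
    using u v assms by (intro L2norm_lincomb_limit sqi_continuous L2_sqi)
  ultimately have "\<exists>w. (\<forall>n. continuous_on UNIV (w n) \<and> equivariant r1 r2 eps (w n)) \<and>
          (\<lambda>n::nat. L2norm (\<lambda>y. w n y - (f y + c *s g y))) \<longlonglongrightarrow> 0"
    using u v by (intro exI[of _ "\<lambda>n y. u n y + c *s v n y"]) (simp add: equivariant_lincomb)
  moreover have "equivariant r1 r2 eps (\<lambda>y. f y + c *s g y)"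
    using assms by (intro equivariant_lincomb) (simp_all add: L2_def)
  ultimately show ?thesis using s by (simp add: L2_def sqi_def)
qed

lemma L2ip_tendsto:
  assumes "\<And>n :: nat. sqi (u n)" "sqi f" "sqi g" "(\<lambda>n. L2norm (\<lambda>y. u n y - f y)) \<longlonglongrightarrow> 0"
  shows "(\<lambda>n. L2ip (u n) g) \<longlonglongrightarrow> L2ip f g"
proof -
  have "(\<lambda>n. L2ip (u n) g - L2ip f g) \<longlonglongrightarrow> 0"
  proof (rule Lim_null_comparison)
    show "(\<lambda>n. L2norm (\<lambda>y. u n y - f y) * L2norm g) \<longlonglongrightarrow> 0"
      using tendsto_mult_right[OF assms(4), of "L2norm g"] by simp
    show "\<forall>\<^sub>F n in sequentially. norm (L2ip (u n) g - L2ip f g) \<le>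
      L2norm (\<lambda>y. u n y - f y) * L2norm g"
      using L2_Cauchy_Schwarz[OF sqi_diff] assms by (simp add: L2ip_diff_left flip: L2ip_diff_left)
  qed
  then show ?thesis by (rule LIM_zero_cancel)
qed

text \<open>The members with eigenvalue l lie in the eigenspace of the closure, and the eigenspace
  is orthogonal to all other members. Completeness then makes the former a maximal orthonormal
  system of the eigenspace, so counting them gives the multiplicity.\<close>

lemma spectral_mult_eq:
  assumes D: "\<And>\<phi>. Dirac r1 r2 nabla \<phi> = DD r1 r2 \<alpha> \<phi>"
    and cnt: "countable J"
    and dom: "\<And>j. j \<in> J \<Longrightarrow> e j \<in> Dirac_domain r1 r2 eps"
    and eig: "\<And>j. j \<in> J \<Longrightarrow> DD r1 r2 \<alpha> (e j) = (\<lambda>y. \<mu> j *\<^sub>R e j y)"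
    and orth: "\<And>i j. i \<in> J \<Longrightarrow> j \<in> J \<Longrightarrow> L2ip (e i) (e j) = (if i = j then 1 else 0)"
    and complete: "\<And>f. f \<in> L2 r1 r2 eps \<Longrightarrow> (\<And>j. j \<in> J \<Longrightarrow> L2ip f (e j) = 0) \<Longrightarrow> L2norm f = 0"
  shows "spectral_mult r1 r2 eps nabla l =
    (if finite {j \<in> J. \<mu> j = l} then enat (card {j \<in> J. \<mu> j = l}) else \<infinity>)"
proof -
  let ?V = "Dirac_eigenspace r1 r2 eps nabla l"
  let ?Jl = "{j \<in> J. \<mu> j = l}"
  have sc: "l *\<^sub>R v = of_real l *s v" for v :: spinor and l
    by (simp add: vec_eq_iff) (simp add: scaleR_conv_of_real)
  have V: "f \<in> L2 r1 r2 eps \<and> (\<exists>u. (\<forall>n::nat. u n \<in> Dirac_domain r1 r2 eps) \<and>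
          (\<lambda>n. L2norm (\<lambda>y. u n y - f y)) \<longlonglongrightarrow> 0 \<and>
          (\<lambda>n. L2norm (\<lambda>y. DD r1 r2 \<alpha> (u n) y - of_real l *s f y)) \<longlonglongrightarrow> 0)"
    if "f \<in> ?V" for f
    using that by (simp only: Dirac_eigenspace_def closure_graph_def D sc mem_Collect_eq prod.case)
  have VI: "f \<in> ?V" if "f \<in> L2 r1 r2 eps" "\<forall>n::nat. u n \<in> Dirac_domain r1 r2 eps"
      "(\<lambda>n. L2norm (\<lambda>y. u n y - f y)) \<longlonglongrightarrow> 0"
      "(\<lambda>n. L2norm (\<lambda>y. DD r1 r2 \<alpha> (u n) y - of_real l *s f y)) \<longlonglongrightarrow> 0" for f u
  proof -
    have "(\<lambda>y. 0 + of_real l *s f y) \<in> L2 r1 r2 eps"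
    proof (rule L2_lincomb)
      show "(\<lambda>y. 0) \<in> L2 r1 r2 eps" by (rule L2_continuous) (auto simp: equivariant_def)
    qed (rule that(1))
    then have "(\<lambda>y. of_real l *s f y) \<in> L2 r1 r2 eps" by simp
    then show ?thesis
      using that
      by (simp only: Dirac_eigenspace_def closure_graph_def D sc mem_Collect_eq prod.case) blast
  qed
  have lin: "(\<lambda>y. f y + c *s g y) \<in> ?V" if f: "f \<in> ?V" and g: "g \<in> ?V" for f g c
  proof -
    obtain u where u: "\<And>n::nat. u n \<in> Dirac_domain r1 r2 eps"
      "(\<lambda>n. L2norm (\<lambda>y. u n y - f y)) \<longlonglongrightarrow> 0"
      "(\<lambda>n. L2norm (\<lambda>y. DD r1 r2 \<alpha> (u n) y - of_real l *s f y)) \<longlonglongrightarrow> 0" using V[OF f] by blast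
    obtain v where v: "\<And>n::nat. v n \<in> Dirac_domain r1 r2 eps"
      "(\<lambda>n. L2norm (\<lambda>y. v n y - g y)) \<longlonglongrightarrow> 0"
      "(\<lambda>n. L2norm (\<lambda>y. DD r1 r2 \<alpha> (v n) y - of_real l *s g y)) \<longlonglongrightarrow> 0" using V[OF g] by blast
    have fg: "f \<in> L2 r1 r2 eps" "g \<in> L2 r1 r2 eps" using V f g by blast+
    have sm: "smooth (u n)" "smooth (v n)" for n using u(1)[of n] v(1)[of n]
      by (auto simp: Dirac_domain_def)
    show ?thesis
    proof (rule VI)
      show "(\<lambda>y. f y + c *s g y) \<in> L2 r1 r2 eps" by (intro L2_lincomb fg)
      show "\<forall>n. (\<lambda>y. u n y + c *s v n y) \<in> Dirac_domain r1 r2 eps"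
        using u(1) v(1) by (auto simp: Dirac_domain_def intro!: smooth_lincomb equivariant_lincomb)
      show "(\<lambda>n. L2norm (\<lambda>y. u n y + c *s v n y - (f y + c *s g y))) \<longlonglongrightarrow> 0"
        using sm u v fg by (intro L2norm_lincomb_limit sqi_continuous smooth_continuous L2_sqi)
      have "(\<lambda>n. L2norm (\<lambda>y. DD r1 r2 \<alpha> (u n) y + c *s DD r1 r2 \<alpha> (v n) y -
          (of_real l *s f y + c *s (of_real l *s g y)))) \<longlonglongrightarrow> 0"
        using sm u v fg
        by (intro L2norm_lincomb_limit sqi_continuous continuous_DD sqi_scale L2_sqi)
      moreover have "of_real l *s f y + c *s (of_real l *s g y) = of_real l *s (f y + c *s g y)"
        for y
        by (simp add: vec_eq_iff algebra_simps)
      ultimately show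
        "(\<lambda>n. L2norm (\<lambda>y. DD r1 r2 \<alpha> (\<lambda>y. u n y + c *s v n y) y -
          of_real l *s (f y + c *s g y))) \<longlonglongrightarrow> 0"
        by (simp add: DD_lincomb[OF sm] mult.commute)
    qed
  qed
  have sq: "sqi (e j)" if "j \<in> J" for j
    by (rule sqi_continuous[OF smooth_continuous_spinor[OF dom[OF that]]])
  have eV: "e j \<in> ?V" if j: "j \<in> ?Jl" for j
  proof (rule VI)
    show "e j \<in> L2 r1 r2 eps"
      using dom[of j] j smooth_continuous_spinor[OF dom[of j]]
      by (intro L2_continuous) (auto simp: Dirac_domain_def)
    show "\<forall>n. e j \<in> Dirac_domain r1 r2 eps" using dom j by auto
    show "(\<lambda>n::nat. L2norm (\<lambda>y. e j y - e j y)) \<longlonglongrightarrow> 0" by (simp add: L2norm_def)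
    show "(\<lambda>n::nat. L2norm (\<lambda>y. DD r1 r2 \<alpha> (e j) y - of_real l *s e j y)) \<longlonglongrightarrow> 0"
      using eig[of j] j by (simp add: L2norm_def sc)
  qed
  \<comment> \<open>For approximants u_n of f, symmetry gives <D u_n, e_j> = mu_j <u_n, e_j>. The
    two sides tend to l <f, e_j> and mu_j <f, e_j>.\<close>
  have perp: "L2ip f (e j) = 0" if f: "f \<in> ?V" and j: "j \<in> J" "\<mu> j \<noteq> l" for f j
  proof -
    obtain u where u: "\<And>n::nat. u n \<in> Dirac_domain r1 r2 eps"
      "(\<lambda>n. L2norm (\<lambda>y. u n y - f y)) \<longlonglongrightarrow> 0"
      "(\<lambda>n. L2norm (\<lambda>y. DD r1 r2 \<alpha> (u n) y - of_real l *s f y)) \<longlonglongrightarrow> 0" using V[OF f] by blast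
    have sf: "sqi f" using V[OF f] L2_sqi by blast
    have "(\<lambda>n. L2ip (u n) (e j)) \<longlonglongrightarrow> L2ip f (e j)"
      using u(2)
      by (rule L2ip_tendsto[OF sqi_continuous[OF smooth_continuous_spinor[OF u(1)]] sf sq[OF j(1)]])
    then have 1: "(\<lambda>n. of_real (\<mu> j) * L2ip (u n) (e j)) \<longlonglongrightarrow> of_real (\<mu> j) * L2ip f (e j)"
      by (rule tendsto_mult_left)
    have "(\<lambda>n. L2ip (DD r1 r2 \<alpha> (u n)) (e j)) \<longlonglongrightarrow> L2ip (\<lambda>y. of_real l *s f y) (e j)"
    proof (rule L2ip_tendsto[OF _ sqi_scale[OF sf] sq[OF j(1)] u(3)])
      show "sqi (DD r1 r2 \<alpha> (u n))" for n
        using u(1)[of n] by (intro sqi_continuous continuous_DD) (simp add: Dirac_domain_def)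
    qed
    moreover have "L2ip (DD r1 r2 \<alpha> (u n)) (e j) = of_real (\<mu> j) * L2ip (u n) (e j)" for n
    proof -
      have "L2ip (DD r1 r2 \<alpha> (u n)) (e j) = L2ip (u n) (DD r1 r2 \<alpha> (e j))"
        by (rule DD_symmetric[OF u(1) dom[OF j(1)]])
      also have "\<dots> = of_real (\<mu> j) * L2ip (u n) (e j)"
        unfolding eig[OF j(1)] sc L2ip_scale_right by simp
      finally show ?thesis .
    qed
    ultimately have "(\<lambda>n. of_real (\<mu> j) * L2ip (u n) (e j)) \<longlonglongrightarrow> of_real l * L2ip f (e j)"
      by (simp add: L2ip_scale_left)
    from LIMSEQ_unique[OF 1 this] show ?thesis using j by simp
  qed
  have inj: "inj_on e ?Jl"
  proof (rule inj_onI)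
    fix i j assume "i \<in> ?Jl" "j \<in> ?Jl" "e i = e j"
    then show "i = j" using orth[of i j] orth[of j j] by (auto split: if_splits)
  qed
  have B: "orthonormal_basis ?V (e ` ?Jl)"
    unfolding orthonormal_basis_def
  proof (intro conjI ballI impI)
    show "e ` ?Jl \<subseteq> ?V" using eV by blast
    show "L2ip f g = (if f = g then 1 else 0)" if fg: "f \<in> e ` ?Jl" "g \<in> e ` ?Jl" for f g
    proof -
      obtain i j where "i \<in> ?Jl" "j \<in> ?Jl" "f = e i" "g = e j" using fg by blast
      then show ?thesis using orth[of i j] inj_onD[OF inj, of i j] by auto
    qed
    show "L2norm f = 0" if f: "f \<in> ?V" and z: "\<forall>g\<in>e ` ?Jl. L2ip f g = 0" for f
    proof (rule complete)
      show "f \<in> L2 r1 r2 eps" using V[OF f] by blast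
      show "L2ip f (e j) = 0" if "j \<in> J" for j
        using perp[OF f that] z that by (cases "\<mu> j = l") auto
    qed
  qed
  have "hilbert_dim ?V = (if finite (e ` ?Jl) then enat (card (e ` ?Jl)) else \<infinity>)"
  proof (rule hilbert_dim_eq[OF _ lin B])
    show "sqi f" if "f \<in> ?V" for f using V[OF that] L2_sqi by blast
    show "countable (e ` ?Jl)"
      by (rule countable_image) (rule countable_subset[OF _ cnt], blast)
  qed
  then show ?thesis
    by (simp add: spectral_mult_def card_image[OF inj] finite_image_iff[OF inj])
qed

section \<open>Series over the integers\<close>

lemma summable_on_int_quadratic: "(\<lambda>m :: int. C / (1 + (real_of_int m)\<^sup>2)) summable_on UNIV"
proof -
  have s: "(\<lambda>n :: nat. 1 / (1 + (real n)\<^sup>2)) summable_on UNIV"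
  proof (rule norm_summable_imp_summable_on)
    have "summable (\<lambda>n :: nat. inverse ((real n)\<^sup>2))"
      using inverse_power_summable[of 2, where 'a = real] by simp
    then show "summable (\<lambda>n :: nat. norm (1 / (1 + (real n)\<^sup>2)))"
    proof (rule summable_comparison_test'[where N = 1])
      fix n :: nat assume "n \<ge> 1"
      then have "0 < (real n)\<^sup>2" by simp
      from le_imp_inverse_le[OF _ this, of "1 + (real n)\<^sup>2"]
      show "norm (norm (1 / (1 + (real n)\<^sup>2))) \<le> inverse ((real n)\<^sup>2)"
        by (simp add: divide_inverse)
    qed
  qed
  have 1: "(\<lambda>m :: int. 1 / (1 + (real_of_int m)\<^sup>2)) summable_on range int"
    using s by (subst summable_on_reindex) (auto simp: o_def)
  have 2: "(\<lambda>m :: int. 1 / (1 + (real_of_int m)\<^sup>2)) summable_on range (\<lambda>n. - int n)"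
    using s by (subst summable_on_reindex) (auto simp: o_def inj_def)
  have "range int \<union> range (\<lambda>n. - int n) = UNIV"
  proof -
    have "m \<in> range int \<union> range (\<lambda>n. - int n)" for m
      by (cases m rule: int_cases2) auto
    then show ?thesis by blast
  qed
  then have "(\<lambda>m :: int. 1 / (1 + (real_of_int m)\<^sup>2)) summable_on UNIV"
    using summable_on_union[OF 1 2] by simp
  from summable_on_cmult_right[OF this, of C] show ?thesis by simp
qed

lemma infsum_int_suminf:
  fixes f :: "int \<Rightarrow> 'b::banach"
  assumes "\<And>m. norm (f m) \<le> M m" "M summable_on UNIV"
  shows "(\<lambda>n. f (int_decode n)) sums (\<Sum>\<^sub>\<infinity>m. f m)"
proof -
  have "f summable_on UNIV"
    by (rule abs_summable_summable[OF Infinite_Sum.abs_summable_on_comparison_test'[OF assms(2)]])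
      (rule assms(1))
  then have "(f has_sum (\<Sum>\<^sub>\<infinity>m. f m)) UNIV" by simp
  then have "((\<lambda>n. f (int_decode n)) has_sum (\<Sum>\<^sub>\<infinity>m. f m)) UNIV"
    by (subst has_sum_reindex_bij_betw[OF bij_int_decode])
  then show ?thesis by (rule has_sum_imp_sums)
qed

text \<open>Termwise differentiation, transported from sequences through an enumeration of the
  integers. The majorant \<open>M' m * norm h\<close> is what makes the tails of the differentiated
  series small uniformly in the point and linearly in h.\<close>

lemma has_derivative_infsum_int:
  fixes f :: "int \<Rightarrow> 'a::real_normed_vector \<Rightarrow> 'b::banach"
  assumes S: "convex S" "open S"
    and d: "\<And>m x. x \<in> S \<Longrightarrow> (f m has_derivative f' m x) (at x)"
    and f: "\<And>m x. x \<in> S \<Longrightarrow> norm (f m x) \<le> M m"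
    and f': "\<And>m x h. x \<in> S \<Longrightarrow> norm (f' m x h) \<le> M' m * norm h"
    and sm: "M summable_on UNIV" "M' summable_on UNIV"
    and x: "x \<in> S"
  shows "((\<lambda>x. \<Sum>\<^sub>\<infinity>m. f m x) has_derivative (\<lambda>h. \<Sum>\<^sub>\<infinity>m. f' m x h)) (at x)"
proof -
  have sms: "(\<lambda>m. M' m * c) summable_on UNIV" for c
    using sm(2) by (rule summable_on_cmult_left)
  have s': "(\<lambda>n. f' (int_decode n) x h) sums (\<Sum>\<^sub>\<infinity>m. f' m x h)" if "x \<in> S" for x h
    by (rule infsum_int_suminf[OF f' sms]) fact
  have sM: "summable (\<lambda>n. M' (int_decode n))"
  proof -
    have "(\<lambda>n. M' (int_decode n)) summable_on UNIV"
      using sm(2) by (subst summable_on_reindex_bij_betw[OF bij_int_decode])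
    then show ?thesis by (rule summable_on_imp_summable)
  qed
  have tail: "\<forall>\<^sub>F n in sequentially. \<forall>x\<in>S. \<forall>h.
      norm ((\<Sum>i<n. f' (int_decode i) x h) - (\<Sum>\<^sub>\<infinity>m. f' m x h)) \<le> e * norm h" if e: "e > 0" for e
  proof -
    have "\<forall>\<^sub>F n in sequentially. (\<Sum>i. M' (int_decode (i + n))) < e"
      using order_tendstoD(2)[OF suminf_exist_split2[OF sM] e] by simp
    then show ?thesis
    proof eventually_elim
      case (elim n)
      show ?case
      proof (intro ballI allI)
        fix x h assume x: "x \<in> S"
        have sa: "summable (\<lambda>i. f' (int_decode i) x h)" using s'[OF x] by (rule sums_summable)
        have sb: "summable (\<lambda>i. M' (int_decode (i + n)) * norm h)"
          using sM by (intro summable_mult2) (subst summable_iff_shift)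
        have "norm ((\<Sum>i<n. f' (int_decode i) x h) - (\<Sum>\<^sub>\<infinity>m. f' m x h)) =
            norm (\<Sum>i. f' (int_decode (i + n)) x h)"
          using suminf_minus_initial_segment[OF sa, of n] sums_unique[OF s'[OF x, of h]]
          by (simp add: norm_minus_commute)
        also have "\<dots> \<le> (\<Sum>i. M' (int_decode (i + n)) * norm h)"
          by (rule norm_suminf_le[OF _ sb]) (rule f'[OF x])
        also have "\<dots> = (\<Sum>i. M' (int_decode (i + n))) * norm h"
          using sM by (intro suminf_mult2[symmetric]) (subst summable_iff_shift)
        also have "\<dots> \<le> e * norm h" using elim by (intro mult_right_mono) auto
        finally show "norm ((\<Sum>i<n. f' (int_decode i) x h) - (\<Sum>\<^sub>\<infinity>m. f' m x h)) \<le> e * norm h" .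
      qed
    qed
  qed
  have "\<exists>g. \<forall>x\<in>S. (\<lambda>n. f (int_decode n) x) sums (g x) \<and>
    (g has_derivative (\<lambda>h. \<Sum>\<^sub>\<infinity>m. f' m x h)) (at x within S)"
  proof (rule has_derivative_series[OF S(1) _ tail x])
    show "((\<lambda>y. f (int_decode n) y) has_derivative f' (int_decode n) y) (at y within S)"
      if "y \<in> S" for n y
      using d[OF that] by (rule has_derivative_at_withinI)
    show "(\<lambda>n. f (int_decode n) x) sums (\<Sum>\<^sub>\<infinity>m. f m x)"
      by (rule infsum_int_suminf[OF f[OF x] sm(1)])
  qed
  then obtain g where g: "\<And>x. x \<in> S \<Longrightarrow> (\<lambda>n. f (int_decode n) x) sums (g x)"
    "\<And>x. x \<in> S \<Longrightarrow> (g has_derivative (\<lambda>h. \<Sum>\<^sub>\<infinity>m. f' m x h)) (at x within S)" by blast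
  have eq: "g y = (\<Sum>\<^sub>\<infinity>m. f m y)" if y: "y \<in> S" for y
    using g(1)[OF y] infsum_int_suminf[OF f[OF y] sm(1)] by (rule sums_unique2)
  have "(g has_derivative (\<lambda>h. \<Sum>\<^sub>\<infinity>m. f' m x h)) (at x)"
    using g(2)[OF x] at_within_open[OF x S(2)] by simp
  then show ?thesis
    by (rule has_derivative_transform_within_open[OF _ S(2) x]) (rule eq)
qed

section \<open>Theta series\<close>

definition pm :: "int \<Rightarrow> complex" where "pm k = (if even k then 1 else -1)"

lemma pm_add: "pm (a + b) = pm a * pm b" by (auto simp: pm_def)
lemma norm_pm [simp]: "norm (pm k) = 1" by (auto simp: pm_def)
lemma pm_cong: "even (a - b) \<Longrightarrow> pm a = pm b" by (auto simp: pm_def)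
lemma pm_square [simp]: "pm k * pm k = 1" by (auto simp: pm_def)
lemma cnj_pm [simp]: "cnj (pm k) = pm k" by (auto simp: pm_def)

text \<open>The period is 2, so an integer frequency yields exactly the sign of its parity under
  integer translations; frequencies in 2Z + epsilon thus produce the equivariance signs.\<close>

definition ch :: "real \<Rightarrow> complex" where "ch t = exp (\<i> * of_real (pi * t))"

lemma norm_ch [simp]: "norm (ch t) = 1" by (simp add: ch_def)
lemma ch_add: "ch (a + b) = ch a * ch b" by (simp add: ch_def ring_distribs exp_add)
lemma ch_0 [simp]: "ch 0 = 1" by (simp add: ch_def)
lemma cnj_ch: "cnj (ch t) = ch (- t)" by (simp add: ch_def exp_cnj)

lemma ch_of_int: "ch (of_int k) = pm k"
proof -
  have "ch (of_int k) = cis (of_int k * pi)" by (simp add: ch_def cis_conv_exp mult.commute)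
  also have "\<dots> = pm k"
  proof (cases "even k")
    case True
    then obtain j where "k = 2 * j" by blast
    then show ?thesis using cis_multiple_2pi[of "of_int j"] by (simp add: pm_def mult_ac)
  next
    case False
    then obtain j where j: "k = 2 * j + 1" by (elim oddE)
    have "cis (of_int k * pi) = cis (2 * pi * of_int j) * cis pi"
      unfolding cis_mult by (simp add: j algebra_simps del: cis_pi)
    then show ?thesis using False by (simp add: pm_def cis_multiple_2pi)
  qed
  finally show ?thesis .
qed

lemma exp_pm: "exp (\<i> * of_real pi * of_int k) = pm k"
  using ch_of_int[of k] by (simp add: ch_def mult.assoc)

lemma continuous_ch [continuous_intros]: "continuous_on S f \<Longrightarrow> continuous_on S (\<lambda>y. ch (f y))"
  unfolding ch_def by (intro continuous_intros)

type_synonym freq = "int \<times> int \<times> int \<times> int"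

definition ph :: "freq \<Rightarrow> real ^ 4 \<Rightarrow> real" where
  "ph = (\<lambda>(x1, x2, x3, x4) v. of_int x1 * v $ 1 + of_int x2 * v $ 2 + of_int x3 *
    v $ 3 + of_int x4 * v $ 4)"

text \<open>The action on frequencies dual to A(m): pulling the phase of \<open>\<xi>\<close> back
  along A(m) gives the phase of its shift, see \<open>ph_shift_matA\<close>.\<close>

definition shift :: "int \<Rightarrow> int \<Rightarrow> int \<Rightarrow> freq \<Rightarrow> freq" where
  "shift r1 r2 m = (\<lambda>(x1, x2, x3, x4). (x1, x2, x3 + m * (r1 * x1), x4 + m * (r2 * x2)))"

lemma ph_add: "ph \<xi> (u + v) = ph \<xi> u + ph \<xi> v"
  and ph_scale: "ph \<xi> (c *\<^sub>R v) = c * ph \<xi> v"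
  by (cases \<xi>; simp add: ph_def algebra_simps)+

lemma ph_shift_matA: "ph (shift r1 r2 m \<xi>) (matA r1 r2 (of_int k) *v v) =
  ph (shift r1 r2 (m + k) \<xi>) v"
  by (cases \<xi>) (simp add: ph_def shift_def matA_mult_vec axis_def algebra_simps)

lemma shift_shift: "shift r1 r2 m (shift r1 r2 k \<xi>) = shift r1 r2 (m + k) \<xi>"
  by (cases \<xi>) (simp add: shift_def algebra_simps)

lemma shift_0 [simp]: "shift r1 r2 0 \<xi> = \<xi>"
  by (cases \<xi>) (simp add: shift_def)

lemma continuous_ph [continuous_intros]: "continuous_on S f \<Longrightarrow> continuous_on S (\<lambda>y. ph \<xi> (f y))"
  by (cases \<xi>) (auto simp: ph_def intro!: continuous_intros)

text \<open>The m-th term is the function \<open>ch (ph \<xi> x) * w m s\<close> evaluated at (0,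
  m)(x, s), with the sign prescribed by the spin structure. The weight may depend on m because
  differentiation in x brings down the shifted phase, which is affine in m.\<close>

definition trm :: "int \<Rightarrow> int \<Rightarrow> int \<Rightarrow> freq \<Rightarrow> (int \<Rightarrow> real \<Rightarrow> complex) \<Rightarrow> int \<Rightarrow> pt \<Rightarrow> complex" where
  "trm r1 r2 e5 \<xi> w m y = pm (e5 * m) * ch (ph (shift r1 r2 m \<xi>) (fst y)) * w m (snd y + of_int m)"

definition Es :: "int \<Rightarrow> int \<Rightarrow> int \<Rightarrow> freq \<Rightarrow> (int \<Rightarrow> real \<Rightarrow> complex) \<Rightarrow> pt \<Rightarrow> complex" where
  "Es r1 r2 e5 \<xi> w y = (\<Sum>\<^sub>\<infinity>m. trm r1 r2 e5 \<xi> w m y)"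

lemma norm_trm: "norm (trm r1 r2 e5 \<xi> w m y) = norm (w m (snd y + of_int m))"
  by (simp add: trm_def norm_mult)

text \<open>A summable majorant that is uniform for s in a bounded interval; it yields locally
  uniform convergence of the series.\<close>

definition decay :: "(int \<Rightarrow> real \<Rightarrow> complex) \<Rightarrow> bool" where
  "decay w \<longleftrightarrow> (\<forall>R. \<exists>C. \<forall>m s. \<bar>s\<bar> \<le> R \<longrightarrow> norm (w m (s + of_int m)) \<le> C / (1 + (real_of_int m)\<^sup>2))"

lemma decayE:
  assumes "decay w"
  obtains C where "\<And>m s. \<bar>s\<bar> \<le> R \<Longrightarrow> norm (w m (s + of_int m)) \<le> C / (1 + (real_of_int m)\<^sup>2)"
  using assms unfolding decay_def by blast

lemma summable_trm:
  assumes "decay w"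
  shows "(\<lambda>m. trm r1 r2 e5 \<xi> w m y) summable_on UNIV"
proof -
  obtain C where "\<And>m s. \<bar>s\<bar> \<le> \<bar>snd y\<bar> \<Longrightarrow> norm (w m (s + of_int m)) \<le> C / (1 + (real_of_int m)\<^sup>2)"
    using decayE[OF assms] by blast
  then show ?thesis
    by (intro abs_summable_summable[OF Infinite_Sum.abs_summable_on_comparison_test'[OF
      summable_on_int_quadratic]])
      (auto simp: norm_trm)
qed

lemma Es_add:
  assumes "decay v" "decay w"
  shows "Es r1 r2 e5 \<xi> (\<lambda>m \<tau>. v m \<tau> + w m \<tau>) y = Es r1 r2 e5 \<xi> v y + Es r1 r2 e5 \<xi> w y"
  unfolding Es_def infsum_add[OF summable_trm[OF assms(1)] summable_trm[OF assms(2)], symmetric]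
  by (simp add: trm_def algebra_simps)

lemma Es_scale: "Es r1 r2 e5 \<xi> (\<lambda>m \<tau>. c * w m \<tau>) y = c * Es r1 r2 e5 \<xi> w y"
  unfolding Es_def infsum_cmult_right'[symmetric] by (simp add: trm_def algebra_simps)

section \<open>Gaussian weights\<close>

definition gau :: "real \<Rightarrow> real \<Rightarrow> real \<Rightarrow> real" where
  "gau \<beta> \<sigma> \<tau> = exp (- (\<beta> * (\<tau> + \<sigma>)\<^sup>2 / 2))"

lemma gau_pos: "gau \<beta> \<sigma> \<tau> > 0" by (simp add: gau_def)

lemma pow_div_fact_le_exp:
  fixes x :: real
  assumes "x \<ge> 0"
  shows "x ^ n / fact n \<le> exp x"
proof -
  have "(\<Sum>k\<in>{n}. x ^ k /\<^sub>R fact k) \<le> (\<Sum>k. x ^ k /\<^sub>R fact k)"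
    using assms summable_exp_generic[of x] by (intro sum_le_suminf) auto
  then show ?thesis by (simp add: exp_def divide_inverse mult.commute)
qed

text \<open>The power is bounded by an exponential through a single term of its series, and the
  exponential is absorbed into the Gaussian by completing the square. The rate \<open>K\<close> is
  left free because the Taylor estimate below must choose it according to a frequency.\<close>

lemma gau_bound:
  assumes "\<beta> > 0" "K > 0"
  shows "(1 + \<bar>\<tau>\<bar>) ^ n * gau \<beta> \<sigma> \<tau> \<le> fact n / K ^ n * exp (K + K * \<bar>\<sigma>\<bar> + K\<^sup>2 / (2 * \<beta>))"
proof -
  define u where "u = \<bar>\<tau> + \<sigma>\<bar>"
  have "(K * (1 + \<bar>\<tau>\<bar>)) ^ n / fact n \<le> exp (K * (1 + \<bar>\<tau>\<bar>))"
    using assms by (intro pow_div_fact_le_exp) simp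
  then have "(1 + \<bar>\<tau>\<bar>) ^ n \<le> fact n / K ^ n * exp (K * (1 + \<bar>\<tau>\<bar>))"
    using assms unfolding power_mult_distrib by (simp add: field_simps)
  then have "(1 + \<bar>\<tau>\<bar>) ^ n * gau \<beta> \<sigma> \<tau> \<le> fact n / K ^ n * exp (K * (1 + \<bar>\<tau>\<bar>)) * gau \<beta> \<sigma> \<tau>"
    using gau_pos[of \<beta> \<sigma> \<tau>] by (intro mult_right_mono) auto
  also have "\<dots> = fact n / K ^ n * exp (K * (1 + \<bar>\<tau>\<bar>) - \<beta> * u\<^sup>2 / 2)"
    by (simp only: gau_def u_def power2_abs mult.assoc mult_exp_exp) simp
  also have "\<dots> \<le> fact n / K ^ n * exp (K + K * \<bar>\<sigma>\<bar> + K\<^sup>2 / (2 * \<beta>))"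
  proof -
    have "K * \<bar>\<tau>\<bar> \<le> K * (u + \<bar>\<sigma>\<bar>)" using assms by (intro mult_left_mono) (auto simp: u_def)
    moreover have "K * u \<le> \<beta> * u\<^sup>2 / 2 + K\<^sup>2 / (2 * \<beta>)"
    proof -
      have "0 \<le> (\<beta> * u - K)\<^sup>2 / (2 * \<beta>)" using assms by simp
      also have "\<dots> = \<beta> * u\<^sup>2 / 2 - K * u + K\<^sup>2 / (2 * \<beta>)"
        using assms by (simp add: power2_eq_square field_simps)
      finally show ?thesis by simp
    qed
    ultimately have "K * (1 + \<bar>\<tau>\<bar>) - \<beta> * u\<^sup>2 / 2 \<le> K + K * \<bar>\<sigma>\<bar> + K\<^sup>2 / (2 * \<beta>)"
      by (simp add: distrib_left)
    then show ?thesis using assms by (intro mult_left_mono) auto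
  qed
  finally show ?thesis .
qed

text \<open>This span is closed under multiplication by m and by the variable and under
  differentiation, so all derivatives of a theta series with such a weight are series of the same
  kind.\<close>

inductive gw :: "real \<Rightarrow> real \<Rightarrow> (int \<Rightarrow> real \<Rightarrow> complex) \<Rightarrow> bool" for \<beta> \<sigma> where
  gw_mono: "gw \<beta> \<sigma> (\<lambda>m \<tau>. c * of_int m ^ j * of_real \<tau> ^ i * of_real (gau \<beta> \<sigma> \<tau>))"
| gw_add: "gw \<beta> \<sigma> v \<Longrightarrow> gw \<beta> \<sigma> w \<Longrightarrow> gw \<beta> \<sigma> (\<lambda>m \<tau>. v m \<tau> + w m \<tau>)"

lemma gw_scale: "gw \<beta> \<sigma> w \<Longrightarrow> gw \<beta> \<sigma> (\<lambda>m \<tau>. d * w m \<tau>)"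
proof (induction rule: gw.induct)
  case (gw_mono c j i)
  show ?case using gw.gw_mono[of \<beta> \<sigma> "d * c" j i] by (simp add: mult.assoc)
next
  case (gw_add v w)
  then show ?case using gw.gw_add[of \<beta> \<sigma>] by (simp add: distrib_left)
qed

lemma gw_mult_index: "gw \<beta> \<sigma> w \<Longrightarrow> gw \<beta> \<sigma> (\<lambda>m \<tau>. of_int m * w m \<tau>)"
proof (induction rule: gw.induct)
  case (gw_mono c j i)
  show ?case using gw.gw_mono[of \<beta> \<sigma> c "Suc j" i] by (simp add: mult_ac)
next
  case (gw_add v w)
  then show ?case using gw.gw_add[of \<beta> \<sigma>] by (simp add: distrib_left)
qed

lemma gw_mult_var: "gw \<beta> \<sigma> w \<Longrightarrow> gw \<beta> \<sigma> (\<lambda>m \<tau>. of_real \<tau> * w m \<tau>)"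
proof (induction rule: gw.induct)
  case (gw_mono c j i)
  show ?case using gw.gw_mono[of \<beta> \<sigma> c j "Suc i"] by (simp add: mult_ac)
next
  case (gw_add v w)
  then show ?case using gw.gw_add[of \<beta> \<sigma>] by (simp add: distrib_left)
qed

lemma gw_poly: "gw \<beta> \<sigma> (\<lambda>m \<tau>. poly p (of_real \<tau>) * of_real (gau \<beta> \<sigma> \<tau>))"
proof (induction p)
  case 0
  show ?case using gw_mono[of \<beta> \<sigma> 0 0 0] by simp
next
  case (pCons a p)
  have "gw \<beta> \<sigma> (\<lambda>m \<tau>. a * of_int m ^ 0 * of_real \<tau> ^ 0 * of_real (gau \<beta> \<sigma> \<tau>) +
      of_real \<tau> * (poly p (of_real \<tau>) * of_real (gau \<beta> \<sigma> \<tau>)))"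
    by (intro gw_add gw_mono gw_mult_var pCons.IH)
  then show ?case by (simp add: algebra_simps)
qed

lemma gw_deriv:
  "gw \<beta> \<sigma> w \<Longrightarrow> \<exists>w'. gw \<beta> \<sigma> w' \<and> (\<forall>m \<tau>. (w m has_vector_derivative w' m \<tau>) (at \<tau>))"
proof (induction rule: gw.induct)
  case (gw_mono c j i)
  let ?g = "\<lambda>\<tau>. of_real (gau \<beta> \<sigma> \<tau>) :: complex"
  let ?w = "\<lambda>(m :: int) \<tau>. c * of_int m ^ j * of_real \<tau> ^ i * ?g \<tau>"
  let ?w' = "\<lambda>(m :: int) \<tau>. (c * of_nat i) * of_int m ^ j * of_real \<tau> ^ (i - 1) * ?g \<tau> +
    ((- c * of_real \<beta>) * of_int m ^ j * of_real \<tau> ^ (Suc i) * ?g \<tau> +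
     (- c * of_real (\<beta> * \<sigma>)) * of_int m ^ j * of_real \<tau> ^ i * ?g \<tau>)"
  have "gw \<beta> \<sigma> ?w'" by (intro gw.gw_add gw.gw_mono)
  moreover have "(?w m has_vector_derivative ?w' m \<tau>) (at \<tau>)" for m \<tau>
  proof -
    have "((\<lambda>\<tau>. \<tau> ^ i * gau \<beta> \<sigma> \<tau>) has_real_derivative
        real i * \<tau> ^ (i - 1) * gau \<beta> \<sigma> \<tau> +
          (- \<beta> * \<tau> ^ Suc i * gau \<beta> \<sigma> \<tau> - \<beta> * \<sigma> * \<tau> ^ i * gau \<beta> \<sigma> \<tau>)) (at \<tau>)"
      unfolding gau_def
      by (auto intro!: derivative_eq_intros simp: algebra_simps)
    then have "((\<lambda>\<tau>. of_real (\<tau> ^ i * gau \<beta> \<sigma> \<tau>) :: complex) has_vector_derivative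
        of_real (real i * \<tau> ^ (i - 1) * gau \<beta> \<sigma> \<tau> +
          (- \<beta> * \<tau> ^ Suc i * gau \<beta> \<sigma> \<tau> - \<beta> * \<sigma> * \<tau> ^ i * gau \<beta> \<sigma> \<tau>))) (at \<tau>)"
      by (intro has_vector_derivative_of_real)
        (simp add: has_real_derivative_iff_has_vector_derivative)
    from has_vector_derivative_mult_right[OF this, of "c * of_int m ^ j"]
    show ?thesis by (simp add: algebra_simps)
  qed
  ultimately show ?case by blast
next
  case (gw_add v w)
  then obtain v' w' where "gw \<beta> \<sigma> v'" "gw \<beta> \<sigma> w'"
    "\<And>m \<tau>. (v m has_vector_derivative v' m \<tau>) (at \<tau>)"
      "\<And>m \<tau>. (w m has_vector_derivative w' m \<tau>) (at \<tau>)" by blast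
  then show ?case
    by (intro exI[of _ "\<lambda>m \<tau>. v' m \<tau> + w' m \<tau>"]) (auto intro: gw.gw_add has_vector_derivative_add)
qed

lemma gw_decay:
  assumes "\<beta> > 0"
  shows "gw \<beta> \<sigma> w \<Longrightarrow> decay w"
proof (induction rule: gw.induct)
  case (gw_mono c j i)
  show ?case
    unfolding decay_def
  proof
    fix R
    \<comment> \<open>The exponents account for the powers of m, the powers of the variable, and the
      weight 1 + m^2.\<close>
    define n where "n = j + i + 2"
    let ?C = "norm c * (2 + \<bar>R\<bar>) ^ (j + 2) * (fact n * exp (1 + \<bar>\<sigma>\<bar> + 1\<^sup>2 / (2 * \<beta>)))"
    have "norm (c * of_int m ^ j * of_real (s + of_int m) ^ i * of_real (gau \<beta> \<sigma> (s + of_int m))) \<le>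
      ?C / (1 + (real_of_int m)\<^sup>2)"
      if s: "\<bar>s\<bar> \<le> R" for m s
    proof -
      define \<tau> where "\<tau> = s + of_int m"
      define K where "K = 2 + \<bar>R\<bar>"
      have K: "K \<ge> 1" by (simp add: K_def)
      \<comment> \<open>Since m differs from the variable by at most \<open>R\<close>, powers of m
        turn into powers of the variable, which the Gaussian absorbs.\<close>
      have m: "1 + \<bar>real_of_int m\<bar> \<le> K * (1 + \<bar>\<tau>\<bar>)"
      proof -
        have "\<bar>real_of_int m\<bar> \<le> \<bar>\<tau>\<bar> + \<bar>R\<bar>" using s unfolding \<tau>_def by linarith
        moreover have "K * (1 + \<bar>\<tau>\<bar>) \<ge> K + \<bar>\<tau>\<bar>" using K mult_right_mono[of 1 K "\<bar>\<tau>\<bar>"]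
          by (simp add: distrib_left)
        ultimately show ?thesis by (simp add: K_def)
      qed
      have "\<bar>real_of_int m\<bar> ^ j * \<bar>\<tau>\<bar> ^ i * (1 + (real_of_int m)\<^sup>2) \<le>
          (1 + \<bar>real_of_int m\<bar>) ^ j * (1 + \<bar>\<tau>\<bar>) ^ i * (1 + \<bar>real_of_int m\<bar>)\<^sup>2"
        by (intro mult_mono power_mono) (auto simp: power2_sum)
      also have "\<dots> = (1 + \<bar>real_of_int m\<bar>) ^ (j + 2) * (1 + \<bar>\<tau>\<bar>) ^ i"
        by (simp add: power_add power2_eq_square mult_ac)
      also have "\<dots> \<le> (K * (1 + \<bar>\<tau>\<bar>)) ^ (j + 2) * (1 + \<bar>\<tau>\<bar>) ^ i"
        using m by (intro mult_right_mono power_mono) auto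
      also have "\<dots> = K ^ (j + 2) * (1 + \<bar>\<tau>\<bar>) ^ n"
        by (simp add: n_def power_mult_distrib power_add mult_ac)
      finally have "\<bar>real_of_int m\<bar> ^ j * \<bar>\<tau>\<bar> ^ i * (1 + (real_of_int m)\<^sup>2) * gau \<beta> \<sigma> \<tau> \<le>
          K ^ (j + 2) * (1 + \<bar>\<tau>\<bar>) ^ n * gau \<beta> \<sigma> \<tau>"
        using gau_pos[of \<beta> \<sigma> \<tau>] by (intro mult_right_mono) auto
      also have "\<dots> \<le> K ^ (j + 2) * (fact n * exp (1 + \<bar>\<sigma>\<bar> + 1\<^sup>2 / (2 * \<beta>)))"
        unfolding mult.assoc[of "K ^ (j + 2)"] 
        using K gau_bound[OF assms, of 1 \<tau> n \<sigma>] by (intro mult_left_mono) auto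
      finally have "norm c * (\<bar>real_of_int m\<bar> ^ j * \<bar>\<tau>\<bar> ^ i * (1 + (real_of_int m)\<^sup>2) * gau \<beta> \<sigma> \<tau>) \<le>
          norm c * (K ^ (j + 2) * (fact n * exp (1 + \<bar>\<sigma>\<bar> + 1\<^sup>2 / (2 * \<beta>))))"
        by (rule mult_left_mono) simp
      moreover have "norm (c * of_int m ^ j * of_real \<tau> ^ i * of_real (gau \<beta> \<sigma> \<tau>)) =
          norm c * (\<bar>real_of_int m\<bar> ^ j * \<bar>\<tau>\<bar> ^ i * gau \<beta> \<sigma> \<tau>)"
        using gau_pos[of \<beta> \<sigma> \<tau>] by (simp add: norm_mult norm_power)
      moreover have "0 < 1 + (real_of_int m)\<^sup>2" by (simp add: add_pos_nonneg)
      ultimately show ?thesis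
        unfolding \<tau>_def[symmetric] K_def[symmetric] by (simp add: pos_le_divide_eq mult_ac)
    qed
    then show "\<exists>C. \<forall>m s. \<bar>s\<bar> \<le> R \<longrightarrow>
      norm (c * of_int m ^ j * of_real (s + of_int m) ^ i * of_real (gau \<beta> \<sigma> (s + of_int m)))
        \<le> C / (1 + (real_of_int m)\<^sup>2)" by blast
  qed
next
  case (gw_add v w)
  show ?case
    unfolding decay_def
  proof
    fix R
    obtain C where C: "\<And>m s. \<bar>s\<bar> \<le> R \<Longrightarrow> norm (v m (s + of_int m)) \<le> C / (1 + (real_of_int m)\<^sup>2)"
      using decayE[OF gw_add.IH(1)] by blast
    obtain D where D: "\<And>m s. \<bar>s\<bar> \<le> R \<Longrightarrow> norm (w m (s + of_int m)) \<le> D / (1 + (real_of_int m)\<^sup>2)"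
      using decayE[OF gw_add.IH(2)] by blast
    have "norm (v m (s + of_int m) + w m (s + of_int m)) \<le> (C + D) / (1 + (real_of_int m)\<^sup>2)"
      if "\<bar>s\<bar> \<le> R" for m s
      using norm_triangle_le[OF add_mono[OF C[OF that] D[OF that]]]
      by (simp add: add_divide_distrib)
    then show "\<exists>C. \<forall>m s. \<bar>s\<bar> \<le> R \<longrightarrow> norm (v m (s + of_int m) + w m (s + of_int m)) \<le>
      C / (1 + (real_of_int m)\<^sup>2)"
      by blast
  qed
qed

section \<open>Differentiability of theta series\<close>

text \<open>The weight whose series is the derivative, in direction h, of the series with weight w;
  w' is the derivative of w.\<close>

definition dw ::
  "int \<Rightarrow> int \<Rightarrow> freq \<Rightarrow> pt \<Rightarrow> (int \<Rightarrow> real \<Rightarrow> complex) \<Rightarrow> (int \<Rightarrow> real \<Rightarrow> complex) \<Rightarrow> (int \<Rightarrow> real \<Rightarrow> complex)"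
    where
  "dw r1 r2 \<xi> h w w' m \<tau> = \<i> * of_real (pi * ph (shift r1 r2 m \<xi>) (fst h)) * w m \<tau> +
    of_real (snd h) * w' m \<tau>"

lemma gw_dw:
  assumes "gw \<beta> \<sigma> w" "gw \<beta> \<sigma> w'"
  shows "gw \<beta> \<sigma> (dw r1 r2 \<xi> h w w')"
proof -
  obtain x1 x2 x3 x4 where \<xi>: "\<xi> = (x1, x2, x3, x4)" by (cases \<xi>)
  let ?Q = "of_int (r1 * x1) * fst h $ 3 + of_int (r2 * x2) * fst h $ 4"
  have "gw \<beta> \<sigma> (\<lambda>m \<tau>. (\<i> * of_real (pi * ph \<xi> (fst h))) * w m \<tau> +
      ((\<i> * of_real (pi * ?Q)) * (of_int m * w m \<tau>) + of_real (snd h) * w' m \<tau>))"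
    by (intro gw_add gw_scale gw_mult_index assms)
  also have "(\<lambda>m \<tau>. (\<i> * of_real (pi * ph \<xi> (fst h))) * w m \<tau> +
      ((\<i> * of_real (pi * ?Q)) * (of_int m * w m \<tau>) + of_real (snd h) * w' m \<tau>))
        = dw r1 r2 \<xi> h w w'"
    by (intro ext) (simp add: dw_def \<xi> ph_def shift_def algebra_simps)
  finally show ?thesis .
qed

lemma abs_ph_le:
  obtains A B where "A \<ge> 0" "B \<ge> 0"
    "\<And>m v. \<bar>ph (shift r1 r2 m \<xi>) v\<bar> \<le> (A + B * \<bar>of_int m\<bar>) * norm v"
proof -
  obtain x1 x2 x3 x4 where \<xi>: "\<xi> = (x1, x2, x3, x4)" by (cases \<xi>)
  define A :: real where "A = \<bar>of_int x1\<bar> + \<bar>of_int x2\<bar> + \<bar>of_int x3\<bar> + \<bar>of_int x4\<bar>"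
  define B :: real where "B = \<bar>of_int (r1 * x1)\<bar> + \<bar>of_int (r2 * x2)\<bar>"
  have "\<bar>ph (shift r1 r2 m \<xi>) v\<bar> \<le> (A + B * \<bar>of_int m\<bar>) * norm v" for m v
  proof -
    have t: "\<bar>c * v $ i\<bar> \<le> d * norm v" if "\<bar>c\<bar> \<le> d" for c d and i :: 4
      unfolding abs_mult using that component_le_norm_cart[of v i] by (intro mult_mono) auto
    have "\<bar>ph (shift r1 r2 m \<xi>) v\<bar> \<le> \<bar>of_int x1 * v $ 1\<bar> + \<bar>of_int x2 * v $ 2\<bar> +
        \<bar>of_int (x3 + m * (r1 * x1)) * v $ 3\<bar> + \<bar>of_int (x4 + m * (r2 * x2)) * v $ 4\<bar>"
      unfolding \<xi> ph_def shift_def prod.case by linarith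
    also have "\<dots> \<le> \<bar>of_int x1\<bar> * norm v + \<bar>of_int x2\<bar> * norm v +
        (\<bar>of_int x3\<bar> + \<bar>of_int (r1 * x1)\<bar> * \<bar>of_int m\<bar>) * norm v +
        (\<bar>of_int x4\<bar> + \<bar>of_int (r2 * x2)\<bar> * \<bar>of_int m\<bar>) * norm v"
    proof (intro add_mono t)
      show "\<bar>of_int (x3 + m * (r1 * x1))\<bar> \<le> \<bar>of_int x3\<bar> + \<bar>of_int (r1 * x1)\<bar> * \<bar>real_of_int m\<bar>"
        using abs_triangle_ineq[of "real_of_int x3" "of_int m * of_int (r1 * x1)"]
        by (simp add: abs_mult mult_ac)
      show "\<bar>of_int (x4 + m * (r2 * x2))\<bar> \<le> \<bar>of_int x4\<bar> + \<bar>of_int (r2 * x2)\<bar> * \<bar>real_of_int m\<bar>"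
        using abs_triangle_ineq[of "real_of_int x4" "of_int m * of_int (r2 * x2)"]
        by (simp add: abs_mult mult_ac)
    qed auto
    also have "\<dots> = (A + B * \<bar>of_int m\<bar>) * norm v" by (simp add: A_def B_def algebra_simps)
    finally show ?thesis .
  qed
  then show ?thesis by (intro that[of A B]) (auto simp: A_def B_def)
qed

lemma has_derivative_trm:
  assumes "\<And>m \<tau>. (w m has_vector_derivative w' m \<tau>) (at \<tau>)"
  shows "(trm r1 r2 e5 \<xi> w m has_derivative (\<lambda>h. trm r1 r2 e5 \<xi> (dw r1 r2 \<xi> h w w') m y)) (at y)"
proof -
  let ?p = "ph (shift r1 r2 m \<xi>)"
  have lin: "bounded_linear ?p"
    by (simp add: linear_conv_bounded_linear[symmetric] linearI ph_add ph_scale)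
  have 1: "((\<lambda>y. ?p (fst y)) has_derivative (\<lambda>h. ?p (fst h))) (at y)"
    by (intro bounded_linear.has_derivative[OF lin] has_derivative_fst has_derivative_ident)
  have 2: "((\<lambda>y. ch (?p (fst y))) has_derivative (\<lambda>h. ch (?p (fst y)) *
    (\<i> * of_real (pi * ?p (fst h))))) (at y)"
  proof -
    have "((\<lambda>y. \<i> * of_real (pi * ?p (fst y))) has_derivative (\<lambda>h. \<i> *
      of_real (pi * ?p (fst h)))) (at y)"
      by (intro has_derivative_mult_right has_derivative_of_real 1)
    from has_derivative_compose[OF this DERIV_exp[unfolded has_field_derivative_def]] show ?thesis
      unfolding ch_def by (simp add: mult.commute)
  qed
  have "((\<lambda>y. snd y + of_int m) has_derivative snd) (at y)"
    by (auto intro!: derivative_eq_intros)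
  then have 3:
    "((\<lambda>y. w m (snd y + of_int m)) has_derivative (\<lambda>h. snd h *\<^sub>R w' m (snd y + of_int m))) (at y)"
    using has_derivative_compose[where f = "\<lambda>y. snd y + of_int m" and g = "w m"]
      assms[unfolded has_vector_derivative_def] by blast
  have "((\<lambda>y. pm (e5 * m) * (ch (?p (fst y)) * w m (snd y + of_int m))) has_derivative
      (\<lambda>h. pm (e5 * m) * (ch (?p (fst y)) * (snd h *\<^sub>R w' m (snd y + of_int m)) +
         ch (?p (fst y)) * (\<i> * of_real (pi * ?p (fst h))) * w m (snd y + of_int m)))) (at y)"
    by (intro has_derivative_mult_right has_derivative_mult 2 3)
  then show ?thesis
    by (simp add: trm_def[abs_def] dw_def scaleR_conv_of_real algebra_simps)
qed

lemma has_derivative_Es: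
  assumes \<beta>: "\<beta> > 0" and w: "gw \<beta> \<sigma> w" "gw \<beta> \<sigma> w'"
    and d: "\<And>m \<tau>. (w m has_vector_derivative w' m \<tau>) (at \<tau>)"
  shows "(Es r1 r2 e5 \<xi> w has_derivative (\<lambda>h. Es r1 r2 e5 \<xi> (dw r1 r2 \<xi> h w w') y)) (at y)"
proof -
  define R where "R = \<bar>snd y\<bar> + 1"
  let ?S = "UNIV \<times> {- R<..<R} :: pt set"
  obtain C1 where C1: "\<And>m s. \<bar>s\<bar> \<le> R \<Longrightarrow> norm (w m (s + of_int m)) \<le> C1 / (1 + (real_of_int m)\<^sup>2)"
    using decayE[OF gw_decay[OF \<beta> w(1)]] by blast
  obtain C2
    where C2: "\<And>m s. \<bar>s\<bar> \<le> R \<Longrightarrow> norm (of_int m * w m (s + of_int m)) \<le> C2 / (1 + (real_of_int m)\<^sup>2)"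
    using decayE[OF gw_decay[OF \<beta> gw_mult_index[OF w(1)]]] by blast
  obtain C3 where C3: "\<And>m s. \<bar>s\<bar> \<le> R \<Longrightarrow> norm (w' m (s + of_int m)) \<le> C3 / (1 + (real_of_int m)\<^sup>2)"
    using decayE[OF gw_decay[OF \<beta> w(2)]] by blast
  obtain A B where AB: "A \<ge> 0" "B \<ge> 0"
    "\<And>m v. \<bar>ph (shift r1 r2 m \<xi>) v\<bar> \<le> (A + B * \<bar>of_int m\<bar>) * norm v"
    using abs_ph_le[of r1 r2 \<xi>] by blast
  \<comment> \<open>The phase factor grows at most like \<open>A + B * \<bar>m\<bar>\<close>;
    \<open>C1\<close> bounds its constant part, \<open>C2\<close> the part with the extra factor m,
    and \<open>C3\<close> the derivative of the weight.\<close>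
  let ?M' = "\<lambda>m. (pi * (A * C1 + B * C2) + C3) / (1 + (real_of_int m)\<^sup>2)"
  have b: "norm (trm r1 r2 e5 \<xi> (dw r1 r2 \<xi> h w w') m z) \<le> ?M' m * norm h" if z: "z \<in> ?S" for z m h
  proof -
    let ?\<tau> = "snd z + of_int m" and ?q = "1 + (real_of_int m)\<^sup>2"
    have sz: "\<bar>snd z\<bar> \<le> R" using z by auto
    have "norm (dw r1 r2 \<xi> h w w' m ?\<tau>) \<le> pi * \<bar>ph (shift r1 r2 m \<xi>) (fst h)\<bar> *
      norm (w m ?\<tau>) + \<bar>snd h\<bar> * norm (w' m ?\<tau>)"
      unfolding dw_def by (rule order_trans[OF norm_triangle_ineq]) (simp add: norm_mult abs_mult)
    also have "\<dots> \<le> pi * ((A + B * \<bar>of_int m\<bar>) * norm h) * norm (w m ?\<tau>) + norm h * norm (w' m ?\<tau>)"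
    proof (intro add_mono mult_mono order_refl)
      show "\<bar>ph (shift r1 r2 m \<xi>) (fst h)\<bar> \<le> (A + B * \<bar>of_int m\<bar>) * norm h"
        using AB norm_fst_le[of "fst h" "snd h"]
        by (intro order_trans[OF AB(3)] mult_left_mono) auto
      show "\<bar>snd h\<bar> \<le> norm h" using norm_snd_le[of "snd h" "fst h"] by simp
    qed (use AB in auto)
    also have "\<dots> =
      norm h * (pi * (A * norm (w m ?\<tau>) + B * norm (of_int m * w m ?\<tau>)) + norm (w' m ?\<tau>))"
      by (simp add: norm_mult algebra_simps)
    also have "\<dots> \<le> norm h * (pi * (A * (C1 / ?q) + B * (C2 / ?q)) + C3 / ?q)"
      using AB sz by (intro mult_left_mono add_mono C1 C2 C3) auto
    also have "\<dots> = ?M' m * norm h" by (simp add: add_divide_distrib algebra_simps)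
    finally show ?thesis by (simp only: norm_trm)
  qed
  have "((\<lambda>y. \<Sum>\<^sub>\<infinity>m. trm r1 r2 e5 \<xi> w m y) has_derivative
    (\<lambda>h. \<Sum>\<^sub>\<infinity>m. trm r1 r2 e5 \<xi> (dw r1 r2 \<xi> h w w') m y)) (at y)"
  proof (rule has_derivative_infsum_int[where S = ?S])
    show "convex ?S" by (intro convex_Times) auto
    show "open ?S" by (intro open_Times) auto
    show "norm (trm r1 r2 e5 \<xi> w m z) \<le> C1 / (1 + (real_of_int m)\<^sup>2)" if "z \<in> ?S" for m z
      using that by (simp add: norm_trm) (intro C1, auto)
    show "y \<in> ?S" by (cases y) (auto simp: R_def)
    show "(\<lambda>m. C1 / (1 + (real_of_int m)\<^sup>2)) summable_on UNIV" "?M' summable_on UNIV"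
      by (rule summable_on_int_quadratic)+
  qed (use b has_derivative_trm[OF d] in auto)
  then show ?thesis by (simp only: Es_def[abs_def])
qed

lemma smooth_Es:
  assumes "\<beta> > 0" "gw \<beta> \<sigma> w"
  shows "smooth (Es r1 r2 e5 \<xi> w)"
proof -
  \<comment> \<open>The induction has to cover all weights at once, because differentiation replaces
    w by \<open>dw\<close>.\<close>
  have "\<forall>w. gw \<beta> \<sigma> w \<longrightarrow> Ck k (Es r1 r2 e5 \<xi> w)" for k
  proof (induction k)
    case 0
    show ?case
    proof (intro allI impI)
      fix w assume w: "gw \<beta> \<sigma> w"
      obtain w' where w': "gw \<beta> \<sigma> w'" "\<And>m \<tau>. (w m has_vector_derivative w' m \<tau>) (at \<tau>)"
        using gw_deriv[OF w] by blast
      show "Ck 0 (Es r1 r2 e5 \<xi> w)"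
        using has_derivative_continuous[OF has_derivative_Es[OF assms(1) w w', of r1 r2 e5 \<xi>]]
        by (simp add: continuous_at_imp_continuous_on)
    qed
  next
    case (Suc k)
    show ?case
    proof (intro allI impI)
      fix w assume w: "gw \<beta> \<sigma> w"
      obtain w' where w': "gw \<beta> \<sigma> w'" "\<And>m \<tau>. (w m has_vector_derivative w' m \<tau>) (at \<tau>)"
        using gw_deriv[OF w] by blast
      note d = has_derivative_Es[OF assms(1) w w', of r1 r2 e5 \<xi>]
      have "frechet_derivative (Es r1 r2 e5 \<xi> w) (at y) = (\<lambda>h. Es r1 r2 e5 \<xi> (dw r1 r2 \<xi> h w w') y)"
        for y
        by (rule frechet_derivative_at[symmetric]) (rule d)
      moreover have "Es r1 r2 e5 \<xi> w differentiable (at y)" for y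
        unfolding differentiable_def using d by blast
      ultimately show "Ck (Suc k) (Es r1 r2 e5 \<xi> w)"
        using Suc gw_dw[OF w w'(1)] by simp
    qed
  qed
  then show ?thesis using assms by (auto simp: smooth_def)
qed

text \<open>In the m-th term the shift contributes m times \<open>r1 * x1\<close> and the frame
  field at y contributes s times \<open>r1 * x1\<close>, with s the last coordinate of y. Together
  they depend on s + m only, so the new weight is again independent of m and the Dirac operator acts
  on functions of one variable.\<close>

lemma along_Es:
  fixes w :: "real \<Rightarrow> complex"
  assumes \<beta>: "\<beta> > 0" and w: "gw \<beta> \<sigma> (\<lambda>m. w)" "gw \<beta> \<sigma> (\<lambda>m. w')"
    and d: "\<And>\<tau>. (w has_vector_derivative w' \<tau>) (at \<tau>)" and \<xi>: "\<xi> = (x1, x2, x3, x4)"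
  shows "along (frame r1 r2 1) (Es r1 r2 e5 \<xi> (\<lambda>m. w)) =
      Es r1 r2 e5 \<xi> (\<lambda>m \<tau>. \<i> * of_real (pi * (of_int x3 + of_int (r1 * x1) * \<tau>)) * w \<tau>)"
    and "along (frame r1 r2 2) (Es r1 r2 e5 \<xi> (\<lambda>m. w)) =
      Es r1 r2 e5 \<xi> (\<lambda>m \<tau>. \<i> * of_real (pi * (of_int x4 + of_int (r2 * x2) * \<tau>)) * w \<tau>)"
    and "along (frame r1 r2 3) (Es r1 r2 e5 \<xi> (\<lambda>m. w)) = Es r1 r2 e5 \<xi> (\<lambda>m. w')"
proof -
  have "frechet_derivative (Es r1 r2 e5 \<xi> (\<lambda>m. w)) (at y) =
    (\<lambda>h. Es r1 r2 e5 \<xi> (dw r1 r2 \<xi> h (\<lambda>m. w) (\<lambda>m. w')) y)" for y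
    by (rule frechet_derivative_at[symmetric]) (rule has_derivative_Es[OF \<beta> w d])
  then have al: "along (frame r1 r2 i) (Es r1 r2 e5 \<xi> (\<lambda>m. w)) y =
      Es r1 r2 e5 \<xi> (dw r1 r2 \<xi> (frame r1 r2 i y) (\<lambda>m. w) (\<lambda>m. w')) y" for i y
    by (simp add: along_def)
  have eq: "Es r1 r2 e5 \<xi> v y = Es r1 r2 e5 \<xi> u y"
    if "\<And>m. v m (snd y + of_int m) = u m (snd y + of_int m)" for u v y
    unfolding Es_def trm_def by (simp add: that)
  show "along (frame r1 r2 1) (Es r1 r2 e5 \<xi> (\<lambda>m. w)) =
      Es r1 r2 e5 \<xi> (\<lambda>m \<tau>. \<i> * of_real (pi * (of_int x3 + of_int (r1 * x1) * \<tau>)) * w \<tau>)"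
    unfolding fun_eq_iff al
    by (intro allI eq)
      (simp add: dw_def \<xi> frame_fvec fvec_def matA_mult_vec ph_def shift_def axis_def algebra_simps)
  show "along (frame r1 r2 2) (Es r1 r2 e5 \<xi> (\<lambda>m. w)) =
      Es r1 r2 e5 \<xi> (\<lambda>m \<tau>. \<i> * of_real (pi * (of_int x4 + of_int (r2 * x2) * \<tau>)) * w \<tau>)"
    unfolding fun_eq_iff al
    by (intro allI eq)
      (simp add: dw_def \<xi> frame_fvec fvec_def matA_mult_vec ph_def shift_def axis_def algebra_simps)
  show "along (frame r1 r2 3) (Es r1 r2 e5 \<xi> (\<lambda>m. w)) = Es r1 r2 e5 \<xi> (\<lambda>m. w')"
    unfolding fun_eq_iff al
    by (intro allI eq) (simp add: dw_def \<xi> frame_fvec fvec_def ph_def shift_def)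
qed

section \<open>Uniform approximation by trigonometric sums\<close>

text \<open>The factor 2 makes the characters periodic under integer translations; the coefficients
  are arbitrary continuous functions of the last coordinate.\<close>

inductive tp :: "(pt \<Rightarrow> complex) \<Rightarrow> bool" where
  tp_base: "continuous_on UNIV q \<Longrightarrow> tp (\<lambda>y. ch (2 * ph \<eta> (fst y)) * q (snd y))"
| tp_add: "tp f \<Longrightarrow> tp g \<Longrightarrow> tp (\<lambda>y. f y + g y)"

lemma ph_freq_add:
  "ph (a1, a2, a3, a4) v + ph (b1, b2, b3, b4) v = ph (a1 + b1, a2 + b2, a3 + b3, a4 + b4) v"
  by (simp add: ph_def algebra_simps)

lemma tp_base_mult:
  assumes "continuous_on UNIV q" "tp g"
  shows "tp (\<lambda>y. (ch (2 * ph \<eta> (fst y)) * q (snd y)) * g y)"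
  using assms(2)
proof (induction rule: tp.induct)
  case (tp_base q' \<eta>')
  obtain a1 a2 a3 a4 b1 b2 b3 b4 where e: "\<eta> = (a1, a2, a3, a4)" "\<eta>' = (b1, b2, b3, b4)"
    by (cases \<eta>, cases \<eta>')
  have "tp (\<lambda>y. ch (2 * ph (a1 + b1, a2 + b2, a3 + b3, a4 + b4) (fst y)) *
    (q (snd y) * q' (snd y)))"
    using tp_base assms(1) by (intro tp.tp_base continuous_intros)
  then show ?case
    by (simp add: e ch_add mult_ac distrib_left flip: ph_freq_add)
next
  case (tp_add f g)
  show ?case using tp.tp_add[OF tp_add.IH] by (simp add: distrib_left)
qed

lemma tp_mult: "tp f \<Longrightarrow> tp g \<Longrightarrow> tp (\<lambda>y. f y * g y)"
proof (induction rule: tp.induct)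
  case (tp_add f1 f2)
  show ?case using tp.tp_add[OF tp_add.IH(1)[OF tp_add.prems] tp_add.IH(2)[OF tp_add.prems]]
    by (simp add: distrib_right)
qed (rule tp_base_mult)

lemma tp_of_snd: "continuous_on UNIV q \<Longrightarrow> tp (\<lambda>y. q (snd y))"
  using tp_base[of q "(0, 0, 0, 0)"] by (simp add: ph_def)

text \<open>Polynomials in torus coordinates, their conjugates and the last coordinate. The
  conjugates supply real and imaginary parts, as the real Stone-Weierstrass theorem
  requires.\<close>

inductive zalg :: "((complex ^ 4) \<times> real \<Rightarrow> complex) \<Rightarrow> bool" where
  zalg_const: "zalg (\<lambda>p. c)"
| zalg_var: "zalg (\<lambda>p. fst p $ i)"
| zalg_cnj: "zalg (\<lambda>p. cnj (fst p $ i))"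
| zalg_snd: "zalg (\<lambda>p. of_real (snd p))"
| zalg_add: "zalg f \<Longrightarrow> zalg g \<Longrightarrow> zalg (\<lambda>p. f p + g p)"
| zalg_mult: "zalg f \<Longrightarrow> zalg g \<Longrightarrow> zalg (\<lambda>p. f p * g p)"

lemma zalg_continuous: "zalg f \<Longrightarrow> continuous_on S f"
  by (induction rule: zalg.induct) (auto intro!: continuous_intros)

definition torus :: "pt \<Rightarrow> (complex ^ 4) \<times> real" where
  "torus y = ((\<chi> i. ch (2 * fst y $ i)), snd y)"

lemma zalg_tp: "zalg f \<Longrightarrow> tp (\<lambda>y. f (torus y))"
proof (induction rule: zalg.induct)
  case (zalg_const c)
  show ?case using tp_of_snd[of "\<lambda>_. c"] by simp
next
  case (zalg_var i)
  have "i = 1 \<or> i = 2 \<or> i = 3 \<or> i = 4" using exhaust_4 by blast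
  then have "\<exists>\<eta>. \<forall>v. ph \<eta> v = v $ i"
    by (elim disjE; intro exI[of _ "(if i = 1 then 1 else 0, if i = 2 then 1 else 0, if i =
      3 then 1 else 0, if i = 4 then 1 else 0)"])
      (auto simp: ph_def)
  then obtain \<eta> where "\<And>v. ph \<eta> v = v $ i" by blast
  then show ?case using tp_base[of "\<lambda>_. 1" \<eta>] by (simp add: torus_def)
next
  case (zalg_cnj i)
  have "i = 1 \<or> i = 2 \<or> i = 3 \<or> i = 4" using exhaust_4 by blast
  then have "\<exists>\<eta>. \<forall>v. ph \<eta> v = - v $ i"
    by (elim disjE; intro exI[of _ "(if i = 1 then -1 else 0, if i =
      2 then -1 else 0, if i = 3 then -1 else 0, if i = 4 then -1 else 0)"])
      (auto simp: ph_def)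
  then obtain \<eta> where "\<And>v. ph \<eta> v = - v $ i" by blast
  then show ?case using tp_base[of "\<lambda>_. 1" \<eta>] by (simp add: torus_def cnj_ch)
next
  case zalg_snd
  show ?case using tp_of_snd[of of_real] by (simp add: torus_def continuous_on_of_real)
qed (auto intro: tp_add tp_mult)

lemma ch_eq_imp:
  assumes "ch (2 * a) = ch (2 * b)"
  shows "a - b \<in> \<int>"
proof -
  have "ch (2 * (a - b)) = 1"
  proof -
    have "ch (2 * b) \<noteq> 0" by (metis norm_ch norm_zero zero_neq_one)
    moreover have "ch (2 * (a - b)) * ch (2 * b) = ch (2 * a)"
      unfolding ch_add[symmetric] by (simp add: algebra_simps)
    ultimately show ?thesis using assms by simp
  qed
  then obtain n where "pi * (2 * (a - b)) = of_int (2 * n) * pi"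
    by (auto simp: ch_def exp_eq_1)
  then have "pi * (2 * (a - b)) = pi * (2 * of_int n)"
    by (simp only: of_int_mult of_int_numeral mult.commute)
  then have "a - b = of_int n" by simp
  then show ?thesis by simp
qed

text \<open>Periodicity lets \<open>v\<close> descend to the product of a compact torus and an
  interval, where Stone-Weierstrass applies.\<close>

lemma torus_approx_real:
  fixes v :: "pt \<Rightarrow> real"
  assumes v: "continuous_on UNIV v" and per: "\<And>x n s. (\<And>i. n $ i \<in> \<int>) \<Longrightarrow> v (x + n, s) = v (x, s)"
    and e: "\<epsilon> > 0"
  shows "\<exists>T. tp T \<and> (\<forall>x s. \<bar>s\<bar> \<le> 1 \<longrightarrow> norm (of_real (v (x, s)) - T (x, s)) \<le> \<epsilon>)"
proof -
  define X :: "((complex ^ 4) \<times> real) set" where "X = {p. (\<forall>i. norm (fst p $ i) = 1) \<and> \<bar>snd p\<bar> \<le> 1}"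
  define K :: "pt set" where "K = {y. (\<forall>i. \<bar>fst y $ i\<bar> \<le> 1) \<and> \<bar>snd y\<bar> \<le> 1}"
  define R where "R = {g :: (complex ^ 4) \<times> real \<Rightarrow> real. zalg (\<lambda>p. of_real (g p))}"
  \<comment> \<open>A choice of preimage under \<open>torus\<close> by means of the argument;
    periodicity makes the value independent of the choice.\<close>
  define V where "V = (\<lambda>p :: (complex ^ 4) \<times> real. v ((\<chi> i. Arg (fst p $ i) / (2 * pi)), snd p))"
  have ct: "continuous_on S torus" for S
    unfolding torus_def by (intro continuous_intros)
  have K: "compact K"
  proof (rule compact_eq_bounded_closed[THEN iffD2], rule conjI)
    show "bounded K"
    proof (rule boundedI)
      fix y assume y: "y \<in> K"
      have "norm (fst y) \<le> (\<Sum>i\<in>UNIV. \<bar>fst y $ i\<bar>)" by (rule norm_le_l1_cart)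
      also have "\<dots> \<le> (\<Sum>i\<in>(UNIV :: 4 set). 1)" using y by (intro sum_mono) (auto simp: K_def)
      finally have "norm (fst y) \<le> 4" by simp
      moreover have "\<bar>snd y\<bar> \<le> 1" using y by (simp add: K_def)
      ultimately show "norm y \<le> 5" using norm_Pair_le[of "fst y" "snd y"] by simp
    qed
    have "K = (\<Inter>i. {y. \<bar>fst y $ i\<bar> \<le> 1}) \<inter> {y. \<bar>snd y\<bar> \<le> 1}" by (auto simp: K_def)
    also have "closed \<dots>" by (intro closed_Int closed_INT ballI closed_Collect_le continuous_intros)
    finally show "closed K" .
  qed
  have KX: "torus y \<in> X" if "\<bar>snd y\<bar> \<le> 1" for y using that by (simp add: torus_def X_def)
  have Vt: "V (torus (x, s)) = v (x, s)" for x s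
  proof -
    define x' :: "real ^ 4" where "x' = (\<chi> i. Arg (ch (2 * x $ i)) / (2 * pi))"
    have "ch (2 * x' $ i) = ch (2 * x $ i)" for i
      using cis_Arg[of "ch (2 * x $ i)"] norm_ch[of "2 * x $ i"]
      by (auto simp: x'_def ch_def cis_conv_exp sgn_eq)
    then have "\<And>i. (x' - x) $ i \<in> \<int>" using ch_eq_imp by simp
    from per[OF this, of x s] show ?thesis by (simp add: V_def torus_def x'_def)
  qed
  have onto: "\<exists>y\<in>K. torus y = p" if p: "p \<in> X" for p
  proof (rule bexI)
    let ?y = "((\<chi> i. Arg (fst p $ i) / (2 * pi)), snd p)"
    have "ch (Arg (fst p $ i) / pi) = fst p $ i" for i
    proof -
      have "norm (fst p $ i) = 1" using p by (simp add: X_def)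
      then have "fst p $ i \<noteq> 0" "sgn (fst p $ i) = fst p $ i" by (auto simp: sgn_eq)
      then show ?thesis using cis_Arg[of "fst p $ i"] by (simp add: ch_def cis_conv_exp)
    qed
    then show "torus ?y = p" by (simp add: torus_def prod_eq_iff vec_eq_iff)
    have "\<bar>Arg z / (2 * pi)\<bar> \<le> 1" for z
      using Arg_bounded[of z] by (simp add: abs_le_iff divide_le_eq le_divide_eq)
    then show "?y \<in> K" using p by (auto simp: K_def X_def)
  qed
  have XK: "X = torus ` K" 
  proof
    show "X \<subseteq> torus ` K" using onto by blast
    show "torus ` K \<subseteq> X" using KX unfolding K_def by blast
  qed
  have X: "compact X" unfolding XK by (rule compact_continuous_image[OF ct K])
  \<comment> \<open>\<open>Arg\<close> jumps, so continuity is proved through closed preimages: the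
    preimage of a closed set under \<open>V\<close> is the image under \<open>torus\<close> of a
    compact set.\<close>
  have cV: "continuous_on X V"
    unfolding continuous_on_closed_vimage[OF compact_imp_closed[OF X]]
  proof (intro allI impI)
    fix B :: "real set" assume B: "closed B"
    have "V -` B \<inter> X = torus ` (v -` B \<inter> K)"
      unfolding XK using Vt by force
    moreover have "compact (v -` B \<inter> K)"
      using closed_vimage[OF B v] K by (intro closed_Int_compact) auto
    ultimately have "compact (V -` B \<inter> X)" using compact_continuous_image[OF ct] by metis
    then show "closed (V -` B \<inter> X)" by (rule compact_imp_closed)
  qed
  interpret function_ring_on R X
  proof
    show "compact X" by (rule X)
    show "continuous_on X f" if "f \<in> R" for f
    proof -
      have "continuous_on X (\<lambda>p. Re (of_real (f p)))"
        by (rule continuous_on_Re[OF zalg_continuous]) (use that in \<open>simp add: R_def\<close>)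
      then show ?thesis by simp
    qed
    show "(\<lambda>x. f x + g x) \<in> R" "(\<lambda>x. f x * g x) \<in> R" if "f \<in> R" "g \<in> R" for f g
      using that by (auto simp: R_def intro: zalg_add zalg_mult)
    show "(\<lambda>_. c) \<in> R" for c by (auto simp: R_def intro: zalg_const)
    show "\<exists>f\<in>R. f x \<noteq> f y" if xy: "x \<in> X" "y \<in> X" "x \<noteq> y" for x y
    proof (cases "snd x = snd y")
      case False
      then show ?thesis by (intro bexI[of _ snd]) (auto simp: R_def intro: zalg_snd)
    next
      case True
      then obtain i where i: "fst x $ i \<noteq> fst y $ i" using xy by (auto simp: prod_eq_iff vec_eq_iff)
      have "zalg (\<lambda>p. (1 / 2) * (fst p $ i + cnj (fst p $ i)))"
        by (intro zalg.intros)
      moreover have "zalg (\<lambda>p. (- \<i> / 2) * (fst p $ i + (-1) * cnj (fst p $ i)))"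
        by (intro zalg.intros)
      moreover have "(1 / 2) * (z + cnj z) = of_real (Re z)"
        "(- \<i> / 2) * (z + (-1) * cnj z) = of_real (Im z)" for z
        by (simp_all add: complex_eq_iff)
      ultimately have "(\<lambda>p. Re (fst p $ i)) \<in> R" "(\<lambda>p. Im (fst p $ i)) \<in> R" by (simp_all add: R_def)
      moreover have "Re (fst x $ i) \<noteq> Re (fst y $ i) \<or> Im (fst x $ i) \<noteq> Im (fst y $ i)"
        using i complex_eq_iff by blast
      ultimately show ?thesis by (elim disjE) (rule bexI, assumption+)+
    qed
  qed
  obtain g where g: "g \<in> R" "\<And>p. p \<in> X \<Longrightarrow> \<bar>V p - g p\<bar> < \<epsilon>"
    using Stone_Weierstrass_basic[OF cV e] by blast
  show ?thesis
  proof (intro exI[of _ "\<lambda>y. of_real (g (torus y))"] conjI allI impI)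
    show "tp (\<lambda>y. of_real (g (torus y)))" using g(1) zalg_tp[of "\<lambda>p. of_real (g p)"]
      by (simp add: R_def)
    fix x s assume "\<bar>s :: real\<bar> \<le> 1"
    then have "\<bar>V (torus (x, s)) - g (torus (x, s))\<bar> < \<epsilon>" by (intro g(2) KX) simp
    then show "norm (of_real (v (x, s)) - of_real (g (torus (x, s))) :: complex) \<le> \<epsilon>"
      by (simp add: Vt flip: of_real_diff)
  qed
qed

lemma torus_approx:
  fixes v :: "pt \<Rightarrow> complex"
  assumes v: "continuous_on UNIV v" and per: "\<And>x n s. (\<And>i. n $ i \<in> \<int>) \<Longrightarrow> v (x + n, s) = v (x, s)"
    and e: "\<epsilon> > 0"
  obtains T where "tp T" "\<And>x s. \<bar>s\<bar> \<le> 1 \<Longrightarrow> norm (v (x, s) - T (x, s)) \<le> \<epsilon>"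
proof -
  obtain T1 where T1: "tp T1" "\<And>x s. \<bar>s\<bar> \<le> 1 \<Longrightarrow> norm (of_real (Re (v (x, s))) - T1 (x, s)) \<le> \<epsilon> / 2"
    using torus_approx_real[of "\<lambda>y. Re (v y)" "\<epsilon> / 2"] v per e by (auto intro!: continuous_intros)
  obtain T2 where T2: "tp T2" "\<And>x s. \<bar>s\<bar> \<le> 1 \<Longrightarrow> norm (of_real (Im (v (x, s))) - T2 (x, s)) \<le> \<epsilon> / 2"
    using torus_approx_real[of "\<lambda>y. Im (v y)" "\<epsilon> / 2"] v per e by (auto intro!: continuous_intros)
  show ?thesis
  proof (rule that[of "\<lambda>y. T1 y + \<i> * T2 y"])
    show "tp (\<lambda>y. T1 y + \<i> * T2 y)"
      using tp_of_snd[of "\<lambda>_. \<i>"] T1 T2 by (intro tp_add tp_mult) simp_all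
    fix x and s :: real assume s: "\<bar>s\<bar> \<le> 1"
    have "v (x, s) - (T1 (x, s) + \<i> * T2 (x, s)) =
        (of_real (Re (v (x, s))) - T1 (x, s)) + \<i> * (of_real (Im (v (x, s))) - T2 (x, s))"
      by (subst complex_eq[of "v (x, s)"]) (simp add: algebra_simps)
    also have "norm \<dots> \<le> \<epsilon> / 2 + \<epsilon> / 2"
      using T1(2)[OF s, of x] T2(2)[OF s, of x]
      by (intro norm_triangle_le add_mono) (auto simp: norm_mult)
    finally show "norm (v (x, s) - (T1 (x, s) + \<i> * T2 (x, s))) \<le> \<epsilon>" by simp
  qed
qed

section \<open>Continuity of theta series\<close>

text \<open>Complements \<open>smooth_Es\<close> for the compactly supported weights, which are
  merely continuous.\<close>

lemma continuous_Es:
  assumes "decay w" "\<And>m. continuous_on UNIV (w m)"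
  shows "continuous_on UNIV (Es r1 r2 e5 \<xi> w)"
proof (rule continuous_at_imp_continuous_on, rule ballI)
  fix y :: pt
  define R where "R = \<bar>snd y\<bar> + 1"
  let ?S = "UNIV \<times> {- R<..<R} :: pt set"
  obtain C where C: "\<And>m s. \<bar>s\<bar> \<le> R \<Longrightarrow> norm (w m (s + of_int m)) \<le> C / (1 + (real_of_int m)\<^sup>2)"
    using decayE[OF assms(1)] by blast
  have "uniform_limit ?S (\<lambda>F z. \<Sum>m\<in>F. trm r1 r2 e5 \<xi> w m z) (\<lambda>z. \<Sum>\<^sub>\<infinity>m. trm r1 r2 e5 \<xi> w m z)
    (finite_subsets_at_top UNIV)"
  proof (rule Weierstrass_m_test_general[OF _ summable_on_int_quadratic])
    show "norm (trm r1 r2 e5 \<xi> w m z) \<le> C / (1 + (real_of_int m)\<^sup>2)" if "z \<in> ?S" for m z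
      using that by (simp add: norm_trm) (intro C, auto)
  qed
  moreover have "continuous_on ?S (\<lambda>z. \<Sum>m\<in>F. trm r1 r2 e5 \<xi> w m z)" for F
    unfolding trm_def by (intro continuous_intros continuous_on_compose2[OF assms(2)]) auto
  ultimately have "continuous_on ?S (\<lambda>z. \<Sum>\<^sub>\<infinity>m. trm r1 r2 e5 \<xi> w m z)"
    by (intro uniform_limit_theorem[where F = "finite_subsets_at_top UNIV"])
      (auto simp: always_eventually)
  moreover have "open ?S" by (intro open_Times) auto
  moreover have "y \<in> ?S" by (cases y) (auto simp: R_def)
  ultimately show "isCont (Es r1 r2 e5 \<xi> w) y"
    unfolding Es_def[abs_def] using continuous_on_eq_continuous_at by blast
qed

text \<open>With t = s + m one has m^2 \<le> 2 t^2 + 2 s^2, whence 1 + m^2 \<le> (2 + 2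
  \<open>R\<^sup>2\<close>) (1 + t^2).\<close>

lemma decay_weighted:
  assumes "\<And>\<tau>. norm (w \<tau>) * (1 + \<tau>\<^sup>2) \<le> C"
  shows "decay (\<lambda>m. w)"
  unfolding decay_def
proof
  fix R
  have C: "C \<ge> 0" using assms[of 0] by (smt (verit) mult_nonneg_nonneg norm_ge_zero zero_le_power2)
  have "norm (w (s + of_int m)) \<le> (C * (2 + 2 * R\<^sup>2)) / (1 + (real_of_int m)\<^sup>2)"
    if s: "\<bar>s\<bar> \<le> R" for m s
  proof -
    define \<tau> where "\<tau> = s + of_int m"
    have "s\<^sup>2 \<le> R\<^sup>2" using power_mono[OF s, of 2] by simp
    moreover have "(real_of_int m)\<^sup>2 = \<tau>\<^sup>2 - 2 * (\<tau> * s) + s\<^sup>2"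
      by (simp add: \<tau>_def power2_eq_square algebra_simps)
    moreover have "0 \<le> \<tau>\<^sup>2 + s\<^sup>2 + 2 * (\<tau> * s)"
      using zero_le_power2[of "\<tau> + s"] by (simp add: power2_sum)
    moreover have "(2 + 2 * R\<^sup>2) * (1 + \<tau>\<^sup>2) = 2 + 2 * R\<^sup>2 + 2 * \<tau>\<^sup>2 + 2 * (\<tau>\<^sup>2 * R\<^sup>2)"
      by (simp add: algebra_simps)
    moreover have "0 \<le> \<tau>\<^sup>2 * R\<^sup>2" by simp
    ultimately have "1 + (real_of_int m)\<^sup>2 \<le> (2 + 2 * R\<^sup>2) * (1 + \<tau>\<^sup>2)" by linarith
    then have "norm (w \<tau>) * (1 + (real_of_int m)\<^sup>2) \<le> norm (w \<tau>) * ((2 + 2 * R\<^sup>2) * (1 + \<tau>\<^sup>2))"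
      by (intro mult_left_mono) auto
    also have "\<dots> = (norm (w \<tau>) * (1 + \<tau>\<^sup>2)) * (2 + 2 * R\<^sup>2)" by simp
    also have "\<dots> \<le> C * (2 + 2 * R\<^sup>2)" using assms by (intro mult_right_mono) auto
    moreover have "0 < 1 + (real_of_int m)\<^sup>2" by (simp add: add_pos_nonneg)
    ultimately show ?thesis unfolding \<tau>_def[symmetric] by (simp add: pos_le_divide_eq)
  qed
  then show "\<exists>C. \<forall>m s. \<bar>s\<bar> \<le> R \<longrightarrow> norm (w (s + of_int m)) \<le> C / (1 + (real_of_int m)\<^sup>2)" by blast
qed

lemma compact_support_weighted:
  fixes w :: "real \<Rightarrow> complex"
  assumes "continuous_on UNIV w" "\<And>\<tau>. \<bar>\<tau>\<bar> \<ge> L \<Longrightarrow> w \<tau> = 0"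
  obtains C where "\<And>\<tau>. norm (w \<tau>) * (1 + \<tau>\<^sup>2) \<le> C" "C \<ge> 0"
proof -
  have "continuous_on {- \<bar>L\<bar>..\<bar>L\<bar>} (\<lambda>\<tau>. norm (w \<tau>) * (1 + \<tau>\<^sup>2))"
    by (intro continuous_intros continuous_on_subset[OF assms(1)]) auto
  then have "compact ((\<lambda>\<tau>. norm (w \<tau>) * (1 + \<tau>\<^sup>2)) ` {- \<bar>L\<bar>..\<bar>L\<bar>})"
    by (rule compact_continuous_image) simp
  then obtain C where C: "\<And>\<tau>. \<tau> \<in> {- \<bar>L\<bar>..\<bar>L\<bar>} \<Longrightarrow> norm (norm (w \<tau>) * (1 + \<tau>\<^sup>2)) \<le> C"
    by (meson compact_imp_bounded bounded_iff imageI)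
  have "norm (w \<tau>) * (1 + \<tau>\<^sup>2) \<le> max C 0" for \<tau>
  proof (cases "\<bar>\<tau>\<bar> \<le> \<bar>L\<bar>")
    case True
    then have "norm (norm (w \<tau>) * (1 + \<tau>\<^sup>2)) \<le> C" by (intro C) auto
    then show ?thesis by simp
  next
    case False
    then show ?thesis using assms(2)[of \<tau>] by simp
  qed
  then show ?thesis by (rule that) simp
qed

text \<open>The factor 4 comes from 1 + m^2 \<le> 4 (1 + t^2) for t = s + m with s in [0,
  1).\<close>

definition sumq :: real where "sumq = (\<Sum>\<^sub>\<infinity>m::int. 4 / (1 + (real_of_int m)\<^sup>2))"

lemma sumq_nonneg: "sumq \<ge> 0"
  unfolding sumq_def by (rule infsum_nonneg) simp

text \<open>The map from weights to theta series is continuous from the sup norm with factor 1 + t^2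
  to uniform convergence on the fundamental domain; this fixes the norm in which weights have to be
  approximated.\<close>

lemma norm_Es_le:
  assumes b: "\<And>\<tau>. norm (w \<tau>) * (1 + \<tau>\<^sup>2) \<le> C" and s: "0 \<le> snd y" "snd y < 1"
  shows "norm (Es r1 r2 e5 \<xi> (\<lambda>m. w) y) \<le> C * sumq"
proof -
  have C: "C \<ge> 0" using b[of 0] by (smt (verit) mult_nonneg_nonneg norm_ge_zero zero_le_power2)
  have "norm (trm r1 r2 e5 \<xi> (\<lambda>m. w) m y) \<le> C * (4 / (1 + (real_of_int m)\<^sup>2))" for m
  proof -
    define \<tau> where "\<tau> = snd y + of_int m"
    have "1 + (real_of_int m)\<^sup>2 \<le> 4 * (1 + \<tau>\<^sup>2)"
    proof -
      have "(real_of_int m)\<^sup>2 = \<tau>\<^sup>2 - 2 * (\<tau> * snd y) + (snd y)\<^sup>2"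
        by (simp add: \<tau>_def power2_eq_square algebra_simps)
      moreover have "0 \<le> \<tau>\<^sup>2 + (snd y)\<^sup>2 + 2 * (\<tau> * snd y)"
        using zero_le_power2[of "\<tau> + snd y"] by (simp add: power2_sum)
      moreover have "(snd y)\<^sup>2 \<le> 1" using s by (simp add: power_le_one)
      ultimately have "(real_of_int m)\<^sup>2 \<le> 2 * \<tau>\<^sup>2 + 2" by linarith
      then show ?thesis using zero_le_power2[of \<tau>] unfolding distrib_left by linarith
    qed
    then have "norm (w \<tau>) * (1 + (real_of_int m)\<^sup>2) \<le> norm (w \<tau>) * (4 * (1 + \<tau>\<^sup>2))"
      by (intro mult_left_mono) auto
    also have "\<dots> = norm (w \<tau>) * (1 + \<tau>\<^sup>2) * 4" by simp
    also have "\<dots> \<le> C * 4" using b[of \<tau>] by (intro mult_right_mono) auto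
    moreover have "0 < 1 + (real_of_int m)\<^sup>2" by (simp add: add_pos_nonneg)
    ultimately show ?thesis unfolding norm_trm \<tau>_def[symmetric] by (simp add: pos_le_divide_eq)
  qed
  moreover have "((\<lambda>m. C * (4 / (1 + (real_of_int m)\<^sup>2))) has_sum C * sumq) UNIV"
    unfolding sumq_def by (intro has_sum_cmult_right has_sum_infsum summable_on_int_quadratic)
  moreover have "((\<lambda>m. trm r1 r2 e5 \<xi> (\<lambda>m. w) m y) has_sum Es r1 r2 e5 \<xi> (\<lambda>m. w) y) UNIV"
    unfolding Es_def by (intro has_sum_infsum summable_trm decay_weighted[OF b])
  ultimately show ?thesis
    using norm_infsum_le[where f = "\<lambda>m. trm r1 r2 e5 \<xi> (\<lambda>m. w) m y" and X = UNIV] by blast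
qed

section \<open>Weighted approximation by polynomials\<close>

text \<open>Membership in the closure of the polynomials for the norm that, after multiplication
  with the Gaussian, is the one in \<open>norm_Es_le\<close>.\<close>

definition papp :: "real \<Rightarrow> real \<Rightarrow> (real \<Rightarrow> complex) \<Rightarrow> bool" where
  "papp \<beta> \<sigma> \<phi> \<longleftrightarrow> (\<forall>\<epsilon>>0. \<exists>p. \<forall>\<tau>. norm (\<phi> \<tau> - poly p (of_real \<tau>)) * gau \<beta> \<sigma> \<tau> * (1 + \<tau>\<^sup>2) \<le> \<epsilon>)"

lemma papp_add:
  assumes "papp \<beta> \<sigma> \<phi>" "papp \<beta> \<sigma> \<psi>"
  shows "papp \<beta> \<sigma> (\<lambda>\<tau>. \<phi> \<tau> + \<psi> \<tau>)"
  unfolding papp_def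
proof (intro allI impI)
  fix \<epsilon> :: real assume "\<epsilon> > 0"
  then have "\<epsilon> / 2 > 0" by simp
  then obtain p q where p: "\<And>\<tau>. norm (\<phi> \<tau> - poly p (of_real \<tau>)) * gau \<beta> \<sigma> \<tau> * (1 + \<tau>\<^sup>2) \<le> \<epsilon> / 2"
    and q: "\<And>\<tau>. norm (\<psi> \<tau> - poly q (of_real \<tau>)) * gau \<beta> \<sigma> \<tau> * (1 + \<tau>\<^sup>2) \<le> \<epsilon> / 2"
    using assms unfolding papp_def by meson
  have "norm (\<phi> \<tau> + \<psi> \<tau> - poly (p + q) (of_real \<tau>)) * gau \<beta> \<sigma> \<tau> * (1 + \<tau>\<^sup>2) \<le> \<epsilon>" for \<tau>
  proof -
    have "norm (\<phi> \<tau> + \<psi> \<tau> - poly (p + q) (of_real \<tau>)) \<le>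
      norm (\<phi> \<tau> - poly p (of_real \<tau>)) + norm (\<psi> \<tau> - poly q (of_real \<tau>))"
      by (simp add: add_diff_add norm_triangle_ineq)
    then have "norm (\<phi> \<tau> + \<psi> \<tau> - poly (p + q) (of_real \<tau>)) * (gau \<beta> \<sigma> \<tau> * (1 + \<tau>\<^sup>2)) \<le>
        (norm (\<phi> \<tau> - poly p (of_real \<tau>)) + norm (\<psi> \<tau> - poly q (of_real \<tau>))) *
          (gau \<beta> \<sigma> \<tau> * (1 + \<tau>\<^sup>2))"
      using gau_pos[of \<beta> \<sigma> \<tau>] by (intro mult_right_mono) auto
    then show ?thesis using p[of \<tau>] q[of \<tau>] unfolding distrib_right mult.assoc by linarith
  qed
  then show "\<exists>p. \<forall>\<tau>. norm (\<phi> \<tau> + \<psi> \<tau> - poly p (of_real \<tau>)) * gau \<beta> \<sigma> \<tau> * (1 + \<tau>\<^sup>2) \<le> \<epsilon>" by blast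
qed

lemma papp_scale:
  assumes "papp \<beta> \<sigma> \<phi>"
  shows "papp \<beta> \<sigma> (\<lambda>\<tau>. c * \<phi> \<tau>)"
  unfolding papp_def
proof (intro allI impI)
  fix \<epsilon> :: real assume e: "\<epsilon> > 0"
  then have "\<epsilon> / (norm c + 1) > 0" by (simp add: add_nonneg_pos)
  then obtain p
    where p: "\<And>\<tau>. norm (\<phi> \<tau> - poly p (of_real \<tau>)) * gau \<beta> \<sigma> \<tau> * (1 + \<tau>\<^sup>2) \<le> \<epsilon> / (norm c + 1)"
    using assms unfolding papp_def by meson
  have "norm (c * \<phi> \<tau> - poly (smult c p) (of_real \<tau>)) * gau \<beta> \<sigma> \<tau> * (1 + \<tau>\<^sup>2) \<le> \<epsilon>" for \<tau>
  proof -
    have "norm (c * \<phi> \<tau> - poly (smult c p) (of_real \<tau>)) = norm c * norm (\<phi> \<tau> - poly p (of_real \<tau>))"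
      by (simp add: norm_mult flip: right_diff_distrib)
    then have "norm (c * \<phi> \<tau> - poly (smult c p) (of_real \<tau>)) * gau \<beta> \<sigma> \<tau> * (1 + \<tau>\<^sup>2) =
        norm c * (norm (\<phi> \<tau> - poly p (of_real \<tau>)) * gau \<beta> \<sigma> \<tau> * (1 + \<tau>\<^sup>2))" by simp
    also have "\<dots> \<le> norm c * (\<epsilon> / (norm c + 1))" by (intro mult_left_mono p) simp
    also have "\<dots> \<le> \<epsilon>" 
    proof -
      have "norm c / (norm c + 1) \<le> 1" by (simp add: divide_le_eq_1 add_nonneg_pos)
      from mult_left_mono[OF this, of \<epsilon>] e show ?thesis by (simp add: mult.commute)
    qed
    finally show ?thesis .
  qed
  then show "\<exists>p. \<forall>\<tau>. norm (c * \<phi> \<tau> - poly p (of_real \<tau>)) * gau \<beta> \<sigma> \<tau> * (1 + \<tau>\<^sup>2) \<le> \<epsilon>" by blast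
qed

text \<open>Taylor polynomials converge: the remainder of order n + 1 carries 1 / n!, and the
  Gaussian bound for the power n + 3 carries (n + 3)! / \<open>K\<close> ^ (n + 3). Their product is
  a cubic polynomial in n times a geometric factor.\<close>

lemma papp_ch:
  assumes \<beta>: "\<beta> > 0"
  shows "papp \<beta> \<sigma> (\<lambda>\<tau>. ch (t * \<tau>))"
  unfolding papp_def
proof (intro allI impI)
  fix \<epsilon> :: real assume e: "\<epsilon> > 0"
  define \<theta> where "\<theta> = \<bar>pi * t\<bar>"
  \<comment> \<open>Then \<open>\<theta> / K\<close> is below 1/2, and \<open>K\<close> is positive
    even when the frequency is zero.\<close>
  define K where "K = 2 * \<theta> + 1"
  define A where "A = exp (K + K * \<bar>\<sigma>\<bar> + K\<^sup>2 / (2 * \<beta>)) / K\<^sup>2"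
  have K: "K > 0" by (simp add: K_def \<theta>_def add_nonneg_pos)
  have A: "A > 0" using K by (simp add: A_def)
  have bound:
    "norm (ch (t * \<tau>) - poly (\<Sum>k\<le>n. monom ((\<i> * of_real (pi * t)) ^ k / fact k) k) (of_real \<tau>)) *
      gau \<beta> \<sigma> \<tau> * (1 + \<tau>\<^sup>2) \<le> A *
        (real (n + 3) * real (n + 2) * real (n + 1) * (1 / 2) ^ Suc n)" for n \<tau>
  proof -
    let ?z = "\<i> * of_real (pi * t * \<tau>) :: complex"
    have "poly (\<Sum>k\<le>n. monom ((\<i> * of_real (pi * t)) ^ k / fact k) k) (of_real \<tau>) =
      (\<Sum>k\<le>n. ?z ^ k / fact k)"
      by (simp add: poly_sum poly_monom power_mult_distrib mult_ac)
    then have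
      "norm (ch (t * \<tau>) - poly (\<Sum>k\<le>n. monom ((\<i> * of_real (pi * t)) ^ k / fact k) k) (of_real \<tau>)) \<le>
        exp \<bar>Re ?z\<bar> * norm ?z ^ Suc n / fact n"
      using Taylor_exp[of ?z n] by (simp add: ch_def mult.assoc)
    also have "\<dots> = (\<theta> * \<bar>\<tau>\<bar>) ^ Suc n / fact n"
      by (simp add: norm_mult abs_mult \<theta>_def mult_ac)
    also have "\<dots> \<le> (\<theta> * (1 + \<bar>\<tau>\<bar>)) ^ Suc n / fact n"
      by (intro divide_right_mono power_mono mult_left_mono) (auto simp: \<theta>_def)
    finally have 1:
      "norm (ch (t * \<tau>) - poly (\<Sum>k\<le>n. monom ((\<i> * of_real (pi * t)) ^ k / fact k) k) (of_real \<tau>)) \<le>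
        \<theta> ^ Suc n / fact n * (1 + \<bar>\<tau>\<bar>) ^ Suc
          n" by (simp only: power_mult_distrib times_divide_eq_left)
    have "norm (ch (t * \<tau>) -
      poly (\<Sum>k\<le>n. monom ((\<i> * of_real (pi * t)) ^ k / fact k) k) (of_real \<tau>)) * (gau
        \<beta> \<sigma> \<tau> * (1 + \<tau>\<^sup>2)) \<le>
        (\<theta> ^ Suc n / fact n * (1 + \<bar>\<tau>\<bar>) ^ Suc n) * (gau \<beta> \<sigma> \<tau> * (1 + \<bar>\<tau>\<bar>)\<^sup>2)"
      using gau_pos[of \<beta> \<sigma> \<tau>] by (intro mult_mono 1) (auto simp: power2_sum \<theta>_def)
    also have "\<dots> = \<theta> ^ Suc n / fact n * ((1 + \<bar>\<tau>\<bar>) ^ (n + 3) * gau \<beta> \<sigma> \<tau>)"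
      by (simp add: power_add power2_eq_square power3_eq_cube mult_ac)
    also have "\<dots> \<le>
      \<theta> ^ Suc n / fact n * (fact (n + 3) / K ^ (n + 3) * exp (K + K * \<bar>\<sigma>\<bar> + K\<^sup>2 / (2 * \<beta>)))"
      by (intro mult_left_mono gau_bound \<beta> K) (simp add: \<theta>_def)
    also have "\<dots> = A * (real (n + 3) * real (n + 2) * real (n + 1) * (\<theta> / K) ^ Suc n)"
    proof -
      have f: "fact (n + 3) = real (n + 3) * real (n + 2) * real (n + 1) * fact n"
        by (simp add: eval_nat_numeral algebra_simps)
      have k: "K ^ (n + 3) = K ^ Suc n * K\<^sup>2"
        by (simp add: power_add power2_eq_square power3_eq_cube)
      show ?thesis unfolding f k A_def using K by (simp add: power_divide field_simps)
    qed
    also have "\<dots> \<le> A * (real (n + 3) * real (n + 2) * real (n + 1) * (1 / 2) ^ Suc n)"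
    proof -
      have "\<theta> / K \<le> 1 / 2" "0 \<le> \<theta> / K" using K by (auto simp: K_def \<theta>_def field_simps)
      then show ?thesis using A by (intro mult_left_mono power_mono) auto
    qed
    finally show ?thesis by (simp only: mult.assoc)
  qed
  have "(\<lambda>n. A * (real (n + 3) * real (n + 2) * real (n + 1) * (1 / 2) ^ Suc n)) \<longlonglongrightarrow> A * 0"
    by (intro tendsto_mult_left) real_asymp
  then have "(\<lambda>n. A * (real (n + 3) * real (n + 2) * real (n + 1) * (1 / 2) ^ Suc n)) \<longlonglongrightarrow> 0" by simp
  from order_tendstoD(2)[OF this e] obtain n where
    "A * (real (n + 3) * real (n + 2) * real (n + 1) * (1 / 2) ^ Suc n) < \<epsilon>"
    by (auto simp: eventually_sequentially)
  then show "\<exists>p. \<forall>\<tau>. norm (ch (t * \<tau>) - poly p (of_real \<tau>)) * gau \<beta> \<sigma> \<tau> * (1 + \<tau>\<^sup>2) \<le> \<epsilon>"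
    using bound[of _ n] by (meson less_imp_le order_trans)
qed

text \<open>The function is made periodic with a large period and then approximated by trigonometric sums,
  whose exponentials lie in the weighted closure of the polynomials by their Taylor expansion.\<close>

lemma papp_compact_support:
  assumes \<beta>: "\<beta> > 0" and \<phi>: "continuous_on UNIV \<phi>" "\<And>\<tau>. \<bar>\<tau>\<bar> \<ge> 1 \<Longrightarrow> \<phi> \<tau> = 0"
  shows "papp \<beta> \<sigma> \<phi>"
  unfolding papp_def
proof (intro allI impI)
  fix \<epsilon> :: real assume e: "\<epsilon> > 0"
  obtain M where M: "\<And>\<tau>. norm (\<phi> \<tau>) * (1 + \<tau>\<^sup>2) \<le> M" "M \<ge> 0"
    using compact_support_weighted[OF \<phi>] by blast
  have M': "norm (\<phi> \<tau>) \<le> M" for \<tau>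
    using M(1)[of \<tau>] mult_left_mono[of 1 "1 + \<tau>\<^sup>2" "norm (\<phi> \<tau>)"] by simp
  define B where "B = fact 3 / 1 ^ 3 * exp (1 + 1 * \<bar>\<sigma>\<bar> + 1\<^sup>2 / (2 * \<beta>))"
  have B: "(1 + \<bar>\<tau>\<bar>) ^ 3 * gau \<beta> \<sigma> \<tau> \<le> B" for \<tau>
    unfolding B_def by (rule gau_bound[OF \<beta>]) simp
  have B0: "B > 0" by (simp add: B_def)
  have g2: "gau \<beta> \<sigma> \<tau> * (1 + \<tau>\<^sup>2) * (1 + \<bar>\<tau>\<bar>) \<le> B" for \<tau>
  proof -
    have "gau \<beta> \<sigma> \<tau> * (1 + \<tau>\<^sup>2) * (1 + \<bar>\<tau>\<bar>) \<le> gau \<beta> \<sigma> \<tau> * (1 + \<bar>\<tau>\<bar>)\<^sup>2 * (1 + \<bar>\<tau>\<bar>)"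
      using gau_pos[of \<beta> \<sigma> \<tau>] by (intro mult_right_mono mult_left_mono) (auto simp: power2_sum)
    also have "\<dots> = (1 + \<bar>\<tau>\<bar>) ^ 3 * gau \<beta> \<sigma> \<tau>" by (simp add: power2_eq_square power3_eq_cube)
    finally show ?thesis using B[of \<tau>] by simp
  qed
  have g1: "gau \<beta> \<sigma> \<tau> * (1 + \<tau>\<^sup>2) \<le> B" for \<tau>
  proof -
    have "gau \<beta> \<sigma> \<tau> * (1 + \<tau>\<^sup>2) * 1 \<le> gau \<beta> \<sigma> \<tau> * (1 + \<tau>\<^sup>2) * (1 + \<bar>\<tau>\<bar>)"
      using gau_pos[of \<beta> \<sigma> \<tau>] by (intro mult_left_mono) auto
    then show ?thesis using g2[of \<tau>] by linarith
  qed
  define \<delta> where "\<delta> = min 1 (\<epsilon> / (2 * B))"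
  have \<delta>: "\<delta> > 0" "\<delta> \<le> 1" "\<delta> * B \<le> \<epsilon> / 2"
    using e B0 by (auto simp: \<delta>_def min_def field_simps)
  \<comment> \<open>Beyond \<open>L\<close> the Gaussian weight is at most \<open>B / L\<close>,
    while the periodic approximant is bounded by \<open>M + 1\<close>; the choice makes their
    product at most \<open>\<epsilon> / 2\<close>. At least 2, so that the copies of the support in
    different periods do not meet.\<close>
  define L where "L = max 2 (2 * B * (M + 1) / \<epsilon>)"
  have L: "L \<ge> 2" "B * (M + 1) \<le> \<epsilon> / 2 * L"
  proof -
    show "L \<ge> 2" by (simp add: L_def)
    have "2 * B * (M + 1) / \<epsilon> \<le> L" by (simp add: L_def)
    then show "B * (M + 1) \<le> \<epsilon> / 2 * L" using e by (simp add: field_simps)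
  qed
  \<comment> \<open>Rescaling turns the period \<open>2 * L\<close> into 1 and puts the support
    inside (-1/2, 1/2).\<close>
  define \<psi> where "\<psi> = (\<lambda>t. \<phi> (2 * L * t))"
  have \<psi>0: "\<psi> t = 0" if "\<bar>t\<bar> \<ge> 1 / 2" for t
  proof -
    have "1 \<le> 2 * L * (1 / 2)" using L by simp
    also have "\<dots> \<le> 2 * L * \<bar>t\<bar>" using that L by (intro mult_left_mono) auto
    finally show ?thesis using L by (simp add: \<psi>_def \<phi>(2) abs_mult)
  qed
  have c\<psi>: "continuous_on UNIV \<psi>" unfolding \<psi>_def
    by (intro continuous_on_compose2[OF \<phi>(1)] continuous_intros) auto
  \<comment> \<open>The periodisation is a theta series with trivial group parameters and zero
    frequency, so its continuity is already available.\<close>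
  define W where "W = Es 0 0 0 (0, 0, 0, 0) (\<lambda>m. \<psi>)"
  have W: "W y = (\<Sum>\<^sub>\<infinity>m. \<psi> (snd y + of_int m))" for y
    by (simp add: W_def Es_def trm_def shift_def ph_def pm_def)
  obtain C' where "\<And>\<tau>. norm (\<psi> \<tau>) * (1 + \<tau>\<^sup>2) \<le> C'"
    using compact_support_weighted[OF c\<psi> \<psi>0] by blast
  then have cW: "continuous_on UNIV W"
    unfolding W_def by (intro continuous_Es decay_weighted c\<psi>)
  have W0: "W (x, t) = \<psi> t" if "\<bar>t\<bar> \<le> 1 / 2" for x t
  proof -
    have z: "\<psi> (t + of_int m) = 0" if "m \<noteq> 0" for m
    proof (rule \<psi>0)
      have "\<bar>real_of_int m\<bar> \<ge> 1" using that by linarith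
      then show "1 / 2 \<le> \<bar>t + of_int m\<bar>" using \<open>\<bar>t\<bar> \<le> 1 / 2\<close> by linarith
    qed
    have "W (x, t) = (\<Sum>\<^sub>\<infinity>m\<in>{0}. \<psi> (t + of_int m))"
      unfolding W by (rule infsum_cong_neutral) (use z in auto)
    then show ?thesis by simp
  qed
  have Wper: "W (x, t + of_int k) = W (x, t)" for x t k
  proof -
    have "bij (\<lambda>m :: int. k + m)" 
      by (rule bij_betw_byWitness[where f' = "\<lambda>m. m - k"]) auto
    from infsum_reindex_bij_betw[OF this, of "\<lambda>m. \<psi> (t + of_int m)"]
    show ?thesis by (simp add: W add.assoc)
  qed
  have Wb: "norm (W (x, t)) \<le> M" for x t
  proof -
    have r: "\<bar>t - of_int (round t)\<bar> \<le> 1 / 2" using of_int_round_abs_le[of t]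
      by (simp add: abs_minus_commute)
    have "W (x, t) = W (x, t - of_int (round t))" using Wper[of x "t - of_int (round t)" "round t"]
      by simp
    also have "\<dots> = \<psi> (t - of_int (round t))" by (rule W0[OF r])
    finally show ?thesis using M' by (simp add: \<psi>_def)
  qed
  \<comment> \<open>The periodic function is placed in the first torus coordinate in order to apply
    the approximation on the torus.\<close>
  define v :: "pt \<Rightarrow> complex" where "v = (\<lambda>y. W (0, fst y $ 1))"
  have cv: "continuous_on UNIV v"
    unfolding v_def by (intro continuous_on_compose2[OF cW] continuous_intros) auto
  have per: "v (x + n, s) = v (x, s)" if n: "\<And>i. n $ i \<in> \<int>" for x n s
  proof -
    obtain k where "n $ 1 = of_int k" using n[of 1] by (auto elim: Ints_cases)
    then show ?thesis using Wper by (simp add: v_def)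
  qed
  obtain T where T: "tp T" "\<And>x s. \<bar>s\<bar> \<le> 1 \<Longrightarrow> norm (v (x, s) - T (x, s)) \<le> \<delta>"
    using torus_approx[OF cv per \<delta>(1)] by blast
  define \<Theta> where "\<Theta> = (\<lambda>\<tau>. T (axis 1 (\<tau> / (2 * L)), 0))"
  have "papp \<beta> \<sigma> \<Theta>"
    using T(1) unfolding \<Theta>_def
  proof (induction rule: tp.induct)
    case (tp_base q \<eta>)
    obtain a b c d where \<eta>: "\<eta> = (a, b, c, d)" by (cases \<eta>)
    have "papp \<beta> \<sigma> (\<lambda>\<tau>. q 0 * ch ((of_int a / L) * \<tau>))" by (intro papp_scale papp_ch \<beta>)
    then show ?case by (simp add: \<eta> ph_def axis_def mult_ac)
  next
    case (tp_add f g)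
    then show ?case using papp_add by simp
  qed
  then obtain p where p: "\<And>\<tau>. norm (\<Theta> \<tau> - poly p (of_real \<tau>)) * gau \<beta> \<sigma> \<tau> * (1 + \<tau>\<^sup>2) \<le> \<epsilon> / 2"
    using e unfolding papp_def by (meson half_gt_zero)
  have approx: "norm (\<phi> \<tau> - \<Theta> \<tau>) * (gau \<beta> \<sigma> \<tau> * (1 + \<tau>\<^sup>2)) \<le> \<epsilon> / 2" for \<tau>
  proof (cases "\<bar>\<tau>\<bar> \<le> L")
    case True
    then have "\<bar>\<tau> / (2 * L)\<bar> \<le> 1 / 2" using L by (simp add: abs_divide field_simps)
    then have "v (axis 1 (\<tau> / (2 * L)), 0) = \<phi> \<tau>"
      using L W0[of "\<tau> / (2 * L)" 0] by (simp add: v_def \<psi>_def axis_def)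
    then have "norm (\<phi> \<tau> - \<Theta> \<tau>) \<le> \<delta>" using T(2)[of 0 "axis 1 (\<tau> / (2 * L))"] by (simp add: \<Theta>_def)
    then have "norm (\<phi> \<tau> - \<Theta> \<tau>) * (gau \<beta> \<sigma> \<tau> * (1 + \<tau>\<^sup>2)) \<le> \<delta> * B"
      using g1[of \<tau>] gau_pos[of \<beta> \<sigma> \<tau>] \<delta> by (intro mult_mono) auto
    then show ?thesis using \<delta> by simp
  next
    case False
    have "norm (\<Theta> \<tau>) \<le> M + 1"
    proof -
      have "norm (\<Theta> \<tau>) \<le> norm (v (axis 1 (\<tau> / (2 * L)), 0)) +
        norm (v (axis 1 (\<tau> / (2 * L)), 0) - \<Theta> \<tau>)"
        using norm_triangle_ineq4[of "v (axis 1 (\<tau> / (2 * L)), 0)"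
          "v (axis 1 (\<tau> / (2 * L)), 0) - \<Theta> \<tau>"] by simp
      also have "\<dots> \<le> M + \<delta>"
        using T(2)[of 0 "axis 1 (\<tau> / (2 * L))"] Wb by (intro add_mono) (auto simp: \<Theta>_def v_def)
      finally show ?thesis using \<delta> by simp
    qed
    moreover have "\<phi> \<tau> = 0" using False L by (intro \<phi>(2)) simp
    ultimately have "norm (\<phi> \<tau> - \<Theta> \<tau>) * (gau \<beta> \<sigma> \<tau> * (1 + \<tau>\<^sup>2)) \<le> (M + 1) * (gau \<beta> \<sigma> \<tau> * (1 + \<tau>\<^sup>2))"
      using gau_pos[of \<beta> \<sigma> \<tau>] by (intro mult_right_mono) auto
    moreover have "(M + 1) * (gau \<beta> \<sigma> \<tau> * (1 + \<tau>\<^sup>2)) * L \<le> \<epsilon> / 2 * L"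
    proof -
      have "gau \<beta> \<sigma> \<tau> * (1 + \<tau>\<^sup>2) * L \<le> gau \<beta> \<sigma> \<tau> * (1 + \<tau>\<^sup>2) * (1 + \<bar>\<tau>\<bar>)"
        using False gau_pos[of \<beta> \<sigma> \<tau>] by (intro mult_left_mono) auto
      then have "(M + 1) * (gau \<beta> \<sigma> \<tau> * (1 + \<tau>\<^sup>2) * L) \<le> (M + 1) * B"
        using g2[of \<tau>] M by (intro mult_left_mono) auto
      then show ?thesis using L(2) unfolding mult.assoc mult.commute[of B] by linarith
    qed
    then have "(M + 1) * (gau \<beta> \<sigma> \<tau> * (1 + \<tau>\<^sup>2)) \<le> \<epsilon> / 2" 
      by (rule mult_right_le_imp_le) (use L in simp)
    ultimately show ?thesis by linarith
  qed
  have "norm (\<phi> \<tau> - poly p (of_real \<tau>)) * gau \<beta> \<sigma> \<tau> * (1 + \<tau>\<^sup>2) \<le> \<epsilon>" for \<tau>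
  proof -
    have "norm (\<phi> \<tau> - poly p (of_real \<tau>)) \<le> norm (\<phi> \<tau> - \<Theta> \<tau>) + norm (\<Theta> \<tau> - poly p (of_real \<tau>))"
      using norm_triangle_ineq[of "\<phi> \<tau> - \<Theta> \<tau>" "\<Theta> \<tau> - poly p (of_real \<tau>)"] by simp
    then have "norm (\<phi> \<tau> - poly p (of_real \<tau>)) * (gau \<beta> \<sigma> \<tau> * (1 + \<tau>\<^sup>2)) \<le>
        (norm (\<phi> \<tau> - \<Theta> \<tau>) + norm (\<Theta> \<tau> - poly p (of_real \<tau>))) * (gau \<beta> \<sigma> \<tau> * (1 + \<tau>\<^sup>2))"
      using gau_pos[of \<beta> \<sigma> \<tau>] by (intro mult_right_mono) auto
    then show ?thesis using p[of \<tau>] approx[of \<tau>] unfolding distrib_right mult.assoc by linarith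
  qed
  then show "\<exists>p. \<forall>\<tau>. norm (\<phi> \<tau> - poly p (of_real \<tau>)) * gau \<beta> \<sigma> \<tau> * (1 + \<tau>\<^sup>2) \<le> \<epsilon>" by blast
qed

section \<open>Density of the theta series\<close>

text \<open>A set of functions that is closed in this sense and contains sufficiently many theta series
  contains every continuous equivariant function.\<close>

definition closedfam :: "((pt \<Rightarrow> complex) \<Rightarrow> bool) \<Rightarrow> bool" where
  "closedfam P \<longleftrightarrow> P (\<lambda>y. 0) \<and> (\<forall>u v c. P u \<longrightarrow> P v \<longrightarrow> P (\<lambda>y. u y + c * v y)) \<and>
     (\<forall>u. continuous_on UNIV u \<longrightarrow> (\<forall>\<epsilon>>0. \<exists>v. P v \<and> (\<forall>y\<in>fund. norm (u y - v y) \<le> \<epsilon>)) \<longrightarrow> P u)"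

lemma closedfam_lin: "closedfam P \<Longrightarrow> P u \<Longrightarrow> P v \<Longrightarrow> P (\<lambda>y. u y + c * v y)"
  unfolding closedfam_def by blast

lemma closedfam_add: "closedfam P \<Longrightarrow> P u \<Longrightarrow> P v \<Longrightarrow> P (\<lambda>y. u y + v y)"
  using closedfam_lin[of P u v 1] by simp

lemma closedfam_scale: "closedfam P \<Longrightarrow> P v \<Longrightarrow> P (\<lambda>y. c * v y)"
  using closedfam_lin[of P "\<lambda>y. 0" v c] unfolding closedfam_def by simp

lemma closedfam_limit:
  assumes "closedfam P" "continuous_on UNIV u"
    "\<And>\<epsilon>. \<epsilon> > 0 \<Longrightarrow> \<exists>v. P v \<and> (\<forall>y\<in>fund. norm (u y - v y) \<le> \<epsilon>)"
  shows "P u"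
  using assms unfolding closedfam_def by blast

lemma fund_snd: "y \<in> fund \<Longrightarrow> 0 \<le> snd y \<and> snd y < 1"
  by (auto simp: fund_def)

lemma decay_compact_support:
  fixes w :: "real \<Rightarrow> complex"
  assumes "continuous_on UNIV w" "\<And>\<tau>. \<bar>\<tau>\<bar> \<ge> 1 \<Longrightarrow> w \<tau> = 0"
  shows "decay (\<lambda>m. w)"
proof -
  obtain C where "\<And>\<tau>. norm (w \<tau>) * (1 + \<tau>\<^sup>2) \<le> C"
    using compact_support_weighted[of w 1] assms by blast
  then show ?thesis by (rule decay_weighted)
qed

text \<open>The quotient of w by the Gaussian is still continuous with compact support, so
  polynomials approximate it in the weighted norm; multiplied back, they approximate w, and
  \<open>norm_Es_le\<close> carries this over to the series.\<close>

lemma closedfam_theta: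
  assumes P: "closedfam P" and \<beta>: "\<beta> > 0"
    and base: "\<And>p. P (Es r1 r2 e5 \<xi> (\<lambda>m \<tau>. poly p (of_real \<tau>) * of_real (gau \<beta> \<sigma> \<tau>)))"
    and w: "continuous_on UNIV w" "\<And>\<tau>. \<bar>\<tau>\<bar> \<ge> 1 \<Longrightarrow> w \<tau> = 0"
  shows "P (Es r1 r2 e5 \<xi> (\<lambda>m. w))"
proof (rule closedfam_limit[OF P])
  have dw: "decay (\<lambda>m. w)" by (rule decay_compact_support[OF w])
  show "continuous_on UNIV (Es r1 r2 e5 \<xi> (\<lambda>m. w))"
    by (rule continuous_Es[OF dw w(1)])
  fix \<epsilon> :: real assume e: "\<epsilon> > 0"
  define \<phi> where "\<phi> = (\<lambda>\<tau>. w \<tau> / of_real (gau \<beta> \<sigma> \<tau>))"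
  have g0: "gau \<beta> \<sigma> \<tau> \<noteq> 0" for \<tau> using gau_pos[of \<beta> \<sigma> \<tau>] by simp
  have "continuous_on UNIV (gau \<beta> \<sigma>)" unfolding gau_def by (intro continuous_intros) simp
  then have "continuous_on UNIV \<phi>"
    unfolding \<phi>_def using g0 by (intro continuous_on_divide continuous_on_of_real w(1)) auto
  then have "papp \<beta> \<sigma> \<phi>" using w(2) by (intro papp_compact_support \<beta>) (auto simp: \<phi>_def)
  moreover have "\<epsilon> / (sumq + 1) > 0" using e sumq_nonneg by (simp add: add_nonneg_pos)
  ultimately obtain p
    where p: "\<And>\<tau>. norm (\<phi> \<tau> - poly p (of_real \<tau>)) * gau \<beta> \<sigma> \<tau> * (1 + \<tau>\<^sup>2) \<le> \<epsilon> / (sumq + 1)"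
    unfolding papp_def by meson
  let ?g = "\<lambda>\<tau>. poly p (of_real \<tau>) * of_real (gau \<beta> \<sigma> \<tau>) :: complex"
  have dg: "decay (\<lambda>m. ?g)" by (rule gw_decay[OF \<beta> gw_poly])
  have bound: "norm (w \<tau> + (- 1) * ?g \<tau>) * (1 + \<tau>\<^sup>2) \<le> \<epsilon> / (sumq + 1)" for \<tau>
  proof -
    have "w \<tau> + (- 1) * ?g \<tau> = (\<phi> \<tau> - poly p (of_real \<tau>)) * of_real (gau \<beta> \<sigma> \<tau>)"
      using g0[of \<tau>] by (simp add: \<phi>_def algebra_simps)
    then show ?thesis using p[of \<tau>] gau_pos[of \<beta> \<sigma> \<tau>] by (simp add: norm_mult)
  qed
  show "\<exists>v. P v \<and> (\<forall>y\<in>fund. norm (Es r1 r2 e5 \<xi> (\<lambda>m. w) y - v y) \<le> \<epsilon>)"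
  proof (intro exI conjI ballI)
    show "P (Es r1 r2 e5 \<xi> (\<lambda>m. ?g))" by (rule base)
    fix y assume y: "y \<in> fund"
    have dg': "decay (\<lambda>m \<tau>. (- 1) * ?g \<tau>)" using gw_decay[OF \<beta> gw_scale[OF gw_poly]] .
    have "Es r1 r2 e5 \<xi> (\<lambda>m. w) y - Es r1 r2 e5 \<xi> (\<lambda>m. ?g) y =
      Es r1 r2 e5 \<xi> (\<lambda>m \<tau>. w \<tau> + (- 1) * ?g \<tau>) y"
      unfolding Es_add[OF dw dg'] Es_scale by simp
    also have "norm \<dots> \<le> \<epsilon> / (sumq + 1) * sumq"
      using fund_snd[OF y] by (intro norm_Es_le bound) auto
    also have "\<dots> \<le> \<epsilon>"
    proof -
      have "sumq / (sumq + 1) \<le> 1" using sumq_nonneg by (simp add: divide_le_eq_1 add_nonneg_pos)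
      from mult_left_mono[OF this, of \<epsilon>] e show ?thesis by simp
    qed
    finally show "norm (Es r1 r2 e5 \<xi> (\<lambda>m. w) y - Es r1 r2 e5 \<xi> (\<lambda>m. ?g) y) \<le> \<epsilon>" .
  qed
qed

text \<open>With vanishing central frequencies the shift is trivial, so the series splits into a
  character in x and a function of s that is periodic up to a sign. Trigonometric approximation of
  the latter leaves only products of characters.\<close>

lemma closedfam_trivial:
  assumes P: "closedfam P" and \<xi>: "\<xi> = (0, 0, x3, x4)"
    and base: "\<And>x5. even (x5 - e5) \<Longrightarrow> P (\<lambda>y. ch (ph \<xi> (fst y)) * ch (of_int x5 * snd y))"
    and w: "continuous_on UNIV w" "\<And>\<tau>. \<bar>\<tau>\<bar> \<ge> 1 \<Longrightarrow> w \<tau> = 0"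
  shows "P (Es r1 r2 e5 \<xi> (\<lambda>m. w))"
proof (rule closedfam_limit[OF P])
  have dw: "decay (\<lambda>m. w)" by (rule decay_compact_support[OF w])
  show "continuous_on UNIV (Es r1 r2 e5 \<xi> (\<lambda>m. w))"
    by (rule continuous_Es[OF dw w(1)])
  define W where "W = (\<lambda>s. Es 0 0 e5 (0, 0, 0, 0) (\<lambda>m. w) (0, s))"
  have cW: "continuous_on UNIV W"
    unfolding W_def
    by (rule continuous_on_compose2[OF continuous_Es[OF dw w(1)]]) (auto intro!: continuous_intros)
  have W: "W s = (\<Sum>\<^sub>\<infinity>m. pm (e5 * m) * w (s + of_int m))" for s
    by (simp add: W_def Es_def trm_def shift_def ph_def)
  have Es: "Es r1 r2 e5 \<xi> (\<lambda>m. w) y = ch (ph \<xi> (fst y)) * W (snd y)" for y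
    unfolding W infsum_cmult_right'[symmetric] by (simp add: Es_def trm_def \<xi> shift_def mult_ac)
  have Wper: "W (s + of_int k) = pm (e5 * k) * W s" for s k
  proof -
    have b: "bij (\<lambda>m :: int. k + m)"
      by (rule bij_betw_byWitness[where f' = "\<lambda>m. m - k"]) auto
    have "W s = (\<Sum>\<^sub>\<infinity>m. pm (e5 * (k + m)) * w (s + of_int (k + m)))"
      unfolding W by (rule infsum_reindex_bij_betw[OF b, symmetric])
    also have "\<dots> = (\<Sum>\<^sub>\<infinity>m. pm (e5 * k) * (pm (e5 * m) * w (s + of_int k + of_int m)))"
      by (simp add: distrib_left pm_add mult_ac add.assoc)
    also have "\<dots> = pm (e5 * k) * W (s + of_int k)"
      unfolding W by (rule infsum_cmult_right')
    finally show ?thesis by (simp flip: mult.assoc)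
  qed
  fix \<epsilon> :: real assume e: "\<epsilon> > 0"
  \<comment> \<open>Multiplication by the character of frequency \<open>- e5\<close> cancels the
    sign in \<open>Wper\<close> and makes the function periodic.\<close>
  define v :: "pt \<Rightarrow> complex" where "v = (\<lambda>y. W (fst y $ 1) * ch (of_int (- e5) * fst y $ 1))"
  have cv: "continuous_on UNIV v"
    unfolding v_def by (intro continuous_intros continuous_on_compose2[OF cW]) auto
  have per: "v (x + n, s) = v (x, s)" if n: "\<And>i. n $ i \<in> \<int>" for x n s
  proof -
    obtain k where k: "n $ 1 = of_int k" using n[of 1] by (auto elim: Ints_cases)
    have "ch (of_int (- e5) * (x $ 1 + of_int k)) =
      ch (of_int (- e5) * x $ 1) * ch (of_int (- e5 * k))"
      unfolding ch_add[symmetric] by (simp add: distrib_left)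
    also have "ch (of_int (- e5 * k)) = pm (e5 * k)" unfolding ch_of_int by (rule pm_cong) simp
    finally show ?thesis by (simp add: v_def k Wper mult_ac)
  qed
  obtain T where T: "tp T" "\<And>x s. \<bar>s\<bar> \<le> 1 \<Longrightarrow> norm (v (x, s) - T (x, s)) \<le> \<epsilon>"
    using torus_approx[OF cv per e] by blast
  let ?U = "\<lambda>T y. ch (ph \<xi> (fst y)) * (ch (of_int e5 * snd y) * T (axis 1 (snd y), 0))"
  show "\<exists>v. P v \<and> (\<forall>y\<in>fund. norm (Es r1 r2 e5 \<xi> (\<lambda>m. w) y - v y) \<le> \<epsilon>)"
  proof (intro exI conjI ballI)
    show "P (?U T)"
      using T(1)
    proof (induction rule: tp.induct)
      case (tp_base q \<eta>)
      obtain a b c d where \<eta>: "\<eta> = (a, b, c, d)" by (cases \<eta>)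
      have "P (\<lambda>y. q 0 * (ch (ph \<xi> (fst y)) * ch (of_int (e5 + 2 * a) * snd y)))"
        by (intro closedfam_scale[OF P] base) simp
      moreover have "ch (of_int (e5 + 2 * a) * s) = ch (of_int e5 * s) * ch (2 * (of_int a * s))"
        for s
        unfolding ch_add[symmetric] by (simp add: algebra_simps)
      ultimately show ?case by (simp add: \<eta> ph_def axis_def mult_ac)
    next
      case (tp_add f g)
      from closedfam_add[OF P tp_add.IH] show ?case by (simp add: distrib_left)
    qed
    fix y :: pt
    have 1: "ch (of_int e5 * s) * ch (of_int (- e5) * s) = 1" for s
      unfolding ch_add[symmetric] by simp
    have "Es r1 r2 e5 \<xi> (\<lambda>m. w) y - ?U T y =
        ch (ph \<xi> (fst y)) *
          (ch (of_int e5 * snd y) * (v (axis 1 (snd y), 0) - T (axis 1 (snd y), 0)))"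
      using 1[of "snd y"] by (simp add: Es v_def axis_def right_diff_distrib mult_ac)
    then show "norm (Es r1 r2 e5 \<xi> (\<lambda>m. w) y - ?U T y) \<le> \<epsilon>"
      using T(2)[of 0 "axis 1 (snd y)"] by (simp add: norm_mult)
  qed
qed

section \<open>Signs of the lattice homomorphism, admissible frequencies and equivariance\<close>

locale spin_structure =
  fixes r1 r2 :: int and eps :: "pt \<Rightarrow> int"
  assumes hom: "eps \<in> hom (grpGamma r1 r2) (integer_mod_group 2)"
begin

definition e1 where "e1 = eps (axis 1 1, 0)"
definition e2 where "e2 = eps (axis 2 1, 0)"
definition e3 where "e3 = eps (axis 3 1, 0)"
definition e4 where "e4 = eps (axis 4 1, 0)"
definition e5 where "e5 = eps (0, 1)"

lemma eps_values: "\<gamma> \<in> carrier (grpGamma r1 r2) \<Longrightarrow> eps \<gamma> = 0 \<or> eps \<gamma> = 1"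
  using hom by (auto simp: hom_def integer_mod_group_def Pi_iff)

lemma pm_eps_mult:
  assumes "\<gamma> \<in> carrier (grpGamma r1 r2)" "\<delta> \<in> carrier (grpGamma r1 r2)"
  shows "pm (eps (\<gamma> \<otimes>\<^bsub>grpG r1 r2\<^esub> \<delta>)) = pm (eps \<gamma>) * pm (eps \<delta>)"
proof -
  have "\<gamma> \<otimes>\<^bsub>grpG r1 r2\<^esub> \<delta> = \<gamma> \<otimes>\<^bsub>grpGamma r1 r2\<^esub> \<delta>" by (simp add: grpGamma_def)
  then have "eps (\<gamma> \<otimes>\<^bsub>grpG r1 r2\<^esub> \<delta>) = (eps \<gamma> + eps \<delta>) mod 2"
    using hom_mult[OF hom assms] by (simp add: integer_mod_group_def)
  then show ?thesis by (auto simp: pm_def)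
qed

lemma pm_eps_multiples:
  assumes g: "\<And>t :: int. g t \<in> carrier (grpGamma r1 r2)"
    and add: "\<And>s t. g (s + t) = g s \<otimes>\<^bsub>grpG r1 r2\<^esub> g t"
  shows "pm (eps (g t)) = pm (eps (g 1) * t)"
proof -
  have m: "pm (eps (g (s + t))) = pm (eps (g s)) * pm (eps (g t))" for s t
    unfolding add by (rule pm_eps_mult[OF g g])
  show ?thesis
  proof (induction t rule: int_induct[where k = 0])
    case base
    show ?case using m[of 0 0] by (auto simp: pm_def split: if_splits)
  next
    case (step1 i)
    then show ?case by (simp add: m distrib_left pm_add)
  next
    case (step2 i)
    have "pm (eps (g i)) = pm (eps (g (i - 1))) * pm (eps (g 1))" using m[of "i - 1" 1] by simp
    then have "pm (eps (g (i - 1))) = pm (eps (g 1) * i) * pm (eps (g 1))"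
      using step2 by (simp add: mult.assoc)
    also have "\<dots> = pm (eps (g 1) * (i - 1))"
      unfolding pm_add[symmetric] by (rule pm_cong) (simp add: algebra_simps)
    finally show ?case .
  qed
qed

text \<open>A lattice point is the product of multiples of the basis vectors followed by (0, k). In
  this order no A(k) acts on a vector, so the sign is that of a linear form in the
  coordinates.\<close>

lemma pm_eps:
  assumes n: "\<And>i. n $ i = of_int (N i)"
  shows "pm (eps (n, of_int k)) = pm (e1 * N 1 + e2 * N 2 + e3 * N 3 + e4 * N 4 + e5 * k)"
proof -
  let ?g = "\<lambda>(i :: 4) (t :: int). (of_int t *\<^sub>R axis i 1 :: real ^ 4, 0 :: real)"
  have gC: "?g i t \<in> carrier (grpGamma r1 r2)" for i t by (auto simp: carrier_grpGamma axis_def)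
  have g: "pm (eps (?g i t)) = pm (eps (axis i 1, 0) * t)" for i t
    using pm_eps_multiples[of "?g i" t] gC by (simp add: mult_grpG matA_mult_vec scaleR_add_left)
  have s: "pm (eps (0, of_int k)) = pm (e5 * k)" for k
    using pm_eps_multiples[of "\<lambda>t. (0, of_int t)" k]
    by (simp add: mult_grpG carrier_grpGamma e5_def)
  have "(n, of_int k) = ?g 1 (N 1) \<otimes>\<^bsub>grpG r1 r2\<^esub> (?g 2 (N 2) \<otimes>\<^bsub>grpG r1 r2\<^esub> (?g 3 (N 3) \<otimes>\<^bsub>grpG r1 r2\<^esub>
      (?g 4 (N 4) \<otimes>\<^bsub>grpG r1 r2\<^esub> (0, of_int k))))"
    by (simp add: mult_grpG matA_mult_vec vec_eq_iff forall_4 axis_def n)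
  moreover have "(0, of_int k) \<in> carrier (grpGamma r1 r2)" by (simp add: carrier_grpGamma)
  moreover have "a \<otimes>\<^bsub>grpG r1 r2\<^esub> b \<in> carrier (grpGamma r1 r2)"
    if "a \<in> carrier (grpGamma r1 r2)" "b \<in> carrier (grpGamma r1 r2)" for a b
    by (rule subgroup.m_closed[OF subgroup_grpGamma that])
  ultimately show ?thesis
    using gC by (simp only: pm_eps_mult g s pm_add e1_def e2_def e3_def e4_def) (simp add: mult_ac)
qed

definition eqv :: "(pt \<Rightarrow> complex) \<Rightarrow> bool" where
  "eqv u \<longleftrightarrow> (\<forall>\<gamma>\<in>carrier (grpGamma r1 r2). \<forall>y. u (\<gamma> \<otimes>\<^bsub>grpG r1 r2\<^esub> y) = pm (eps \<gamma>) * u y)"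

lemma equivariant_iff: "equivariant r1 r2 eps \<phi> \<longleftrightarrow> (\<forall>j. eqv (\<lambda>y. \<phi> y $ j))"
  unfolding equivariant_def eqv_def exp_pm vec_eq_iff by (auto simp del: split_paired_All)

definition adm :: "freq \<Rightarrow> bool" where
  "adm = (\<lambda>(x1, x2, x3, x4). even (x1 - e1) \<and> even (x2 - e2) \<and> even (x3 - e3) \<and> even (x4 - e4))"

lemma coset2_iff: "x \<in> coset2 e \<longleftrightarrow> even (x - e)"
proof
  assume "even (x - e)"
  then obtain z where "x - e = 2 * z" by blast
  then have "x = 2 * z + e" by simp
  then show "x \<in> coset2 e" by (auto simp: coset2_def)
qed (auto simp: coset2_def)

lemma adm_even: "adm (x1, x2, x3, x4) \<Longrightarrow> even (r1 * x1)" "adm (x1, x2, x3, x4) \<Longrightarrow> even (r2 * x2)"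
  using weights_even[OF hom] unfolding coset2_iff adm_def e1_def e2_def by blast+

text \<open>A shift changes the third and fourth frequencies by multiples of \<open>r1 * x1\<close>
  and \<open>r2 * x2\<close>, which are even by \<open>weights_even\<close>.\<close>

lemma adm_shift: "adm (shift r1 r2 m \<xi>) \<longleftrightarrow> adm \<xi>"
proof -
  obtain x1 x2 x3 x4 where \<xi>: "\<xi> = (x1, x2, x3, x4)" by (cases \<xi>)
  have "even (r1 * x1)" "even (r2 * x2)" if "even (x1 - e1)" "even (x2 - e2)"
    using weights_even[OF hom] that unfolding coset2_iff e1_def e2_def by blast+
  then show ?thesis by (auto simp: \<xi> adm_def shift_def)
qed

lemma ch_ph_int:
  assumes "adm \<xi>" and n: "\<And>i. n $ i = of_int (N i)"
  shows "ch (ph \<xi> n) = pm (e1 * N 1 + e2 * N 2 + e3 * N 3 + e4 * N 4)"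
proof -
  obtain x1 x2 x3 x4 where \<xi>: "\<xi> = (x1, x2, x3, x4)" by (cases \<xi>)
  have "ph \<xi> n = of_int (x1 * N 1 + x2 * N 2 + x3 * N 3 + x4 * N 4)" by (simp add: \<xi> ph_def n)
  then have "ch (ph \<xi> n) = pm (x1 * N 1 + x2 * N 2 + x3 * N 3 + x4 * N 4)" by (simp only: ch_of_int)
  also have "\<dots> = pm (e1 * N 1 + e2 * N 2 + e3 * N 3 + e4 * N 4)"
  proof (rule pm_cong)
    have "(x1 * N 1 + x2 * N 2 + x3 * N 3 + x4 * N 4) -
      (e1 * N 1 + e2 * N 2 + e3 * N 3 + e4 * N 4) =
        (x1 - e1) * N 1 + (x2 - e2) * N 2 + (x3 - e3) * N 3 + (x4 - e4) * N
          4" by (simp add: algebra_simps)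
    then show "even ((x1 * N 1 + x2 * N 2 + x3 * N 3 + x4 * N 4) -
      (e1 * N 1 + e2 * N 2 + e3 * N 3 + e4 * N 4))"
      using assms(1) by (simp only: \<xi> adm_def prod.case) simp
  qed
  finally show ?thesis .
qed

lemma GammaE:
  assumes "\<gamma> \<in> carrier (grpGamma r1 r2)"
  obtains n N k where "\<gamma> = (n, of_int k)" "\<And>i. n $ i = of_int (N i)"
proof -
  obtain n s where g: "\<gamma> = (n, s)" "\<And>i. n $ i \<in> \<int>" "s \<in> \<int>"
    using assms by (auto simp: carrier_grpGamma)
  have "n $ i = of_int \<lfloor>n $ i\<rfloor>" for i using g(2)[of i] by simp
  moreover have "\<gamma> = (n, of_int \<lfloor>s\<rfloor>)" using g by simp
  ultimately show ?thesis using that[of n "\<lfloor>s\<rfloor>" "\<lambda>i. \<lfloor>n $ i\<rfloor>"] by blast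
qed

abbreviation Th :: "freq \<Rightarrow> (real \<Rightarrow> complex) \<Rightarrow> pt \<Rightarrow> complex" where
  "Th \<xi> w \<equiv> Es r1 r2 e5 \<xi> (\<lambda>m. w)"

text \<open>The vector part of a lattice element multiplies all terms by the same sign, because
  every shift of an admissible frequency is admissible; its integer part only reindexes the
  sum.\<close>

lemma eqv_Th:
  assumes "adm \<xi>"
  shows "eqv (Th \<xi> w)"
  unfolding eqv_def
proof (intro ballI allI)
  fix \<gamma> y :: pt assume "\<gamma> \<in> carrier (grpGamma r1 r2)"
  then obtain n k N where g: "\<gamma> = (n, of_int k)" "\<And>i. n $ i = of_int (N i)" by (rule GammaE) metis
  obtain x s where y: "y = (x, s)" by force
  have t: "trm r1 r2 e5 \<xi> (\<lambda>m. w) m (\<gamma> \<otimes>\<^bsub>grpG r1 r2\<^esub> y) =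
      pm (eps \<gamma>) * trm r1 r2 e5 \<xi> (\<lambda>m. w) (m + k) y" for m
  proof -
    have "ch (ph (shift r1 r2 m \<xi>) n) = pm (e1 * N 1 + e2 * N 2 + e3 * N 3 + e4 * N 4)"
      using assms by (intro ch_ph_int g) (simp add: adm_shift)
    moreover have "pm (e5 * m) = pm (e5 * k) * pm (e5 * (m + k))"
      unfolding pm_add[symmetric] by (rule pm_cong) (simp add: algebra_simps)
    moreover have "of_int k + s + of_int m = s + of_int (m + k)" by simp
    ultimately show ?thesis
      unfolding trm_def g(1) y mult_grpG fst_conv snd_conv ph_add ch_add ph_shift_matA
        pm_eps[OF g(2)] pm_add
      by (simp only: mult_ac)
  qed
  have b: "bij (\<lambda>m :: int. m + k)"
    by (rule bij_betw_byWitness[where f' = "\<lambda>m. m - k"]) auto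
  have "Th \<xi> w (\<gamma> \<otimes>\<^bsub>grpG r1 r2\<^esub> y) = pm (eps \<gamma>) * (\<Sum>\<^sub>\<infinity>m. trm r1 r2 e5 \<xi> (\<lambda>m. w) (m + k) y)"
    unfolding Es_def t by (rule infsum_cmult_right')
  also have "(\<Sum>\<^sub>\<infinity>m. trm r1 r2 e5 \<xi> (\<lambda>m. w) (m + k) y) = Th \<xi> w y"
    unfolding Es_def by (rule infsum_reindex_bij_betw[OF b])
  finally show "Th \<xi> w (\<gamma> \<otimes>\<^bsub>grpG r1 r2\<^esub> y) = pm (eps \<gamma>) * Th \<xi> w y" .
qed

text \<open>Frequencies in one orbit give, up to sign, the same series with a translated weight.
  Hence one frequency per orbit suffices.\<close>

lemma Th_shift: "Th (shift r1 r2 k \<xi>) w y = pm (e5 * k) * Th \<xi> (\<lambda>\<tau>. w (\<tau> - of_int k)) y"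
proof -
  have b: "bij (\<lambda>m :: int. m + k)"
    by (rule bij_betw_byWitness[where f' = "\<lambda>m. m - k"]) auto
  have t: "trm r1 r2 e5 (shift r1 r2 k \<xi>) (\<lambda>m. w) m y =
      pm (e5 * k) * trm r1 r2 e5 \<xi> (\<lambda>m \<tau>. w (\<tau> - of_int k)) (m + k) y" for m
  proof -
    have "pm (e5 * m) = pm (e5 * k) * pm (e5 * (m + k))"
      unfolding pm_add[symmetric] by (rule pm_cong) (simp add: algebra_simps)
    moreover have "snd y + of_int (m + k) - of_int k = snd y + of_int m" by simp
    ultimately show ?thesis unfolding trm_def shift_shift by (simp only: mult_ac)
  qed
  have "Th (shift r1 r2 k \<xi>) w y =
    pm (e5 * k) * (\<Sum>\<^sub>\<infinity>m. trm r1 r2 e5 \<xi> (\<lambda>m \<tau>. w (\<tau> - of_int k)) (m + k) y)"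
    unfolding Es_def t by (rule infsum_cmult_right')
  also have "(\<Sum>\<^sub>\<infinity>m. trm r1 r2 e5 \<xi> (\<lambda>m \<tau>. w (\<tau> - of_int k)) (m + k) y) =
    Th \<xi> (\<lambda>\<tau>. w (\<tau> - of_int k)) y"
    unfolding Es_def by (rule infsum_reindex_bij_betw[OF b])
  finally show ?thesis .
qed

text \<open>With the hat function as a partition of unity on the line, an equivariant function is the sum
  over the integral translates of its restriction to the strip of height two, and there the
  trigonometric approximation applies.\<close>

definition hat :: "real \<Rightarrow> real" where "hat s = max 0 (1 - \<bar>s\<bar>)"

lemma closedfam_equivariant:
  assumes P: "closedfam P"
    and base: "\<And>\<xi> w. adm \<xi> \<Longrightarrow> continuous_on UNIV w \<Longrightarrow> (\<And>\<tau>. \<bar>\<tau>\<bar> \<ge> 1 \<Longrightarrow> w \<tau> = 0) \<Longrightarrow> P (Th \<xi> w)"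
    and u: "continuous_on UNIV u" "eqv u"
  shows "P u"
proof (rule closedfam_limit[OF P u(1)])
  fix \<epsilon> :: real assume e: "\<epsilon> > 0"
  let ?e = "(e1, e2, e3, e4)"
  have adme: "adm ?e" by (simp add: adm_def)
  \<comment> \<open>Dividing by the character of the admissible frequency (e1, e2, e3, e4) removes
    the signs and makes the function periodic in x.\<close>
  define v where "v = (\<lambda>y. u y * ch (- ph ?e (fst y)))"
  have cv: "continuous_on UNIV v" unfolding v_def using u by (intro continuous_intros)
  have per: "v (x + n, s) = v (x, s)" if n: "\<And>i. n $ i \<in> \<int>" for x n s
  proof -
    have N: "n $ i = of_int \<lfloor>n $ i\<rfloor>" for i using n[of i] by simp
    have g: "(n, of_int 0) \<in> carrier (grpGamma r1 r2)" using n by (simp add: carrier_grpGamma)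
    have "(n, of_int 0) \<otimes>\<^bsub>grpG r1 r2\<^esub> (x, s) = (x + n, s)" by (simp add: mult_grpG matA_mult_vec)
    then have "u (x + n, s) = pm (eps (n, of_int 0)) * u (x, s)" using u(2) g
      unfolding eqv_def by metis
    moreover have "pm (eps (n, of_int 0)) = ch (ph ?e n)"
      using pm_eps[OF N, of 0] ch_ph_int[OF adme N] by simp
    moreover have "ch (- ph ?e (x + n)) = ch (- ph ?e x) * ch (- ph ?e n)"
      unfolding ch_add[symmetric] ph_add by simp
    moreover have "ch (ph ?e n) * ch (- ph ?e n) = 1" unfolding ch_add[symmetric] by simp
    ultimately show ?thesis by (simp add: v_def mult_ac)
  qed
  obtain T where T: "tp T" "\<And>x s. \<bar>s\<bar> \<le> 1 \<Longrightarrow> norm (v (x, s) - T (x, s)) \<le> \<epsilon>"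
    using torus_approx[OF cv per e] by blast
  let ?A = "\<lambda>m y. (matA r1 r2 (of_int m) *v fst y, snd y + of_int m) :: pt"
  \<comment> \<open>For s in [0, 1) the hat at s + m is nonzero only for m = 0 and m = -1, so two
    translates suffice on the fundamental domain.\<close>
  let ?L = "\<lambda>T y. \<Sum>m\<in>{0, -1}. pm (e5 * m) * of_real (hat (snd y + of_int m)) *
    ch (ph ?e (fst (?A m y))) * T (?A m y)"
  \<comment> \<open>For an elementary trigonometric term the two-term sum is, on the fundamental
    domain, a theta series of admissible frequency with weight hat times coefficient.\<close>
  have lift: "\<exists>U. P U \<and> (\<forall>y\<in>fund. U y = ?L T y)" if "tp T" for T
    using that
  proof (induction rule: tp.induct)
    case (tp_base q \<eta>)
    obtain a b c d where \<eta>: "\<eta> = (a, b, c, d)" by (cases \<eta>)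
    let ?\<zeta> = "(2 * a + e1, 2 * b + e2, 2 * c + e3, 2 * d + e4)"
    let ?w = "\<lambda>\<tau>. of_real (hat \<tau>) * q \<tau>"
    have ph: "ph ?\<zeta> x = ph ?e x + 2 * ph \<eta> x" for x by (simp add: \<eta> ph_def algebra_simps)
    show ?case
    proof (intro exI[of _ "Th ?\<zeta> ?w"] conjI ballI)
      show "P (Th ?\<zeta> ?w)"
        unfolding hat_def using tp_base
        by (intro base continuous_intros) (auto simp: adm_def)
      fix y assume y: "y \<in> fund"
      have "Th ?\<zeta> ?w y = (\<Sum>\<^sub>\<infinity>m\<in>{0, -1}. trm r1 r2 e5 ?\<zeta> (\<lambda>m. ?w) m y)"
        unfolding Es_def
      proof (rule infsum_cong_neutral)
        fix m :: int assume "m \<in> UNIV - {0, -1}"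
        then have "m \<ge> 1 \<or> m \<le> -2" by auto
        then have "\<bar>snd y + of_int m\<bar> \<ge> 1" using fund_snd[OF y] by linarith
        then show "trm r1 r2 e5 ?\<zeta> (\<lambda>m. ?w) m y = 0" by (simp add: trm_def hat_def)
      qed auto
      also have "\<dots> = (\<Sum>m\<in>{0, -1}. trm r1 r2 e5 ?\<zeta> (\<lambda>m. ?w) m y)" by (rule infsum_finite) simp
      also have "\<dots> = ?L (\<lambda>y. ch (2 * ph \<eta> (fst y)) * q (snd y)) y"
      proof (rule sum.cong[OF refl])
        fix m :: int
        have "ch (ph (shift r1 r2 m ?\<zeta>) (fst y)) = ch (ph ?\<zeta> (matA r1 r2 (of_int m) *v fst y))"
          using ph_shift_matA[of r1 r2 0 ?\<zeta> m "fst y"] by simp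
        then show "trm r1 r2 e5 ?\<zeta> (\<lambda>m. ?w) m y = pm (e5 * m) * of_real (hat (snd y + of_int m)) *
            ch (ph ?e (fst (?A m y))) * (ch (2 * ph \<eta> (fst (?A m y))) * q (snd (?A m y)))"
          unfolding trm_def ph ch_add by (simp only: fst_conv snd_conv mult_ac)
      qed
      finally show "Th ?\<zeta> ?w y = ?L (\<lambda>y. ch (2 * ph \<eta> (fst y)) * q (snd y)) y" .
    qed
  next
    case (tp_add f g)
    then obtain U V where UV: "P U" "\<forall>y\<in>fund. U y = ?L f y" "P V" "\<forall>y\<in>fund. V y = ?L g y" by blast
    show ?case
    proof (intro exI[of _ "\<lambda>y. U y + V y"] conjI ballI)
      show "P (\<lambda>y. U y + V y)" by (rule closedfam_add[OF P UV(1,3)])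
      fix y assume "y \<in> fund"
      then have "U y + V y = ?L f y + ?L g y" using UV by simp
      also have "\<dots> = ?L (\<lambda>y. f y + g y) y" unfolding sum.distrib[symmetric]
        by (simp add: distrib_left)
      finally show "U y + V y = ?L (\<lambda>y. f y + g y) y" .
    qed
  qed
  obtain U where U: "P U" "\<And>y. y \<in> fund \<Longrightarrow> U y = ?L T y" using lift[OF T(1)] by blast
  show "\<exists>v. P v \<and> (\<forall>y\<in>fund. norm (u y - v y) \<le> \<epsilon>)"
  proof (intro exI[of _ U] conjI ballI U(1))
    fix y assume y: "y \<in> fund"
    have s: "0 \<le> snd y" "snd y < 1" using fund_snd[OF y] by auto
    have uA: "u y = pm (e5 * m) * ch (ph ?e (fst (?A m y))) * v (?A m y)" for m
    proof -
      have g: "(0, of_int m) \<in> carrier (grpGamma r1 r2)" by (simp add: carrier_grpGamma)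
      have "(0, of_int m) \<otimes>\<^bsub>grpG r1 r2\<^esub> y = ?A m y" by (cases y) (simp add: mult_grpG)
      then have "u (?A m y) = pm (eps (0, of_int m)) * u y" using u(2) g unfolding eqv_def by metis
      moreover have "pm (eps (0, of_int m)) = pm (e5 * m)" using pm_eps[of 0 "\<lambda>_. 0" m] by simp
      moreover have "ch (ph ?e z) * ch (- ph ?e z) = 1" for z unfolding ch_add[symmetric] by simp
      ultimately show ?thesis by (simp add: v_def mult_ac)
    qed
    have hat1: "(\<Sum>m\<in>{0, -1 :: int}. hat (snd y + of_int m)) = 1" using s by (simp add: hat_def)
    have "u y = (\<Sum>m\<in>{0, -1 :: int}. of_real (hat (snd y + of_int m)) * u y)"
      unfolding sum_distrib_right[symmetric] of_real_sum[symmetric] hat1 by simp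
    also have "\<dots> = ?L v y"
    proof (rule sum.cong[OF refl])
      fix m :: int
      show "of_real (hat (snd y + of_int m)) * u y =
          pm (e5 * m) * of_real (hat (snd y + of_int m)) * ch (ph ?e (fst (?A m y))) * v (?A m y)"
        by (subst uA[of m]) (simp only: mult_ac)
    qed
    finally have "u y - U y =
      (\<Sum>m\<in>{0, -1 :: int}. pm (e5 * m) * of_real (hat (snd y + of_int m)) * ch
        (ph ?e (fst (?A m y))) *
        (v (?A m y) - T (?A m y)))"
      unfolding U(2)[OF y] by (simp only: sum_subtractf[symmetric] right_diff_distrib)
    also have "norm \<dots> \<le> (\<Sum>m\<in>{0, -1 :: int}. hat (snd y + of_int m) * \<epsilon>)"
    proof (rule sum_norm_le)
      fix m :: int assume m: "m \<in> {0, -1}"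
      have "norm (v (?A m y) - T (?A m y)) \<le> \<epsilon>" using m s by (intro T(2)) auto
      then show "norm (pm (e5 * m) * of_real (hat (snd y + of_int m)) *
        ch (ph ?e (fst (?A m y))) * (v (?A m y) - T (?A m y)))
          \<le> hat (snd y + of_int m) * \<epsilon>"
        by (simp add: norm_mult hat_def mult_left_mono)
    qed
    also have "\<dots> = \<epsilon>" unfolding sum_distrib_right[symmetric] hat1 by simp
    finally show "norm (u y - U y) \<le> \<epsilon>" .
  qed
qed

end

section \<open>Fourier orthogonality on the fundamental domain\<close>

lemma set_integrable_continuous_fund:
  fixes h :: "pt \<Rightarrow> complex"
  assumes h: "continuous_on UNIV h"
  shows "set_integrable lborel fund h"
proof -
  have "compact (h ` closure fund)"
    using bounded_fund
    by (intro compact_continuous_image continuous_on_subset[OF h]) (auto simp: compact_closure)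
  then obtain C where "\<And>y. y \<in> closure fund \<Longrightarrow> norm (h y) \<le> C"
    by (meson compact_imp_bounded bounded_iff imageI)
  then show ?thesis
    using closure_subset
    by (intro set_integrable_fund_bounded borel_measurable_continuous_onI h) blast
qed

lemma nonzero_freq_coordinate:
  assumes "\<eta> \<noteq> (0, 0, 0, 0)"
  obtains v where "ph \<eta> v = 1"
proof -
  obtain a b c d where \<eta>: "\<eta> = (a, b, c, d)" by (cases \<eta>)
  have "a \<noteq> 0 \<or> b \<noteq> 0 \<or> c \<noteq> 0 \<or> d \<noteq> 0" using assms by (auto simp: \<eta>)
  then have "ph \<eta> (axis 1 (1 / of_int a)) = 1 \<or> ph \<eta> (axis 2 (1 / of_int b)) = 1 \<or>
      ph \<eta> (axis 3 (1 / of_int c)) = 1 \<or> ph \<eta> (axis 4 (1 / of_int d)) = 1"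
    by (auto simp: \<eta> ph_def axis_def)
  then show ?thesis using that by blast
qed

lemma ch_even: "ch (of_int (2 * k)) = 1"
  unfolding ch_of_int by (simp add: pm_def)

text \<open>Translation by a vector on which the frequency takes the value 1 changes the sign of the
  integrand but not its integral. The same cube is a fundamental domain for the group with
  \<open>r1 = r2 = 0\<close>, whose translations leave the last coordinate alone.\<close>

lemma integral_fund_char:
  assumes ev: "\<eta> = (2 * a, 2 * b, 2 * c, 2 * d)" and nz: "\<eta> \<noteq> (0, 0, 0, 0)"
    and q: "continuous_on UNIV q"
  shows "(LINT y:fund|lborel. ch (ph \<eta> (fst y)) * q (snd y)) = 0"
proof -
  obtain v where v: "ph \<eta> v = 1" using nonzero_freq_coordinate[OF nz] by blast
  \<comment> \<open>The fractional part makes the integrand invariant under the whole lattice and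
    changes nothing on the fundamental domain.\<close>
  define F where "F = (\<lambda>y :: pt. ch (ph \<eta> (fst y)) * q (frac (snd y)))"
  have "(\<lambda>y :: pt. ch (ph \<eta> (fst y))) \<in> borel_measurable borel"
    by (intro borel_measurable_continuous_onI continuous_intros)
  moreover have "(\<lambda>y :: pt. q (frac (snd y))) \<in> borel_measurable borel"
  proof -
    have [measurable]: "q \<in> borel_measurable borel" by (rule borel_measurable_continuous_onI[OF q])
    have [measurable]: "(snd :: pt \<Rightarrow> real) \<in> borel_measurable borel"
      by (intro borel_measurable_continuous_onI continuous_intros)
    show ?thesis unfolding frac_def by measurable
  qed
  ultimately have F: "F \<in> borel_measurable borel" unfolding F_def by (rule borel_measurable_times)
  have "compact (q ` {0..1})" by (rule compact_continuous_image[OF continuous_on_subset[OF q]]) auto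
  then obtain C where C: "\<And>s. s \<in> {0..1} \<Longrightarrow> norm (q s) \<le> C"
    by (meson compact_imp_bounded bounded_iff imageI)
  have b: "norm (F y) \<le> C" for y
    unfolding F_def norm_mult norm_ch using C[of "frac (snd y)"] frac_lt_1[of "snd y"] by simp
  have inv: "F (\<gamma> \<otimes>\<^bsub>grpG 0 0\<^esub> y) = F y" if g: "\<gamma> \<in> carrier (grpGamma 0 0)" for \<gamma> y
  proof -
    obtain n s where \<gamma>: "\<gamma> = (n, s)" "\<And>i. n $ i \<in> \<int>" "s \<in> \<int>" using g
      by (auto simp: carrier_grpGamma)
    have "\<forall>i. \<exists>m. n $ i = of_int m" using \<gamma>(2) by (auto elim: Ints_cases)
    then obtain M where M: "\<And>i. n $ i = of_int (M i)" by metis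
    have "ph \<eta> n = of_int (2 * (a * M 1 + b * M 2 + c * M 3 + d * M 4))"
      by (simp add: ev ph_def M algebra_simps)
    then have "ch (ph \<eta> n) = 1" by (simp only: ch_even)
    moreover have "frac (s + t) = frac t" for t using \<gamma>(3)
      by (auto simp: frac_def elim!: Ints_cases)
    ultimately show ?thesis
      by (cases y) (simp add: \<gamma>(1) F_def mult_grpG matA_mult_vec ph_add ch_add)
  qed
  have "(LINT y:fund|lborel. F (y \<otimes>\<^bsub>grpG 0 0\<^esub> (v, 0))) = (LINT y:fund|lborel. F y)"
    by (rule integral_fund_right[OF F b inv])
  moreover have "F (y \<otimes>\<^bsub>grpG 0 0\<^esub> (v, 0)) = - F y" for y
    using ch_of_int[of 1]
    by (cases y) (simp add: F_def mult_grpG matA_mult_vec ph_add ch_add v pm_def)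
  ultimately have "(LINT y:fund|lborel. F y) = 0"
    by (simp add: set_lebesgue_integral_def)
  moreover have "(LINT y:fund|lborel. F y) = (LINT y:fund|lborel. ch (ph \<eta> (fst y)) * q (snd y))"
    using fund_snd by (intro set_lebesgue_integral_cong) (auto simp: F_def frac_eq)
  ultimately show ?thesis by simp
qed

lemma integral_fund_char_snd:
  assumes "k \<noteq> 0"
  shows "(LINT y:fund|lborel. ch (of_int (2 * k) * snd y)) = 0"
proof -
  define F where "F = (\<lambda>y :: pt. ch (of_int (2 * k) * snd y))"
  have F: "F \<in> borel_measurable borel"
    unfolding F_def by (intro borel_measurable_continuous_onI continuous_intros)
  have inv: "F (\<gamma> \<otimes>\<^bsub>grpG 0 0\<^esub> y) = F y" if g: "\<gamma> \<in> carrier (grpGamma 0 0)" for \<gamma> y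
  proof -
    obtain n j where \<gamma>: "\<gamma> = (n, of_int j)" using g
      by (auto simp: carrier_grpGamma elim!: Ints_cases)
    have "of_int (2 * k) * (of_int j + t) = of_int (2 * (k * j)) + of_int (2 * k) * t" for t :: real
      by (simp add: distrib_left)
    then show ?thesis by (cases y) (simp only: \<gamma> F_def mult_grpG snd_conv ch_add ch_even mult_1)
  qed
  have "(LINT y:fund|lborel. F (y \<otimes>\<^bsub>grpG 0 0\<^esub> (0, 1 / of_int (2 * k)))) = (LINT y:fund|lborel. F y)"
    by (rule integral_fund_right[OF F _ inv, where C = 1]) (simp_all add: F_def)
  moreover have "F (y \<otimes>\<^bsub>grpG 0 0\<^esub> (0, 1 / of_int (2 * k))) = - F y" for y
  proof -
    have "of_int (2 * k) * (t + 1 / of_int (2 * k)) = of_int (2 * k) * t + of_int 1" for t :: real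
      using assms by (simp add: distrib_left)
    then show ?thesis
      by (cases y) (simp only: F_def mult_grpG snd_conv ch_add ch_of_int, simp add: pm_def)
  qed
  ultimately have "(LINT y:fund|lborel. F y) = 0" by (simp add: set_lebesgue_integral_def)
  then show ?thesis by (simp add: F_def)
qed

lemma integral_fund_norm_le:
  fixes h :: "pt \<Rightarrow> complex"
  assumes "continuous_on UNIV h" "\<And>y. y \<in> fund \<Longrightarrow> norm (h y) \<le> C"
  shows "norm (LINT y:fund|lborel. h y) \<le> C * measure lborel fund"
proof -
  have "norm (LINT y:fund|lborel. h y) \<le> (LINT y:fund|lborel. norm (h y))"
    by (rule set_integral_norm_bound[OF set_integrable_continuous_fund[OF assms(1)]])
  also have "\<dots> \<le> (LINT y:fund|lborel. C)"
    using assms set_integrable_continuous_fund[OF assms(1)]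
    by (intro set_integral_mono set_integrable_norm)
      (auto intro!: set_integrable_fund_bounded[where C = "\<bar>C\<bar>"])
  also have "\<dots> = C * measure lborel fund"
    by (simp add: set_lebesgue_integral_def)
  finally show ?thesis .
qed

lemma integral_fund_uniform_limit:
  fixes u g :: "pt \<Rightarrow> complex"
  assumes u: "continuous_on UNIV u" and g: "continuous_on UNIV g"
    and approx: "\<And>\<epsilon>. \<epsilon> > 0 \<Longrightarrow> \<exists>v. continuous_on UNIV v \<and> (\<forall>y\<in>fund. norm (u y - v y) \<le> \<epsilon>) \<and>
      (LINT y:fund|lborel. v y * g y) = I"
  shows "(LINT y:fund|lborel. u y * g y) = I"
proof -
  have "compact (g ` closure fund)"
    using bounded_fund
    by (intro compact_continuous_image continuous_on_subset[OF g]) (auto simp: compact_closure)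
  then obtain C where C: "\<And>y. y \<in> closure fund \<Longrightarrow> norm (g y) \<le> C"
    by (meson compact_imp_bounded bounded_iff imageI)
  define D where "D = \<bar>C\<bar> * measure lborel fund + 1"
  have D: "D > 0" unfolding D_def by (intro add_nonneg_pos mult_nonneg_nonneg) auto
  have "norm ((LINT y:fund|lborel. u y * g y) - I) \<le> e" if e: "e > 0" for e
  proof -
    have "e / D > 0" using e D by simp
    then obtain v where v: "continuous_on UNIV v" "\<And>y. y \<in> fund \<Longrightarrow> norm (u y - v y) \<le> e / D"
      "(LINT y:fund|lborel. v y * g y) = I" using approx by blast
    have "(LINT y:fund|lborel. u y * g y) - I = (LINT y:fund|lborel. u y * g y - v y * g y)"
      unfolding v(3)[symmetric] using u v g
      by (intro set_integral_diff(2)[symmetric] set_integrable_continuous_fund continuous_intros)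
    also have "norm \<dots> \<le> (e / D * \<bar>C\<bar>) * measure lborel fund"
    proof (rule integral_fund_norm_le)
      show "continuous_on UNIV (\<lambda>y. u y * g y - v y * g y)" by (intro continuous_intros u v g)
      fix y assume y: "y \<in> fund"
      have "norm (g y) \<le> \<bar>C\<bar>" using C[of y] y closure_subset[of fund]
        by (meson abs_ge_self order_trans subsetD)
      then have "norm ((u y - v y) * g y) \<le> e / D * \<bar>C\<bar>"
        unfolding norm_mult using v(2)[OF y] e D by (intro mult_mono) auto
      then show "norm (u y * g y - v y * g y) \<le> e / D * \<bar>C\<bar>" by (simp add: left_diff_distrib)
    qed
    also have "\<dots> = e * ((D - 1) / D)" by (simp add: D_def)
    also have "\<dots> \<le> e" using e D by (intro mult_left_le) auto
    finally show ?thesis .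
  qed
  then have "norm ((LINT y:fund|lborel. u y * g y) - I) \<le> 0"
    by (rule field_le_epsilon[where y = 0, simplified]) 
  then show ?thesis by simp
qed

text \<open>Unfolding: the series converges uniformly on the fundamental domain, so a finite partial
  sum may replace it, and there only the term m = 0 contributes.\<close>

lemma integral_fund_Es:
  assumes w: "decay w" "\<And>m. continuous_on UNIV (w m)" and g: "continuous_on UNIV g"
    and z: "\<And>m. m \<noteq> 0 \<Longrightarrow> (LINT y:fund|lborel. trm r1 r2 e5 \<xi> w m y * g y) = 0"
  shows "(LINT y:fund|lborel. Es r1 r2 e5 \<xi> w y * g y) =
    (LINT y:fund|lborel. trm r1 r2 e5 \<xi> w 0 y * g y)"
proof (rule integral_fund_uniform_limit[OF continuous_Es[OF w] g])
  fix \<epsilon> :: real assume e: "\<epsilon> > 0"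
  obtain C where C: "\<And>m s. \<bar>s\<bar> \<le> 1 \<Longrightarrow> norm (w m (s + of_int m)) \<le> C / (1 + (real_of_int m)\<^sup>2)"
    using decayE[OF w(1)] by blast
  have "uniform_limit fund (\<lambda>F z. \<Sum>m\<in>F. trm r1 r2 e5 \<xi> w m z) (\<lambda>z. \<Sum>\<^sub>\<infinity>m. trm r1 r2 e5 \<xi> w m z)
    (finite_subsets_at_top UNIV)"
  proof (rule Weierstrass_m_test_general[OF _ summable_on_int_quadratic])
    show "norm (trm r1 r2 e5 \<xi> w m z) \<le> C / (1 + (real_of_int m)\<^sup>2)" if "z \<in> fund" for m z
      using fund_snd[OF that] by (simp add: norm_trm) (intro C, auto)
  qed
  then have
    "\<forall>\<^sub>F F in finite_subsets_at_top UNIV. \<forall>z\<in>fund. dist (\<Sum>m\<in>F. trm r1 r2 e5 \<xi> w m z)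
      (Es r1 r2 e5 \<xi> w z) < \<epsilon>"
    unfolding Es_def using e by (rule uniform_limitD)
  \<comment> \<open>The partial sum must contain the index 0, whose term is the one that
    survives.\<close>
  moreover have "\<forall>\<^sub>F F in finite_subsets_at_top UNIV. finite F \<and> {0 :: int} \<subseteq> F"
    unfolding eventually_finite_subsets_at_top by (intro exI[of _ "{0}"]) auto
  ultimately have
    "\<forall>\<^sub>F F in finite_subsets_at_top UNIV. (\<forall>z\<in>fund. dist (\<Sum>m\<in>F. trm r1 r2 e5 \<xi> w m z)
      (Es r1 r2 e5 \<xi> w z) < \<epsilon>) \<and>
      finite F \<and> {0 :: int} \<subseteq> F" by (rule eventually_conj)
  from eventually_happens'[OF finite_subsets_at_top_neq_bot this]
  obtain F where FF: "(\<forall>z\<in>fund. dist (\<Sum>m\<in>F. trm r1 r2 e5 \<xi> w m z) (Es r1 r2 e5 \<xi> w z) < \<epsilon>) \<and>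
    finite F \<and> {0 :: int} \<subseteq> F" ..
  have F: "\<And>z. z \<in> fund \<Longrightarrow> dist (\<Sum>m\<in>F. trm r1 r2 e5 \<xi> w m z) (Es r1 r2 e5 \<xi> w z) < \<epsilon>"
    "finite F" "0 \<in> F"
    using FF by auto
  have ct: "continuous_on UNIV (\<lambda>y. trm r1 r2 e5 \<xi> w m y)" for m
    unfolding trm_def by (intro continuous_intros continuous_on_compose2[OF w(2)]) auto
  show "\<exists>v. continuous_on UNIV v \<and> (\<forall>y\<in>fund. norm (Es r1 r2 e5 \<xi> w y - v y) \<le> \<epsilon>) \<and>
      (LINT y:fund|lborel. v y * g y) = (LINT y:fund|lborel. trm r1 r2 e5 \<xi> w 0 y * g y)"
  proof (intro exI[of _ "\<lambda>y. \<Sum>m\<in>F. trm r1 r2 e5 \<xi> w m y"] conjI ballI)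
    show "continuous_on UNIV (\<lambda>y. \<Sum>m\<in>F. trm r1 r2 e5 \<xi> w m y)" by (intro continuous_on_sum ct)
    show "norm (Es r1 r2 e5 \<xi> w y - (\<Sum>m\<in>F. trm r1 r2 e5 \<xi> w m y)) \<le> \<epsilon>" if "y \<in> fund" for y
      using F(1)[OF that] by (simp add: dist_norm norm_minus_commute)
    have "(LINT y:fund|lborel. (\<Sum>m\<in>F. trm r1 r2 e5 \<xi> w m y) * g y) =
        (\<Sum>m\<in>F. LINT y:fund|lborel. trm r1 r2 e5 \<xi> w m y * g y)"
      unfolding sum_distrib_right set_lebesgue_integral_def scaleR_sum_right
      using set_integrable_continuous_fund[OF continuous_on_mult[OF ct g]]
      by (intro Bochner_Integration.integral_sum) (simp add: set_integrable_def)
    also have "\<dots> = (\<Sum>m\<in>F. if m = 0 then LINT y:fund|lborel. trm r1 r2 e5 \<xi> w 0 y * g y else 0)"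
      using z by (intro sum.cong) auto
    also have "\<dots> = (LINT y:fund|lborel. trm r1 r2 e5 \<xi> w 0 y * g y)" using F by simp
    finally show "(LINT y:fund|lborel. (\<Sum>m\<in>F. trm r1 r2 e5 \<xi> w m y) * g y) =
      (LINT y:fund|lborel. trm r1 r2 e5 \<xi> w 0 y * g y)" .
  qed
qed

text \<open>If the integral vanished, the nonnegative integrand would vanish almost everywhere, yet
  it is positive on a nonempty open set.\<close>

lemma integral_fund_norm_nonzero:
  fixes h :: "real \<Rightarrow> complex"
  assumes h: "continuous_on UNIV h" and s: "0 < s" "s < 1" "h s \<noteq> 0"
  shows "(LINT y:fund|lborel. h (snd y) * cnj (h (snd y))) \<noteq> 0"
proof
  assume z: "(LINT y:fund|lborel. h (snd y) * cnj (h (snd y))) = 0"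
  have ch: "continuous_on UNIV (\<lambda>y :: pt. h (snd y))"
    by (rule continuous_on_compose2[OF h]) (auto intro!: continuous_intros)
  have sq: "h t * cnj (h t) = of_real ((norm (h t))\<^sup>2)" for t by (simp only: complex_norm_square)
  have si: "set_integrable lborel fund (\<lambda>y :: pt. h (snd y) * cnj (h (snd y)))"
    by (intro set_integrable_continuous_fund continuous_intros ch)
  have i: "integrable lborel (\<lambda>y :: pt. indicator fund y * (norm (h (snd y)))\<^sup>2)"
    using integrable_Re[OF si[unfolded set_integrable_def sq]] by simp
  have "Re (LINT y:fund|lborel. h (snd y) * cnj (h (snd y))) =
    (LINT y|lborel. indicator fund y * (norm (h (snd y)))\<^sup>2)"
    using integral_Re[OF si[unfolded set_integrable_def]] unfolding set_lebesgue_integral_def sq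
    by simp
  then have "(LINT y|lborel. indicator fund y * (norm (h (snd y)))\<^sup>2) = 0" using z by simp
  then have ae: "AE y in lborel. indicator fund y * (norm (h (snd y)))\<^sup>2 = 0"
    using integral_nonneg_eq_0_iff_AE[OF i] by simp
  \<comment> \<open>Strict inequalities select the interior of the cube, so that this set is
    open.\<close>
  define U where "U = {y :: pt. (\<forall>i. 0 < fst y $ i \<and> fst y $ i < 1) \<and> 0 < snd y \<and>
    snd y < 1 \<and> h (snd y) \<noteq> 0}"
  have "U = (\<Inter>i. {y. 0 < fst y $ i} \<inter> {y. fst y $ i < 1}) \<inter>
    ({y. 0 < snd y} \<inter> {y. snd y < 1} \<inter> {y. h (snd y) \<noteq> 0})"
    by (auto simp: U_def)
  also have "open \<dots>"
    by (intro open_Int open_INT ballI open_Collect_less open_Collect_neq continuous_intros ch) auto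
  finally have "open U" .
  moreover have "((\<chi> i. 1 / 2), s) \<in> U" using s by (simp add: U_def)
  ultimately have nn: "\<not> negligible U" by (intro open_not_negligible) auto
  have "AE y in lborel. y \<notin> U"
    using ae by eventually_elim (auto simp: U_def fund_def indicator_def less_imp_le)
  then have "U \<in> null_sets lborel"
    using \<open>open U\<close> by (subst AE_iff_null_sets) auto
  then show False using nn null_sets_completionI[of U lborel]
    by (simp add: negligible_iff_null_sets)
qed

section \<open>Orthogonal complements\<close>

definition sv :: "2 \<Rightarrow> (pt \<Rightarrow> complex) \<Rightarrow> (pt \<Rightarrow> spinor)" where
  "sv i u = (\<lambda>y. axis i (u y))"

lemma continuous_sv: "continuous_on S u \<Longrightarrow> continuous_on S (sv i u)"
proof -
  assume u: "continuous_on S u"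
  have "continuous_on S (\<lambda>y. if j = i then u y else 0)" for j using u by (cases "j = i") auto
  then show ?thesis unfolding sv_def axis_def by (rule continuous_on_vec_lambda)
qed

lemma sqi_sv: "continuous_on UNIV u \<Longrightarrow> sqi (sv i u)"
  by (intro sqi_continuous continuous_sv)

lemma spip_sv: "spip v (sv i u y) = v $ i * cnj (u y)"
  using exhaust_2[of i] by (auto simp: spip_def sv_def axis_def sum_2)

lemma norm_sv: "norm (sv i u y) = norm (u y)"
  using exhaust_2[of i] by (auto simp: sv_def norm_vec_def L2_set_def axis_def sum_2)

lemma L2norm_le:
  assumes "sqi f" "\<And>y. y \<in> fund \<Longrightarrow> norm (f y) \<le> C" "C \<ge> 0"
  shows "L2norm f \<le> C * sqrt (measure lborel fund)"
proof -
  have "(LINT y:fund|lborel. (norm (f y))\<^sup>2) \<le> (LINT y:fund|lborel. C\<^sup>2)"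
    using assms by (intro set_integral_mono)
      (auto simp: sqi_def intro!: power_mono set_integrable_fund_bounded[where C = "C\<^sup>2"])
  also have "\<dots> = C\<^sup>2 * measure lborel fund" by (simp add: set_lebesgue_integral_def)
  finally have "L2norm f \<le> sqrt (C\<^sup>2 * measure lborel fund)"
    unfolding L2norm_def by (rule real_sqrt_le_mono)
  then show ?thesis using assms(3) by (simp add: real_sqrt_mult)
qed

text \<open>The link between density and completeness: what is orthogonal to f survives uniform
  limits, so orthogonality to the generating functions spreads to everything they
  approximate.\<close>

lemma closedfam_orthogonal:
  assumes f: "sqi f"
  shows "closedfam (\<lambda>u. continuous_on UNIV u \<and> L2ip f (sv i u) = 0)"
  unfolding closedfam_def
proof (intro conjI allI impI)
  show "continuous_on UNIV (\<lambda>y :: pt. 0 :: complex)" by (rule continuous_on_const)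
  show "L2ip f (sv i (\<lambda>y. 0)) = 0" by (simp add: L2ip_eq spip_sv)
  fix u v :: "pt \<Rightarrow> complex" and c
  assume u: "continuous_on UNIV u \<and> L2ip f (sv i u) = 0"
    and v: "continuous_on UNIV v \<and> L2ip f (sv i v) = 0"
  show "continuous_on UNIV (\<lambda>y. u y + c * v y)" using u v by (intro continuous_intros) auto
  have "sv i (\<lambda>y. u y + c * v y) = (\<lambda>y. sv i u y + c *s sv i v y)"
    by (simp add: sv_def fun_eq_iff vec_eq_iff axis_def)
  then show "L2ip f (sv i (\<lambda>y. u y + c * v y)) = 0"
    using u v f by (simp add: L2ip_add_right sqi_sv sqi_scale L2ip_scale_right)
next
  fix u :: "pt \<Rightarrow> complex"
  assume u: "continuous_on UNIV u"
    and a: "\<forall>\<epsilon>>0. \<exists>v. (continuous_on UNIV v \<and> L2ip f (sv i v) = 0) \<and>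
      (\<forall>y\<in>fund. norm (u y - v y) \<le> \<epsilon>)"
  show "continuous_on UNIV u" by (rule u)
  define D where "D = L2norm f * sqrt (measure lborel fund) + 1"
  have D: "D > 0" unfolding D_def by (intro add_nonneg_pos mult_nonneg_nonneg) auto
  have "norm (L2ip f (sv i u)) \<le> e" if e: "e > 0" for e
  proof -
    have "e / D > 0" using e D by simp
    then obtain v where v: "continuous_on UNIV v" "L2ip f (sv i v) = 0"
      "\<And>y. y \<in> fund \<Longrightarrow> norm (u y - v y) \<le> e / D"
      using a by blast
    have s: "sqi (\<lambda>y. sv i u y - sv i v y)" by (intro sqi_diff sqi_sv u v)
    have "L2ip f (sv i u) = L2ip f (\<lambda>y. sv i u y - sv i v y)"
      using L2ip_diff_right[OF sqi_sv[OF u] sqi_sv[OF v(1)] f, of i i] v(2) by simp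
    also have "norm \<dots> \<le> L2norm f * L2norm (\<lambda>y. sv i u y - sv i v y)"
      by (rule L2_Cauchy_Schwarz[OF f s])
    also have "\<dots> \<le> L2norm f * (e / D * sqrt (measure lborel fund))"
    proof (intro mult_left_mono L2norm_le s)
      fix y assume "y \<in> fund"
      have "sv i u y - sv i v y = sv i (\<lambda>y. u y - v y) y" by (simp add: sv_def vec_eq_iff axis_def)
      then show "norm (sv i u y - sv i v y) \<le> e / D" using v(3)[OF \<open>y \<in> fund\<close>]
        by (simp add: norm_sv)
    qed (use e D in auto)
    also have "\<dots> = e * ((D - 1) / D)" by (simp add: D_def)
    also have "\<dots> \<le> e" using e D by (intro mult_left_le) auto
    finally show ?thesis .
  qed
  then have "norm (L2ip f (sv i u)) \<le> 0" by (rule field_le_epsilon[where y = 0, simplified]) 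
  then show "L2ip f (sv i u) = 0" by simp
qed

text \<open>By definition f is a limit of continuous equivariant functions. They are all orthogonal
  to f, hence so is f itself.\<close>

lemma (in spin_structure) L2norm_zero_of_orthogonal:
  assumes f: "f \<in> L2 r1 r2 eps"
    and z: "\<And>i u. continuous_on UNIV u \<Longrightarrow> eqv u \<Longrightarrow> L2ip f (sv i u) = 0"
  shows "L2norm f = 0"
proof -
  obtain u where u: "\<And>n :: nat. continuous_on UNIV (u n)" "\<And>n. equivariant r1 r2 eps (u n)"
    "(\<lambda>n. L2norm (\<lambda>y. u n y - f y)) \<longlonglongrightarrow> 0" using f by (auto simp: L2_def)
  have sf: "sqi f" by (rule L2_sqi[OF f])
  have "L2ip f (u n) = 0" for n
  proof -
    have c: "continuous_on UNIV (\<lambda>y. u n y $ j)" for j using u(1) by (intro continuous_intros)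
    have e: "eqv (\<lambda>y. u n y $ j)" for j using u(2) equivariant_iff by blast
    have "u n = (\<lambda>y. sv 1 (\<lambda>y. u n y $ 1) y + sv 2 (\<lambda>y. u n y $ 2) y)"
      by (simp add: fun_eq_iff vec_eq_iff sv_def axis_def forall_2)
    then have "L2ip f (u n) = L2ip f (\<lambda>y. sv 1 (\<lambda>y. u n y $ 1) y + sv 2 (\<lambda>y. u n y $ 2) y)" by simp
    also have "\<dots> = L2ip f (sv 1 (\<lambda>y. u n y $ 1)) + L2ip f (sv 2 (\<lambda>y. u n y $ 2))"
      by (rule L2ip_add_right[OF sqi_sv[OF c] sqi_sv[OF c] sf])
    finally show ?thesis by (simp add: z[OF c e])
  qed
  then have "L2ip (u n) f = 0" for n by (subst L2ip_commute) simp
  moreover have "(\<lambda>n. L2ip (u n) f) \<longlonglongrightarrow> L2ip f f"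
    by (rule L2ip_tendsto[OF sqi_continuous[OF u(1)] sf sf u(3)])
  ultimately have "L2ip f f = 0" by (simp add: LIMSEQ_const_iff)
  then show ?thesis by (simp add: L2ip_self)
qed

section \<open>Hermite functions\<close>

text \<open>Hermite polynomials for the weight exp(-beta (t + sigma)^2), whose square root is
  \<open>gau\<close>. The recursion is the raising operator acting on polynomial times
  Gaussian.\<close>

primrec hermite :: "real \<Rightarrow> real \<Rightarrow> nat \<Rightarrow> complex poly" where
  "hermite \<beta> \<sigma> 0 = 1"
| "hermite \<beta> \<sigma> (Suc k) = smult (of_real (2 * \<beta>)) ([:of_real \<sigma>, 1:] * hermite \<beta> \<sigma> k) -
  pderiv (hermite \<beta> \<sigma> k)"

lemma hermite_degree:
  assumes "\<beta> > 0"
  shows "degree (hermite \<beta> \<sigma> k) \<le> k \<and> coeff (hermite \<beta> \<sigma> k) k \<noteq> 0"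
proof (induction k)
  case (Suc k)
  have d: "degree (hermite \<beta> \<sigma> k) \<le> k" using Suc by simp
  then have c: "coeff (hermite \<beta> \<sigma> k) j = 0" if "j > k" for j using that by (intro coeff_eq_0) simp
  have "degree (hermite \<beta> \<sigma> (Suc k)) \<le> Suc k"
  proof (rule degree_le, intro allI impI)
    fix i assume "i > Suc k"
    then show "coeff (hermite \<beta> \<sigma> (Suc k)) i = 0"
      by (cases i) (simp_all add: c coeff_pderiv)
  qed
  moreover have "coeff (hermite \<beta> \<sigma> (Suc k)) (Suc k) \<noteq> 0"
    using Suc assms by (simp add: c coeff_pderiv)
  ultimately show ?case by simp
qed simp

text \<open>The lowering relation, by differentiating the recursion once more.\<close>

lemma pderiv_hermite:
  "pderiv (hermite \<beta> \<sigma> (Suc k)) = smult (of_real (2 * \<beta> * real (Suc k))) (hermite \<beta> \<sigma> k)"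
proof (induction k)
  case 0
  show ?case by (simp add: pderiv_smult pderiv_pCons)
next
  case (Suc k)
  let ?H = "hermite \<beta> \<sigma>" and ?X = "[:of_real \<sigma>, 1:] :: complex poly"
  have X: "pderiv (?X * q) = q + ?X * pderiv q" for q :: "complex poly"
    unfolding pderiv_mult by (simp add: pderiv_pCons)
  have "pderiv (?H (Suc (Suc k))) =
    smult (of_real (2 * \<beta>)) (?H (Suc k) + ?X * pderiv (?H (Suc k))) - pderiv (pderiv (?H (Suc k)))"
    unfolding hermite.simps(2)[of \<beta> \<sigma> "Suc k"] pderiv_diff pderiv_smult X ..
  also have "\<dots> = smult (of_real (2 * \<beta>)) (?H (Suc k)) +
    smult (of_real (2 * \<beta> * real (Suc k))) (smult (of_real (2 * \<beta>)) (?X * ?H k) - pderiv (?H k))"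
    unfolding Suc.IH pderiv_smult
    by (simp add: smult_add_right smult_diff_right algebra_simps del: hermite.simps)
  also have "\<dots> = smult (of_real (2 * \<beta> * real (Suc (Suc k)))) (?H (Suc k))"
    unfolding hermite.simps(2)[symmetric] smult_add_left[symmetric]
    by (simp add: algebra_simps del: hermite.simps)
  finally show ?case .
qed

definition hw :: "real \<Rightarrow> real \<Rightarrow> complex poly \<Rightarrow> real \<Rightarrow> complex" where
  "hw \<beta> \<sigma> p \<tau> = poly p (of_real \<tau>) * of_real (gau \<beta> \<sigma> \<tau>)"

lemma gw_hw: "gw \<beta> \<sigma> (\<lambda>m. hw \<beta> \<sigma> p)"
  using gw_poly[of \<beta> \<sigma> p] by (simp add: hw_def[abs_def])

lemma decay_hw: "\<beta> > 0 \<Longrightarrow> decay (\<lambda>m. hw \<beta> \<sigma> p)"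
  by (rule gw_decay[OF _ gw_hw])

lemma continuous_hw: "continuous_on S (hw \<beta> \<sigma> p)"
  unfolding hw_def gau_def by (intro continuous_intros) simp

lemma hw_deriv:
  "(hw \<beta> \<sigma> p has_vector_derivative hw \<beta> \<sigma> (pderiv p -
    smult (of_real \<beta>) ([:of_real \<sigma>, 1:] * p)) \<tau>) (at \<tau>)"
proof -
  have 1: "((\<lambda>t. poly p (of_real t)) has_vector_derivative poly (pderiv p) (of_real \<tau>)) (at \<tau>)"
    by (rule has_vector_derivative_real_field) (rule poly_DERIV)
  have "(gau \<beta> \<sigma> has_real_derivative - \<beta> * (\<tau> + \<sigma>) * gau \<beta> \<sigma> \<tau>) (at \<tau>)"
    unfolding gau_def by (auto intro!: derivative_eq_intros)
  then have 2:
    "((\<lambda>t. of_real (gau \<beta> \<sigma> t) :: complex) has_vector_derivative of_real (- \<beta> *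
      (\<tau> + \<sigma>) * gau \<beta> \<sigma> \<tau>)) (at \<tau>)"
    by (intro has_vector_derivative_of_real)
      (simp add: has_real_derivative_iff_has_vector_derivative)
  from has_vector_derivative_mult[OF 1 2] show ?thesis
    by (simp add: hw_def[abs_def] algebra_simps)
qed

lemma hw_nonzero:
  assumes "p \<noteq> 0"
  obtains s where "0 < s" "s < 1" "hw \<beta> \<sigma> p s \<noteq> 0"
proof -
  have "infinite {0<..<1 :: real}" by simp
  then have "infinite (complex_of_real ` {0<..<1})" by (simp add: finite_image_iff inj_on_def)
  then have "\<not> complex_of_real ` {0<..<1} \<subseteq> {z. poly p z = 0}"
    using poly_roots_finite[OF assms] finite_subset by blast
  then obtain s where "s \<in> {0<..<1 :: real}" "poly p (of_real s) \<noteq> 0" by blast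
  then show ?thesis using gau_pos[of \<beta> \<sigma> s] by (intro that[of s]) (auto simp: hw_def)
qed

section \<open>Spinors with scalar components\<close>

lemma bounded_linear_axis: "bounded_linear (axis i :: complex \<Rightarrow> spinor)"
proof -
  have "linear (axis i :: complex \<Rightarrow> spinor)"
    by (rule linearI) (simp_all add: vec_eq_iff axis_def)
  then show ?thesis by (simp add: linear_conv_bounded_linear)
qed

lemma smooth_sv: "smooth u \<Longrightarrow> smooth (sv i u)"
  unfolding smooth_def sv_def using Ck_bounded_linear[OF bounded_linear_axis] by blast

lemma smooth_add: "smooth f \<Longrightarrow> smooth g \<Longrightarrow> smooth (\<lambda>y. f y + g y)"
  unfolding smooth_def using Ck_add by blast

definition pair :: "(pt \<Rightarrow> complex) \<Rightarrow> (pt \<Rightarrow> complex) \<Rightarrow> pt \<Rightarrow> spinor" where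
  "pair u v = (\<lambda>y. sv 1 u y + sv 2 v y)"

lemma pair_nth [simp]: "pair u v y $ 1 = u y" "pair u v y $ 2 = v y"
  by (simp_all add: pair_def sv_def axis_def)

lemma smooth_pair: "smooth u \<Longrightarrow> smooth v \<Longrightarrow> smooth (pair u v)"
  unfolding pair_def by (intro smooth_add smooth_sv)

lemma along_pair:
  assumes "smooth u" "smooth v"
  shows "along X (pair u v) = pair (along X u) (along X v)"
proof
  fix y
  have "(pair u v has_derivative (\<lambda>h. axis 1 (frechet_derivative u (at y) h) +
    axis 2 (frechet_derivative v (at y) h))) (at y)"
    unfolding pair_def sv_def
    by (intro has_derivative_add bounded_linear.has_derivative[OF bounded_linear_axis]
      smooth_has_derivative assms)
  from frechet_derivative_at[OF this, symmetric] show "along X (pair u v) y =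
    pair (along X u) (along X v) y"
    by (simp add: along_def pair_def sv_def)
qed

lemma DD_pair:
  assumes "smooth u" "smooth v"
  shows "DD r1 r2 \<alpha> (pair u v) = pair
    (\<lambda>y. \<i> * along (frame r1 r2 1) v y - along (frame r1 r2 2) v y + \<i> * along
      (frame r1 r2 3) u y + of_real \<alpha> * u y)
    (\<lambda>y. \<i> * along (frame r1 r2 1) u y + along (frame r1 r2 2) u y - \<i> * along
      (frame r1 r2 3) v y + of_real \<alpha> * v y)"
  unfolding DD_def along_pair[OF assms] fun_eq_iff
  by (simp add: sum_3 clifford_mult vec_eq_iff forall_2) (simp add: scaleR_conv_of_real)

lemma L2ip_pair_right:
  assumes "sqi f" "continuous_on UNIV u" "continuous_on UNIV v"
  shows "L2ip f (pair u v) = L2ip f (sv 1 u) + L2ip f (sv 2 v)"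
  unfolding pair_def by (rule L2ip_add_right[OF sqi_sv[OF assms(2)] sqi_sv[OF assms(3)] assms(1)])

lemma L2ip_pairs:
  assumes "continuous_on UNIV u" "continuous_on UNIV v" "continuous_on UNIV u'"
    "continuous_on UNIV v'"
  shows "L2ip (pair u v) (pair u' v') = (LINT y:fund|lborel. u y * cnj (u' y)) +
    (LINT y:fund|lborel. v y * cnj (v' y))"
proof -
  have "L2ip (pair u v) (pair u' v') = (LINT y:fund|lborel. u y * cnj (u' y) + v y * cnj (v' y))"
    by (simp add: L2ip_eq spip_def sum_2)
  also have "\<dots> = (LINT y:fund|lborel. u y * cnj (u' y)) + (LINT y:fund|lborel. v y * cnj (v' y))"
    using assms by (intro set_integral_add set_integrable_continuous_fund continuous_intros)
  finally show ?thesis .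
qed

section \<open>Orthogonality of theta series\<close>

locale spin_pos = spin_structure +
  assumes r1_pos: "r1 > 0" and r2_pos: "r2 > 0"
begin

lemma adm_diff:
  assumes "adm \<xi>" "adm \<zeta>" "\<xi> \<noteq> \<zeta>"
  obtains a b c d where "\<And>x. ph \<xi> x - ph \<zeta> x = ph (2 * a, 2 * b, 2 * c, 2 * d) x"
    "(2 * a, 2 * b, 2 * c, 2 * d) \<noteq> (0 :: int, 0 :: int, 0 :: int, 0 :: int)"
proof -
  obtain x1 x2 x3 x4 where \<xi>: "\<xi> = (x1, x2, x3, x4)" by (cases \<xi>)
  obtain y1 y2 y3 y4 where \<zeta>: "\<zeta> = (y1, y2, y3, y4)" by (cases \<zeta>)
  have "even (x1 - y1)" "even (x2 - y2)" "even (x3 - y3)" "even (x4 - y4)"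
    using assms(1,2) by (auto simp: \<xi> \<zeta> adm_def)
  then obtain a b c d where d: "x1 - y1 = 2 * a" "x2 - y2 = 2 * b" "x3 - y3 = 2 * c"
    "x4 - y4 = 2 * d"
    unfolding dvd_def by blast
  have x: "x1 = y1 + 2 * a" "x2 = y2 + 2 * b" "x3 = y3 + 2 * c" "x4 = y4 + 2 * d"
    using d by simp_all
  have "ph \<xi> x - ph \<zeta> x = ph (2 * a, 2 * b, 2 * c, 2 * d) x" for x
    unfolding \<xi> \<zeta> x ph_def by (simp add: algebra_simps)
  moreover have "(2 * a, 2 * b, 2 * c, 2 * d) \<noteq> (0, 0, 0, 0)" using assms(3) by (auto simp: \<xi> \<zeta> x)
  ultimately show ?thesis by (rule that)
qed

lemma integral_char_orthogonal:
  assumes "adm \<xi>" "adm \<zeta>" "\<xi> \<noteq> \<zeta>" "continuous_on UNIV q"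
  shows "(LINT y:fund|lborel. ch (ph \<xi> (fst y)) * ch (- ph \<zeta> (fst y)) * q (snd y)) = 0"
proof -
  obtain a b c d where e: "\<And>x. ph \<xi> x - ph \<zeta> x = ph (2 * a, 2 * b, 2 * c, 2 * d) x"
    "(2 * a, 2 * b, 2 * c, 2 * d) \<noteq> (0 :: int, 0 :: int, 0 :: int, 0 :: int)"
    using adm_diff[OF assms(1-3)] by metis
  have "ch (ph \<xi> x) * ch (- ph \<zeta> x) = ch (ph (2 * a, 2 * b, 2 * c, 2 * d) x)" for x
    unfolding ch_add[symmetric] e(1)[symmetric] by simp
  then show ?thesis using integral_fund_char[OF refl e(2) assms(4)] by simp
qed

lemma continuous_shifted: "continuous_on UNIV w \<Longrightarrow> continuous_on UNIV (\<lambda>s. w (s + c :: real))"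
  by (rule continuous_on_compose2) (auto intro!: continuous_intros)

text \<open>Termwise Fourier orthogonality leaves only m = 0. With \<open>\<zeta>\<close> outside
  the orbit the remaining integral also vanishes; with \<open>\<zeta> = \<xi>\<close> it detects
  that the series is nonzero.\<close>

lemma Th_char_orthogonal:
  assumes "adm \<xi>" "adm \<zeta>" and w: "decay (\<lambda>m. w)" "continuous_on UNIV w"
    and q: "continuous_on UNIV q"
    and ne: "\<And>m. m \<noteq> 0 \<Longrightarrow> shift r1 r2 m \<xi> \<noteq> \<zeta>"
  shows "(LINT y:fund|lborel. Th \<xi> w y * (ch (- ph \<zeta> (fst y)) * q (snd y))) =
    (LINT y:fund|lborel. ch (ph \<xi> (fst y)) * ch (- ph \<zeta> (fst y)) * (w (snd y) * q (snd y)))"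
proof -
  have cq: "continuous_on UNIV (\<lambda>y :: pt. q (snd y))"
    by (rule continuous_on_compose2[OF q]) (auto intro!: continuous_intros)
  have "(LINT y:fund|lborel. Th \<xi> w y * (ch (- ph \<zeta> (fst y)) * q (snd y))) =
      (LINT y:fund|lborel. trm r1 r2 e5 \<xi> (\<lambda>m. w) 0 y * (ch (- ph \<zeta> (fst y)) * q (snd y)))"
  proof (rule integral_fund_Es[OF w(1) w(2)])
    show "continuous_on UNIV (\<lambda>y. ch (- ph \<zeta> (fst y)) * q (snd y))" by (intro continuous_intros cq)
    fix m :: int assume m: "m \<noteq> 0"
    have "(LINT y:fund|lborel. ch (ph (shift r1 r2 m \<xi>) (fst y)) * ch (- ph \<zeta> (fst y)) *
        (pm (e5 * m) * w (snd y + of_int m) * q (snd y))) = 0"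
      using assms m
      by (intro integral_char_orthogonal[where q = "\<lambda>s. pm (e5 * m) * w (s + of_int m) * q s"]
        continuous_intros continuous_shifted) (auto simp: adm_shift)
    then show "(LINT y:fund|lborel. trm r1 r2 e5 \<xi> (\<lambda>m. w) m y *
      (ch (- ph \<zeta> (fst y)) * q (snd y))) = 0"
      by (simp add: trm_def mult_ac)
  qed
  then show ?thesis by (simp add: trm_def mult_ac pm_def)
qed

lemma Th_char_zero:
  assumes "adm \<xi>" "adm \<zeta>" and w: "decay (\<lambda>m. w)" "continuous_on UNIV w"
    and q: "continuous_on UNIV q"
    and ne: "\<And>m. shift r1 r2 m \<xi> \<noteq> \<zeta>"
  shows "(LINT y:fund|lborel. Th \<xi> w y * (ch (- ph \<zeta> (fst y)) * q (snd y))) = 0"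
proof -
  have "\<xi> \<noteq> \<zeta>" using ne[of 0] by simp
  then show ?thesis
    unfolding Th_char_orthogonal[OF assms(1-5) ne]
    using assms by (intro integral_char_orthogonal[where q = "\<lambda>s. w s * q s"] continuous_intros)
qed

lemma set_integral_cnj: "(LINT y:fund|lborel. cnj (h y)) = cnj (LINT y:fund|lborel. h y)"
  unfolding set_lebesgue_integral_def
  by (simp only: Bochner_Integration.integral_cnj flip: complex_cnj_scaleR)

lemma Th_orthogonal:
  assumes "adm \<xi>" "adm \<zeta>" and w: "decay (\<lambda>m. w)" "continuous_on UNIV w"
    and v: "decay (\<lambda>m. v)" "continuous_on UNIV v"
    and ne: "\<And>m k. shift r1 r2 m \<xi> \<noteq> shift r1 r2 k \<zeta>"
  shows "(LINT y:fund|lborel. Th \<xi> w y * cnj (Th \<zeta> v y)) = 0"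
proof -
  have z: "(LINT y:fund|lborel. trm r1 r2 e5 \<xi> (\<lambda>m. w) m y * cnj (Th \<zeta> v y)) = 0" for m
  proof -
    have "(LINT y:fund|lborel. Th \<zeta> v y * (ch (- ph (shift r1 r2 m \<xi>) (fst y)) *
      (pm (e5 * m) * cnj (w (snd y + of_int m))))) = 0"
    proof (rule Th_char_zero[OF assms(2) _ v, where q = "\<lambda>s. pm (e5 * m) * cnj (w (s + of_int m))"])
      show "adm (shift r1 r2 m \<xi>)" using assms by (simp add: adm_shift)
      show "continuous_on UNIV (\<lambda>s. pm (e5 * m) * cnj (w (s + of_int m)))"
        by (intro continuous_intros continuous_shifted w)
      show "shift r1 r2 k \<zeta> \<noteq> shift r1 r2 m \<xi>" for k using ne[of m k] by metis
    qed
    then have "cnj (LINT y:fund|lborel. Th \<zeta> v y * cnj (trm r1 r2 e5 \<xi> (\<lambda>m. w) m y)) = 0"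
      by (simp add: trm_def cnj_ch mult_ac)
    then show ?thesis unfolding set_integral_cnj[symmetric] by (simp add: mult.commute)
  qed
  have "continuous_on UNIV (\<lambda>y. cnj (Th \<zeta> v y))"
    by (intro continuous_intros continuous_Es v)
  from integral_fund_Es[OF w(1) w(2) this, of r1 r2 e5 \<xi>] z show ?thesis by simp
qed

section \<open>The eigenfunctions with nontrivial central character\<close>

definition rh :: "freq \<Rightarrow> real" where "rh = (\<lambda>(x1, x2, x3, x4). rho r1 r2 x1 x2)"

text \<open>The component of (x3, x4) normal to (\<open>r1 * x1\<close>, \<open>r2 * x2\<close>);
  shifts move (x3, x4) parallel to that vector and leave it unchanged.\<close>

definition dd :: "freq \<Rightarrow> real" where
  "dd = (\<lambda>(x1, x2, x3, x4). of_int (r1 * x1 * x4 - r2 * x2 * x3) / rho r1 r2 x1 x2)"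

text \<open>The direction of (\<open>r1 * x1\<close>, \<open>r2 * x2\<close>) as a complex number of
  modulus one.\<close>

definition om :: "freq \<Rightarrow> complex" where
  "om = (\<lambda>(x1, x2, x3, x4). (of_int (r1 * x1) + \<i> * of_int (r2 * x2)) / of_real (rho r1 r2 x1 x2))"

text \<open>Its negative is the point of the line at which (x3 + a t, x4 + b t) is shortest, with a
  = \<open>r1 * x1\<close> and b = \<open>r2 * x2\<close>: the centre of the oscillator.\<close>

definition sg :: "freq \<Rightarrow> real" where
  "sg = (\<lambda>(x1, x2, x3, x4). of_int (x3 * (r1 * x1) + x4 * (r2 * x2)) / (rho r1 r2 x1 x2)\<^sup>2)"

definition be :: "freq \<Rightarrow> real" where "be \<xi> = pi * rh \<xi>"

definition nontriv :: "freq \<Rightarrow> bool" where "nontriv = (\<lambda>(x1, x2, x3, x4). x1 \<noteq> 0 \<or> x2 \<noteq> 0)"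

text \<open>The signed integer records the oscillator level as its absolute value and the branch of
  the square root as its sign; level zero has a single eigenvalue.\<close>

definition mu :: "freq \<Rightarrow> int \<Rightarrow> real" where
  "mu \<xi> \<kappa> = (if \<kappa> = 0 then - (pi * dd \<xi>)
     else of_int (sgn \<kappa>) * sqrt (2 * pi * of_int \<bar>\<kappa>\<bar> * rh \<xi> + (pi * dd \<xi>)\<^sup>2))"

definition cc :: "freq \<Rightarrow> int \<Rightarrow> complex" where "cc \<xi> \<kappa> = \<i> * of_real (mu \<xi> \<kappa> + pi * dd \<xi>)"

definition hk :: "freq \<Rightarrow> nat \<Rightarrow> complex poly" where "hk \<xi> = hermite (be \<xi>) (sg \<xi>)"

text \<open>The value at level zero is harmless, because there \<open>cc\<close> vanishes by the
  choice of \<open>mu \<xi> 0\<close>.\<close>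

definition hpred :: "freq \<Rightarrow> nat \<Rightarrow> complex poly" where
  "hpred \<xi> k = (if k = 0 then 0 else hk \<xi> (k - 1))"

text \<open>Let (u, cnj omega * i * v) be the components, T = beta (t + sigma) and D = pi d. On s =
  u + v and q = u - v the operator without alpha acts by s -> i (q' + T q) + D s and q -> i (s' - T
  s) - D q, that is, by lowering and raising. So q is twice the Hermite function of level k, s is a
  multiple of that of level k - 1, and the second row forces the factor \<open>cc\<close>.\<close>

definition p1 :: "freq \<Rightarrow> int \<Rightarrow> complex poly" where
  "p1 \<xi> \<kappa> = smult (cc \<xi> \<kappa>) (hpred \<xi> (nat \<bar>\<kappa>\<bar>)) + hk \<xi> (nat \<bar>\<kappa>\<bar>)"

definition p2 :: "freq \<Rightarrow> int \<Rightarrow> complex poly" where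
  "p2 \<xi> \<kappa> = smult (cnj (om \<xi>) * \<i>) (smult (cc \<xi> \<kappa>) (hpred \<xi> (nat \<bar>\<kappa>\<bar>)) - hk \<xi> (nat \<bar>\<kappa>\<bar>))"

definition Tw :: "freq \<Rightarrow> complex poly \<Rightarrow> pt \<Rightarrow> complex" where
  "Tw \<xi> p = Th \<xi> (hw (be \<xi>) (sg \<xi>) p)"

definition ef :: "freq \<Rightarrow> int \<Rightarrow> pt \<Rightarrow> spinor" where
  "ef \<xi> \<kappa> = pair (Tw \<xi> (p1 \<xi> \<kappa>)) (Tw \<xi> (p2 \<xi> \<kappa>))"

lemma rh_pos: "nontriv \<xi> \<Longrightarrow> rh \<xi> > 0"
proof -
  assume n: "nontriv \<xi>"
  obtain x1 x2 x3 x4 where \<xi>: "\<xi> = (x1, x2, x3, x4)" by (cases \<xi>)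
  have "r1\<^sup>2 * x1\<^sup>2 > 0 \<or> r2\<^sup>2 * x2\<^sup>2 > 0" using n r1_pos r2_pos by (auto simp: \<xi> nontriv_def)
  moreover have "r1\<^sup>2 * x1\<^sup>2 \<ge> 0" "r2\<^sup>2 * x2\<^sup>2 \<ge> 0" by simp_all
  ultimately have "r1\<^sup>2 * x1\<^sup>2 + r2\<^sup>2 * x2\<^sup>2 > 0" by linarith
  then have "(0 :: real) < of_int (r1\<^sup>2 * x1\<^sup>2 + r2\<^sup>2 * x2\<^sup>2)" by (simp only: of_int_0_less_iff)
  then show ?thesis by (simp add: \<xi> rh_def rho_def)
qed

lemma be_pos: "nontriv \<xi> \<Longrightarrow> be \<xi> > 0" using rh_pos by (simp add: be_def)

lemma rho_square: "(rho r1 r2 x1 x2)\<^sup>2 = (of_int (r1 * x1))\<^sup>2 + (of_int (r2 * x2))\<^sup>2"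
proof -
  have "(0 :: real) \<le> of_int (r1\<^sup>2 * x1\<^sup>2 + r2\<^sup>2 * x2\<^sup>2)" by simp
  then show ?thesis unfolding rho_def by (simp add: power_mult_distrib)
qed

lemma om_unit: "nontriv \<xi> \<Longrightarrow> om \<xi> * cnj (om \<xi>) = 1"
proof -
  assume n: "nontriv \<xi>"
  obtain x1 x2 x3 x4 where \<xi>: "\<xi> = (x1, x2, x3, x4)" by (cases \<xi>)
  let ?a = "of_int (r1 * x1) :: real" and ?b = "of_int (r2 * x2) :: real"
  have r: "rho r1 r2 x1 x2 > 0" using rh_pos[OF n] by (simp add: \<xi> rh_def)
  have "om \<xi> = Complex (?a / rho r1 r2 x1 x2) (?b / rho r1 r2 x1 x2)"
    by (simp add: \<xi> om_def complex_eq_iff)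
  then have "(norm (om \<xi>))\<^sup>2 = (?a / rho r1 r2 x1 x2)\<^sup>2 + (?b / rho r1 r2 x1 x2)\<^sup>2"
    by (simp add: cmod_power2)
  also have "\<dots> = 1" using r
    unfolding power_divide add_divide_distrib[symmetric] rho_square[symmetric] by simp
  finally show ?thesis using complex_norm_square[of "om \<xi>"] by simp
qed

text \<open>The vector (x3, x4) is decomposed along (\<open>r1 * x1\<close>, \<open>r2 * x2\<close>)
  and its normal; as complex numbers, x3 + i x4 = omega (rho sigma + i d).\<close>

lemma om_linear:
  assumes n: "nontriv \<xi>" and \<xi>: "\<xi> = (x1, x2, x3, x4)"
  shows "(of_int x3 + of_int (r1 * x1) * z) + \<i> * (of_int x4 + of_int (r2 * x2) * z) =
      om \<xi> * (of_real (rh \<xi>) * (z + of_real (sg \<xi>)) + \<i> * of_real (dd \<xi>))"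
    and "(of_int x3 + of_int (r1 * x1) * z) - \<i> * (of_int x4 + of_int (r2 * x2) * z) =
      cnj (om \<xi>) * (of_real (rh \<xi>) * (z + of_real (sg \<xi>)) - \<i> * of_real (dd \<xi>))"
proof -
  let ?a = "of_int (r1 * x1) :: complex" and ?b = "of_int (r2 * x2) :: complex"
  define R where "R = complex_of_real (rho r1 r2 x1 x2)"
  have R: "R \<noteq> 0" using rh_pos[OF n] by (simp add: \<xi> rh_def R_def)
  have R2: "R * R = ?a * ?a + ?b * ?b"
  proof -
    have "R * R = of_real ((rho r1 r2 x1 x2)\<^sup>2)" by (simp add: R_def power2_eq_square)
    then show ?thesis unfolding rho_square by (simp add: power2_eq_square)
  qed
  have o: "om \<xi> = (?a + \<i> * ?b) / R" "cnj (om \<xi>) = (?a - \<i> * ?b) / R"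
    by (simp_all add: \<xi> om_def R_def)
  have s: "of_real (rh \<xi>) * of_real (sg \<xi>) = (of_int x3 * ?a + of_int x4 * ?b) / R"
    using R by (simp add: \<xi> rh_def sg_def R_def power2_eq_square)
  have d: "of_real (dd \<xi>) = (?a * of_int x4 - ?b * of_int x3) / R"
    by (simp add: \<xi> dd_def R_def)
  have h: "of_real (rh \<xi>) = R" by (simp add: \<xi> rh_def R_def)
  have e1: "om \<xi> * R = ?a + \<i> * ?b" "cnj (om \<xi>) * R = ?a - \<i> * ?b"
    using R unfolding o(2) by (simp_all add: o(1))
  have e2: "om \<xi> * (of_real (rh \<xi>) * of_real (sg \<xi>) + \<i> * of_real (dd \<xi>)) =
    of_int x3 + \<i> * of_int x4"
  proof -
    have "om \<xi> * (of_real (rh \<xi>) * of_real (sg \<xi>) + \<i> * of_real (dd \<xi>)) =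
      (?a + \<i> * ?b) * ((of_int x3 * ?a + of_int x4 * ?b) + \<i> * (?a * of_int x4 - ?b * of_int x3))
        / (R * R)"
      unfolding o s d using R by (simp add: add_divide_distrib[symmetric])
    also have "(?a + \<i> * ?b) * ((of_int x3 * ?a + of_int x4 * ?b) + \<i> *
      (?a * of_int x4 - ?b * of_int x3)) =
      (?a * ?a + ?b * ?b) * (of_int x3 + \<i> * of_int x4)"
      by (simp add: algebra_simps)
    finally show ?thesis using R unfolding R2[symmetric] by simp
  qed
  have e3: "cnj (om \<xi>) * (of_real (rh \<xi>) * of_real (sg \<xi>) - \<i> * of_real (dd \<xi>)) =
    of_int x3 - \<i> * of_int x4"
    using arg_cong[OF e2, of cnj] by simp
  have "om \<xi> * (of_real (rh \<xi>) * (z + of_real (sg \<xi>)) + \<i> * of_real (dd \<xi>)) =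
      om \<xi> * R * z + om \<xi> * (of_real (rh \<xi>) * of_real (sg \<xi>) + \<i> * of_real (dd \<xi>))"
    by (simp add: h algebra_simps)
  then show "(of_int x3 + ?a * z) + \<i> * (of_int x4 + ?b * z) =
      om \<xi> * (of_real (rh \<xi>) * (z + of_real (sg \<xi>)) + \<i> * of_real (dd \<xi>))"
    unfolding e1 e2 by (simp add: algebra_simps)
  have "cnj (om \<xi>) * (of_real (rh \<xi>) * (z + of_real (sg \<xi>)) - \<i> * of_real (dd \<xi>)) =
      cnj (om \<xi>) * R * z + cnj (om \<xi>) * (of_real (rh \<xi>) * of_real (sg \<xi>) - \<i> * of_real (dd \<xi>))"
    by (simp add: h algebra_simps)
  then show "(of_int x3 + ?a * z) - \<i> * (of_int x4 + ?b * z) =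
      cnj (om \<xi>) * (of_real (rh \<xi>) * (z + of_real (sg \<xi>)) - \<i> * of_real (dd \<xi>))"
    unfolding e1 e3 by (simp add: algebra_simps)
qed

lemma mu_square:
  assumes "nontriv \<xi>"
  shows "(mu \<xi> \<kappa> - pi * dd \<xi>) * (mu \<xi> \<kappa> + pi * dd \<xi>) = 2 * be \<xi> * of_int \<bar>\<kappa>\<bar>"
proof (cases "\<kappa> = 0")
  case False
  have "0 \<le> 2 * pi * of_int \<bar>\<kappa>\<bar> * rh \<xi> + (pi * dd \<xi>)\<^sup>2"
    using rh_pos[OF assms] by (intro add_nonneg_nonneg mult_nonneg_nonneg) auto
  moreover have "(of_int (sgn \<kappa>) :: real)\<^sup>2 = 1" using False by (auto simp: sgn_if)
  ultimately have "(mu \<xi> \<kappa>)\<^sup>2 = 2 * pi * of_int \<bar>\<kappa>\<bar> * rh \<xi> + (pi * dd \<xi>)\<^sup>2"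
    using False by (simp add: mu_def power_mult_distrib)
  then show ?thesis by (simp add: be_def power2_eq_square algebra_simps)
qed (simp add: mu_def)

text \<open>Within one orbit distinct levels have distinct eigenvalues, so symmetry of the operator
  alone gives orthogonality of the corresponding eigenfunctions.\<close>

lemma mu_inj:
  assumes "nontriv \<xi>" "mu \<xi> \<kappa> = mu \<xi> \<kappa>'"
  shows "\<kappa> = \<kappa>'"
proof -
  have "2 * be \<xi> * of_int \<bar>\<kappa>\<bar> = 2 * be \<xi> * of_int \<bar>\<kappa>'\<bar>"
    unfolding mu_square[OF assms(1), symmetric] assms(2) ..
  then have "real_of_int \<bar>\<kappa>\<bar> = of_int \<bar>\<kappa>'\<bar>" using be_pos[OF assms(1)] by (simp del: of_int_abs)
  then have abs: "\<bar>\<kappa>\<bar> = \<bar>\<kappa>'\<bar>" by (simp only: of_int_eq_iff)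
  show ?thesis
  proof (cases "\<kappa> = 0")
    case False
    have "0 < 2 * pi * of_int \<bar>\<kappa>\<bar> * rh \<xi> + (pi * dd \<xi>)\<^sup>2"
      using rh_pos[OF assms(1)] False by (intro add_pos_nonneg mult_pos_pos) auto
    then have "sqrt (2 * pi * of_int \<bar>\<kappa>\<bar> * rh \<xi> + (pi * dd \<xi>)\<^sup>2) > 0" by simp
    moreover have "\<kappa>' \<noteq> 0" using False abs by auto
    ultimately have "sgn \<kappa> = sgn \<kappa>'" using assms(2) False abs by (simp add: mu_def)
    then show ?thesis using abs by (metis abs_mult_sgn mult.commute)
  qed (use abs in auto)
qed

lemma Tw_add: "nontriv \<xi> \<Longrightarrow> Tw \<xi> p y + Tw \<xi> q y = Tw \<xi> (p + q) y"
  unfolding Tw_def Es_add[OF decay_hw decay_hw, OF be_pos be_pos, symmetric]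
  by (simp add: hw_def[abs_def] distrib_right)

lemma Tw_scale: "c * Tw \<xi> p y = Tw \<xi> (smult c p) y"
  unfolding Tw_def Es_scale[symmetric] by (simp add: hw_def[abs_def] mult.assoc)

lemma Tw_diff:
  assumes "nontriv \<xi>"
  shows "Tw \<xi> p y - Tw \<xi> q y = Tw \<xi> (p - q) y"
proof -
  have "Tw \<xi> p y - Tw \<xi> q y = Tw \<xi> p y + (-1) * Tw \<xi> q y" by simp
  also have "\<dots> = Tw \<xi> (p + smult (-1) q) y" unfolding Tw_scale Tw_add[OF assms] ..
  finally show ?thesis by simp
qed

lemma smooth_Tw: "nontriv \<xi> \<Longrightarrow> smooth (Tw \<xi> p)"
  unfolding Tw_def by (rule smooth_Es[OF be_pos gw_hw])

lemma along_Tw: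
  assumes n: "nontriv \<xi>" and \<xi>: "\<xi> = (x1, x2, x3, x4)"
  shows "along (frame r1 r2 1) (Tw \<xi> p) =
    Tw \<xi> (smult (\<i> * of_real pi) ([:of_int x3, of_int (r1 * x1):] * p))"
    and "along (frame r1 r2 2) (Tw \<xi> p) =
      Tw \<xi> (smult (\<i> * of_real pi) ([:of_int x4, of_int (r2 * x2):] * p))"
    and "along (frame r1 r2 3) (Tw \<xi> p) =
      Tw \<xi> (pderiv p - smult (of_real (be \<xi>)) ([:of_real (sg \<xi>), 1:] * p))"
proof -
  note a = along_Es[OF be_pos[OF n] gw_hw gw_hw hw_deriv \<xi>]
  show "along (frame r1 r2 1) (Tw \<xi> p) =
    Tw \<xi> (smult (\<i> * of_real pi) ([:of_int x3, of_int (r1 * x1):] * p))"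
    unfolding Tw_def a by (simp add: hw_def[abs_def] algebra_simps)
  show "along (frame r1 r2 2) (Tw \<xi> p) =
    Tw \<xi> (smult (\<i> * of_real pi) ([:of_int x4, of_int (r2 * x2):] * p))"
    unfolding Tw_def a by (simp add: hw_def[abs_def] algebra_simps)
  show "along (frame r1 r2 3) (Tw \<xi> p) =
    Tw \<xi> (pderiv p - smult (of_real (be \<xi>)) ([:of_real (sg \<xi>), 1:] * p))"
    unfolding Tw_def a ..
qed

lemma Tw_cong: "(\<And>z. poly p z = poly q z) \<Longrightarrow> Tw \<xi> p = Tw \<xi> q"
  unfolding Tw_def hw_def[abs_def] by simp

text \<open>Here T stands for beta (t + sigma), D for pi d, K for 2 beta k, and h, h' for the values
  of the Hermite polynomials of levels k and k - 1; \<open>2 * T * h' - h\<close> is the derivative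
  of the latter.\<close>

lemma eigen_identity1:
  fixes T D c m h h' K :: complex
  assumes "c = \<i> * (m + D)" "(m - D) * (m + D) = K"
  shows "- ((T + \<i> * D) * (\<i> * (c * h' - h))) + \<i> *
    (c * (2 * T * h' - h) + K * h' - T * (c * h' + h)) = m * (c * h' + h)"
  unfolding assms(2)[symmetric] assms(1) by (simp add: algebra_simps)

lemma eigen_identity2:
  fixes T D c m h h' K :: complex
  assumes "c = \<i> * (m + D)" "(m - D) * (m + D) = K"
  shows "- ((T - \<i> * D) * (c * h' + h)) + (c * (2 * T * h' - h) - K * h' - T * (c * h' - h)) =
    m * (\<i> * (c * h' - h))"
  unfolding assms(2)[symmetric] assms(1) by (simp add: algebra_simps)

text \<open>The lowering relation leads to c (mu - D) = 2 i beta k with D = pi d and c =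
  \<open>cc\<close>. Since c = i (mu + D), this is \<open>mu_square\<close>.\<close>

lemma DD_ef:
  assumes n: "nontriv \<xi>"
  shows "DD r1 r2 \<alpha> (ef \<xi> \<kappa>) = (\<lambda>y. (\<alpha> + mu \<xi> \<kappa>) *\<^sub>R ef \<xi> \<kappa> y)"
proof -
  obtain x1 x2 x3 x4 where \<xi>: "\<xi> = (x1, x2, x3, x4)" by (cases \<xi>)
  define k where "k = nat \<bar>\<kappa>\<bar>"
  let ?P = "[:of_int x3, of_int (r1 * x1):] :: complex poly"
    and ?Q = "[:of_int x4, of_int (r2 * x2):] :: complex poly"
  let ?S = "[:of_real (sg \<xi>), 1:] :: complex poly"
  let ?\<beta> = "of_real (be \<xi>) :: complex" and ?m = "of_real (mu \<xi> \<kappa>) :: complex"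
    and ?D = "of_real (pi * dd \<xi>) :: complex"
  let ?c = "cc \<xi> \<kappa>" and ?o = "cnj (om \<xi>)"
  have c: "?c = \<i> * (?m + ?D)" by (simp add: cc_def)
  have K: "(?m - ?D) * (?m + ?D) = 2 * ?\<beta> * of_nat k"
  proof -
    have "(?m - ?D) * (?m + ?D) = of_real ((mu \<xi> \<kappa> - pi * dd \<xi>) * (mu \<xi> \<kappa> + pi * dd \<xi>))" by simp
    also have "\<dots> = of_real (2 * be \<xi> * of_int \<bar>\<kappa>\<bar>)" by (simp only: mu_square[OF n])
    also have "\<dots> = 2 * ?\<beta> * of_nat k" by (simp add: k_def flip: of_int_abs)
    finally show ?thesis .
  qed
  have hd: "pderiv (hk \<xi> k) = smult (2 * ?\<beta> * of_nat k) (hpred \<xi> k)"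
  proof (cases k)
    case (Suc j)
    then show ?thesis using pderiv_hermite[of "be \<xi>" "sg \<xi>" j]
      by (simp add: hk_def hpred_def del: hermite.simps)
  qed (simp add: hk_def hpred_def)
  \<comment> \<open>The recursion solved for the derivative of the lower polynomial. The factor c is
    kept so that the equation also holds at level zero, where c = 0.\<close>
  have hp: "?c * poly (pderiv (hpred \<xi> k)) z =
    ?c * (2 * (?\<beta> * (z + of_real (sg \<xi>))) * poly (hpred \<xi> k) z - poly (hk \<xi> k) z)" for z
  proof (cases k)
    case 0
    then have "\<kappa> = 0" by (simp add: k_def)
    then show ?thesis by (simp add: cc_def mu_def)
  next
    case (Suc j)
    then show ?thesis by (simp add: hk_def hpred_def algebra_simps)
  qed
  note om = om_linear[OF n \<xi>]
  have oo: "om \<xi> * (?o * z) = z" for z using om_unit[OF n] by (simp flip: mult.assoc)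
  have E1: "Tw \<xi> (smult \<i> (smult (\<i> * of_real pi) (?P * p2 \<xi> \<kappa>)) -
    smult (\<i> * of_real pi) (?Q * p2 \<xi> \<kappa>) +
      smult \<i> (pderiv (p1 \<xi> \<kappa>) - smult ?\<beta> (?S * p1 \<xi> \<kappa>))) = Tw \<xi> (smult ?m (p1 \<xi> \<kappa>))"
  proof (rule Tw_cong)
    fix z
    let ?h = "poly (hk \<xi> k) z" and ?h' = "poly (hpred \<xi> k) z" and ?T = "?\<beta> * (z + of_real (sg \<xi>))"
    let ?g = "?o * (\<i> * (?c * ?h' - ?h))"
    have "poly (smult \<i> (smult (\<i> * of_real pi) (?P * p2 \<xi> \<kappa>)) -
      smult (\<i> * of_real pi) (?Q * p2 \<xi> \<kappa>) +
        smult \<i> (pderiv (p1 \<xi> \<kappa>) - smult ?\<beta> (?S * p1 \<xi> \<kappa>))) z =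
      - (of_real pi * ((of_int x3 + of_int (r1 * x1) * z) + \<i> * (of_int x4 + of_int (r2 * x2) * z))
        * ?g) +
      \<i> * (?c * poly (pderiv (hpred \<xi> k)) z + 2 * ?\<beta> * of_nat k * ?h' - ?T * (?c * ?h' + ?h))"
      unfolding p1_def p2_def k_def[symmetric] pderiv_add pderiv_smult hd
      by (simp add: algebra_simps)
    also have "of_real pi * ((of_int x3 + of_int (r1 * x1) * z) + \<i> *
      (of_int x4 + of_int (r2 * x2) * z)) * ?g =
        of_real pi * (of_real (rh \<xi>) * (z + of_real (sg \<xi>)) + \<i> * of_real (dd \<xi>)) * (om \<xi> * ?g)"
      unfolding om by (simp only: mult_ac)
    also have "\<dots> = (?T + \<i> * ?D) * (\<i> * (?c * ?h' - ?h))"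
      unfolding oo by (simp add: be_def algebra_simps)
    finally show "poly (smult \<i> (smult (\<i> * of_real pi) (?P * p2 \<xi> \<kappa>)) -
      smult (\<i> * of_real pi) (?Q * p2 \<xi> \<kappa>) +
        smult \<i> (pderiv (p1 \<xi> \<kappa>) - smult ?\<beta> (?S * p1 \<xi> \<kappa>))) z = poly (smult ?m (p1 \<xi> \<kappa>)) z"
      unfolding hp eigen_identity1[OF c K] by (simp add: p1_def k_def)
  qed
  have E2: "Tw \<xi> (smult \<i> (smult (\<i> * of_real pi) (?P * p1 \<xi> \<kappa>)) +
    smult (\<i> * of_real pi) (?Q * p1 \<xi> \<kappa>) -
      smult \<i> (pderiv (p2 \<xi> \<kappa>) - smult ?\<beta> (?S * p2 \<xi> \<kappa>))) = Tw \<xi> (smult ?m (p2 \<xi> \<kappa>))"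
  proof (rule Tw_cong)
    fix z
    let ?h = "poly (hk \<xi> k) z" and ?h' = "poly (hpred \<xi> k) z" and ?T = "?\<beta> * (z + of_real (sg \<xi>))"
    have "poly (smult \<i> (smult (\<i> * of_real pi) (?P * p1 \<xi> \<kappa>)) +
      smult (\<i> * of_real pi) (?Q * p1 \<xi> \<kappa>) -
        smult \<i> (pderiv (p2 \<xi> \<kappa>) - smult ?\<beta> (?S * p2 \<xi> \<kappa>))) z =
      - (of_real pi * ((of_int x3 + of_int (r1 * x1) * z) - \<i> * (of_int x4 + of_int (r2 * x2) * z))
        * (?c * ?h' + ?h)) +
      ?o * (?c * poly (pderiv (hpred \<xi> k)) z - 2 * ?\<beta> * of_nat k * ?h' - ?T * (?c * ?h' - ?h))"
      unfolding p1_def p2_def k_def[symmetric] pderiv_add pderiv_smult pderiv_diff hd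
      by (simp add: algebra_simps)
    also have "of_real pi * ((of_int x3 + of_int (r1 * x1) * z) - \<i> *
      (of_int x4 + of_int (r2 * x2) * z)) * (?c * ?h' + ?h) =
        ?o * ((?T - \<i> * ?D) * (?c * ?h' + ?h))"
      unfolding om by (simp add: be_def algebra_simps)
    also have "- (?o * ((?T - \<i> * ?D) * (?c * ?h' + ?h))) +
        ?o * (?c * poly (pderiv (hpred \<xi> k)) z - 2 * ?\<beta> * of_nat k * ?h' - ?T * (?c * ?h' - ?h)) =
        ?o * (- ((?T - \<i> * ?D) * (?c * ?h' + ?h)) +
          (?c * poly (pderiv (hpred \<xi> k)) z - 2 * ?\<beta> * of_nat k * ?h' - ?T * (?c * ?h' - ?h)))"
      by (simp only: distrib_left mult_minus_right)
    finally show "poly (smult \<i> (smult (\<i> * of_real pi) (?P * p1 \<xi> \<kappa>)) +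
      smult (\<i> * of_real pi) (?Q * p1 \<xi> \<kappa>) -
        smult \<i> (pderiv (p2 \<xi> \<kappa>) - smult ?\<beta> (?S * p2 \<xi> \<kappa>))) z = poly (smult ?m (p2 \<xi> \<kappa>)) z"
      unfolding hp eigen_identity2[OF c K] by (simp add: p2_def k_def)
  qed
  show ?thesis
    unfolding ef_def DD_pair[OF smooth_Tw[OF n] smooth_Tw[OF n]] along_Tw[OF n \<xi>]
      fun_eq_iff vec_eq_iff forall_2
    unfolding Tw_scale Tw_add[OF n] Tw_diff[OF n] pair_nth E1 E2
    by (simp only: vector_scaleR_component pair_nth)
      (simp add: scaleR_conv_of_real distrib_right flip: Tw_scale Tw_add[OF n])
qed

lemma ef_domain:
  assumes "nontriv \<xi>" "adm \<xi>"
  shows "ef \<xi> \<kappa> \<in> Dirac_domain r1 r2 eps"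
proof -
  have "eqv (Tw \<xi> p)" for p unfolding Tw_def by (rule eqv_Th[OF assms(2)])
  then have "equivariant r1 r2 eps (ef \<xi> \<kappa>)"
    unfolding equivariant_iff forall_2 ef_def by simp
  then show ?thesis
    using assms by (simp add: Dirac_domain_def ef_def smooth_pair smooth_Tw)
qed

lemma continuous_Tw: "nontriv \<xi> \<Longrightarrow> continuous_on UNIV (Tw \<xi> p)"
  by (rule smooth_continuous[OF smooth_Tw])

lemma shift_neq:
  assumes "nontriv \<xi>" "m \<noteq> 0"
  shows "shift r1 r2 m \<xi> \<noteq> \<xi>"
  using assms r1_pos r2_pos by (cases \<xi>) (auto simp: shift_def nontriv_def)

text \<open>The function is tested against its own term m = 0. This test function is not
  equivariant, but all other terms are orthogonal to it, and what remains is the integral of the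
  squared weight.\<close>

lemma ef_nonzero:
  assumes n: "nontriv \<xi>" and a: "adm \<xi>"
  shows "L2norm (ef \<xi> \<kappa>) \<noteq> 0"
proof
  assume z: "L2norm (ef \<xi> \<kappa>) = 0"
  let ?w = "hw (be \<xi>) (sg \<xi>) (p1 \<xi> \<kappa>)"
  let ?k = "nat \<bar>\<kappa>\<bar>"
  define g where "g = (\<lambda>y :: pt. ch (ph \<xi> (fst y)) * ?w (snd y))"
  have cw: "continuous_on UNIV (\<lambda>y :: pt. ?w (snd y))"
    by (rule continuous_on_compose2[OF continuous_hw]) (auto intro!: continuous_intros)
  have cg: "continuous_on UNIV g" unfolding g_def by (intro continuous_intros cw)
  have sq: "sqi (ef \<xi> \<kappa>)"
    by (rule sqi_continuous[OF smooth_continuous_spinor[OF ef_domain[OF n a]]])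
  have "norm (L2ip (ef \<xi> \<kappa>) (sv 1 g)) \<le> 0"
    using L2_Cauchy_Schwarz[OF sq sqi_sv[OF cg, of 1]] z by simp
  then have "0 = (LINT y:fund|lborel. Tw \<xi> (p1 \<xi> \<kappa>) y * cnj (g y))"
    by (simp add: L2ip_eq spip_sv ef_def)
  also have "\<dots> = (LINT y:fund|lborel. Th \<xi> ?w y * (ch (- ph \<xi> (fst y)) * cnj (?w (snd y))))"
    by (simp add: g_def Tw_def cnj_ch)
  also have "\<dots> = (LINT y:fund|lborel. ch (ph \<xi> (fst y)) * ch (- ph \<xi> (fst y)) *
    (?w (snd y) * cnj (?w (snd y))))"
    by (rule Th_char_orthogonal[OF a a decay_hw[OF be_pos[OF n]] continuous_hw,
      where q = "\<lambda>s. cnj (?w s)"])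
      (auto intro!: continuous_intros continuous_hw shift_neq[OF n])
  also have "\<dots> = (LINT y:fund|lborel. ?w (snd y) * cnj (?w (snd y)))"
    by (simp flip: ch_add)
  finally have I: "(LINT y:fund|lborel. ?w (snd y) * cnj (?w (snd y))) = 0" by simp
  \<comment> \<open>The coefficient of degree k comes from the Hermite polynomial of level k alone,
    since the other summand has smaller degree.\<close>
  have "p1 \<xi> \<kappa> \<noteq> 0"
  proof
    assume "p1 \<xi> \<kappa> = 0"
    then have "coeff (p1 \<xi> \<kappa>) ?k = 0" by simp
    moreover have "coeff (hpred \<xi> ?k) ?k = 0"
    proof (cases ?k)
      case (Suc j)
      have "degree (hk \<xi> j) \<le> j" unfolding hk_def using hermite_degree[OF be_pos[OF n]] by blast
      then show ?thesis unfolding Suc by (simp add: hpred_def coeff_eq_0)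
    qed (simp add: hpred_def)
    moreover have "coeff (hk \<xi> ?k) ?k \<noteq> 0" unfolding hk_def using hermite_degree[OF be_pos[OF n]]
      by blast
    ultimately show False by (simp add: p1_def)
  qed
  then obtain s where "0 < s" "s < 1" "?w s \<noteq> 0" by (rule hw_nonzero)
  from integral_fund_norm_nonzero[OF continuous_hw this] I show False by simp
qed

lemma ef_orthogonal:
  assumes n: "nontriv \<xi>" "nontriv \<zeta>" and a: "adm \<xi>" "adm \<zeta>"
    and ne: "\<And>m k. shift r1 r2 m \<xi> \<noteq> shift r1 r2 k \<zeta>"
  shows "L2ip (ef \<xi> \<kappa>) (ef \<zeta> \<kappa>') = 0"
proof -
  have "(LINT y:fund|lborel. Tw \<xi> p y * cnj (Tw \<zeta> q y)) = 0" for p q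
    unfolding Tw_def
    by (rule Th_orthogonal[OF a decay_hw[OF be_pos[OF n(1)]] continuous_hw
      decay_hw[OF be_pos[OF n(2)]] continuous_hw ne])
  then show ?thesis unfolding ef_def using n by (subst L2ip_pairs) (simp_all add: continuous_Tw)
qed

end

section \<open>The eigenfunctions with trivial central character\<close>

definition cf :: "int \<Rightarrow> int \<Rightarrow> int \<Rightarrow> pt \<Rightarrow> complex" where
  "cf x3 x4 x5 y = ch (ph (0, 0, x3, x4) (fst y)) * ch (of_int x5 * snd y)"

definition lf :: "int \<Rightarrow> int \<Rightarrow> int \<Rightarrow> pt \<Rightarrow> real" where
  "lf x3 x4 x5 y = ph (0, 0, x3, x4) (fst y) + of_int x5 * snd y"

lemma has_derivative_cf:
  "((\<lambda>y. c * cf x3 x4 x5 y) has_derivative (\<lambda>h. \<i> * of_real (pi * lf x3 x4 x5 h) *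
    (c * cf x3 x4 x5 y))) (at y)"
proof -
  have "linear (lf x3 x4 x5)"
    by (rule linearI) (simp_all add: lf_def ph_add ph_scale algebra_simps)
  then have "bounded_linear (lf x3 x4 x5)" by (simp add: linear_conv_bounded_linear)
  then have l: "(lf x3 x4 x5 has_derivative lf x3 x4 x5) (at y)"
    by (rule bounded_linear_imp_has_derivative)
  have "((\<lambda>y. \<i> * of_real (pi * lf x3 x4 x5 y)) has_derivative (\<lambda>h. \<i> *
    of_real (pi * lf x3 x4 x5 h))) (at y)"
    by (intro has_derivative_mult_right has_derivative_of_real l)
  from has_derivative_mult_right[OF has_derivative_compose[OF this
    DERIV_exp[unfolded has_field_derivative_def]], of c]
  show ?thesis
    by (simp add: cf_def lf_def ch_add[symmetric]) (simp add: ch_def mult_ac)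
qed

lemma smooth_cf: "smooth (\<lambda>y. c * cf x3 x4 x5 y)"
  and along_cf: "along X (\<lambda>y. c * cf x3 x4 x5 y) =
    (\<lambda>y. \<i> * of_real (pi * lf x3 x4 x5 (X y)) * (c * cf x3 x4 x5 y))"
proof -
  have fd: "frechet_derivative (\<lambda>y. c * cf x3 x4 x5 y) (at y) =
    (\<lambda>h. \<i> * of_real (pi * lf x3 x4 x5 h) * (c * cf x3 x4 x5 y))" for c y
    by (rule frechet_derivative_at[symmetric]) (rule has_derivative_cf)
  have "Ck k (\<lambda>y. c * cf x3 x4 x5 y)" for k
  proof (induction k arbitrary: c)
    case 0
    show ?case unfolding Ck.simps cf_def by (intro continuous_intros)
  next
    case (Suc k)
    have "(\<lambda>y. c * cf x3 x4 x5 y) differentiable (at y)" for y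
      using has_derivative_cf unfolding differentiable_def by blast
    then show ?case using Suc[of "\<i> * of_real (pi * lf x3 x4 x5 _) * c"]
      by (simp add: fd mult.assoc)
  qed
  then show "smooth (\<lambda>y. c * cf x3 x4 x5 y)" by (simp add: smooth_def)
  show "along X (\<lambda>y. c * cf x3 x4 x5 y) =
    (\<lambda>y. \<i> * of_real (pi * lf x3 x4 x5 (X y)) * (c * cf x3 x4 x5 y))"
    by (simp add: along_def fd)
qed

lemma lf_frame:
  "lf x3 x4 x5 (frame r1 r2 1 y) = of_int x3"
  "lf x3 x4 x5 (frame r1 r2 2 y) = of_int x4"
  "lf x3 x4 x5 (frame r1 r2 3 y) = of_int x5"
  by (simp_all add: lf_def frame_fvec fvec_def matA_mult_vec ph_def axis_def)

definition rad :: "int \<Rightarrow> int \<Rightarrow> int \<Rightarrow> real" where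
  "rad x3 x4 x5 = sqrt (of_int (x3\<^sup>2 + x4\<^sup>2 + x5\<^sup>2))"

text \<open>Eigenvectors of the Hermitian matrix with rows \<open>(-x5, -z)\<close> and \<open>(-cnj z, x5)\<close>, where
  \<open>z = x3 + \<i> x4\<close>, for the eigenvalues \<open>\<plusminus>rad x3 x4 x5\<close>.\<close>

definition tv :: "int \<Rightarrow> int \<Rightarrow> int \<Rightarrow> bool \<Rightarrow> complex \<times> complex" where
  "tv x3 x4 x5 b =
    (if x3 = 0 \<and> x4 = 0 then (if (x5 \<ge> 0) = b then (0, 1) else (1, 0))
     else if b then (- (of_int x3 + \<i> * of_int x4), of_real (rad x3 x4 x5) + of_int x5)
     else (of_int x3 + \<i> * of_int x4, of_real (rad x3 x4 x5) - of_int x5))"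

definition tmu :: "int \<Rightarrow> int \<Rightarrow> int \<Rightarrow> bool \<Rightarrow> real" where
  "tmu x3 x4 x5 b = (if b then pi * rad x3 x4 x5 else - (pi * rad x3 x4 x5))"

lemma rad_mult: "complex_of_real (rad x3 x4 x5) * of_real (rad x3 x4 x5) =
    of_int x3 * of_int x3 + of_int x4 * of_int x4 + of_int x5 * of_int x5"
proof -
  have "rad x3 x4 x5 * rad x3 x4 x5 = of_int (x3\<^sup>2 + x4\<^sup>2 + x5\<^sup>2)"
    unfolding rad_def by (rule real_sqrt_mult_self[THEN trans]) simp
  then have "complex_of_real (rad x3 x4 x5 * rad x3 x4 x5) = of_int (x3\<^sup>2 + x4\<^sup>2 + x5\<^sup>2)" by simp
  then show ?thesis by (simp add: power2_eq_square)
qed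

lemma rad_axis: "rad 0 0 x5 = \<bar>of_int x5\<bar>"
  by (simp add: rad_def real_sqrt_abs)

text \<open>When x3 = x4 = 0 the matrix is diagonal and the generic eigenvector can be zero, so
  coordinate vectors take its place. If x5 = 0 as well, both choices have eigenvalue 0 and stay
  independent, which matches the two coinciding deltas.\<close>

lemma tv_eigen:
  "- ((of_int x3 + \<i> * of_int x4) * snd (tv x3 x4 x5 b)) - of_int x5 * fst (tv x3 x4 x5 b) =
    (if b then of_real (rad x3 x4 x5) else - of_real (rad x3 x4 x5)) * fst (tv x3 x4 x5 b)"
  "- ((of_int x3 - \<i> * of_int x4) * fst (tv x3 x4 x5 b)) + of_int x5 * snd (tv x3 x4 x5 b) =
    (if b then of_real (rad x3 x4 x5) else - of_real (rad x3 x4 x5)) * snd (tv x3 x4 x5 b)"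
  using rad_mult[of x3 x4 x5]
  by (auto simp: tv_def rad_axis algebra_simps)

lemma freq_nonzero:
  assumes "\<not> (x3 = 0 \<and> x4 = 0)"
  shows "of_int x3 + \<i> * of_int x4 \<noteq> 0"
  using assms by (auto simp: complex_eq_iff)

lemma tv_nonzero: "fst (tv x3 x4 x5 b) \<noteq> 0 \<or> snd (tv x3 x4 x5 b) \<noteq> 0"
  using freq_nonzero[of x3 x4] by (auto simp: tv_def)

lemma tv_orthogonal:
  assumes "b \<noteq> b'"
  shows "fst (tv x3 x4 x5 b) * cnj (fst (tv x3 x4 x5 b')) + snd (tv x3 x4 x5 b) *
    cnj (snd (tv x3 x4 x5 b')) = 0"
  using assms rad_mult[of x3 x4 x5] by (cases b; cases b') (auto simp: tv_def algebra_simps)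

text \<open>Independence of the two eigenvectors; completeness uses it to recover both components of
  a spinor.\<close>

lemma tv_det: "fst (tv x3 x4 x5 True) * snd (tv x3 x4 x5 False) - snd (tv x3 x4 x5 True) *
  fst (tv x3 x4 x5 False) \<noteq> 0"
proof (cases "x3 = 0 \<and> x4 = 0")
  case False
  have "rad x3 x4 x5 \<noteq> 0"
  proof
    assume "rad x3 x4 x5 = 0"
    then have "x3\<^sup>2 + x4\<^sup>2 + x5\<^sup>2 = 0" unfolding rad_def real_sqrt_eq_0_iff of_int_eq_0_iff .
    then show False using False by (smt (verit) zero_le_power2 zero_eq_power2)
  qed
  moreover define z where "z = complex_of_int x3 + \<i> * of_int x4"
  then have "fst (tv x3 x4 x5 True) * snd (tv x3 x4 x5 False) - snd (tv x3 x4 x5 True) *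
    fst (tv x3 x4 x5 False) =
      - 2 * z * of_real (rad x3 x4 x5)"
    using False by (simp add: tv_def algebra_simps)
  moreover have "z \<noteq> 0" unfolding z_def by (rule freq_nonzero[OF False])
  ultimately show ?thesis by simp
qed (auto simp: tv_def)

definition tf :: "int \<Rightarrow> int \<Rightarrow> int \<Rightarrow> bool \<Rightarrow> pt \<Rightarrow> spinor" where
  "tf x3 x4 x5 b =
    pair (\<lambda>y. fst (tv x3 x4 x5 b) * cf x3 x4 x5 y) (\<lambda>y. snd (tv x3 x4 x5 b) * cf x3 x4 x5 y)"

lemma DD_tf: "DD r1 r2 \<alpha> (tf x3 x4 x5 b) = (\<lambda>y. (\<alpha> + tmu x3 x4 x5 b) *\<^sub>R tf x3 x4 x5 b y)"
proof -
  let ?v = "fst (tv x3 x4 x5 b)" and ?w = "snd (tv x3 x4 x5 b)"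
  let ?m = "complex_of_real (tmu x3 x4 x5 b)"
  have m: "?m = of_real pi * (if b then of_real (rad x3 x4 x5) else - of_real (rad x3 x4 x5))"
    by (simp add: tmu_def)
  have 1: "\<i> * (\<i> * of_real (pi * of_int x3) * (?w * C)) - \<i> * of_real (pi * of_int x4) * (?w * C) +
      \<i> * (\<i> * of_real (pi * of_int x5) * (?v * C)) = ?m * (?v * C)" for C
  proof -
    have "\<i> * (\<i> * of_real (pi * of_int x3) * (?w * C)) - \<i> * of_real (pi * of_int x4) * (?w * C) +
        \<i> * (\<i> * of_real (pi * of_int x5) * (?v * C)) =
      of_real pi * (- ((of_int x3 + \<i> * of_int x4) * ?w) - of_int x5 * ?v) * C"
      by (simp add: algebra_simps)
    then show ?thesis unfolding tv_eigen m by (simp only: mult_ac)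
  qed
  have 2: "\<i> * (\<i> * of_real (pi * of_int x3) * (?v * C)) + \<i> * of_real (pi * of_int x4) * (?v * C) -
      \<i> * (\<i> * of_real (pi * of_int x5) * (?w * C)) = ?m * (?w * C)" for C
  proof -
    have "\<i> * (\<i> * of_real (pi * of_int x3) * (?v * C)) + \<i> * of_real (pi * of_int x4) * (?v * C) -
        \<i> * (\<i> * of_real (pi * of_int x5) * (?w * C)) =
      of_real pi * (- ((of_int x3 - \<i> * of_int x4) * ?v) + of_int x5 * ?w) * C"
      by (simp add: algebra_simps)
    then show ?thesis unfolding tv_eigen m by (simp only: mult_ac)
  qed
  show ?thesis
    unfolding tf_def DD_pair[OF smooth_cf smooth_cf] along_cf lf_frame fun_eq_iff
      vec_eq_iff forall_2
    unfolding vector_scaleR_component pair_nth 1 2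
    by (simp add: scaleR_conv_of_real algebra_simps)
qed

lemma continuous_cf: "continuous_on UNIV (cf x3 x4 x5)"
  using smooth_continuous[OF smooth_cf[of 1 x3 x4 x5]] by simp

lemma norm_cf: "cf x3 x4 x5 y * cnj (cf x3 x4 x5 y) = 1"
proof -
  have "norm (cf x3 x4 x5 y) = 1" by (simp add: cf_def norm_mult)
  then show ?thesis using complex_norm_square[of "cf x3 x4 x5 y"] by simp
qed

lemma measure_fund_pos: "(LINT y:fund|lborel. (1 :: complex)) \<noteq> 0"
  using integral_fund_norm_nonzero[of "\<lambda>_. 1" "1 / 2"] by (simp add: continuous_on_const)

lemma L2ip_tf:
  "L2ip (tf x3 x4 x5 b) (tf y3 y4 y5 b') =
    (fst (tv x3 x4 x5 b) * cnj (fst (tv y3 y4 y5 b')) + snd (tv x3 x4 x5 b) * cnj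
      (snd (tv y3 y4 y5 b'))) *
    (LINT y:fund|lborel. cf x3 x4 x5 y * cnj (cf y3 y4 y5 y))"
proof -
  have m: "(LINT y:fund|lborel. a * cf x3 x4 x5 y * cnj (c * cf y3 y4 y5 y)) =
      a * cnj c * (LINT y:fund|lborel. cf x3 x4 x5 y * cnj (cf y3 y4 y5 y))" for a c
    unfolding set_integral_mult_right[symmetric] by (simp add: mult_ac)
  have c: "continuous_on UNIV (\<lambda>y. a * cf x3 x4 x5 y)" "continuous_on UNIV (\<lambda>y. a * cf y3 y4 y5 y)"
    for a
    by (intro continuous_intros continuous_cf)+
  show ?thesis
    unfolding tf_def L2ip_pairs[OF c(1) c(1) c(2) c(2)] m by (simp add: distrib_right)
qed

lemma tf_nonzero: "L2norm (tf x3 x4 x5 b) \<noteq> 0"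
proof
  assume "L2norm (tf x3 x4 x5 b) = 0"
  then have z: "L2ip (tf x3 x4 x5 b) (tf x3 x4 x5 b) = 0" by (simp add: L2ip_self)
  let ?v = "fst (tv x3 x4 x5 b)" and ?w = "snd (tv x3 x4 x5 b)"
  have "?v * cnj ?v + ?w * cnj ?w = of_real ((norm ?v)\<^sup>2 + (norm ?w)\<^sup>2)"
    by (simp only: complex_norm_square of_real_add)
  moreover have "(norm ?v)\<^sup>2 + (norm ?w)\<^sup>2 \<noteq> 0"
    using tv_nonzero[of x3 x4 x5 b] by (auto simp: sum_power2_eq_zero_iff)
  ultimately have "?v * cnj ?v + ?w * cnj ?w \<noteq> 0" by (simp only: of_real_eq_0_iff not_False_eq_True)
  then show False using z measure_fund_pos unfolding L2ip_tf norm_cf by simp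
qed

section \<open>A complete orthogonal system of eigenfunctions\<close>

datatype idx = Triv int int int bool | Theta freq int

context spin_pos
begin

lemma tf_domain:
  assumes "adm (0, 0, x3, x4)" "even (x5 - e5)"
  shows "tf x3 x4 x5 b \<in> Dirac_domain r1 r2 eps"
proof -
  have "eqv (\<lambda>y. c * cf x3 x4 x5 y)" for c
    unfolding eqv_def
  proof (intro ballI allI)
    fix \<gamma> y :: pt assume "\<gamma> \<in> carrier (grpGamma r1 r2)"
    then obtain n k N where g: "\<gamma> = (n, of_int k)" "\<And>i. n $ i = of_int (N i)" by (rule GammaE) metis
    obtain x s where y: "y = (x, s)" by (cases y)
    have "ph (0, 0, x3, x4) (matA r1 r2 (of_int k) *v x) = ph (0, 0, x3, x4) x"
      by (simp add: ph_def matA_mult_vec axis_def)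
    moreover have "ch (of_int x5 * of_int k) = pm (e5 * k)"
    proof -
      have "ch (of_int x5 * of_int k) = pm (x5 * k)" using ch_of_int[of "x5 * k"] by simp
      also have "\<dots> = pm (e5 * k)" using assms(2) by (intro pm_cong) (simp flip: left_diff_distrib)
      finally show ?thesis .
    qed
    ultimately show "c * cf x3 x4 x5 (\<gamma> \<otimes>\<^bsub>grpG r1 r2\<^esub> y) = pm (eps \<gamma>) * (c * cf x3 x4 x5 y)"
      unfolding g(1) y mult_grpG cf_def fst_conv snd_conv ph_add distrib_left ch_add
        ch_ph_int[OF assms(1) g(2)] pm_eps[OF g(2)] pm_add
      by (simp only: mult_ac)
  qed
  then have "equivariant r1 r2 eps (tf x3 x4 x5 b)"
    unfolding equivariant_iff forall_2 tf_def by simp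
  then show ?thesis by (simp add: Dirac_domain_def tf_def smooth_pair smooth_cf)
qed

lemma cf_orthogonal:
  assumes "adm (0, 0, x3, x4)" "even (x5 - e5)" "adm (0, 0, y3, y4)" "even (y5 - e5)"
    and ne: "(x3, x4, x5) \<noteq> (y3, y4, y5)"
  shows "(LINT y:fund|lborel. cf x3 x4 x5 y * cnj (cf y3 y4 y5 y)) = 0"
proof (cases "x3 = y3 \<and> x4 = y4")
  case True
  have "even (x5 - y5)" using assms by presburger
  then obtain k where k: "x5 - y5 = 2 * k" by blast
  have "cf x3 x4 x5 y * cnj (cf y3 y4 y5 y) = ch (of_int (2 * k) * snd y)" for y
    unfolding k[symmetric] cf_def complex_cnj_mult cnj_ch ch_add[symmetric] using True
    by (simp add: algebra_simps)
  moreover have "k \<noteq> 0" using k ne True by auto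
  ultimately show ?thesis using integral_fund_char_snd by simp
next
  case False
  have "(LINT y:fund|lborel. ch (ph (0, 0, x3, x4) (fst y)) * ch (- ph (0, 0, y3, y4) (fst y)) *
      (ch (of_int x5 * snd y) * ch (- (of_int y5 * snd y)))) = 0"
    using assms(1,3) False
    by (intro integral_char_orthogonal[where q = "\<lambda>s. ch (of_int x5 * s) *
      ch (- (of_int y5 * s))"] continuous_intros) auto
  then show ?thesis by (simp add: cf_def cnj_ch mult_ac)
qed

text \<open>A transversal of the shift orbits: a coordinate that actually moves, x3 if x1 is nonzero
  and x4 otherwise, is reduced modulo its step.\<close>

definition rep :: "freq \<Rightarrow> bool" where
  "rep = (\<lambda>(x1, x2, x3, x4). if x1 \<noteq> 0 then 0 \<le> x3 \<and> x3 < \<bar>r1 * x1\<bar> else x2 \<noteq> 0 \<and>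
    0 \<le> x4 \<and> x4 < \<bar>r2 * x2\<bar>)"

lemma rep_nontriv: "rep \<xi> \<Longrightarrow> nontriv \<xi>"
  by (cases \<xi>) (auto simp: rep_def nontriv_def split: if_splits)

lemma ex_rep:
  assumes "nontriv \<xi>"
  obtains k where "rep (shift r1 r2 k \<xi>)"
proof -
  obtain x1 x2 x3 x4 where \<xi>: "\<xi> = (x1, x2, x3, x4)" by (cases \<xi>)
  \<comment> \<open>The step \<open>a\<close> may be negative, so the quotient by its absolute value
    is multiplied by its sign to give the right number of shifts.\<close>
  have red: "0 \<le> x + - (x div \<bar>a\<bar>) * sgn a * a \<and> x + - (x div \<bar>a\<bar>) * sgn a * a < \<bar>a\<bar>"
    if "a \<noteq> 0" for x a :: int
  proof -
    have "sgn a * a = \<bar>a\<bar>" by (simp add: abs_sgn mult.commute)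
    then have "x + - (x div \<bar>a\<bar>) * sgn a * a = x mod \<bar>a\<bar>"
      by (simp add: mult.assoc minus_div_mult_eq_mod[symmetric])
    then show ?thesis using that by simp
  qed
  show ?thesis
  proof (cases "x1 = 0")
    case False
    then have "r1 * x1 \<noteq> 0" using r1_pos by simp
    from red[OF this, of x3] False have "rep (shift r1 r2 (- (x3 div \<bar>r1 * x1\<bar>) * sgn (r1 * x1)) \<xi>)"
      by (simp add: rep_def shift_def \<xi>)
    then show ?thesis by (rule that)
  next
    case True
    then have "r2 * x2 \<noteq> 0" "x2 \<noteq> 0" using r2_pos assms by (auto simp: nontriv_def \<xi>)
    from red[OF this(1), of x4] True this(2) have
      "rep (shift r1 r2 (- (x4 div \<bar>r2 * x2\<bar>) * sgn (r2 * x2)) \<xi>)"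
      by (simp add: rep_def shift_def \<xi>)
    then show ?thesis by (rule that)
  qed
qed

lemma rep_unique:
  assumes "rep \<xi>" "rep \<zeta>" "shift r1 r2 m \<xi> = shift r1 r2 k \<zeta>"
  shows "\<xi> = \<zeta>"
proof -
  have small: "n = 0" if "0 \<le> x" "x < \<bar>a\<bar>" "0 \<le> x + n * a" "x + n * a < \<bar>a\<bar>" for n x a :: int
  proof (rule ccontr)
    assume "n \<noteq> 0"
    then have "1 * \<bar>a\<bar> \<le> \<bar>n\<bar> * \<bar>a\<bar>" by (intro mult_right_mono) auto
    then have "\<bar>a\<bar> \<le> \<bar>n * a\<bar>" by (simp add: abs_mult)
    then show False using that by linarith
  qed
  obtain x1 x2 x3 x4 where \<xi>: "\<xi> = (x1, x2, x3, x4)" by (cases \<xi>)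
  have "shift r1 r2 (- k) (shift r1 r2 k \<zeta>) = \<zeta>" by (simp add: shift_shift)
  then have z: "\<zeta> = shift r1 r2 (m - k) \<xi>" unfolding assms(3)[symmetric] by (simp add: shift_shift)
  have "m - k = 0"
  proof (cases "x1 = 0")
    case False
    then show ?thesis using assms(1,2) small[of x3 "r1 * x1" "m - k"]
      by (simp add: z \<xi> rep_def shift_def)
  next
    case True
    then show ?thesis using assms(1,2) small[of x4 "r2 * x2" "m - k"]
      by (simp add: z \<xi> rep_def shift_def)
  qed
  then show ?thesis by (simp add: z)
qed

definition J :: "idx set" where
  "J = {Triv x3 x4 x5 b |x3 x4 x5 b. adm (0, 0, x3, x4) \<and> even (x5 - e5)} \<union>
    {Theta \<xi> \<kappa> |\<xi> \<kappa>. adm \<xi> \<and> rep \<xi>}"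

lemma J_Triv: "Triv x3 x4 x5 b \<in> J \<longleftrightarrow> adm (0, 0, x3, x4) \<and> even (x5 - e5)"
  and J_Theta: "Theta \<xi> \<kappa> \<in> J \<longleftrightarrow> adm \<xi> \<and> rep \<xi>"
  unfolding J_def by blast+

definition ev :: "idx \<Rightarrow> real" where
  "ev j = (case j of Triv x3 x4 x5 b \<Rightarrow> tmu x3 x4 x5 b | Theta \<xi> \<kappa> \<Rightarrow> mu \<xi> \<kappa>)"

definition e0 :: "idx \<Rightarrow> pt \<Rightarrow> spinor" where
  "e0 j = (case j of Triv x3 x4 x5 b \<Rightarrow> tf x3 x4 x5 b | Theta \<xi> \<kappa> \<Rightarrow> ef \<xi> \<kappa>)"

lemma countable_J: "countable J"
proof -
  have "J \<subseteq> range (\<lambda>(x3, x4, x5, b). Triv x3 x4 x5 b) \<union> range (\<lambda>(\<xi>, \<kappa>). Theta \<xi> \<kappa>)"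
    by (auto simp: J_def image_iff)
  then show ?thesis by (rule countable_subset) simp
qed

lemma e0_props:
  assumes "j \<in> J"
  shows e0_domain: "e0 j \<in> Dirac_domain r1 r2 eps"
    and DD_e0: "DD r1 r2 \<alpha> (e0 j) = (\<lambda>y. (\<alpha> + ev j) *\<^sub>R e0 j y)"
    and e0_nonzero: "L2norm (e0 j) \<noteq> 0"
proof -
  have "e0 j \<in> Dirac_domain r1 r2 eps \<and> DD r1 r2 \<alpha> (e0 j) = (\<lambda>y. (\<alpha> + ev j) *\<^sub>R e0 j y) \<and>
    L2norm (e0 j) \<noteq> 0"
  proof (cases j)
    case (Triv x3 x4 x5 b)
    then have "adm (0, 0, x3, x4)" "even (x5 - e5)" using assms J_Triv by blast+
    then show ?thesis unfolding Triv e0_def ev_def idx.case using tf_domain DD_tf tf_nonzero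
      by blast
  next
    case (Theta \<xi> \<kappa>)
    then have "adm \<xi>" "nontriv \<xi>" using assms J_Theta rep_nontriv by blast+
    then show ?thesis unfolding Theta e0_def ev_def idx.case using ef_domain DD_ef ef_nonzero
      by blast
  qed
  then show "e0 j \<in> Dirac_domain r1 r2 eps" "DD r1 r2 \<alpha> (e0 j) = (\<lambda>y. (\<alpha> + ev j) *\<^sub>R e0 j y)"
    "L2norm (e0 j) \<noteq> 0"
    by blast+
qed

lemma eigen_orthogonal:
  assumes "f \<in> Dirac_domain r1 r2 eps" "g \<in> Dirac_domain r1 r2 eps"
    and "DD r1 r2 0 f = (\<lambda>y. a *\<^sub>R f y)" "DD r1 r2 0 g = (\<lambda>y. b *\<^sub>R g y)" "a \<noteq> b"
  shows "L2ip f g = 0"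
proof -
  have sc: "l *\<^sub>R v = of_real l *s v" for v :: spinor and l
    by (simp add: vec_eq_iff) (simp add: scaleR_conv_of_real)
  have "of_real a * L2ip f g = L2ip (DD r1 r2 0 f) g" unfolding assms(3) sc L2ip_scale_left ..
  also have "\<dots> = L2ip f (DD r1 r2 0 g)" by (rule DD_symmetric[OF assms(1,2)])
  also have "\<dots> = of_real b * L2ip f g" unfolding assms(4) sc L2ip_scale_right by simp
  finally show ?thesis using assms(5) by simp
qed

lemma tf_ef_orthogonal:
  assumes "adm (0, 0, x3, x4)" "adm \<xi>" "nontriv \<xi>"
  shows "L2ip (ef \<xi> \<kappa>) (tf x3 x4 x5 b) = 0"
proof -
  have z: "(LINT y:fund|lborel. Tw \<xi> p y * cnj (c * cf x3 x4 x5 y)) = 0" for p c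
  proof -
    have "(LINT y:fund|lborel. Th \<xi> (hw (be \<xi>) (sg \<xi>) p) y *
      (ch (- ph (0, 0, x3, x4) (fst y)) * (cnj c * ch (- (of_int x5 * snd y))))) = 0"
      by (rule Th_char_zero[OF assms(2,1) decay_hw[OF be_pos[OF assms(3)]] continuous_hw,
            where q = "\<lambda>s. cnj c * ch (- (of_int x5 * s))"])
        (use assms(3) in \<open>cases \<xi>, auto intro!: continuous_intros simp: shift_def nontriv_def\<close>)
    then show ?thesis by (simp add: Tw_def cf_def cnj_ch mult_ac)
  qed
  have "continuous_on UNIV (\<lambda>y. c * cf x3 x4 x5 y)" for c by (intro continuous_intros continuous_cf)
  then show ?thesis unfolding ef_def tf_def using assms(3)
    by (subst L2ip_pairs) (simp_all only: continuous_Tw z add_0)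
qed

text \<open>Distinct levels over one frequency are separated by their eigenvalues, distinct orbits
  and distinct characters by Fourier orthogonality, and the two spinors over one character by
  orthogonality of the eigenvectors.\<close>

lemma e0_orthogonal:
  assumes i: "i \<in> J" and j: "j \<in> J" and ne: "i \<noteq> j"
  shows "L2ip (e0 i) (e0 j) = 0"
proof -
  have mixed: "L2ip (e0 (Theta \<xi> \<kappa>)) (e0 (Triv x3 x4 x5 b)) = 0"
    if "Theta \<xi> \<kappa> \<in> J" "Triv x3 x4 x5 b \<in> J" for \<xi> \<kappa> x3 x4 x5 b
    using that unfolding J_Theta J_Triv e0_def idx.case
    by (intro tf_ef_orthogonal rep_nontriv) blast+
  show ?thesis
  proof (cases i)
    case iT: (Triv x3 x4 x5 b)
    show ?thesis
    proof (cases j)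
      case jT: (Triv y3 y4 y5 b')
      show ?thesis
      proof (cases "(x3, x4, x5) = (y3, y4, y5)")
        case True
        then have "b \<noteq> b'" using ne iT jT by auto
        then show ?thesis using True tv_orthogonal[of b b' x3 x4 x5]
          by (simp add: e0_def iT jT L2ip_tf)
      next
        case False
        then have "(LINT y:fund|lborel. cf x3 x4 x5 y * cnj (cf y3 y4 y5 y)) = 0"
          using i j unfolding iT jT J_Triv by (intro cf_orthogonal) blast+
        then show ?thesis unfolding iT jT e0_def idx.case L2ip_tf by simp
      qed
    next
      case (Theta \<xi> \<kappa>)
      then have "L2ip (e0 j) (e0 i) = 0" using mixed i j iT by simp
      then show ?thesis by (subst L2ip_commute) simp
    qed
  next
    case iT: (Theta \<xi> \<kappa>)
    show ?thesis
    proof (cases j)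
      case (Triv y3 y4 y5 b')
      then show ?thesis using mixed i j iT by simp
    next
      case jT: (Theta \<zeta> \<kappa>')
      have r: "adm \<xi>" "rep \<xi>" "adm \<zeta>" "rep \<zeta>" using i j unfolding iT jT J_Theta by blast+
      show ?thesis
      proof (cases "\<xi> = \<zeta>")
        case True
        then have "\<kappa> \<noteq> \<kappa>'" using ne iT jT by auto
        then have "0 + ev i \<noteq> 0 + ev j"
          using mu_inj[OF rep_nontriv[OF r(2)], of \<kappa> \<kappa>'] True by (auto simp: ev_def iT jT)
        then show ?thesis
          by (rule eigen_orthogonal[OF e0_domain[OF i] e0_domain[OF j] DD_e0[OF i] DD_e0[OF j]])
      next
        case False
        then have "shift r1 r2 m \<xi> \<noteq> shift r1 r2 k \<zeta>" for m k using rep_unique[OF r(2,4)] by blast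
        then show ?thesis
          unfolding iT jT e0_def idx.case by (intro ef_orthogonal rep_nontriv r)
      qed
    qed
  qed
qed

section \<open>Completeness of the system\<close>

lemma L2ip_Tw:
  assumes "sqi f" "nontriv \<xi>"
  shows "L2ip f (sv i (Tw \<xi> (p + q))) = L2ip f (sv i (Tw \<xi> p)) + L2ip f (sv i (Tw \<xi> q))"
    and "L2ip f (sv i (Tw \<xi> (smult c p))) = cnj c * L2ip f (sv i (Tw \<xi> p))"
proof -
  have "sv i (Tw \<xi> (p + q)) = (\<lambda>y. sv i (Tw \<xi> p) y + sv i (Tw \<xi> q) y)"
    unfolding sv_def fun_eq_iff Tw_add[OF assms(2), symmetric] by (simp add: vec_eq_iff axis_def)
  then show "L2ip f (sv i (Tw \<xi> (p + q))) = L2ip f (sv i (Tw \<xi> p)) + L2ip f (sv i (Tw \<xi> q))"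
    using assms by (simp add: L2ip_add_right sqi_sv continuous_Tw)
  have "sv i (Tw \<xi> (smult c p)) = (\<lambda>y. c *s sv i (Tw \<xi> p) y)"
    unfolding sv_def fun_eq_iff Tw_scale[symmetric] by (simp add: vec_eq_iff axis_def)
  then show "L2ip f (sv i (Tw \<xi> (smult c p))) = cnj c * L2ip f (sv i (Tw \<xi> p))"
    by (simp add: L2ip_scale_right)
qed

text \<open>The eigenfunctions of both signs at one level share their Hermite polynomials but differ
  in \<open>cc\<close>, so the two orthogonality relations separate. This gives orthogonality to
  each Hermite function in each component, and then to all polynomials by induction on the
  degree.\<close>

lemma orthogonal_Tw:
  assumes f: "sqi f" and n: "nontriv \<xi>" and z: "\<And>\<kappa>. L2ip f (ef \<xi> \<kappa>) = 0"
  shows "L2ip f (sv i (Tw \<xi> p)) = 0"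
proof -
  let ?A = "\<lambda>p. L2ip f (sv 1 (Tw \<xi> p))" and ?B = "\<lambda>p. L2ip f (sv 2 (Tw \<xi> p))"
  define w0 where "w0 = cnj (cnj (om \<xi>) * \<i>)"
  have o0: "w0 \<noteq> 0" using om_unit[OF n] by (auto simp: w0_def)
  \<comment> \<open>In these combinations each relation at level k + 1 involves only X at k and Y at
    k + 1; they mirror the sum and difference that the operator raises and lowers.\<close>
  define X where "X k = ?A (hk \<xi> k) + w0 * ?B (hk \<xi> k)" for k
  define Y where "Y k = ?A (hk \<xi> k) - w0 * ?B (hk \<xi> k)" for k
  have minus: "L2ip f (sv j (Tw \<xi> (p - q))) = L2ip f (sv j (Tw \<xi> p)) - L2ip f (sv j (Tw \<xi> q))"
    for j p q
    using L2ip_Tw(1)[OF f n, of j p "smult (-1) q"] L2ip_Tw(2)[OF f n, of j "-1" q] by simp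
  have e: "?A (p1 \<xi> \<kappa>) + ?B (p2 \<xi> \<kappa>) = 0" for \<kappa>
    using z[of \<kappa>] unfolding ef_def L2ip_pair_right[OF f continuous_Tw[OF n] continuous_Tw[OF n]] .
  have eS: "cnj (cc \<xi> \<kappa>) * X k + Y (Suc k) = 0" if "\<bar>\<kappa>\<bar> = int (Suc k)" for \<kappa> k
  proof -
    have "nat \<bar>\<kappa>\<bar> = Suc k" using that by simp
    then show ?thesis
      using e[of \<kappa>] unfolding p1_def p2_def L2ip_Tw[OF f n] minus hpred_def w0_def[symmetric]
      by (simp add: X_def Y_def algebra_simps)
  qed
  have Y0: "Y 0 = 0"
    using e[of 0] unfolding p1_def p2_def L2ip_Tw[OF f n] minus hpred_def w0_def[symmetric]
    by (simp add: Y_def cc_def mu_def)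
  have X: "X k = 0" for k
  proof -
    have "cc \<xi> (int (Suc k)) \<noteq> cc \<xi> (- int (Suc k))"
      using mu_inj[OF n, of "int (Suc k)" "- int (Suc k)"]
      by (auto simp: cc_def simp flip: of_real_add)
    moreover have "cnj (cc \<xi> (int (Suc k))) * X k = cnj (cc \<xi> (- int (Suc k))) * X k"
      using eS[of "int (Suc k)" k] eS[of "- int (Suc k)" k] by (simp add: add_eq_0_iff2)
    ultimately show ?thesis by simp
  qed
  have Y: "Y k = 0" for k
  proof (cases k)
    case (Suc j)
    then show ?thesis using eS[of "int (Suc j)" j] X by simp
  qed (use Y0 in simp)
  have "?A (hk \<xi> k) = 0 \<and> ?B (hk \<xi> k) = 0" for k
  proof -
    have "2 * ?A (hk \<xi> k) = X k + Y k" "2 * (w0 * ?B (hk \<xi> k)) = X k - Y k"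
      by (simp_all add: X_def Y_def)
    then show ?thesis using X Y o0 by simp
  qed
  then have h: "L2ip f (sv i (Tw \<xi> (hk \<xi> k))) = 0" for k
    using exhaust_2[of i] by auto
  have "\<forall>p. degree p \<le> d \<longrightarrow> L2ip f (sv i (Tw \<xi> p)) = 0" for d
  proof (induction d)
    case 0
    show ?case
    proof (intro allI impI)
      fix p :: "complex poly" assume "degree p \<le> 0"
      then obtain a where "p = [:a:]" by (metis degree_eq_zeroE le_zero_eq)
      then have "p = smult a (hk \<xi> 0)" by (simp add: hk_def)
      then show "L2ip f (sv i (Tw \<xi> p)) = 0" using L2ip_Tw(2)[OF f n] h by simp
    qed
  next
    case (Suc d)
    show ?case
    proof (intro allI impI)
      fix p :: "complex poly" assume p: "degree p \<le> Suc d"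
      let ?H = "hk \<xi> (Suc d)"
      have H: "degree ?H \<le> Suc d" "coeff ?H (Suc d) \<noteq> 0"
        unfolding hk_def using hermite_degree[OF be_pos[OF n], of "sg \<xi>" "Suc d"] by blast+
      define q where "q = p - smult (coeff p (Suc d) / coeff ?H (Suc d)) ?H"
      have "degree q \<le> d"
      proof (rule degree_le, intro allI impI)
        fix j assume "d < j"
        then consider "j = Suc d" | "j > Suc d" by linarith
        then show "coeff q j = 0"
          by cases (use H p in \<open>simp_all add: q_def coeff_eq_0\<close>)
      qed
      then have "L2ip f (sv i (Tw \<xi> q)) = 0" using Suc by blast
      then have "L2ip f (sv i (Tw \<xi> (q + smult (coeff p (Suc d) / coeff ?H (Suc d)) ?H))) = 0"
        by (simp only: L2ip_Tw(1)[OF f n] L2ip_Tw(2)[OF f n] h mult_zero_right add_0_left)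
      then show "L2ip f (sv i (Tw \<xi> p)) = 0" by (simp add: q_def)
    qed
  qed
  then show ?thesis by blast
qed

text \<open>A shift by k leaves rho fixed and adds k to \<open>sg\<close>, so the centre of the
  Gaussian follows the translated weight and only the polynomial is recentred.\<close>

lemma Tw_shift:
  assumes "nontriv \<xi>"
  shows "Tw (shift r1 r2 k \<xi>) p = (\<lambda>y. pm (e5 * k) * Tw \<xi> (pcompose p [:- of_int k, 1:]) y)"
proof -
  obtain x1 x2 x3 x4 where \<xi>: "\<xi> = (x1, x2, x3, x4)" by (cases \<xi>)
  have b: "be (shift r1 r2 k \<xi>) = be \<xi>" by (simp add: \<xi> be_def rh_def shift_def)
  have r: "rho r1 r2 x1 x2 \<noteq> 0" using rh_pos[OF assms] by (simp add: \<xi> rh_def)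
  have s: "sg (shift r1 r2 k \<xi>) = sg \<xi> + of_int k"
  proof -
    have "of_int ((x3 + k * (r1 * x1)) * (r1 * x1) + (x4 + k * (r2 * x2)) * (r2 * x2)) =
        of_int (x3 * (r1 * x1) + x4 * (r2 * x2)) + of_int k * (rho r1 r2 x1 x2)\<^sup>2"
      unfolding rho_square by (simp add: power2_eq_square algebra_simps)
    then show ?thesis using r by (simp only: \<xi> sg_def shift_def prod.case add_divide_distrib) simp
  qed
  have "hw (be \<xi>) (sg \<xi> + of_int k) p (\<tau> - of_int k) =
    hw (be \<xi>) (sg \<xi>) (pcompose p [:- of_int k, 1:]) \<tau>" for \<tau>
    by (simp add: hw_def gau_def poly_pcompose)
  then show ?thesis unfolding Tw_def fun_eq_iff b s Th_shift by simp
qed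

text \<open>The family orthogonal to f contains the Gaussian theta series of the chosen
  representatives, by \<open>Tw_shift\<close> those of all nontrivial admissible frequencies, and
  all admissible characters; density then yields every continuous equivariant function.\<close>

lemma e0_complete:
  assumes f: "f \<in> L2 r1 r2 eps" and z: "\<And>j. j \<in> J \<Longrightarrow> L2ip f (e0 j) = 0"
  shows "L2norm f = 0"
proof (rule L2norm_zero_of_orthogonal[OF f])
  have sf: "sqi f" by (rule L2_sqi[OF f])
  fix i and u :: "pt \<Rightarrow> complex" assume u: "continuous_on UNIV u" "eqv u"
  let ?P = "\<lambda>u. continuous_on UNIV u \<and> L2ip f (sv i u) = 0"
  have P: "closedfam ?P" by (rule closedfam_orthogonal[OF sf])
  have theta: "?P (Tw \<xi> p)" if a: "adm \<xi>" and n: "nontriv \<xi>" for \<xi> p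
  proof -
    obtain k where k: "rep (shift r1 r2 k \<xi>)" using ex_rep[OF n] by blast
    define \<zeta> where "\<zeta> = shift r1 r2 k \<xi>"
    have \<zeta>: "rep \<zeta>" "adm \<zeta>" "nontriv \<zeta>" using k a rep_nontriv by (auto simp: \<zeta>_def adm_shift)
    have "L2ip f (ef \<zeta> \<kappa>) = 0" for \<kappa>
      using z[of "Theta \<zeta> \<kappa>"] \<zeta> unfolding J_Theta e0_def idx.case by blast
    then have "?P (Tw \<zeta> q)" for q using orthogonal_Tw[OF sf \<zeta>(3)] continuous_Tw[OF \<zeta>(3)] by blast
    moreover have "\<xi> = shift r1 r2 (- k) \<zeta>" by (simp add: \<zeta>_def shift_shift)
    ultimately show ?thesis
      using closedfam_scale[OF P, of "Tw \<zeta> (pcompose p [:- of_int (- k), 1:])"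
        "pm (e5 * - k)"] Tw_shift[OF \<zeta>(3), of "- k" p]
      by metis
  qed
  have triv: "?P (cf x3 x4 x5)" if a: "adm (0, 0, x3, x4)" "even (x5 - e5)" for x3 x4 x5
  proof -
    let ?A = "L2ip f (sv 1 (cf x3 x4 x5))" and ?B = "L2ip f (sv 2 (cf x3 x4 x5))"
    have sc: "L2ip f (sv j (\<lambda>y. c * cf x3 x4 x5 y)) = cnj c * L2ip f (sv j (cf x3 x4 x5))" for j c
    proof -
      have "sv j (\<lambda>y. c * cf x3 x4 x5 y) = (\<lambda>y. c *s sv j (cf x3 x4 x5) y)"
        by (simp add: sv_def fun_eq_iff vec_eq_iff axis_def)
      then show ?thesis by (simp add: L2ip_scale_right)
    qed
    have c: "continuous_on UNIV (\<lambda>y. c * cf x3 x4 x5 y)" for c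
      by (intro continuous_intros continuous_cf)
    have e: "cnj (fst (tv x3 x4 x5 b)) * ?A + cnj (snd (tv x3 x4 x5 b)) * ?B = 0" for b
    proof -
      have "L2ip f (tf x3 x4 x5 b) = 0"
        using z[of "Triv x3 x4 x5 b"] a unfolding J_Triv e0_def idx.case by blast
      then show ?thesis unfolding tf_def L2ip_pair_right[OF sf c c] sc .
    qed
    define v1 v2 w1 w2 where "v1 = cnj (fst (tv x3 x4 x5 True))"
      and "v2 = cnj (snd (tv x3 x4 x5 True))"
      and "w1 = cnj (fst (tv x3 x4 x5 False))" and "w2 = cnj (snd (tv x3 x4 x5 False))"
    have ee: "v1 * ?A + v2 * ?B = 0" "w1 * ?A + w2 * ?B = 0"
      using e[of True] e[of False] by (simp_all add: v1_def v2_def w1_def w2_def)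
    have "cnj (fst (tv x3 x4 x5 True) * snd (tv x3 x4 x5 False) - snd (tv x3 x4 x5 True) *
      fst (tv x3 x4 x5 False)) \<noteq> 0"
      using tv_det by (simp only: complex_cnj_zero_iff not_False_eq_True)
    then have det: "v1 * w2 - v2 * w1 \<noteq> 0" by (simp add: v1_def v2_def w1_def w2_def)
    \<comment> \<open>Cramer's rule for the two relations given by the eigenvectors.\<close>
    have "(v1 * w2 - v2 * w1) * ?A = w2 * (v1 * ?A + v2 * ?B) - v2 * (w1 * ?A + w2 * ?B)"
      "(v1 * w2 - v2 * w1) * ?B = v1 * (w1 * ?A + w2 * ?B) - w1 * (v1 * ?A + v2 * ?B)"
      by (simp_all add: algebra_simps)
    then have "?A = 0" "?B = 0" using det unfolding ee by simp_all
    then show ?thesis using exhaust_2[of i] continuous_cf by auto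
  qed
  have "?P u"
  proof (rule closedfam_equivariant[OF P _ u])
    fix \<xi> and w :: "real \<Rightarrow> complex"
    assume a: "adm \<xi>" and w: "continuous_on UNIV w" "\<And>\<tau>. \<bar>\<tau>\<bar> \<ge> 1 \<Longrightarrow> w \<tau> = 0"
    show "?P (Th \<xi> w)"
    proof (cases "nontriv \<xi>")
      case True
      show ?thesis
        by (rule closedfam_theta[OF P be_pos[OF True] _ w, where \<sigma> = "sg \<xi>"])
          (use theta[OF a True] in \<open>simp add: Tw_def hw_def[abs_def]\<close>)
    next
      case False
      then obtain x3 x4 where \<xi>: "\<xi> = (0, 0, x3, x4)" by (cases \<xi>) (auto simp: nontriv_def)
      show ?thesis
        by (rule closedfam_trivial[OF P \<xi> _ w]) (use triv a in \<open>simp add: \<xi> cf_def[abs_def]\<close>)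
    qed
  qed
  then show "L2ip f (sv i u) = 0" by blast
qed

lemma spectral_mult_card:
  assumes D: "\<And>\<phi>. Dirac r1 r2 nabla \<phi> = DD r1 r2 \<alpha> \<phi>"
  shows "spectral_mult r1 r2 eps nabla l =
    (if finite {j \<in> J. \<alpha> + ev j = l} then enat (card {j \<in> J. \<alpha> + ev j = l}) else \<infinity>)"
proof (rule spectral_mult_eq[OF D countable_J])
  define e where "e j = (\<lambda>y. of_real (1 / L2norm (e0 j)) *s e0 j y)" for j
  have lin: "e j = (\<lambda>y. 0 + of_real (1 / L2norm (e0 j)) *s e0 j y)" for j by (simp add: e_def)
  have s0: "smooth (\<lambda>y :: pt. 0 :: spinor)" by (simp add: smooth_def Ck_const)
  show "e j \<in> Dirac_domain r1 r2 eps" if "j \<in> J" for j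
  proof -
    have z: "equivariant r1 r2 eps (\<lambda>y. 0)" by (simp add: equivariant_def)
    show ?thesis
      using e0_domain[OF that] unfolding lin Dirac_domain_def mem_Collect_eq
      by (intro conjI smooth_lincomb equivariant_lincomb s0 z) blast+
  qed
  show "DD r1 r2 \<alpha> (e j) = (\<lambda>y. (\<alpha> + ev j) *\<^sub>R e j y)" if j: "j \<in> J" for j
  proof -
    have s: "smooth (e0 j)" using e0_domain[OF j] by (simp add: Dirac_domain_def)
    have z: "DD r1 r2 \<alpha> (\<lambda>y. 0) = (\<lambda>y. 0)"
      by (simp add: DD_def along_def frechet_derivative_const fun_eq_iff vec_eq_iff
        matrix_vector_mult_def)
    have "DD r1 r2 \<alpha> (e j) =
      (\<lambda>y. DD r1 r2 \<alpha> (\<lambda>y. 0) y + of_real (1 / L2norm (e0 j)) *s DD r1 r2 \<alpha> (e0 j) y)"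
      unfolding lin by (rule DD_lincomb[OF s0 s])
    then have "DD r1 r2 \<alpha> (e j) = (\<lambda>y. of_real (1 / L2norm (e0 j)) *s ((\<alpha> + ev j) *\<^sub>R e0 j y))"
      unfolding z DD_e0[OF j] by simp
    then show ?thesis by (simp add: e_def fun_eq_iff vec_eq_iff)
  qed
  show "L2ip (e i) (e j) = (if i = j then 1 else 0)" if i: "i \<in> J" and j: "j \<in> J" for i j
  proof (cases "i = j")
    case True
    have "L2ip (e j) (e j) = of_real (1 / L2norm (e0 j) * (1 / L2norm (e0 j)) * (L2norm (e0 j))\<^sup>2)"
      unfolding e_def L2ip_scale_left L2ip_scale_right L2ip_self by simp
    also have "\<dots> = 1" using e0_nonzero[OF j] by (simp add: power2_eq_square)
    finally show ?thesis using True by simp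
  next
    case False
    then show ?thesis
      unfolding e_def L2ip_scale_left L2ip_scale_right e0_orthogonal[OF i j False] by simp
  qed
  show "L2norm f = 0" if f: "f \<in> L2 r1 r2 eps" and z: "\<And>j. j \<in> J \<Longrightarrow> L2ip f (e j) = 0" for f
  proof (rule e0_complete[OF f])
    fix j assume j: "j \<in> J"
    show "L2ip f (e0 j) = 0"
      using z[OF j] e0_nonzero[OF j] unfolding e_def L2ip_scale_right by simp
  qed
qed

end

section \<open>Counting the eigenfunctions\<close>

text \<open>It agrees with the convention in \<open>hilbert_dim\<close>. Sums of deltas become
  cardinalities of index sets, so the formulas can be compared by bijections.\<close>

definition ecard :: "'a set \<Rightarrow> enat" where
  "ecard S = (if finite S then enat (card S) else \<infinity>)"

lemma ecard_bij_betw: "bij_betw f A B \<Longrightarrow> ecard A = ecard B"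
  by (simp add: ecard_def bij_betw_finite bij_betw_same_card)

lemma ecard_empty [simp]: "ecard {} = 0"
  by (simp add: ecard_def zero_enat_def)

lemma ecard_singleton [simp]: "ecard {x} = 1"
  by (simp add: ecard_def one_enat_def)

lemma ecard_mono: "A \<subseteq> B \<Longrightarrow> ecard A \<le> ecard B"
  by (auto simp: ecard_def card_mono finite_subset)

lemma ecard_Un_disjoint: "A \<inter> B = {} \<Longrightarrow> ecard (A \<union> B) = ecard A + ecard B"
  by (auto simp: ecard_def card_Un_disjoint)

lemma ecard_le:
  assumes "\<And>G. finite G \<Longrightarrow> G \<subseteq> S \<Longrightarrow> enat (card G) \<le> c"
  shows "ecard S \<le> c"
proof (cases "finite S")
  case True
  then show ?thesis using assms[of S] by (simp add: ecard_def)
next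
  case False
  have "enat n \<le> c" for n
    using infinite_arbitrarily_large[OF False, of n] assms by blast
  then have "c = \<infinity>" by (cases c) (auto, metis Suc_n_not_le_n)
  then show ?thesis by simp
qed

lemma ecard_Sigma_finite: "finite F \<Longrightarrow> ecard (Sigma F B) = (\<Sum>x\<in>F. ecard (B x))"
proof (induction F rule: finite_induct)
  case (insert x F)
  have "Sigma (insert x F) B = {x} \<times> B x \<union> Sigma F B" by auto
  moreover have "ecard ({x} \<times> B x) = ecard (B x)"
    by (rule ecard_bij_betw[of snd]) (auto simp: bij_betw_def inj_on_def image_def)
  moreover have "{x} \<times> B x \<inter> Sigma F B = {}" using insert by auto
  ultimately show ?case using insert by (simp add: ecard_Un_disjoint)
qed simp

text \<open>The sum is the supremum of its finite partial sums, and a finite subset of the disjoint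
  union meets only finitely many fibres.\<close>

lemma infsum_ecard: "(\<Sum>\<^sub>\<infinity>x\<in>A. ecard (B x)) = ecard (Sigma A B)"
proof -
  have "(\<Sum>\<^sub>\<infinity>x\<in>A. ecard (B x)) = (SUP F\<in>{F. finite F \<and> F \<subseteq> A}. \<Sum>x\<in>F. ecard (B x))"
    by (rule nonneg_infsum_complete) simp
  also have "\<dots> = ecard (Sigma A B)"
  proof (rule antisym)
    show "(SUP F\<in>{F. finite F \<and> F \<subseteq> A}. \<Sum>x\<in>F. ecard (B x)) \<le> ecard (Sigma A B)"
      by (intro SUP_least) (auto simp: ecard_Sigma_finite[symmetric] intro!: ecard_mono)
    show "ecard (Sigma A B) \<le> (SUP F\<in>{F. finite F \<and> F \<subseteq> A}. \<Sum>x\<in>F. ecard (B x))"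
    proof (rule ecard_le)
      fix G assume G: "finite G" "G \<subseteq> Sigma A B"
      have "enat (card G) \<le> ecard (Sigma (fst ` G) B)"
        using G ecard_mono[of G "Sigma (fst ` G) B"] by (force simp: ecard_def)
      also have "\<dots> = (\<Sum>x\<in>fst ` G. ecard (B x))"
        using G by (intro ecard_Sigma_finite) simp
      also have "\<dots> \<le> (SUP F\<in>{F. finite F \<and> F \<subseteq> A}. \<Sum>x\<in>F. ecard (B x))"
        using G by (intro SUP_upper) auto
      finally show "enat (card G) \<le> \<dots>" .
    qed
  qed
  finally show ?thesis .
qed

lemma ecard_times: "of_nat n * ecard B = ecard ({..<n} \<times> B)"
  by (simp add: ecard_Sigma_finite)

text \<open>Indexing by truth values keeps the count two when the two eigenvalues coincide.\<close>

lemma delta_pair: "delta a l + delta b l = ecard {c. (if c then a else b) = l}"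
proof -
  have "{c. (if c then a else b) = l} = (if a = l then {True} else {}) \<union> (if b =
    l then {False} else {})"
    by (auto split: if_splits)
  then show ?thesis by (subst \<open>_ = _\<close>, subst ecard_Un_disjoint) (auto simp: delta_def)
qed

text \<open>The single delta and the pairs over positive k are merged into one family over the
  integers, matching the signed level in \<open>mu\<close>.\<close>

lemma delta_sum_int:
  assumes "a = m 0" "\<And>k. k > 0 \<Longrightarrow> u k = m (int k)" "\<And>k. k > 0 \<Longrightarrow> v k = m (- int k)"
  shows "delta a l + (\<Sum>\<^sub>\<infinity>k\<in>{1::nat..}. delta (u k) l + delta (v k) l) = ecard {\<kappa>::int. m \<kappa> = l}"
proof -
  have "(\<Sum>\<^sub>\<infinity>k\<in>{1::nat..}. delta (u k) l + delta (v k) l) =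
    (\<Sum>\<^sub>\<infinity>k\<in>{1::nat..}. delta (m (int k)) l + delta (m (- int k)) l)"
    using assms(2,3) by (intro infsum_cong) auto
  note * = this assms(1)
  let ?S = "Sigma {1::nat..} (\<lambda>k. {c. (if c then m (int k) else m (- int k)) = l})"
  have "bij_betw (\<lambda>(k, c). if c then int k else - int k) ?S {\<kappa>. \<kappa> \<noteq> 0 \<and> m \<kappa> = l}"
  proof (rule bij_betw_byWitness[of _ "\<lambda>\<kappa>. (nat \<bar>\<kappa>\<bar>, \<kappa> > 0)"])
    show "(\<lambda>(k, c). if c then int k else - int k) ` ?S \<subseteq> {\<kappa>. \<kappa> \<noteq> 0 \<and> m \<kappa> = l}"
      by (rule image_subsetI) (simp add: case_prod_unfold mem_Sigma_iff split_beta Sigma_def; force)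
    show "(\<lambda>\<kappa>. (nat \<bar>\<kappa>\<bar>, \<kappa> > 0)) ` {\<kappa>. \<kappa> \<noteq> 0 \<and> m \<kappa> = l} \<subseteq> ?S"
      by (rule image_subsetI) (auto split: if_splits)
  qed auto
  then have S: "ecard ?S = ecard {\<kappa>. \<kappa> \<noteq> 0 \<and> m \<kappa> = l}" by (rule ecard_bij_betw)
  have "{\<kappa>. \<kappa> = 0 \<and> m \<kappa> = l} = (if m 0 = l then {0} else {})" by auto
  then have z: "ecard {\<kappa>. \<kappa> = 0 \<and> m \<kappa> = l} = delta (m 0) l" by (auto simp: delta_def)
  have "{\<kappa>. m \<kappa> = l} = {\<kappa>. \<kappa> = 0 \<and> m \<kappa> = l} \<union> {\<kappa>. \<kappa> \<noteq> 0 \<and> m \<kappa> = l}" by auto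
  also have "ecard \<dots> = delta (m 0) l + ecard ?S"
    by (subst ecard_Un_disjoint) (blast, simp only: z S)
  finally show ?thesis unfolding * by (simp add: delta_pair infsum_ecard)
qed

section \<open>Comparison with the four sums of the formula\<close>

context spin_pos
begin

lemma e_values: "e1 = 0 \<or> e1 = 1" "e2 = 0 \<or> e2 = 1" "e3 = 0 \<or> e3 = 1" "e4 = 0 \<or> e4 = 1"
  unfolding e1_def e2_def e3_def e4_def
  by (intro eps_values; auto simp: carrier_grpGamma axis_def)+

lemma ecard_Triv:
  "ecard {Triv x3 x4 x5 b |x3 x4 x5 b. adm (0, 0, x3, x4) \<and> even (x5 - e5) \<and>
    \<alpha> + tmu x3 x4 x5 b = l} =
    mpart1 e1 e2 e3 e4 e5 \<alpha> l" (is "ecard ?T = _")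
proof (cases "e1 = 1 \<or> e2 = 1")
  case True
  then have t: "?T = {}" by (auto simp: adm_def)
  show ?thesis unfolding t using True by (simp add: mpart1_def)
next
  case False
  then have e: "e1 = 0" "e2 = 0" using e_values by auto
  let ?S = "Sigma (coset2 e3 \<times> coset2 e4 \<times> coset2 e5) (\<lambda>(x3, x4, x5). {b. \<alpha> + tmu x3 x4 x5 b = l})"
  have "bij_betw (\<lambda>((x3, x4, x5), b). Triv x3 x4 x5 b) ?S ?T"
    by (rule bij_betw_byWitness[of _ "\<lambda>j. case j of Triv x3 x4 x5 b \<Rightarrow> ((x3, x4, x5), b)"])
      (auto simp: e adm_def coset2_iff)
  then have "ecard ?T = ecard ?S" by (rule ecard_bij_betw[symmetric])
  also have "\<dots> = mpart1 e1 e2 e3 e4 e5 \<alpha> l"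
    unfolding infsum_ecard[symmetric] mpart1_def
    by (simp add: e delta_pair case_prod_unfold tmu_def rad_def if_distrib[of "\<lambda>x. \<alpha> +
      x"] cong: if_cong)
  finally show ?thesis .
qed

lemma abs_sgn_div: "a * b / \<bar>a\<bar> = sgn a * b" if "a \<noteq> 0" for a b :: real
  using that by (cases "a > 0") simp_all

lemma mu_x1:
  assumes "x1 \<noteq> 0"
  shows "mu (x1, 0, x3, x4) 0 = - (pi * sgn (of_int (r1 * x1)) * of_int x4)"
    and "k > 0 \<Longrightarrow> mu (x1, 0, x3, x4) (int k) =
      sqrt (2 * pi * of_nat k * of_int \<bar>r1 * x1\<bar> + pi\<^sup>2 * (of_int x4)\<^sup>2)"
    and "k > 0 \<Longrightarrow> mu (x1, 0, x3, x4) (- int k) =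
      - sqrt (2 * pi * of_nat k * of_int \<bar>r1 * x1\<bar> + pi\<^sup>2 * (of_int x4)\<^sup>2)"
proof -
  have r: "rho r1 r2 x1 0 = of_int \<bar>r1 * x1\<bar>"
    by (simp add: rho_def real_sqrt_mult abs_mult)
  have n: "real_of_int (r1 * x1) \<noteq> 0" using r1_pos assms by simp
  have d: "dd (x1, 0, x3, x4) = sgn (of_int (r1 * x1)) * of_int x4"
    unfolding dd_def prod.case r of_int_abs using abs_sgn_div[OF n, of "of_int x4"] by simp
  have s: "(sgn (real_of_int (r1 * x1)))\<^sup>2 = 1" using n by (simp add: sgn_if)
  show "mu (x1, 0, x3, x4) 0 = - (pi * sgn (of_int (r1 * x1)) * of_int x4)"
    by (simp only: mu_def d) simp
  show "k > 0 \<Longrightarrow> mu (x1, 0, x3, x4) (int k) =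
      sqrt (2 * pi * of_nat k * of_int \<bar>r1 * x1\<bar> + pi\<^sup>2 * (of_int x4)\<^sup>2)"
    "k > 0 \<Longrightarrow> mu (x1, 0, x3, x4) (- int k) =
      - sqrt (2 * pi * of_nat k * of_int \<bar>r1 * x1\<bar> + pi\<^sup>2 * (of_int x4)\<^sup>2)"
    by (simp_all only: mu_def d rh_def prod.case r power_mult_distrib s) simp_all
qed

lemma mu_x2:
  assumes "x2 \<noteq> 0"
  shows "mu (0, x2, x3, x4) 0 = pi * sgn (of_int (r2 * x2)) * of_int x3"
    and "k > 0 \<Longrightarrow> mu (0, x2, x3, x4) (int k) =
      sqrt (2 * pi * of_nat k * of_int \<bar>r2 * x2\<bar> + pi\<^sup>2 * (of_int x3)\<^sup>2)"
    and "k > 0 \<Longrightarrow> mu (0, x2, x3, x4) (- int k) =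
      - sqrt (2 * pi * of_nat k * of_int \<bar>r2 * x2\<bar> + pi\<^sup>2 * (of_int x3)\<^sup>2)"
proof -
  have r: "rho r1 r2 0 x2 = of_int \<bar>r2 * x2\<bar>"
    by (simp add: rho_def real_sqrt_mult abs_mult)
  have n: "real_of_int (r2 * x2) \<noteq> 0" using r2_pos assms by simp
  have d: "dd (0, x2, x3, x4) = - sgn (of_int (r2 * x2)) * of_int x3"
    unfolding dd_def prod.case r of_int_abs using abs_sgn_div[OF n, of "of_int x3"] by simp
  have s: "(sgn (real_of_int (r2 * x2)))\<^sup>2 = 1" using n by (simp add: sgn_if)
  show "mu (0, x2, x3, x4) 0 = pi * sgn (of_int (r2 * x2)) * of_int x3"
    by (simp only: mu_def d) simp
  show "k > 0 \<Longrightarrow> mu (0, x2, x3, x4) (int k) =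
      sqrt (2 * pi * of_nat k * of_int \<bar>r2 * x2\<bar> + pi\<^sup>2 * (of_int x3)\<^sup>2)"
    "k > 0 \<Longrightarrow> mu (0, x2, x3, x4) (- int k) =
      - sqrt (2 * pi * of_nat k * of_int \<bar>r2 * x2\<bar> + pi\<^sup>2 * (of_int x3)\<^sup>2)"
    by (simp_all only: mu_def d rh_def prod.case r power_mult_distrib s power2_minus) simp_all
qed

lemma mu_lambda:
  shows "\<alpha> + mu (x1, x2, x3, x4) 0 = lambda0 r1 r2 \<alpha> x1 x2 x3 x4"
    and "k > 0 \<Longrightarrow> \<alpha> + mu (x1, x2, x3, x4) (int k) = lambda_k r1 r2 \<alpha> 1 k x1 x2 x3 x4"
    and "k > 0 \<Longrightarrow> \<alpha> + mu (x1, x2, x3, x4) (- int k) = lambda_k r1 r2 \<alpha> (-1) k x1 x2 x3 x4"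
proof -
  have s: "(pi * (x / rho r1 r2 x1 x2))\<^sup>2 = pi\<^sup>2 * (x\<^sup>2 / of_int (r1\<^sup>2 * x1\<^sup>2 + r2\<^sup>2 * x2\<^sup>2))" for x
    unfolding power_mult_distrib power_divide rho_square by (simp add: power_mult_distrib)
  show "\<alpha> + mu (x1, x2, x3, x4) 0 = lambda0 r1 r2 \<alpha> x1 x2 x3 x4"
    by (simp add: mu_def dd_def lambda0_def)
  show "k > 0 \<Longrightarrow> \<alpha> + mu (x1, x2, x3, x4) (int k) = lambda_k r1 r2 \<alpha> 1 k x1 x2 x3 x4"
    "k > 0 \<Longrightarrow> \<alpha> + mu (x1, x2, x3, x4) (- int k) = lambda_k r1 r2 \<alpha> (-1) k x1 x2 x3 x4"
    by (simp_all only: mu_def dd_def rh_def prod.case lambda_k_def s) simp_all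
qed

definition Theta_set :: "(int \<Rightarrow> int \<Rightarrow> bool) \<Rightarrow> real \<Rightarrow> (freq \<times> int) set" where
  "Theta_set P c = {((x1, x2, x3, x4), \<kappa>). adm (x1, x2, x3, x4) \<and> rep (x1, x2, x3, x4) \<and> P x1 x2 \<and>
     mu (x1, x2, x3, x4) \<kappa> = c}"

text \<open>The interval of length d q splits into d / 2 blocks of length 2 q. Moving x by 2 q is
  compensated by moving y by 2 c, which permutes the coset of y, so every block contributes the same
  number.\<close>

lemma ecard_strip:
  fixes q d c :: int
  assumes "even d" "d \<ge> 0" "q > 0" and K: "\<And>i x y. K (x + 2 * i * q) (y + 2 * i * c) = K x y"
  shows "ecard ({..<nat (d div 2)} \<times> Sigma (coset2 e \<inter>
    {0..2 * q - 1}) (\<lambda>x. Sigma (coset2 e') (K x))) =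
    ecard (Sigma {x \<in> coset2 e. 0 \<le> x \<and> x < d * q} (\<lambda>x. Sigma (coset2 e') (K x)))" (is "ecard
      ?A = ecard ?B")
proof (rule ecard_bij_betw)
  obtain h where h: "d = 2 * h" using \<open>even d\<close> by blast
  let ?f = "\<lambda>(i, x, y, \<kappa>). (x + 2 * int i * q, y + 2 * int i * c, \<kappa>)"
  \<comment> \<open>Division of x by \<open>2 * q\<close> returns the number of the block and the
    position in it; y is moved back accordingly.\<close>
  let ?g = "\<lambda>(x, y, \<kappa>). (nat (x div (2 * q)), x mod (2 * q), y - 2 * (x div (2 * q)) * c, \<kappa>)"
  show "bij_betw ?f ?A ?B"
  proof (rule bij_betw_byWitness[of _ ?g])
    show "\<forall>a\<in>?A. ?g (?f a) = a"
    proof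
      fix a assume "a \<in> ?A"
      then obtain i x y \<kappa> where a: "a = (i, x, y, \<kappa>)" "0 \<le> x" "x < 2 * q" by auto
      have "(x + int i * (2 * q)) div (2 * q) = int i" "(x + int i * (2 * q)) mod (2 * q) = x"
        using a(2,3) assms(3) by simp_all
      moreover have "x + int i * (2 * q) = x + 2 * int i * q" by simp
      ultimately show "?g (?f a) = a" by (simp add: a(1))
    qed
    show "\<forall>b\<in>?B. ?f (?g b) = b"
    proof
      fix b assume "b \<in> ?B"
      then obtain x y \<kappa> where b: "b = (x, y, \<kappa>)" "0 \<le> x" by auto
      have "int (nat (x div (2 * q))) = x div (2 * q)"
        using assms(3) b(2) by (simp add: pos_imp_zdiv_nonneg_iff)
      moreover have "x mod (2 * q) + 2 * (x div (2 * q)) * q = x"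
        using mod_mult_div_eq[of x "2 * q"] by (simp add: mult_ac)
      ultimately show "?f (?g b) = b" by (simp add: b(1))
    qed
    show "?f ` ?A \<subseteq> ?B"
    proof (rule image_subsetI)
      fix a assume "a \<in> ?A"
      then obtain i x y \<kappa> where a: "a = (i, x, y, \<kappa>)" "int i < h" "x \<in> coset2 e"
        "0 \<le> x" "x \<le> 2 * q - 1"
        "y \<in> coset2 e'" "\<kappa> \<in> K x y" by (auto simp: h)
      have "(int i + 1) * q \<le> h * q" using a(2) assms(3) by (intro mult_right_mono) auto
      then have "x + 2 * int i * q < d * q" using a(5) by (simp add: h algebra_simps)
      moreover have "0 \<le> x + 2 * int i * q" using a(4) assms(3) by simp
      ultimately show "?f a \<in> ?B" using a K[of x "int i" y] by (auto simp: coset2_iff)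
    qed
    show "?g ` ?B \<subseteq> ?A"
    proof (rule image_subsetI)
      fix b assume "b \<in> ?B"
      then obtain x y \<kappa> where b: "b = (x, y, \<kappa>)" "x \<in> coset2 e" "0 \<le> x" "x < d * q"
        "y \<in> coset2 e'" "\<kappa> \<in> K x y"
        by auto
      define i where "i = x div (2 * q)"
      have x: "x = x mod (2 * q) + 2 * i * q"
        using mod_mult_div_eq[of x "2 * q"] by (simp add: i_def mult_ac)
      have m: "0 \<le> x mod (2 * q)" "x mod (2 * q) < 2 * q" using assms(3) by simp_all
      have i0: "0 \<le> i" using assms(3) b(3) by (simp add: i_def pos_imp_zdiv_nonneg_iff)
      have "2 * i * q \<le> x" using x m(1) by linarith
      also have "x < h * (2 * q)" using b(4) by (simp add: h)
      finally have "i * (2 * q) < h * (2 * q)" by (simp add: mult_ac)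
      then have i: "i < h" using assms(3) by (simp add: mult_less_cancel_right)
      have "K (x mod (2 * q)) (y - 2 * i * c) = K x y"
        using K[of "x mod (2 * q)" i "y - 2 * i * c"] x by simp
      moreover have "even (x mod (2 * q) - e)"
      proof -
        have "x mod (2 * q) - e = (x - e) - 2 * (i * q)" using x by simp
        then show ?thesis using b(2) unfolding coset2_iff by simp
      qed
      ultimately show "?g b \<in> ?A" using b i i0 m by (auto simp: coset2_iff h i_def[symmetric])
    qed
  qed
qed

text \<open>The case q = 1 with no motion in y: a block of length 2 contains exactly one element of
  the coset.\<close>

lemma ecard_strip_1:
  assumes "e = 0 \<or> e = 1" "even d" "d \<ge> 0"
  shows "of_nat (nat (d div 2)) * ecard (Sigma (coset2 e') K) =
    ecard (Sigma {x \<in> coset2 e. 0 \<le> x \<and> x < d} (\<lambda>x. Sigma (coset2 e') K))"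
proof -
  have "coset2 e \<inter> {0..2 * 1 - 1} = {e}"
  proof -
    have "x = e" if "even (x - e)" "0 \<le> x" "x \<le> 1" for x using that assms(1) by presburger
    then show ?thesis using assms(1) by (auto simp: coset2_iff)
  qed
  then show ?thesis
    using ecard_strip[of d 1 "\<lambda>x. K" 0 e e'] assms(2,3) by (simp add: ecard_Sigma_finite)
qed

text \<open>For x2 = 0 the eigenvalue does not depend on x3, so the representatives of x3 modulo
  \<open>r1 * x1\<close> only contribute their number, half of
  \<open>\<bar>r1 * x1\<bar>\<close>.\<close>

lemma ecard_Theta_x1:
  "ecard (Theta_set (\<lambda>x1 x2. x1 \<noteq> 0 \<and> x2 = 0) (l - \<alpha>)) = mpart2 r1 e1 e2 e4 \<alpha> l"
  (is "ecard ?T = _")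
proof (cases "e2 = 1")
  case True
  then have t: "?T = {}" by (auto simp: Theta_set_def adm_def)
  show ?thesis unfolding t using True by (simp add: mpart2_def)
next
  case False
  then have e: "e2 = 0" using e_values by auto
  define m where "m x1 x4 = mu (x1, 0, 0, x4)" for x1 x4
  let ?K = "\<lambda>x1 x4. {\<kappa>. \<alpha> + m x1 x4 \<kappa> = l}"
  let ?S = "SIGMA x1:coset2 e1 - {0}. SIGMA x3:{x \<in> coset2 e3. 0 \<le> x \<and> x <
    \<bar>r1 * x1\<bar>}. Sigma (coset2 e4) (?K x1)"
  have mu: "mu (x1, 0, x3, x4) = m x1 x4" for x1 x3 x4
    by (simp add: m_def fun_eq_iff mu_def dd_def rh_def)
  have "bij_betw (\<lambda>(x1, x3, x4, \<kappa>). ((x1, 0, x3, x4), \<kappa>)) ?S ?T"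
    by (rule bij_betw_byWitness[of _ "\<lambda>((x1, x2, x3, x4), \<kappa>). (x1, x3, x4, \<kappa>)"])
      (auto simp: Theta_set_def adm_def rep_def coset2_iff e mu)
  then have "ecard ?T = ecard ?S" by (rule ecard_bij_betw[symmetric])
  also have "\<dots> =
    (\<Sum>\<^sub>\<infinity>x1\<in>coset2 e1 - {0}. of_nat (nat (\<bar>r1 * x1\<bar> div 2)) * ecard (Sigma (coset2 e4) (?K x1)))"
    unfolding infsum_ecard[symmetric]
  proof (rule infsum_cong)
    fix x1 assume "x1 \<in> coset2 e1 - {0}"
    then have "even \<bar>r1 * x1\<bar>"
      using adm_even(1)[of x1 0 e3 e4] by (simp add: adm_def e coset2_iff)
    from ecard_strip_1[OF e_values(3) this, of e4 "?K x1"]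
    show "(\<Sum>\<^sub>\<infinity>x3\<in>{x \<in> coset2 e3. 0 \<le> x \<and> x < \<bar>r1 * x1\<bar>}. \<Sum>\<^sub>\<infinity>x4\<in>coset2 e4. ecard (?K x1 x4)) =
        of_nat (nat (\<bar>r1 * x1\<bar> div 2)) * (\<Sum>\<^sub>\<infinity>x4\<in>coset2 e4. ecard (?K x1 x4))"
      by (simp only: infsum_ecard abs_ge_zero)
  qed
  also have "\<dots> = mpart2 r1 e1 e2 e4 \<alpha> l"
    unfolding infsum_ecard[symmetric] mpart2_def
    by (simp only: e zero_neq_one if_False, rule sym)
      (intro infsum_cong arg_cong2[where f = "(*)"] refl delta_sum_int; simp add: m_def mu_x1)
  finally show ?thesis .
qed

text \<open>The mirror case: now x4 is the coordinate reduced by the shifts, and the eigenvalue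
  depends on x3.\<close>

lemma ecard_Theta_x2:
  "ecard (Theta_set (\<lambda>x1 x2. x1 = 0 \<and> x2 \<noteq> 0) (l - \<alpha>)) = mpart3 r2 e1 e2 e3 \<alpha> l"
  (is "ecard ?T = _")
proof (cases "e1 = 1")
  case True
  then have t: "?T = {}" by (auto simp: Theta_set_def adm_def)
  show ?thesis unfolding t using True by (simp add: mpart3_def)
next
  case False
  then have e: "e1 = 0" using e_values by auto
  define m where "m x2 x3 = mu (0, x2, x3, 0)" for x2 x3
  let ?K = "\<lambda>x2 x3. {\<kappa>. \<alpha> + m x2 x3 \<kappa> = l}"
  let ?S = "SIGMA x2:coset2 e2 - {0}. SIGMA x4:{x \<in> coset2 e4. 0 \<le> x \<and> x <
    \<bar>r2 * x2\<bar>}. Sigma (coset2 e3) (?K x2)"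
  have mu: "mu (0, x2, x3, x4) = m x2 x3" for x2 x3 x4
    by (simp add: m_def fun_eq_iff mu_def dd_def rh_def)
  have "bij_betw (\<lambda>(x2, x4, x3, \<kappa>). ((0, x2, x3, x4), \<kappa>)) ?S ?T"
    by (rule bij_betw_byWitness[of _ "\<lambda>((x1, x2, x3, x4), \<kappa>). (x2, x4, x3, \<kappa>)"])
      (auto simp: Theta_set_def adm_def rep_def coset2_iff e mu)
  then have "ecard ?T = ecard ?S" by (rule ecard_bij_betw[symmetric])
  also have "\<dots> =
    (\<Sum>\<^sub>\<infinity>x2\<in>coset2 e2 - {0}. of_nat (nat (\<bar>r2 * x2\<bar> div 2)) * ecard (Sigma (coset2 e3) (?K x2)))"
    unfolding infsum_ecard[symmetric]
  proof (rule infsum_cong)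
    fix x2 assume "x2 \<in> coset2 e2 - {0}"
    then have "even \<bar>r2 * x2\<bar>"
      using adm_even(2)[of 0 x2 e3 e4] by (simp add: adm_def e coset2_iff)
    from ecard_strip_1[OF e_values(4) this, of e3 "?K x2"]
    show "(\<Sum>\<^sub>\<infinity>x4\<in>{x \<in> coset2 e4. 0 \<le> x \<and> x < \<bar>r2 * x2\<bar>}. \<Sum>\<^sub>\<infinity>x3\<in>coset2 e3. ecard (?K x2 x3)) =
        of_nat (nat (\<bar>r2 * x2\<bar> div 2)) * (\<Sum>\<^sub>\<infinity>x3\<in>coset2 e3. ecard (?K x2 x3))"
      by (simp only: infsum_ecard abs_ge_zero)
  qed
  also have "\<dots> = mpart3 r2 e1 e2 e3 \<alpha> l"
    unfolding infsum_ecard[symmetric] mpart3_def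
    by (simp only: e zero_neq_one if_False, rule sym)
      (intro infsum_cong arg_cong2[where f = "(*)"] refl delta_sum_int; simp add: m_def mu_x2)
  finally show ?thesis .
qed

text \<open>The vector added to (x3, x4) is a multiple of (\<open>r1 * x1\<close>,
  \<open>r2 * x2\<close>), so the normal component, and with it every eigenvalue, is
  unchanged.\<close>

lemma mu_translate:
  assumes "d dvd \<bar>r1 * x1\<bar>" "d dvd r2 * x2"
  shows "mu (x1, x2, x3 + 2 * i * (\<bar>r1 * x1\<bar> div d), x4 + 2 * i * (r2 * x2 div d * sgn (r1 * x1))) =
    mu (x1, x2, x3, x4)"
proof -
  define a b q c where "a = r1 * x1" and "b = r2 * x2" and "q = \<bar>a\<bar> div d" and "c = b div d"
  have q: "\<bar>a\<bar> = d * q" "b = d * c" using assms by (simp_all add: a_def b_def q_def c_def)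
  have "a * (x4 + 2 * i * (c * sgn a)) - b * (x3 + 2 * i * q) =
    a * x4 - b * x3 + 2 * i * (a * sgn a * c - b * q)"
    by (simp add: algebra_simps)
  also have "a * sgn a = \<bar>a\<bar>" by (simp add: sgn_if)
  also have "\<bar>a\<bar> * c - b * q = 0" unfolding q by simp
  finally have "a * (x4 + 2 * i * (c * sgn a)) - b * (x3 + 2 * i * q) = a * x4 - b * x3" by simp
  then show ?thesis unfolding a_def b_def q_def c_def
    by (simp only: fun_eq_iff mu_def dd_def rh_def prod.case) simp
qed

text \<open>Representatives have x3 in an interval of length \<open>\<bar>r1 * x1\<bar>\<close>,
  which is the gcd times q; \<open>ecard_strip\<close> folds it to length 2 q with weight half the
  gcd.\<close>

lemma ecard_Theta_both:
  "ecard (Theta_set (\<lambda>x1 x2. x1 \<noteq> 0 \<and> x2 \<noteq> 0) (l - \<alpha>)) = mpart4 r1 r2 e1 e2 e3 e4 \<alpha> l"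
  (is "ecard ?T = _")
proof -
  let ?K = "\<lambda>x1 x2 x3 x4. {\<kappa>. \<alpha> + mu (x1, x2, x3, x4) \<kappa> = l}"
  let ?S = "SIGMA x1:coset2 e1 - {0}. SIGMA x2:coset2 e2 - {0}.
    SIGMA x3:{x \<in> coset2 e3. 0 \<le> x \<and> x < \<bar>r1 * x1\<bar>}. Sigma (coset2 e4) (?K x1 x2 x3)"
  let ?d = "\<lambda>x1 x2. gcd \<bar>r1 * x1\<bar> \<bar>r2 * x2\<bar>"
  let ?R = "\<lambda>x1 x2. coset2 e3 \<inter> {0..2 * (\<bar>r1 * x1\<bar> div ?d x1 x2) - 1}"
  have ecard_S: "ecard ?S = (\<Sum>\<^sub>\<infinity>x1\<in>coset2 e1 - {0}. \<Sum>\<^sub>\<infinity>x2\<in>coset2 e2 - {0}.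
      ecard (SIGMA x3:{x \<in> coset2 e3. 0 \<le> x \<and> x < \<bar>r1 * x1\<bar>}. Sigma (coset2 e4) (?K x1 x2 x3)))"
    by (simp only: infsum_ecard)
  have "bij_betw (\<lambda>(x1, x2, x3, x4, \<kappa>). ((x1, x2, x3, x4), \<kappa>)) ?S ?T"
    by (rule bij_betw_byWitness[of _ "\<lambda>((x1, x2, x3, x4), \<kappa>). (x1, x2, x3, x4, \<kappa>)"])
      (auto simp: Theta_set_def adm_def rep_def coset2_iff)
  then have "ecard ?T = ecard ?S" by (rule ecard_bij_betw[symmetric])
  also have "\<dots> = (\<Sum>\<^sub>\<infinity>x1\<in>coset2 e1 - {0}. \<Sum>\<^sub>\<infinity>x2\<in>coset2 e2 - {0}. of_nat (nat (?d x1 x2 div 2)) *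
      ecard (Sigma (?R x1 x2) (\<lambda>x3. Sigma (coset2 e4) (?K x1 x2 x3))))"
    unfolding ecard_S
  proof (intro infsum_cong)
    fix x1 x2 assume x: "x1 \<in> coset2 e1 - {0}" "x2 \<in> coset2 e2 - {0}"
    let ?q = "\<bar>r1 * x1\<bar> div ?d x1 x2"
    have "adm (x1, x2, e3, e4)" using x by (simp add: adm_def coset2_iff)
    from adm_even[OF this] have ev: "even (?d x1 x2)" by simp
    have n: "r1 * x1 \<noteq> 0" using r1_pos x by simp
    have dq: "?d x1 x2 * ?q = \<bar>r1 * x1\<bar>" by simp
    have q: "?q > 0" using n dq
      by (metis abs_ge_zero gcd_ge_0_int linorder_neqE_linordered_idom mult_eq_0_iff
      pos_imp_zdiv_neg_iff zero_less_abs_iff gcd_pos_int not_le)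
    have K: "?K x1 x2 (x + 2 * i * ?q) (y + 2 * i * (r2 * x2 div ?d x1 x2 * sgn (r1 * x1))) =
      ?K x1 x2 x y" for i x y
      by (subst mu_translate) simp_all
    show "ecard (SIGMA x3:{x \<in> coset2 e3. 0 \<le> x \<and> x < \<bar>r1 * x1\<bar>}. Sigma (coset2 e4) (?K x1 x2 x3)) =
      of_nat (nat (?d x1 x2 div 2)) * ecard
        (Sigma (?R x1 x2) (\<lambda>x3. Sigma (coset2 e4) (?K x1 x2 x3)))"
      unfolding ecard_times using ecard_strip[where K = "?K x1 x2", OF ev _ q K, of e3 e4] dq
      by simp
  qed
  also have "\<dots> = mpart4 r1 r2 e1 e2 e3 e4 \<alpha> l"
  proof -
    have f: "finite (?R x1 x2)" for x1 x2 by simp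
    have k: "ecard (?K x1 x2 x3 x4) = delta (lambda0 r1 r2 \<alpha> x1 x2 x3 x4) l +
      (\<Sum>\<^sub>\<infinity>k\<in>{1::nat..}. delta (lambda_k r1 r2 \<alpha> 1 k x1 x2 x3 x4) l +
        delta (lambda_k r1 r2 \<alpha> (-1) k x1 x2 x3 x4) l)" for x1 x2 x3 x4
      by (rule sym, rule delta_sum_int) (simp_all only: mu_lambda)
    show ?thesis
      unfolding ecard_Sigma_finite[OF f]
      unfolding infsum_ecard[symmetric] mpart4_def Let_def k ..
  qed
  finally show ?thesis .
qed

text \<open>The index set splits according to which of the central frequencies x1 and x2
  vanish.\<close>

lemma multiplicity_parts:
  "ecard {j \<in> J. \<alpha> + ev j = l} = mpart1 e1 e2 e3 e4 e5 \<alpha> l + mpart2 r1 e1 e2 e4 \<alpha> l +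
    mpart3 r2 e1 e2 e3 \<alpha> l + mpart4 r1 r2 e1 e2 e3 e4 \<alpha> l"
proof -
  let ?T = "{Triv x3 x4 x5 b |x3 x4 x5 b. adm (0, 0, x3, x4) \<and> even (x5 - e5) \<and>
    \<alpha> + tmu x3 x4 x5 b = l}"
  let ?A = "Theta_set (\<lambda>x1 x2. x1 \<noteq> 0 \<and> x2 = 0) (l - \<alpha>)"
  let ?B = "Theta_set (\<lambda>x1 x2. x1 = 0 \<and> x2 \<noteq> 0) (l - \<alpha>)"
  let ?C = "Theta_set (\<lambda>x1 x2. x1 \<noteq> 0 \<and> x2 \<noteq> 0) (l - \<alpha>)"
  have im: "ecard ((\<lambda>z. Theta (fst z) (snd z)) ` (?A \<union> ?B \<union> ?C)) = ecard (?A \<union> ?B \<union> ?C)"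
    by (rule ecard_bij_betw[symmetric], rule inj_on_imp_bij_betw)
      (rule inj_onI, simp only: idx.inject prod_eq_iff)
  have parts: "ecard (?A \<union> ?B \<union> ?C) = ecard ?A + ecard ?B + ecard ?C"
  proof -
    have d: "Theta_set P c \<inter> Theta_set Q c = {}" if "\<forall>x1 x2. P x1 x2 \<longrightarrow> \<not> Q x1 x2" for P Q c
      using that by (auto simp: Theta_set_def)
    have "?A \<inter> ?B = {}" "?A \<inter> ?C = {}" "?B \<inter> ?C = {}" by (rule d, blast)+
    moreover from this have "(?A \<union> ?B) \<inter> ?C = {}" by blast
    ultimately show ?thesis by (simp only: ecard_Un_disjoint)
  qed
  have J: "{j \<in> J. \<alpha> + ev j = l} = ?T \<union> (\<lambda>z. Theta (fst z) (snd z)) ` (?A \<union> ?B \<union> ?C)"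
  proof (rule Set.set_eqI)
    fix j
    show "j \<in> {j \<in> J. \<alpha> + ev j = l} \<longleftrightarrow> j \<in> ?T \<union> (\<lambda>z. Theta (fst z) (snd z)) ` (?A \<union> ?B \<union> ?C)"
    proof (cases j)
      case (Triv x3 x4 x5 b)
      then show ?thesis by (auto simp: J_Triv ev_def)
    next
      case (Theta \<xi> \<kappa>)
      obtain x1 x2 x3 x4 where \<xi>: "\<xi> = (x1, x2, x3, x4)" by (cases \<xi>)
      have im: "j \<in> (\<lambda>z. Theta (fst z) (snd z)) ` S \<longleftrightarrow> (\<xi>, \<kappa>) \<in> S" for S
        unfolding Theta image_iff idx.inject by (metis prod.collapse fst_conv snd_conv)
      have t: "(\<xi>, \<kappa>) \<in> Theta_set P c \<longleftrightarrow> adm \<xi> \<and> rep \<xi> \<and> P x1 x2 \<and> mu \<xi> \<kappa> = c" for P c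
        by (simp add: Theta_set_def \<xi>)
      have "j \<in> {j \<in> J. \<alpha> + ev j = l} \<longleftrightarrow> adm \<xi> \<and> rep \<xi> \<and> mu \<xi> \<kappa> = l - \<alpha>"
        by (simp only: mem_Collect_eq Theta J_Theta ev_def idx.case) (auto simp: algebra_simps)
      moreover have "j \<notin> ?T" using Theta by blast
      moreover have "rep \<xi> \<Longrightarrow> x1 \<noteq> 0 \<or> x2 \<noteq> 0" by (auto simp: \<xi> rep_def split: if_splits)
      ultimately show ?thesis unfolding Un_iff im t by blast
    qed
  qed
  have "ecard (?T \<union> (\<lambda>z. Theta (fst z) (snd z)) ` (?A \<union> ?B \<union> ?C)) =
      ecard ?T + ecard ((\<lambda>z. Theta (fst z) (snd z)) ` (?A \<union> ?B \<union> ?C))"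
    by (rule ecard_Un_disjoint) blast
  then show ?thesis
    unfolding J im parts ecard_Triv ecard_Theta_x1 ecard_Theta_x2 ecard_Theta_both
    by (simp only: add.assoc)
qed

end

theorem mainTheorem5:
  fixes r1 r2 :: int
    and nabla :: "(pt \<Rightarrow> pt) \<Rightarrow> (pt \<Rightarrow> pt) \<Rightarrow> (pt \<Rightarrow> pt)"
    and eps :: "pt \<Rightarrow> int"
  assumes "r1 > 0" and "r2 > 0" and "r2 dvd r1"
    and "metric_connection r1 r2 nabla"
    and "left_invariant_connection r1 r2 nabla"
    and "\<And>j y. (\<Sum>i\<in>UNIV. metricH r1 r2 y
           (nabla (frame r1 r2 i) (frame r1 r2 j) y) (frame r1 r2 i y)) = 0"
    and "eps \<in> hom (grpGamma r1 r2) (integer_mod_group 2)"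
  shows "spectral_mult r1 r2 eps nabla =
    (let \<alpha> = alpha_const r1 r2 nabla;
         e1 = eps (axis 1 1, 0); e2 = eps (axis 2 1, 0);
         e3 = eps (axis 3 1, 0); e4 = eps (axis 4 1, 0);
         e5 = eps (0, 1)
     in (\<lambda>l. mpart1 e1 e2 e3 e4 e5 \<alpha> l + mpart2 r1 e1 e2 e4 \<alpha> l +
             mpart3 r2 e1 e2 e3 \<alpha> l + mpart4 r1 r2 e1 e2 e3 e4 \<alpha> l))"
proof -
  interpret spin_pos r1 r2 eps by unfold_locales (use assms in auto)
  have D: "Dirac r1 r2 nabla \<phi> = DD r1 r2 (alpha_const r1 r2 nabla) \<phi>" for \<phi>
    using Dirac_eq[OF assms(4-6)] unfolding DD_def .
  show ?thesis
    unfolding Let_def fun_eq_iff spectral_mult_card[OF D] ecard_def[symmetric] multiplicity_parts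
      e1_def e2_def e3_def e4_def e5_def by simp
qed

end
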